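(* There is a constant $0<c\le1$, depending only on the algebraic structure of $\mathbb{G}$, with the following property. If $\xi_1,\xi_2\in\widehat{\mathbb{G}}$, $u_1\in\mathcal{M}_{\xi_1}$ and $u_2\in\mathcal{M}_{\xi_2}$, then the product $u_1u_2$ belongs to $\bigoplus_\xi\mathcal{M}_\xi$, where the sum ranges over those $\xi\in\widehat{\mathbb{G}}$ with $$ c\,\big||\xi_1|-|\xi_2|\big|\le|\xi|\le|\xi_1|+|\xi_2|. $$
   Context: $\mathbb{G}$ is a simply connected compact semisimple Lie group, with the bi-invariant Riemannian metric given by minus the Killing form and corresponding Laplacian $\Delta$. $\widehat{\mathbb{G}}$ is the set of equivalence classes of irreducible unitary representations of $\mathbb{G}$. For $\xi\in\widehat{\mathbb{G}}$, $\mathcal{M}_\xi\subset L^2(\mathbb{G})$ is the span of the matrix entries of $\xi$; it is an eigenspace of $-\Delta$ with eigenvalue $\lambda_\xi=|\bm{J}(\xi)+\bm{\varpi}|^2-|\bm{\varpi}|^2\ge0$, where $\bm{J}(\xi)$ is the highest weight of $\xi$ and $\bm{\varpi}$ is the sum of the fundamental weights (norm on the dual of the Cartan subalgebra induced by the Killing form). $|\xi|:=\sqrt{\lambda_\xi}$. *)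

theory Defs
  imports
    "HOL-Library.Function_Algebras"
    "HOL-Analysis.Analysis"
    "HOL-Algebra.Group"
    "Jordan_Normal_Form.Schur_Decomposition"
begin

section \<open>Function spaces as vector spaces\<close>

instantiation "fun" :: (type, real_vector) real_vector
begin

definition "c *\<^sub>R f = (\<lambda>x. c *\<^sub>R f x)"

instance
  by standard (simp_all add: scaleR_fun_def plus_fun_def scaleR_add_left scaleR_add_right)

end

interpretation fun_cvec: vector_space "\<lambda>(c::complex) (u :: 'g \<Rightarrow> complex). (\<lambda>x. c * u x)"
  by unfold_locales (simp_all add: plus_fun_def algebra_simps)


section \<open>Smooth manifolds and Lie groups\<close>

text \<open>On open subsets of finite-dimensional spaces, \<open>Ck_on k\<close> is \<open>k\<close>-fold continuous
  differentiability, phrased by iterated directional derivatives so that the type of the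
  function does not change.\<close>

fun Ck_on :: "nat \<Rightarrow> 'a::real_normed_vector set \<Rightarrow> ('a \<Rightarrow> 'b::real_normed_vector) \<Rightarrow> bool" where
  "Ck_on 0 S f \<longleftrightarrow> continuous_on S f"
| "Ck_on (Suc k) S f \<longleftrightarrow>
     (\<forall>x\<in>S. f differentiable (at x)) \<and> (\<forall>v. Ck_on k S (\<lambda>x. frechet_derivative f (at x) v))"

definition smooth_on :: "'a::real_normed_vector set \<Rightarrow> ('a \<Rightarrow> 'b::real_normed_vector) \<Rightarrow> bool" where
  "smooth_on S f \<longleftrightarrow> (\<forall>k. Ck_on k S f)"

text \<open>A chart is a pair of its domain and the coordinate map, which is only relevant on the
  domain.\<close>

type_synonym ('g, 'e) chart = "'g set \<times> ('g \<Rightarrow> 'e)"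

definition smooth_atlas ::
    "('g::topological_space, 'e::euclidean_space) chart set \<Rightarrow> bool" where
  "smooth_atlas A \<longleftrightarrow>
     (\<Union>(U, \<phi>)\<in>A. U) = UNIV \<and>
     (\<forall>(U, \<phi>)\<in>A. open U \<and> open (\<phi> ` U) \<and> homeomorphism U (\<phi> ` U) \<phi> (inv_into U \<phi>)) \<and>
     (\<forall>(U, \<phi>)\<in>A. \<forall>(V, \<psi>)\<in>A. smooth_on (\<phi> ` (U \<inter> V)) (\<psi> \<circ> inv_into U \<phi>))"

definition smooth_map ::
    "('g::topological_space, 'e::euclidean_space) chart set \<Rightarrow>
     ('h::topological_space, 'f::euclidean_space) chart set \<Rightarrow> ('g \<Rightarrow> 'h) \<Rightarrow> bool" where
  "smooth_map A B f \<longleftrightarrow>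
     continuous_on UNIV f \<and>
     (\<forall>(U, \<phi>)\<in>A. \<forall>(V, \<psi>)\<in>B. smooth_on (\<phi> ` (U \<inter> f -` V)) (\<psi> \<circ> f \<circ> inv_into U \<phi>))"

definition prod_atlas ::
    "('g, 'e) chart set \<Rightarrow> ('h, 'f) chart set \<Rightarrow> ('g \<times> 'h, 'e \<times> 'f) chart set" where
  "prod_atlas A B = {(U \<times> V, map_prod \<phi> \<psi>) | U \<phi> V \<psi>. (U, \<phi>) \<in> A \<and> (V, \<psi>) \<in> B}"

definition euclidean_atlas :: "('e, 'e) chart set" where
  "euclidean_atlas = {(UNIV, id)}"

record ('g, 'e) lie_structure = "'g monoid" +
  atlas :: "('g, 'e) chart set"

text \<open>The topological space \<open>'g\<close> is the underlying space of the group. Any atlas, not necessarily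
  maximal, determines the smooth structure.\<close>

definition lie_group ::
    "('g::{t2_space, second_countable_topology}, 'e::euclidean_space) lie_structure \<Rightarrow> bool" where
  "lie_group G \<longleftrightarrow>
     Group.group G \<and> carrier G = UNIV \<and> smooth_atlas (atlas G) \<and>
     smooth_map (prod_atlas (atlas G) (atlas G)) (atlas G) (\<lambda>(x, y). x \<otimes>\<^bsub>G\<^esub> y) \<and>
     smooth_map (atlas G) (atlas G) (\<lambda>x. inv\<^bsub>G\<^esub> x)"


section \<open>The Lie algebra\<close>

definition smooth_functions ::
    "('g::topological_space, 'e::euclidean_space) lie_structure \<Rightarrow> ('g \<Rightarrow> real) set" where
  "smooth_functions G = {f. smooth_map (atlas G) euclidean_atlas f}"

text \<open>Vector fields are derivations of the algebra of smooth functions. They are set to zero off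
  that algebra, so that they form a subspace of the space of all operators.\<close>

definition vector_fields ::
    "('g::topological_space, 'e::euclidean_space) lie_structure \<Rightarrow>
     (('g \<Rightarrow> real) \<Rightarrow> ('g \<Rightarrow> real)) set" where
  "vector_fields G =
     {X. (\<forall>f\<in>smooth_functions G. X f \<in> smooth_functions G) \<and>
         (\<forall>f\<in>smooth_functions G. \<forall>h\<in>smooth_functions G. X (f + h) = X f + X h) \<and>
         (\<forall>f\<in>smooth_functions G. \<forall>c. X (c *\<^sub>R f) = c *\<^sub>R X f) \<and>
         (\<forall>f\<in>smooth_functions G. \<forall>h\<in>smooth_functions G. X (f * h) = X f * h + f * X h) \<and>
         (\<forall>f. f \<notin> smooth_functions G \<longrightarrow> X f = 0)}"

definition lie_algebra ::
    "('g::topological_space, 'e::euclidean_space) lie_structure \<Rightarrow>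
     (('g \<Rightarrow> real) \<Rightarrow> ('g \<Rightarrow> real)) set" where
  "lie_algebra G =
     {X \<in> vector_fields G. \<forall>g. \<forall>f\<in>smooth_functions G.
        X (\<lambda>h. f (g \<otimes>\<^bsub>G\<^esub> h)) = (\<lambda>h. X f (g \<otimes>\<^bsub>G\<^esub> h))}"

definition bracket ::
    "(('g \<Rightarrow> real) \<Rightarrow> ('g \<Rightarrow> real)) \<Rightarrow> (('g \<Rightarrow> real) \<Rightarrow> ('g \<Rightarrow> real)) \<Rightarrow>
     (('g \<Rightarrow> real) \<Rightarrow> ('g \<Rightarrow> real))" where
  "bracket X Y = (\<lambda>f. X (Y f) - Y (X f))"

text \<open>Semisimple means that the radical vanishes: there is no nonzero solvable ideal.\<close>

definition lie_ideal ::
    "('g::topological_space, 'e::euclidean_space) lie_structure \<Rightarrow>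
     (('g \<Rightarrow> real) \<Rightarrow> ('g \<Rightarrow> real)) set \<Rightarrow> bool" where
  "lie_ideal G I \<longleftrightarrow>
     Real_Vector_Spaces.subspace I \<and> I \<subseteq> lie_algebra G \<and> (\<forall>X\<in>lie_algebra G. \<forall>Y\<in>I. bracket X Y \<in> I)"

fun derived_series ::
    "(('g \<Rightarrow> real) \<Rightarrow> ('g \<Rightarrow> real)) set \<Rightarrow> nat \<Rightarrow> (('g \<Rightarrow> real) \<Rightarrow> ('g \<Rightarrow> real)) set" where
  "derived_series I 0 = I"
| "derived_series I (Suc k) =
     Real_Vector_Spaces.span {bracket X Y | X Y. X \<in> derived_series I k \<and> Y \<in> derived_series I k}"

definition semisimple ::
    "('g::topological_space, 'e::euclidean_space) lie_structure \<Rightarrow> bool" where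
  "semisimple G \<longleftrightarrow>
     (\<forall>I. lie_ideal G I \<and> (\<exists>k. derived_series I k = {0}) \<longrightarrow> I = {0})"

definition trace_on :: "'v::real_vector set \<Rightarrow> ('v \<Rightarrow> 'v) \<Rightarrow> real" where
  "trace_on V T =
     (let B = (SOME B. Real_Vector_Spaces.independent B \<and> Real_Vector_Spaces.span B = V)
      in \<Sum>b\<in>B. Real_Vector_Spaces.representation B (T b) b)"

definition killing_form ::
    "('g::topological_space, 'e::euclidean_space) lie_structure \<Rightarrow>
     (('g \<Rightarrow> real) \<Rightarrow> ('g \<Rightarrow> real)) \<Rightarrow> (('g \<Rightarrow> real) \<Rightarrow> ('g \<Rightarrow> real)) \<Rightarrow> real" where
  "killing_form G X Y = trace_on (lie_algebra G) (\<lambda>Z. bracket X (bracket Y Z))"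


section \<open>The Laplacian of the bi-invariant metric\<close>

text \<open>A left-invariant metric is determined by the inner products of left-invariant vector
  fields.\<close>

definition metric ::
    "('g::topological_space, 'e::euclidean_space) lie_structure \<Rightarrow>
     (('g \<Rightarrow> real) \<Rightarrow> ('g \<Rightarrow> real)) \<Rightarrow> (('g \<Rightarrow> real) \<Rightarrow> ('g \<Rightarrow> real)) \<Rightarrow> real" where
  "metric G X Y = - killing_form G X Y"

text \<open>The Koszul formula. The three terms of the form \<open>X \<langle>Y, Z\<rangle>\<close> vanish, because the inner
  products of left-invariant fields are constant functions.\<close>

definition levi_civita ::
    "('g::topological_space, 'e::euclidean_space) lie_structure \<Rightarrow>
     (('g \<Rightarrow> real) \<Rightarrow> ('g \<Rightarrow> real)) \<Rightarrow> (('g \<Rightarrow> real) \<Rightarrow> ('g \<Rightarrow> real)) \<Rightarrow>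
     (('g \<Rightarrow> real) \<Rightarrow> ('g \<Rightarrow> real))" where
  "levi_civita G X Y = (THE W. W \<in> lie_algebra G \<and>
     (\<forall>Z\<in>lie_algebra G. 2 * metric G W Z =
        metric G (bracket X Y) Z - metric G (bracket Y Z) X + metric G (bracket Z X) Y))"

definition orthonormal_frame ::
    "('g::topological_space, 'e::euclidean_space) lie_structure \<Rightarrow>
     (('g \<Rightarrow> real) \<Rightarrow> ('g \<Rightarrow> real)) set \<Rightarrow> bool" where
  "orthonormal_frame G E \<longleftrightarrow>
     finite E \<and> Real_Vector_Spaces.span E = lie_algebra G \<and>
     (\<forall>X\<in>E. \<forall>Y\<in>E. metric G X Y = (if X = Y then 1 else 0))"

text \<open>The Laplace--Beltrami operator is the trace of the Hessian
  \<open>(X, Y) \<mapsto> X (Y f) - (\<nabla>\<^sub>X Y) f\<close> with respect to the metric.\<close>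

definition laplacian ::
    "('g::topological_space, 'e::euclidean_space) lie_structure \<Rightarrow>
     ('g \<Rightarrow> real) \<Rightarrow> ('g \<Rightarrow> real)" where
  "laplacian G f =
     (let E = (SOME E. orthonormal_frame G E) in \<Sum>X\<in>E. X (X f) - levi_civita G X X f)"

definition complex_laplacian ::
    "('g::topological_space, 'e::euclidean_space) lie_structure \<Rightarrow>
     ('g \<Rightarrow> complex) \<Rightarrow> ('g \<Rightarrow> complex)" where
  "complex_laplacian G u =
     (\<lambda>g. Complex (laplacian G (\<lambda>h. Re (u h)) g) (laplacian G (\<lambda>h. Im (u h)) g))"


section \<open>The unitary dual\<close>

definition unitary_mat :: "nat \<Rightarrow> complex mat \<Rightarrow> bool" where
  "unitary_mat n T \<longleftrightarrow> T \<in> carrier_mat n n \<and> mat_adjoint T * T = 1\<^sub>m n"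

definition unitary_rep ::
    "('g::topological_space, 'e) lie_structure \<Rightarrow> nat \<Rightarrow> ('g \<Rightarrow> complex mat) \<Rightarrow> bool" where
  "unitary_rep G n \<pi> \<longleftrightarrow>
     (\<forall>g. unitary_mat n (\<pi> g)) \<and>
     (\<forall>g h. \<pi> (g \<otimes>\<^bsub>G\<^esub> h) = \<pi> g * \<pi> h) \<and>
     (\<forall>i<n. \<forall>j<n. continuous_on UNIV (\<lambda>g. \<pi> g $$ (i, j)))"

definition invariant_subspace :: "nat \<Rightarrow> ('g \<Rightarrow> complex mat) \<Rightarrow> complex Matrix.vec set \<Rightarrow> bool" where
  "invariant_subspace n \<pi> W \<longleftrightarrow>
     W \<subseteq> carrier_vec n \<and> 0\<^sub>v n \<in> W \<and> (\<forall>v\<in>W. \<forall>w\<in>W. v + w \<in> W) \<and>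
     (\<forall>c. \<forall>v\<in>W. c \<cdot>\<^sub>v v \<in> W) \<and> (\<forall>g. \<forall>v\<in>W. \<pi> g *\<^sub>v v \<in> W)"

definition irreducible_unitary_reps ::
    "('g::topological_space, 'e) lie_structure \<Rightarrow> ('g \<Rightarrow> complex mat) set" where
  "irreducible_unitary_reps G =
     {\<pi>. \<exists>n>0. unitary_rep G n \<pi> \<and>
        (\<forall>W. invariant_subspace n \<pi> W \<longrightarrow> W = {0\<^sub>v n} \<or> W = carrier_vec n)}"

definition unitary_equivalence ::
    "('g::topological_space, 'e) lie_structure \<Rightarrow>
     (('g \<Rightarrow> complex mat) \<times> ('g \<Rightarrow> complex mat)) set" where
  "unitary_equivalence G =
     {(\<pi>, \<rho>). \<pi> \<in> irreducible_unitary_reps G \<and> \<rho> \<in> irreducible_unitary_reps G \<and>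
        (\<exists>n T. unitary_mat n T \<and> (\<forall>g. T * \<pi> g = \<rho> g * T))}"

text \<open>Irreducible unitary representations of a compact group are finite-dimensional, so that
  matrix representations yield all equivalence classes.\<close>

definition unitary_dual ::
    "('g::topological_space, 'e) lie_structure \<Rightarrow> ('g \<Rightarrow> complex mat) set set" where
  "unitary_dual G = irreducible_unitary_reps G // unitary_equivalence G"

text \<open>Equivalent representations have the same span of matrix entries, so the span over the whole
  class \<open>\<xi>\<close> is that of any single representative.\<close>

definition matrix_entry_space :: "('g \<Rightarrow> complex mat) set \<Rightarrow> ('g \<Rightarrow> complex) set" where
  "matrix_entry_space \<xi> =
     fun_cvec.span {\<lambda>g. \<pi> g $$ (i, j) | \<pi> i j.
       \<pi> \<in> \<xi> \<and> (\<forall>g. i < dim_row (\<pi> g) \<and> j < dim_col (\<pi> g))}"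

text \<open>The matrix entries of \<open>\<xi>\<close> are eigenfunctions of \<open>- \<Delta>\<close> for a common eigenvalue \<open>\<lambda>\<^sub>\<xi>\<close>, which in
  terms of the highest weight \<open>J(\<xi>)\<close> and the sum \<open>\<varpi>\<close> of the fundamental weights equals
  \<open>|J(\<xi>) + \<varpi>|^2 - |\<varpi>|^2\<close>.\<close>

definition eigenvalue_of ::
    "('g::topological_space, 'e::euclidean_space) lie_structure \<Rightarrow>
     ('g \<Rightarrow> complex mat) set \<Rightarrow> real" where
  "eigenvalue_of G \<xi> = (THE l. \<forall>u\<in>matrix_entry_space \<xi>.
     (\<lambda>g. - complex_laplacian G u g) = (\<lambda>g. complex_of_real l * u g))"

definition dual_abs ::
    "('g::topological_space, 'e::euclidean_space) lie_structure \<Rightarrow>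
     ('g \<Rightarrow> complex mat) set \<Rightarrow> real" where
  "dual_abs G \<xi> = sqrt (eigenvalue_of G \<xi>)"

end

theory Submission
  imports Defs "Jordan_Normal_Form.Spectral_Radius"
begin

text \<open>One can take \<open>c = 1\<close>, and no weight theory is needed. Let \<open>X\<close> range over a frame that is
  orthonormal for minus the Killing form. On the matrix entries of \<open>\<pi>\<close> the Laplacian is the operator
  \<open>\<Sum>\<^sub>X (d\<pi> X)\<^sup>2\<close>, which commutes with \<open>\<pi>\<close> and is therefore the scalar \<open>- \<lambda>\<^sub>\<pi>\<close> by Schur's lemma. If \<open>\<xi>\<close> occurs
  in \<open>\<pi> \<otimes> \<rho>\<close> and \<open>v\<close> is a unit vector of that component, then, \<open>d\<pi> X\<close> being skew-Hermitian,
  \<open>\<lambda>\<^sub>\<xi> = \<Sum>\<^sub>X |(d\<pi> X \<otimes> 1) v + (1 \<otimes> d\<rho> X) v|\<^sup>2\<close>, whereas \<open>\<Sum>\<^sub>X |(d\<pi> X \<otimes> 1) v|\<^sup>2 = \<lambda>\<^sub>\<pi>\<close> and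
  \<open>\<Sum>\<^sub>X |(1 \<otimes> d\<rho> X) v|\<^sup>2 = \<lambda>\<^sub>\<rho>\<close>. Both bounds are the triangle inequality for these vectors.

  Three facts about \<open>G\<close> enter. Its Lie algebra is finite-dimensional, by Hadamard's lemma. Continuous
  unitary representations are smooth, by convolution with a smooth bump function. The Killing form is
  negative definite: averaging over \<open>G\<close> yields an inner product for which every \<open>ad X\<close> is skew, so
  the trace of \<open>(ad X)\<^sup>2\<close> is minus a sum of squares that vanishes only for central \<open>X\<close>. The averages use
  the invariant mean on continuous functions, constructed by von Neumann's method.\<close>

section \<open>Iterated differentiability\<close>

text \<open>The identity for \<open>\<pi>\<close> has to hold for every unit vector of the tensor
  product, not only for pure tensors. It does because a scalar Casimir operator gives each column of
  the vector, read as an array, an energy proportional to its squared norm. Much of the length comes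
  from the form of the notions. The trace, the frame, the connection and the eigenvalue are given by
  \<open>SOME\<close> or \<open>THE\<close>, so each calls for existence and for independence of the
  choice. Vector fields act on globally defined functions, so local arguments pass through cut-offs.
  Representations are merely continuous, so a convolution must make them differentiable before
  \<open>d\<pi>\<close> makes sense. One theorem on differentiation under a bounded functional
  serves twice: for the integral in Hadamard's lemma and for the mean in the convolution.
  Subrepresentations are carried by matrices with orthonormal columns, since comparing energies
  requires an isometric intertwiner from the component into the tensor product.\<close>

lemma Ck_on_cong:
  assumes "open S" "\<And>x. x \<in> S \<Longrightarrow> f x = g x"
  shows "Ck_on k S f \<longleftrightarrow> Ck_on k S g"
proof -
  have "Ck_on k S g" if "Ck_on k S f" "\<And>x. x \<in> S \<Longrightarrow> f x = g x" for f g :: "'a \<Rightarrow> 'b"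
    using that
  proof (induction k arbitrary: f g)
    case 0
    then show ?case by (simp cong: continuous_on_cong_simp)
  next
    case (Suc k)
    \<comment> \<open>\<open>at x\<close> sees a full neighbourhood of \<open>x\<close>, so
      agreement on \<open>S\<close> reaches the derivatives through openness of
      \<open>S\<close>.\<close>
    have D: "g differentiable (at x)" if "x \<in> S" for x
      using Suc.prems that has_derivative_transform_within_open[OF _ \<open>open S\<close>, of f _ x UNIV g]
      unfolding differentiable_def Ck_on.simps by blast
    have "Ck_on k S (\<lambda>x. frechet_derivative g (at x) v)" for v
    proof (rule Suc.IH)
      show "Ck_on k S (\<lambda>x. frechet_derivative f (at x) v)" using Suc.prems by simp
      show "frechet_derivative f (at x) v = frechet_derivative g (at x) v" if "x \<in> S" for x
        using frechet_derivative_transform_within_open[of f x S g] Suc.prems that \<open>open S\<close> by simp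
    qed
    with D show ?case by simp
  qed
  from this[of f g] this[of g f] assms(2) show ?thesis by auto
qed

lemma Ck_on_imp_continuous_on: "Ck_on k S f \<Longrightarrow> continuous_on S f"
  by (cases k) (auto intro!: continuous_at_imp_continuous_on differentiable_imp_continuous_within)

lemma Ck_on_SucD: "Ck_on (Suc k) S f \<Longrightarrow> Ck_on k S f"
proof (induction k arbitrary: f)
  case 0
  then show ?case using Ck_on_imp_continuous_on by (metis Ck_on.simps(1))
next
  case (Suc k)
  then show ?case by (simp only: Ck_on.simps) blast
qed

text \<open>Derivatives are taken in the ambient space, so restricting to any subset, open or not,
  leaves them unchanged.\<close>

lemma Ck_on_subset: "Ck_on k S f \<Longrightarrow> T \<subseteq> S \<Longrightarrow> Ck_on k T f"
  by (induction k arbitrary: f) (auto intro: continuous_on_subset)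

lemma Ck_on_local:
  assumes "\<And>x. x \<in> S \<Longrightarrow> \<exists>T. open T \<and> x \<in> T \<and> Ck_on k T f"
  shows "Ck_on k S f"
  using assms
proof (induction k arbitrary: f)
  case 0
  have "continuous (at x) f" if "x \<in> S" for x
    using 0[OF that] continuous_on_eq_continuous_at[of _ f] by auto
  then show ?case by (simp add: continuous_at_imp_continuous_on)
next
  case (Suc k)
  have "f differentiable (at x)" if "x \<in> S" for x
    using Suc.prems[OF that] by auto
  moreover have "Ck_on k S (\<lambda>x. frechet_derivative f (at x) v)" for v
  proof (rule Suc.IH)
    fix x assume "x \<in> S"
    from Suc.prems[OF this] obtain T where T: "open T" "x \<in> T" "Ck_on (Suc k) T f" by blast
    then show "\<exists>T. open T \<and> x \<in> T \<and> Ck_on k T (\<lambda>x. frechet_derivative f (at x) v)"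
      by (intro exI[of _ T]) simp
  qed
  ultimately show ?case by simp
qed

lemma Ck_on_const [simp]: "Ck_on k S (\<lambda>x. c)"
  by (induction k arbitrary: c) auto

lemma frechet_derivative_bounded_linear:
  "bounded_linear L \<Longrightarrow> f differentiable (at x) \<Longrightarrow>
    frechet_derivative (\<lambda>x. L (f x)) (at x) v = L (frechet_derivative f (at x) v)"
  using frechet_derivative_at[OF bounded_linear.has_derivative[of L f _ "at x"]] frechet_derivative_works
  by metis

lemma bounded_linear_differentiable:
  "bounded_linear L \<Longrightarrow> f differentiable (at x) \<Longrightarrow> (\<lambda>x. L (f x)) differentiable (at x)"
  unfolding differentiable_def using bounded_linear.has_derivative by blast

lemma Ck_on_bounded_linear:
  assumes "open S" "bounded_linear L" "Ck_on k S f"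
  shows "Ck_on k S (\<lambda>x. L (f x))"
  using assms(3)
proof (induction k arbitrary: f)
  case 0
  then show ?case using bounded_linear.continuous_on[OF assms(2)] by simp
next
  case (Suc k)
  have "Ck_on k S (\<lambda>x. frechet_derivative (\<lambda>x. L (f x)) (at x) v)" for v
  proof (subst Ck_on_cong[OF \<open>open S\<close>])
    show "frechet_derivative (\<lambda>x. L (f x)) (at x) v = L (frechet_derivative f (at x) v)"
      if "x \<in> S" for x
      by (rule frechet_derivative_bounded_linear[OF assms(2)]) (use Suc.prems that in simp)
    show "Ck_on k S (\<lambda>x. L (frechet_derivative f (at x) v))" using Suc by simp
  qed
  with Suc.prems show ?case by (simp add: bounded_linear_differentiable[OF assms(2)])
qed

lemma Ck_on_id: "Ck_on k S (\<lambda>x. x)"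
  by (cases k) (auto simp: frechet_derivative_ident)

lemma Ck_on_linear: "open S \<Longrightarrow> bounded_linear L \<Longrightarrow> Ck_on k S L"
  using Ck_on_bounded_linear[OF _ _ Ck_on_id] by blast

lemma Ck_on_add:
  assumes "open S" "Ck_on k S f" "Ck_on k S g"
  shows "Ck_on k S (\<lambda>x. f x + g x)"
  using assms(2,3)
proof (induction k arbitrary: f g)
  case 0
  then show ?case by (simp add: continuous_on_add)
next
  case (Suc k)
  have D: "frechet_derivative (\<lambda>x. f x + g x) (at x) v =
      frechet_derivative f (at x) v + frechet_derivative g (at x) v" if "x \<in> S" for x v
  proof -
    have "((\<lambda>x. f x + g x) has_derivative
      (\<lambda>v. frechet_derivative f (at x) v + frechet_derivative g (at x) v)) (at x)"
      using Suc.prems that by (auto intro!: has_derivative_add simp: frechet_derivative_works[symmetric])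
    from frechet_derivative_at[OF this] show ?thesis by metis
  qed
  have "Ck_on k S (\<lambda>x. frechet_derivative (\<lambda>x. f x + g x) (at x) v)" for v
  proof (subst Ck_on_cong[OF \<open>open S\<close> D])
    show "Ck_on k S (\<lambda>x. frechet_derivative f (at x) v + frechet_derivative g (at x) v)"
      using Suc by simp
  qed
  with Suc.prems show ?case by simp
qed

lemma Ck_on_sum:
  assumes "open S" "\<And>i. i \<in> I \<Longrightarrow> Ck_on k S (f i)"
  shows "Ck_on k S (\<lambda>x. \<Sum>i\<in>I. f i x)"
  using assms(2)
  by (induction I rule: infinite_finite_induct) (auto intro!: Ck_on_add[OF assms(1)])

lemma Ck_on_scaleR:
  assumes "open S" "Ck_on k S f" "Ck_on k S g"
  shows "Ck_on k S (\<lambda>x. f x *\<^sub>R g x)"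
  using assms(2,3)
proof (induction k arbitrary: f g)
  case 0
  then show ?case by (simp add: continuous_on_scaleR)
next
  case (Suc k)
  have H: "((\<lambda>x. f x *\<^sub>R g x) has_derivative
      (\<lambda>v. f x *\<^sub>R frechet_derivative g (at x) v + frechet_derivative f (at x) v *\<^sub>R g x)) (at x)"
    if "x \<in> S" for x
    using Suc.prems that by (auto intro!: has_derivative_scaleR simp: frechet_derivative_works[symmetric])
  have D: "frechet_derivative (\<lambda>x. f x *\<^sub>R g x) (at x) v =
      f x *\<^sub>R frechet_derivative g (at x) v + frechet_derivative f (at x) v *\<^sub>R g x" if "x \<in> S" for x v
    using frechet_derivative_at[OF H[OF that]] by metis
  have "Ck_on k S (\<lambda>x. frechet_derivative (\<lambda>x. f x *\<^sub>R g x) (at x) v)" for v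
  proof (subst Ck_on_cong[OF \<open>open S\<close> D])
    show "Ck_on k S (\<lambda>x. f x *\<^sub>R frechet_derivative g (at x) v + frechet_derivative f (at x) v *\<^sub>R g x)"
      using Ck_on_SucD[OF Suc.prems(1)] Ck_on_SucD[OF Suc.prems(2)] Suc.prems
      by (intro Ck_on_add[OF \<open>open S\<close>] Suc.IH) simp_all
  qed
  with H show ?case unfolding Ck_on.simps differentiable_def by blast
qed

lemma Ck_on_mult:
  fixes f g :: "'a::real_normed_vector \<Rightarrow> real"
  shows "open S \<Longrightarrow> Ck_on k S f \<Longrightarrow> Ck_on k S g \<Longrightarrow> Ck_on k S (\<lambda>x. f x * g x)"
  using Ck_on_scaleR[of S k f g] by simp

text \<open>The chain rule differentiates \<open>g\<close> in a direction that varies with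
  \<open>x\<close>, whereas \<open>Ck_on\<close> speaks of fixed directions. Expanding the direction
  in \<open>Basis\<close> leaves fixed directions with scalar coefficients, to which the sum and
  product rules apply.\<close>

lemma Ck_on_compose:
  fixes f :: "'a::real_normed_vector \<Rightarrow> 'b::euclidean_space" and g :: "'b \<Rightarrow> 'c::real_normed_vector"
  assumes "open S" "open T" "Ck_on k S f" "Ck_on k T g" "f ` S \<subseteq> T"
  shows "Ck_on k S (\<lambda>x. g (f x))"
  using assms(3,4)
proof (induction k arbitrary: g)
  case 0
  then show ?case using assms(5) by (auto intro: continuous_on_compose2)
next
  case (Suc k)
  have ex: "frechet_derivative (\<lambda>x. g (f x)) (at x) v =
      (\<Sum>b\<in>Basis. (frechet_derivative f (at x) v \<bullet> b) *\<^sub>R frechet_derivative g (at (f x)) b)"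
    if x: "x \<in> S" for x v
  proof -
    have fx: "f differentiable (at x)" "g differentiable (at (f x))" using Suc.prems x assms(5) by auto
    then have lin: "linear (frechet_derivative g (at (f x)))" by (rule_tac linear_frechet_derivative)
    have "frechet_derivative (\<lambda>x. g (f x)) (at x) v
        = frechet_derivative g (at (f x)) (frechet_derivative f (at x) v)"
      using frechet_derivative_compose[OF fx] by (simp add: o_def)
    also have "\<dots> = frechet_derivative g (at (f x))
        (\<Sum>b\<in>Basis. (frechet_derivative f (at x) v \<bullet> b) *\<^sub>R b)"
      by (simp add: euclidean_representation)
    finally show ?thesis by (simp add: linear_sum[OF lin] linear_scale[OF lin])
  qed
  have "Ck_on k S (\<lambda>x. frechet_derivative (\<lambda>x. g (f x)) (at x) v)" for v
  proof (subst Ck_on_cong[OF \<open>open S\<close> ex])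
    show "Ck_on k S (\<lambda>x. \<Sum>b\<in>Basis. (frechet_derivative f (at x) v \<bullet> b) *\<^sub>R
        frechet_derivative g (at (f x)) b)"
    proof (intro Ck_on_sum Ck_on_scaleR \<open>open S\<close>)
      fix b :: 'b
      show "Ck_on k S (\<lambda>x. frechet_derivative f (at x) v \<bullet> b)"
        using Suc.prems by (intro Ck_on_bounded_linear[OF \<open>open S\<close> bounded_linear_inner_left]) simp
      show "Ck_on k S (\<lambda>x. frechet_derivative g (at (f x)) b)"
        \<comment> \<open>Only \<open>g\<close> changes in the induction; \<open>f\<close> merely
          drops one order of differentiability.\<close>
        by (rule Suc.IH) (use Suc.prems Ck_on_SucD in auto)
    qed
  qed
  moreover have "(\<lambda>x. g (f x)) differentiable (at x)" if "x \<in> S" for x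
    using Suc.prems that assms(5) differentiable_chain_at[of f x g] by (auto simp: o_def)
  ultimately show ?case by simp
qed

lemma Ck_on_Pair:
  assumes "open S" "Ck_on k S f" "Ck_on k S g"
  shows "Ck_on k S (\<lambda>x. (f x, g x))"
proof -
  have "bounded_linear (\<lambda>y. (y, 0))" "bounded_linear (\<lambda>y. (0, y))"
    by (auto intro!: bounded_linear_Pair bounded_linear_ident)
  from Ck_on_add[OF assms(1) Ck_on_bounded_linear[OF assms(1) this(1) assms(2)]
      Ck_on_bounded_linear[OF assms(1) this(2) assms(3)]]
  show ?thesis by simp
qed

lemma smooth_on_cong:
  "open S \<Longrightarrow> (\<And>x. x \<in> S \<Longrightarrow> f x = g x) \<Longrightarrow> smooth_on S f \<longleftrightarrow> smooth_on S g"
  unfolding smooth_on_def using Ck_on_cong by blast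

lemma smooth_on_subset: "smooth_on S f \<Longrightarrow> T \<subseteq> S \<Longrightarrow> smooth_on T f"
  unfolding smooth_on_def using Ck_on_subset by blast

lemma smooth_on_imp_continuous_on: "smooth_on S f \<Longrightarrow> continuous_on S f"
  unfolding smooth_on_def using Ck_on_imp_continuous_on by blast

lemma smooth_on_local:
  assumes "\<And>x. x \<in> S \<Longrightarrow> \<exists>T. open T \<and> x \<in> T \<and> smooth_on T f"
  shows "smooth_on S f"
  using assms Ck_on_local[of S _ f] unfolding smooth_on_def by meson

lemma smooth_on_const [simp]: "smooth_on S (\<lambda>x. c)"
  by (simp add: smooth_on_def)

lemma smooth_on_id: "smooth_on S (\<lambda>x. x)"
  by (simp add: smooth_on_def Ck_on_id)

lemma smooth_on_bounded_linear:
  "open S \<Longrightarrow> bounded_linear L \<Longrightarrow> smooth_on S f \<Longrightarrow> smooth_on S (\<lambda>x. L (f x))"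
  by (simp add: smooth_on_def Ck_on_bounded_linear)

lemma smooth_on_linear: "open S \<Longrightarrow> bounded_linear L \<Longrightarrow> smooth_on S L"
  by (simp add: smooth_on_def Ck_on_linear)

lemma smooth_on_add:
  "open S \<Longrightarrow> smooth_on S f \<Longrightarrow> smooth_on S g \<Longrightarrow> smooth_on S (\<lambda>x. f x + g x)"
  by (simp add: smooth_on_def Ck_on_add)

lemma smooth_on_sum:
  "open S \<Longrightarrow> (\<And>i. i \<in> I \<Longrightarrow> smooth_on S (f i)) \<Longrightarrow> smooth_on S (\<lambda>x. \<Sum>i\<in>I. f i x)"
  by (simp add: smooth_on_def Ck_on_sum)

lemma smooth_on_mult:
  fixes f g :: "'a::real_normed_vector \<Rightarrow> real"
  shows "open S \<Longrightarrow> smooth_on S f \<Longrightarrow> smooth_on S g \<Longrightarrow> smooth_on S (\<lambda>x. f x * g x)"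
  by (simp add: smooth_on_def Ck_on_mult)

lemma smooth_on_compose:
  fixes f :: "'a::real_normed_vector \<Rightarrow> 'b::euclidean_space" and g :: "'b \<Rightarrow> 'c::real_normed_vector"
  shows "open S \<Longrightarrow> open T \<Longrightarrow> smooth_on S f \<Longrightarrow> smooth_on T g \<Longrightarrow> f ` S \<subseteq> T \<Longrightarrow>
    smooth_on S (\<lambda>x. g (f x))"
  by (simp add: smooth_on_def Ck_on_compose)

lemma smooth_on_Pair:
  "open S \<Longrightarrow> smooth_on S f \<Longrightarrow> smooth_on S g \<Longrightarrow> smooth_on S (\<lambda>x. (f x, g x))"
  by (simp add: smooth_on_def Ck_on_Pair)

lemma smooth_on_differentiable: "smooth_on S f \<Longrightarrow> x \<in> S \<Longrightarrow> f differentiable (at x)"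
  unfolding smooth_on_def by (metis Ck_on.simps(2))

lemma smooth_on_frechet_derivative:
  "smooth_on S f \<Longrightarrow> smooth_on S (\<lambda>x. frechet_derivative f (at x) v)"
  unfolding smooth_on_def by (metis Ck_on.simps(2))

section \<open>Flat functions and bump functions\<close>

lemma poly_exp_at_top: "((\<lambda>t. poly P t * exp (- t)) \<longlongrightarrow> (0::real)) at_top"
proof -
  have "((\<lambda>t. \<Sum>i\<le>degree P. coeff P i * (t ^ i / exp t)) \<longlongrightarrow> (\<Sum>i\<le>degree P. coeff P i * 0)) at_top"
    by (intro tendsto_sum tendsto_mult tendsto_const tendsto_power_div_exp_0)
  then show ?thesis
    by (simp add: poly_altdef exp_minus sum_distrib_right divide_inverse mult.assoc)
qed

text \<open>The functions \<open>P (1 / x) exp (- 1 / x)\<close> are closed under differentiation, also at \<open>0\<close>.\<close>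

definition flat :: "real poly \<Rightarrow> real \<Rightarrow> real" where
  "flat P x = (if x > 0 then poly P (1 / x) * exp (- (1 / x)) else 0)"

text \<open>For \<open>x > 0\<close> the product and chain rules produce the factor
  \<open>1 / x^2\<close> and the polynomial \<open>P - pderiv P\<close>; in the variable
  \<open>t = 1 / x\<close> the new polynomial is \<open>t^2\<close> times that difference. At
  \<open>0\<close> the difference quotient is \<open>t P(t) exp (- t)\<close>, which tends to
  \<open>0\<close>.\<close>

lemma flat_deriv:
  "(flat P has_real_derivative flat ([:0, 0, 1:] * (P - pderiv P)) x) (at x)"
proof (cases "x = 0")
  case True
  have "((\<lambda>h. flat P h / h) \<longlongrightarrow> 0) (at_right 0)"
  proof -
    have "((\<lambda>h::real. poly ([:0, 1:] * P) (inverse h) * exp (- inverse h)) \<longlongrightarrow> 0) (at_right 0)"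
      by (rule filterlim_compose[OF poly_exp_at_top filterlim_inverse_at_top_right])
    then show ?thesis
      by (rule Lim_transform_eventually)
        (auto simp: flat_def divide_inverse intro!: eventually_at_rightI[of 0 1])
  qed
  moreover have "((\<lambda>h. flat P h / h) \<longlongrightarrow> 0) (at_left 0)"
    by (rule Lim_transform_eventually[OF tendsto_const])
      (auto simp: flat_def intro!: eventually_at_leftI[of "-1" 0])
  ultimately have "((\<lambda>h. flat P h / h) \<longlongrightarrow> 0) (at 0)"
    by (intro filterlim_split_at)
  then show ?thesis using True by (simp add: DERIV_def flat_def)
next
  case False
  show ?thesis
  proof (cases "x > 0")
    case True
    have "((\<lambda>x. poly P (1 / x) * exp (- (1 / x))) has_real_derivative
        flat ([:0, 0, 1:] * (P - pderiv P)) x) (at x)"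
      using True
      by (auto intro!: derivative_eq_intros simp: flat_def field_simps power2_eq_square)
    then show ?thesis
      by (rule has_field_derivative_transform_within_open[of _ _ _ "{0<..}"])
        (use True in \<open>auto simp: flat_def\<close>)
  next
    case N: False
    with False have "x < 0" by simp
    then have "((\<lambda>x. 0) has_real_derivative flat ([:0, 0, 1:] * (P - pderiv P)) x) (at x)"
      by (simp add: flat_def)
    then show ?thesis
      by (rule has_field_derivative_transform_within_open[of _ _ _ "{..<0}"])
        (use \<open>x < 0\<close> in \<open>auto simp: flat_def\<close>)
  qed
qed

lemma smooth_flat: "smooth_on UNIV (flat P)"
proof -
  have "Ck_on k UNIV (flat P)" for k
  proof (induction k arbitrary: P)
    case 0
    then show ?case
      using flat_deriv by (auto intro!: continuous_at_imp_continuous_on DERIV_isCont)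
  next
    case (Suc k)
    let ?Q = "[:0, 0, 1:] * (P - pderiv P)"
    have H: "(flat P has_derivative (\<lambda>v. flat ?Q x * v)) (at x)" for x
      using flat_deriv[of P x] unfolding has_field_derivative_def .
    then have "frechet_derivative (flat P) (at x) v = v *\<^sub>R flat ?Q x" for x v
      using frechet_derivative_at[OF H[of x]] by (metis mult.commute real_scaleR_def)
    then have "(\<lambda>x. frechet_derivative (flat P) (at x) v) = (\<lambda>x. v *\<^sub>R flat ?Q x)" for v by auto
    moreover have "Ck_on k UNIV (\<lambda>x. v *\<^sub>R flat ?Q x)" for v
      by (rule Ck_on_scaleR) (use Suc in auto)
    ultimately have "\<forall>v. Ck_on k UNIV (\<lambda>x. frechet_derivative (flat P) (at x) v)" by metis
    with H show ?case unfolding Ck_on.simps differentiable_def by blast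
  qed
  then show ?thesis by (simp add: smooth_on_def)
qed

text \<open>The flat function with constant polynomial is composed with
  \<open>r^2 - |y - y0|^2\<close>, which is positive exactly inside the ball, and divided by its
  value at the centre.\<close>

lemma smooth_bump_exists:
  fixes y0 :: "'a::euclidean_space"
  assumes "r > 0"
  obtains \<beta> :: "'a \<Rightarrow> real" where "smooth_on UNIV \<beta>" "\<beta> y0 = 1" "\<And>y. \<beta> y \<ge> 0"
    "\<And>y. y \<notin> cball y0 r \<Longrightarrow> \<beta> y = 0"
proof
  \<comment> \<open>The squared distance is written out in coordinates so that its smoothness
    follows from the rules for sums and products.\<close>
  define s :: "'a \<Rightarrow> real" where "s y = r\<^sup>2 + (\<Sum>b\<in>Basis. (- ((y - y0) \<bullet> b)) * ((y - y0) \<bullet> b))" for y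
  have s: "s y = r\<^sup>2 - (dist y0 y)\<^sup>2" for y
    unfolding s_def dist_norm norm_minus_commute[of y0] power2_norm_eq_inner
      euclidean_inner[of "y - y0" "y - y0"] by (simp add: sum_negf)
  define \<beta> where "\<beta> y = flat 1 (s y) * (1 / flat 1 (r\<^sup>2))" for y
  have sub: "smooth_on UNIV (\<lambda>y. (y - y0) \<bullet> b)" for b
    unfolding diff_conv_add_uminus
    by (intro smooth_on_bounded_linear[OF open_UNIV bounded_linear_inner_left] smooth_on_add
        smooth_on_id smooth_on_const open_UNIV)
  have "smooth_on UNIV s" unfolding s_def
    by (intro smooth_on_add smooth_on_sum smooth_on_mult open_UNIV smooth_on_const sub
        smooth_on_bounded_linear[OF _ bounded_linear_minus[OF bounded_linear_ident]])
  then show "smooth_on UNIV \<beta>" unfolding \<beta>_def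
    by (intro smooth_on_mult open_UNIV smooth_on_const
        smooth_on_compose[OF _ open_UNIV _ smooth_flat]) auto
  show "\<beta> y0 = 1" using assms by (simp add: \<beta>_def s flat_def)
  show "\<beta> y \<ge> 0" for y by (simp add: \<beta>_def flat_def)
  show "\<beta> y = 0" if "y \<notin> cball y0 r" for y
  proof -
    have "r < dist y0 y" using that by simp
    then have "r\<^sup>2 < (dist y0 y)\<^sup>2" using assms by (intro power_strict_mono) auto
    then show ?thesis by (simp add: \<beta>_def flat_def s)
  qed
qed

section \<open>Smooth maps between manifolds\<close>

lemma smooth_atlas_chart:
  assumes "smooth_atlas A" "(U, \<phi>) \<in> A"
  shows "open U" "open (\<phi> ` U)" "inj_on \<phi> U" "continuous_on U \<phi>" "continuous_on (\<phi> ` U) (inv_into U \<phi>)"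
proof -
  have *: "open U \<and> open (\<phi> ` U) \<and> homeomorphism U (\<phi> ` U) \<phi> (inv_into U \<phi>)"
    using assms unfolding smooth_atlas_def by fast
  then show "open U" "open (\<phi> ` U)" "continuous_on U \<phi>" "continuous_on (\<phi> ` U) (inv_into U \<phi>)"
    by (auto simp: homeomorphism_def)
  show "inj_on \<phi> U" using * unfolding homeomorphism_def by (metis inj_on_inverseI)
qed

lemma smooth_atlas_cover:
  assumes "smooth_atlas A"
  obtains U \<phi> where "(U, \<phi>) \<in> A" "p \<in> U"
proof -
  have "p \<in> (\<Union>(U, \<phi>)\<in>A. U)" using assms unfolding smooth_atlas_def by auto
  then show ?thesis using that by auto
qed

lemma smooth_atlas_transition:
  "smooth_atlas A \<Longrightarrow> (U, \<phi>) \<in> A \<Longrightarrow> (V, \<psi>) \<in> A \<Longrightarrow>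
    smooth_on (\<phi> ` (U \<inter> V)) (\<psi> \<circ> inv_into U \<phi>)"
  unfolding smooth_atlas_def by fast

lemma smooth_atlas_open_image:
  assumes "smooth_atlas A" "(U, \<phi>) \<in> A" "open W" "W \<subseteq> U"
  shows "open (\<phi> ` W)"
proof -
  note c = smooth_atlas_chart[OF assms(1,2)]
  have "\<phi> ` W = \<phi> ` U \<inter> inv_into U \<phi> -` W"
    using assms(4) c(3) by (auto simp: image_iff)
  then show ?thesis
    using continuous_on_open_vimage[OF c(2)] c(5) assms(3) by (metis Int_commute)
qed

lemma smooth_map_continuous: "smooth_map A B f \<Longrightarrow> continuous_on UNIV f"
  by (simp add: smooth_map_def)

lemma smooth_mapD:
  "smooth_map A B f \<Longrightarrow> (U, \<phi>) \<in> A \<Longrightarrow> (V, \<psi>) \<in> B \<Longrightarrow>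
    smooth_on (\<phi> ` (U \<inter> f -` V)) (\<psi> \<circ> f \<circ> inv_into U \<phi>)"
  unfolding smooth_map_def by fast

lemma smooth_mapI:
  assumes "continuous_on UNIV f"
    and "\<And>U \<phi> V \<psi>. (U, \<phi>) \<in> A \<Longrightarrow> (V, \<psi>) \<in> B \<Longrightarrow>
      smooth_on (\<phi> ` (U \<inter> f -` V)) (\<psi> \<circ> f \<circ> inv_into U \<phi>)"
  shows "smooth_map A B f"
  unfolding smooth_map_def using assms by fast

text \<open>\<open>f\<close> may carry a single chart domain across several charts of
  \<open>B\<close>. Smoothness is therefore checked locally: around each point an intermediate chart
  is chosen and the domain shrunk until \<open>f\<close> lands in it.\<close>

lemma smooth_map_compose:
  assumes A: "smooth_atlas A" and B: "smooth_atlas B" and C: "smooth_atlas C"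
    and f: "smooth_map A B f" and g: "smooth_map B C g"
  shows "smooth_map A C (\<lambda>x. g (f x))"
proof (rule smooth_mapI)
  have cf: "continuous_on UNIV f" and cg: "continuous_on UNIV g"
    using f g by (auto dest: smooth_map_continuous)
  then show "continuous_on UNIV (\<lambda>x. g (f x))"
    by (auto intro: continuous_on_compose2)
  fix U \<phi> W \<theta> assume U: "(U, \<phi>) \<in> A" and W: "(W, \<theta>) \<in> C"
  note cU = smooth_atlas_chart[OF A U]
  have opn: "open (U \<inter> f -` X)" if "open X" for X
    using open_vimage[OF that cf] cU(1) by auto
  show "smooth_on (\<phi> ` (U \<inter> (\<lambda>x. g (f x)) -` W)) (\<theta> \<circ> (\<lambda>x. g (f x)) \<circ> inv_into U \<phi>)"
  proof (rule smooth_on_local)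
    fix y assume "y \<in> \<phi> ` (U \<inter> (\<lambda>x. g (f x)) -` W)"
    then obtain p where p: "p \<in> U" "g (f p) \<in> W" "y = \<phi> p" by auto
    obtain V \<psi> where V: "(V, \<psi>) \<in> B" "f p \<in> V" using smooth_atlas_cover[OF B] by metis
    note cV = smooth_atlas_chart[OF B V(1)]
    let ?X = "V \<inter> g -` W"
    have X: "open ?X" using cV(1) open_vimage[OF smooth_atlas_chart(1)[OF C W] cg] by auto
    let ?T = "\<phi> ` (U \<inter> f -` ?X)"
    have T: "open ?T" using smooth_atlas_open_image[OF A U opn[OF X]] by auto
    have "smooth_on ?T (\<lambda>z. (\<theta> \<circ> g \<circ> inv_into V \<psi>) ((\<psi> \<circ> f \<circ> inv_into U \<phi>) z))"
    proof (rule smooth_on_compose[OF T, where g = "\<theta> \<circ> g \<circ> inv_into V \<psi>" and f = "\<psi> \<circ> f \<circ> inv_into U \<phi>"])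
      show "open (\<psi> ` ?X)" using smooth_atlas_open_image[OF B V(1) X] by auto
      show "smooth_on ?T (\<psi> \<circ> f \<circ> inv_into U \<phi>)"
        by (rule smooth_on_subset[OF smooth_mapD[OF f U V(1)]]) auto
      show "smooth_on (\<psi> ` ?X) (\<theta> \<circ> g \<circ> inv_into V \<psi>)"
        by (rule smooth_mapD[OF g V(1) W])
      show "(\<psi> \<circ> f \<circ> inv_into U \<phi>) ` ?T \<subseteq> \<psi> ` ?X"
        using cU(3) by (auto simp: inv_into_f_f)
    qed
    then have "smooth_on ?T (\<theta> \<circ> (\<lambda>x. g (f x)) \<circ> inv_into U \<phi>)"
      by (rule smooth_on_cong[THEN iffD1, OF T, rotated])
        (use cU(3) cV(3) in \<open>auto simp: inv_into_f_f\<close>)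
    then show "\<exists>T. open T \<and> y \<in> T \<and> smooth_on T (\<theta> \<circ> (\<lambda>x. g (f x)) \<circ> inv_into U \<phi>)"
      using T p V by blast
  qed
qed

lemma smooth_map_id: "smooth_atlas A \<Longrightarrow> smooth_map A A (\<lambda>x. x)"
  by (rule smooth_mapI) (use smooth_atlas_transition in \<open>auto simp: o_def vimage_def\<close>)

lemma smooth_map_const: "smooth_map A B (\<lambda>x. c)"
  by (rule smooth_mapI) (auto simp: o_def)

lemma smooth_atlas_euclidean: "smooth_atlas (euclidean_atlas :: ('e::euclidean_space, 'e) chart set)"
proof -
  have inv: "inv_into UNIV (id :: 'e \<Rightarrow> 'e) = id" by (simp add: inv_id)
  have "smooth_on UNIV (id :: 'e \<Rightarrow> 'e)" using smooth_on_id by (simp add: id_def)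
  then show ?thesis
    by (auto simp: smooth_atlas_def euclidean_atlas_def inv homeomorphism_def)
qed

text \<open>\<open>inv_into\<close> is a choice that means something on the image, so computations
  with product charts are carried out on the product of the two images, where both inverse charts
  are genuine.\<close>

lemma inv_into_map_prod:
  assumes "inj_on \<phi> U" "inj_on \<psi> V" "y \<in> \<phi> ` U" "z \<in> \<psi> ` V"
  shows "inv_into (U \<times> V) (map_prod \<phi> \<psi>) (y, z) = (inv_into U \<phi> y, inv_into V \<psi> z)"
proof -
  have "inj_on (map_prod \<phi> \<psi>) (U \<times> V)" using assms by (simp add: map_prod_inj_on)
  from inv_into_f_f[OF this, of "(inv_into U \<phi> y, inv_into V \<psi> z)"] assms show ?thesis
    by (simp add: f_inv_into_f inv_into_into)
qed

lemma prod_atlasE: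
  assumes "(X, \<gamma>) \<in> prod_atlas A B"
  obtains U \<phi> V \<psi> where "X = U \<times> V" "\<gamma> = map_prod \<phi> \<psi>" "(U, \<phi>) \<in> A" "(V, \<psi>) \<in> B"
  using assms unfolding prod_atlas_def by auto

lemma prod_atlasI: "(U, \<phi>) \<in> A \<Longrightarrow> (V, \<psi>) \<in> B \<Longrightarrow> (U \<times> V, map_prod \<phi> \<psi>) \<in> prod_atlas A B"
  unfolding prod_atlas_def by auto

lemma smooth_atlas_prod:
  assumes A: "smooth_atlas A" and B: "smooth_atlas B"
  shows "smooth_atlas (prod_atlas A B)"
  unfolding smooth_atlas_def
proof (intro conjI)
  show "(\<Union>(U, \<phi>)\<in>prod_atlas A B. U) = UNIV"
  proof -
    have "\<exists>W\<in>prod_atlas A B. (p, q) \<in> fst W" for p q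
    proof -
      obtain U \<phi> V \<psi> where "(U, \<phi>) \<in> A" "p \<in> U" "(V, \<psi>) \<in> B" "q \<in> V"
        using smooth_atlas_cover[OF A, of p] smooth_atlas_cover[OF B, of q] by metis
      then show ?thesis using prod_atlasI[of U \<phi> A V \<psi> B] by force
    qed
    then show ?thesis by (auto simp: split_beta)
  qed
  show "\<forall>(X, \<gamma>)\<in>prod_atlas A B. open X \<and> open (\<gamma> ` X) \<and> homeomorphism X (\<gamma> ` X) \<gamma> (inv_into X \<gamma>)"
  proof (intro ballI, clarify)
    fix X \<gamma> assume "(X, \<gamma>) \<in> prod_atlas A B"
    then obtain U \<phi> V \<psi> where X: "X = U \<times> V" "\<gamma> = map_prod \<phi> \<psi>" and U: "(U, \<phi>) \<in> A" and V: "(V, \<psi>) \<in> B"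
      by (rule prod_atlasE)
    note cU = smooth_atlas_chart[OF A U] and cV = smooth_atlas_chart[OF B V]
    have im: "\<gamma> ` X = \<phi> ` U \<times> \<psi> ` V" by (auto simp: X)
    have inv: "inv_into X \<gamma> p = (inv_into U \<phi> (fst p), inv_into V \<psi> (snd p))" if "p \<in> \<gamma> ` X" for p
      using inv_into_map_prod[OF cU(3) cV(3), of "fst p" "snd p"] that by (auto simp: X)
    have inj: "inj_on \<gamma> X" using cU(3) cV(3) by (simp add: X map_prod_inj_on)
    have "continuous_on X \<gamma>" unfolding X map_prod_def split_beta
      by (intro continuous_intros continuous_on_compose2[OF cU(4)] continuous_on_compose2[OF cV(4)]) auto
    moreover have "continuous_on (\<gamma> ` X) (inv_into X \<gamma>)"
      by (subst continuous_on_cong[OF refl inv], assumption, unfold im)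
        (intro continuous_intros continuous_on_compose2[OF cU(5)] continuous_on_compose2[OF cV(5)]; auto)
    moreover have "inv_into X \<gamma> ` \<gamma> ` X = X" using inj by simp
    ultimately show "open X \<and> open (\<gamma> ` X) \<and> homeomorphism X (\<gamma> ` X) \<gamma> (inv_into X \<gamma>)"
      unfolding homeomorphism_def using cU(1,2) cV(1,2) inj
      by (simp add: f_inv_into_f[of _ \<gamma> X] im open_Times) (simp add: X(1) open_Times)
  qed
  show "\<forall>(X, \<gamma>)\<in>prod_atlas A B. \<forall>(X', \<gamma>')\<in>prod_atlas A B.
      smooth_on (\<gamma> ` (X \<inter> X')) (\<gamma>' \<circ> inv_into X \<gamma>)"
  proof (intro ballI, clarify)
    fix X \<gamma> X' \<gamma>' assume "(X, \<gamma>) \<in> prod_atlas A B" "(X', \<gamma>') \<in> prod_atlas A B"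
    then obtain U \<phi> V \<psi> U' \<phi>' V' \<psi>' where X: "X = U \<times> V" "\<gamma> = map_prod \<phi> \<psi>"
      and U: "(U, \<phi>) \<in> A" and V: "(V, \<psi>) \<in> B"
      and X': "X' = U' \<times> V'" "\<gamma>' = map_prod \<phi>' \<psi>'" and U': "(U', \<phi>') \<in> A" and V': "(V', \<psi>') \<in> B"
      by (metis prod_atlasE)
    note cU = smooth_atlas_chart[OF A U] and cV = smooth_atlas_chart[OF B V]
    have im: "\<gamma> ` (X \<inter> X') = \<phi> ` (U \<inter> U') \<times> \<psi> ` (V \<inter> V')" by (auto simp: X X')
    have "open (U \<inter> U')" "open (V \<inter> V')"
      using cU(1) cV(1) smooth_atlas_chart(1)[OF A U'] smooth_atlas_chart(1)[OF B V'] by auto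
    then have opU: "open (\<phi> ` (U \<inter> U'))" and opV: "open (\<psi> ` (V \<inter> V'))"
      using smooth_atlas_open_image[OF A U] smooth_atlas_open_image[OF B V] by auto
    then have op: "open (\<phi> ` (U \<inter> U') \<times> \<psi> ` (V \<inter> V'))" by (rule open_Times)
    show "smooth_on (\<gamma> ` (X \<inter> X')) (\<gamma>' \<circ> inv_into X \<gamma>)"
      unfolding im
    proof (subst smooth_on_cong[OF op])
      show "(\<gamma>' \<circ> inv_into X \<gamma>) p = ((\<phi>' \<circ> inv_into U \<phi>) (fst p), (\<psi>' \<circ> inv_into V \<psi>) (snd p))"
        if "p \<in> \<phi> ` (U \<inter> U') \<times> \<psi> ` (V \<inter> V')" for p
        using inv_into_map_prod[OF cU(3) cV(3), of "fst p" "snd p"] that by (auto simp: X X')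
      show "smooth_on (\<phi> ` (U \<inter> U') \<times> \<psi> ` (V \<inter> V'))
          (\<lambda>p. ((\<phi>' \<circ> inv_into U \<phi>) (fst p), (\<psi>' \<circ> inv_into V \<psi>) (snd p)))"
        by (intro smooth_on_Pair op
            smooth_on_compose[OF op opU _ smooth_atlas_transition[OF A U U']]
            smooth_on_compose[OF op opV _ smooth_atlas_transition[OF B V V']]
            smooth_on_linear bounded_linear_fst bounded_linear_snd) auto
    qed
  qed
qed

lemma smooth_map_Pair:
  assumes C: "smooth_atlas C" and A: "smooth_atlas A" and B: "smooth_atlas B"
    and f: "smooth_map C A f" and g: "smooth_map C B g"
  shows "smooth_map C (prod_atlas A B) (\<lambda>x. (f x, g x))"
proof (rule smooth_mapI)
  have cf: "continuous_on UNIV f" and cg: "continuous_on UNIV g"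
    using f g by (auto dest: smooth_map_continuous)
  then show "continuous_on UNIV (\<lambda>x. (f x, g x))" by (rule continuous_on_Pair)
  fix W \<theta> X \<gamma> assume W: "(W, \<theta>) \<in> C" and "(X, \<gamma>) \<in> prod_atlas A B"
  then obtain U \<phi> V \<psi> where X: "X = U \<times> V" "\<gamma> = map_prod \<phi> \<psi>" and U: "(U, \<phi>) \<in> A" and V: "(V, \<psi>) \<in> B"
    using prod_atlasE by metis
  have "open (W \<inter> (\<lambda>x. (f x, g x)) -` X)"
    using open_vimage[OF smooth_atlas_chart(1)[OF A U] cf] open_vimage[OF smooth_atlas_chart(1)[OF B V] cg]
      smooth_atlas_chart(1)[OF C W] by (auto simp: X vimage_def mem_Times_iff Collect_conj_eq)
  then have op: "open (\<theta> ` (W \<inter> (\<lambda>x. (f x, g x)) -` X))"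
    using smooth_atlas_open_image[OF C W] by auto
  show "smooth_on (\<theta> ` (W \<inter> (\<lambda>x. (f x, g x)) -` X)) (\<gamma> \<circ> (\<lambda>x. (f x, g x)) \<circ> inv_into W \<theta>)"
  proof (subst smooth_on_cong[OF op])
    show "(\<gamma> \<circ> (\<lambda>x. (f x, g x)) \<circ> inv_into W \<theta>) y =
      ((\<phi> \<circ> f \<circ> inv_into W \<theta>) y, (\<psi> \<circ> g \<circ> inv_into W \<theta>) y)" for y by (simp add: X)
    show "smooth_on (\<theta> ` (W \<inter> (\<lambda>x. (f x, g x)) -` X))
      (\<lambda>y. ((\<phi> \<circ> f \<circ> inv_into W \<theta>) y, (\<psi> \<circ> g \<circ> inv_into W \<theta>) y))"
      by (intro smooth_on_Pair op smooth_on_subset[OF smooth_mapD[OF f W U]]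
          smooth_on_subset[OF smooth_mapD[OF g W V]]) (auto simp: X)
  qed
qed

lemma smooth_map_fst:
  assumes A: "smooth_atlas A" and B: "smooth_atlas B"
  shows "smooth_map (prod_atlas A B) A fst"
proof (rule smooth_mapI)
  show "continuous_on UNIV (fst :: 'a \<times> 'c \<Rightarrow> 'a)" by (intro continuous_intros)
  fix X \<gamma> W \<theta> assume "(X, \<gamma>) \<in> prod_atlas A B" and W: "(W, \<theta>) \<in> A"
  then obtain U \<phi> V \<psi> where X: "X = U \<times> V" "\<gamma> = map_prod \<phi> \<psi>" and U: "(U, \<phi>) \<in> A" and V: "(V, \<psi>) \<in> B"
    using prod_atlasE by metis
  note cU = smooth_atlas_chart[OF A U] and cV = smooth_atlas_chart[OF B V]
  have opU: "open (\<phi> ` (U \<inter> W))"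
    using smooth_atlas_open_image[OF A U] smooth_atlas_chart(1)[OF A W] cU(1) by auto
  have im: "\<gamma> ` (X \<inter> fst -` W) = \<phi> ` (U \<inter> W) \<times> \<psi> ` V" by (auto simp: X image_iff)
  have op: "open (\<phi> ` (U \<inter> W) \<times> \<psi> ` V)" using opU cV(2) by (rule open_Times)
  show "smooth_on (\<gamma> ` (X \<inter> fst -` W)) (\<theta> \<circ> fst \<circ> inv_into X \<gamma>)"
    unfolding im
  proof (subst smooth_on_cong[OF op])
    show "(\<theta> \<circ> fst \<circ> inv_into X \<gamma>) p = (\<theta> \<circ> inv_into U \<phi>) (fst p)"
      if "p \<in> \<phi> ` (U \<inter> W) \<times> \<psi> ` V" for p
      using inv_into_map_prod[OF cU(3) cV(3), of "fst p" "snd p"] that by (auto simp: X)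
    show "smooth_on (\<phi> ` (U \<inter> W) \<times> \<psi> ` V) (\<lambda>p. (\<theta> \<circ> inv_into U \<phi>) (fst p))"
      by (rule smooth_on_compose[OF op opU _ smooth_atlas_transition[OF A U W]])
        (auto intro: smooth_on_linear op bounded_linear_fst)
  qed
qed

lemma smooth_map_snd:
  assumes A: "smooth_atlas A" and B: "smooth_atlas B"
  shows "smooth_map (prod_atlas A B) B snd"
proof (rule smooth_mapI)
  show "continuous_on UNIV (snd :: 'a \<times> 'c \<Rightarrow> 'c)" by (intro continuous_intros)
  fix X \<gamma> W \<theta> assume "(X, \<gamma>) \<in> prod_atlas A B" and W: "(W, \<theta>) \<in> B"
  then obtain U \<phi> V \<psi> where X: "X = U \<times> V" "\<gamma> = map_prod \<phi> \<psi>" and U: "(U, \<phi>) \<in> A" and V: "(V, \<psi>) \<in> B"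
    using prod_atlasE by metis
  note cU = smooth_atlas_chart[OF A U] and cV = smooth_atlas_chart[OF B V]
  have opV: "open (\<psi> ` (V \<inter> W))"
    using smooth_atlas_open_image[OF B V] smooth_atlas_chart(1)[OF B W] cV(1) by auto
  have im: "\<gamma> ` (X \<inter> snd -` W) = \<phi> ` U \<times> \<psi> ` (V \<inter> W)" by (auto simp: X image_iff)
  have op: "open (\<phi> ` U \<times> \<psi> ` (V \<inter> W))" using cU(2) opV by (rule open_Times)
  show "smooth_on (\<gamma> ` (X \<inter> snd -` W)) (\<theta> \<circ> snd \<circ> inv_into X \<gamma>)"
    unfolding im
  proof (subst smooth_on_cong[OF op])
    show "(\<theta> \<circ> snd \<circ> inv_into X \<gamma>) p = (\<theta> \<circ> inv_into V \<psi>) (snd p)"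
      if "p \<in> \<phi> ` U \<times> \<psi> ` (V \<inter> W)" for p
      using inv_into_map_prod[OF cU(3) cV(3), of "fst p" "snd p"] that by (auto simp: X)
    show "smooth_on (\<phi> ` U \<times> \<psi> ` (V \<inter> W)) (\<lambda>p. (\<theta> \<circ> inv_into V \<psi>) (snd p))"
      by (rule smooth_on_compose[OF op opV _ smooth_atlas_transition[OF B V W]])
        (auto intro: smooth_on_linear op bounded_linear_snd)
  qed
qed

text \<open>Global continuity, which \<open>smooth_map\<close> demands separately, is recovered by
  gluing the continuous chart expressions along the open chart domains.\<close>

lemma smooth_map_euclidean_iff:
  assumes A: "smooth_atlas A"
  shows "smooth_map A euclidean_atlas f \<longleftrightarrow> (\<forall>(U, \<phi>)\<in>A. smooth_on (\<phi> ` U) (\<lambda>y. f (inv_into U \<phi> y)))"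
proof
  assume "smooth_map A euclidean_atlas f"
  from smooth_mapD[OF this, of _ _ UNIV id]
  show "\<forall>(U, \<phi>)\<in>A. smooth_on (\<phi> ` U) (\<lambda>y. f (inv_into U \<phi> y))"
    by (auto simp: euclidean_atlas_def o_def)
next
  assume *: "\<forall>(U, \<phi>)\<in>A. smooth_on (\<phi> ` U) (\<lambda>y. f (inv_into U \<phi> y))"
  have "\<exists>U. open U \<and> p \<in> U \<and> continuous_on U f" for p
  proof -
    obtain U \<phi> where U: "(U, \<phi>) \<in> A" "p \<in> U" using smooth_atlas_cover[OF A] by metis
    note cU = smooth_atlas_chart[OF A U(1)]
    have "continuous_on (\<phi> ` U) (\<lambda>y. f (inv_into U \<phi> y))"
      using * U smooth_on_imp_continuous_on by blast
    from continuous_on_compose2[OF this cU(4)] have "continuous_on U (\<lambda>q. f (inv_into U \<phi> (\<phi> q)))" by auto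
    then have "continuous_on U f" using cU(3) by (auto cong: continuous_on_cong)
    then show ?thesis using U(2) cU(1) by blast
  qed
  then obtain N where N: "\<And>p. open (N p)" "\<And>p. p \<in> N p" "\<And>p. continuous_on (N p) f" by metis
  then have "continuous_on (\<Union> (range N)) f" by (intro continuous_on_open_Union) auto
  moreover have "\<Union> (range N) = UNIV" using N(2) by auto
  ultimately have "continuous_on UNIV f" by simp
  then show "smooth_map A euclidean_atlas f"
    by (rule smooth_mapI) (use * in \<open>auto simp: euclidean_atlas_def o_def\<close>)
qed

text \<open>The support has compact, hence closed, preimage in the Hausdorff space, so a point
  outside \<open>U\<close> has a neighbourhood on which the extension vanishes. Inside
  \<open>U\<close> the extension is a transition map followed by \<open>f\<close>.\<close>

lemma smooth_map_extend_zero: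
  fixes A :: "('g::t2_space, 'e::euclidean_space) chart set" and f :: "'e \<Rightarrow> real"
  assumes A: "smooth_atlas A" and U: "(U, \<phi>) \<in> A"
    and f: "smooth_on (\<phi> ` U) f" and K: "compact K" "K \<subseteq> \<phi> ` U"
    and 0: "\<And>y. y \<in> \<phi> ` U \<Longrightarrow> y \<notin> K \<Longrightarrow> f y = 0"
  shows "smooth_map A euclidean_atlas (\<lambda>p. if p \<in> U then f (\<phi> p) else 0)" (is "smooth_map _ _ ?F")
  unfolding smooth_map_euclidean_iff[OF A]
proof (intro ballI, clarify)
  fix V \<psi> assume V: "(V, \<psi>) \<in> A"
  note cU = smooth_atlas_chart[OF A U] and cV = smooth_atlas_chart[OF A V]
  define K' where "K' = inv_into U \<phi> ` K"
  have "compact K'" unfolding K'_def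
    by (rule compact_continuous_image[OF continuous_on_subset[OF cU(5)]]) (use K in auto)
  then have clK: "closed K'" by (rule compact_imp_closed)
  have out: "?F p = 0" if "p \<notin> K'" for p
  proof -
    have "\<phi> p \<notin> K" if "p \<in> U"
    proof
      assume "\<phi> p \<in> K"
      then have "inv_into U \<phi> (\<phi> p) \<in> K'" unfolding K'_def by blast
      with that \<open>p \<notin> K'\<close> show False using cU(3) by simp
    qed
    then show ?thesis using 0 by auto
  qed
  show "smooth_on (\<psi> ` V) (\<lambda>y. ?F (inv_into V \<psi> y))"
  proof (rule smooth_on_local)
    fix y assume "y \<in> \<psi> ` V"
    then obtain p where p: "p \<in> V" "y = \<psi> p" by auto
    show "\<exists>T. open T \<and> y \<in> T \<and> smooth_on T (\<lambda>y. ?F (inv_into V \<psi> y))"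
    proof (cases "p \<in> U")
      case True
      let ?T = "\<psi> ` (V \<inter> U)"
      have T: "open ?T" using smooth_atlas_open_image[OF A V] cU(1) cV(1) by auto
      have "smooth_on ?T (\<lambda>y. f ((\<phi> \<circ> inv_into V \<psi>) y))"
        by (rule smooth_on_compose[OF T cU(2) smooth_atlas_transition[OF A V U] f])
          (use cV(3) in auto)
      then have "smooth_on ?T (\<lambda>y. ?F (inv_into V \<psi> y))"
        by (rule smooth_on_cong[THEN iffD1, OF T, rotated]) (use cV(3) in auto)
      with T True p show ?thesis by blast
    next
      case False
      let ?T = "\<psi> ` (V - K')"
      \<comment> \<open>Removing the closed set \<open>K'\<close> from the chart leaves a
        neighbourhood of \<open>p\<close> that misses the support.\<close>
      have T: "open ?T" using smooth_atlas_open_image[OF A V, of "V - K'"] cV(1) clK by auto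
      have "smooth_on ?T (\<lambda>y. ?F (inv_into V \<psi> y))"
      proof (subst smooth_on_cong[OF T, where g = "\<lambda>_. 0"])
        show "?F (inv_into V \<psi> y) = 0" if "y \<in> ?T" for y
          using that out cV(3) by (metis DiffE Diff_subset image_iff inv_into_f_f)
      qed simp
      moreover have "K' \<subseteq> U" using K(2) by (auto simp: K'_def intro: inv_into_into)
      ultimately show ?thesis using T False p by blast
    qed
  qed
qed

section \<open>The invariant mean of a compact group\<close>

locale compact_group =
  fixes mul :: "'g::t2_space \<Rightarrow> 'g \<Rightarrow> 'g" (infixl "\<cdot>" 70)
    and iv :: "'g \<Rightarrow> 'g" and e :: 'g
  assumes assoc: "(x \<cdot> y) \<cdot> z = x \<cdot> (y \<cdot> z)"
    and e_left [simp]: "e \<cdot> x = x" and e_right [simp]: "x \<cdot> e = x"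
    and iv_left [simp]: "iv x \<cdot> x = e" and iv_right [simp]: "x \<cdot> iv x = e"
    and cont_mul: "continuous_on UNIV (\<lambda>(x, y). x \<cdot> y)"
    and compact: "compact (UNIV :: 'g set)"
begin

text \<open>Right averages and right means are the left ones of the opposite group; this supplies
  them without a second development.\<close>

lemma opposite: "compact_group (\<lambda>x y. y \<cdot> x) iv e"
proof
  have "continuous_on UNIV (\<lambda>p. (\<lambda>(x, y). x \<cdot> y) (prod.swap p))"
    by (rule continuous_on_compose2[OF cont_mul]) (auto intro: continuous_on_swap)
  then show "continuous_on UNIV (\<lambda>(x, y). y \<cdot> x)" by (simp add: split_beta)
qed (auto simp: assoc compact)

lemma iv_cancel [simp]: "iv x \<cdot> (x \<cdot> y) = y" "x \<cdot> (iv x \<cdot> y) = y"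
  by (simp_all flip: assoc)

lemma continuous_translate:
  assumes "continuous_on UNIV (f :: 'g \<Rightarrow> 'b::topological_space)"
  shows "continuous_on UNIV (\<lambda>x. f (a \<cdot> x))" "continuous_on UNIV (\<lambda>x. f (x \<cdot> a))"
  using continuous_on_compose2[OF assms continuous_on_compose2[OF cont_mul, of UNIV "\<lambda>x. (a, x)"]]
    continuous_on_compose2[OF assms continuous_on_compose2[OF cont_mul, of UNIV "\<lambda>x. (x, a)"]]
  by (auto simp: continuous_on_Pair continuous_on_const continuous_on_id)

definition left_translations :: "(('g \<Rightarrow> real) \<Rightarrow> ('g \<Rightarrow> real)) set" where
  "left_translations = range (\<lambda>a f x. f (a \<cdot> x))"

text \<open>The hull is formed among operators rather than among the translates of one function, so
  that one and the same average can be applied to two functions; additivity of the mean depends on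
  this.\<close>

definition averages :: "(('g \<Rightarrow> real) \<Rightarrow> ('g \<Rightarrow> real)) set" where
  "averages = convex hull left_translations"

lemma averages_induct [consumes 1, case_names translation convex]:
  assumes "T \<in> averages" "\<And>a. P (\<lambda>f x. f (a \<cdot> x))"
    and "\<And>S T u v. P S \<Longrightarrow> P T \<Longrightarrow> 0 \<le> u \<Longrightarrow> 0 \<le> v \<Longrightarrow> u + v = 1 \<Longrightarrow> P (\<lambda>f x. u * S f x + v * T f x)"
  shows "P T"
  using assms(1) unfolding averages_def
proof (rule hull_induct)
  show "P T" if "T \<in> left_translations" for T using that assms(2) by (auto simp: left_translations_def)
  have "u *\<^sub>R S + v *\<^sub>R T = (\<lambda>f x. u * S f x + v * T f x)"
    for u v and S T :: "('g \<Rightarrow> real) \<Rightarrow> ('g \<Rightarrow> real)"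
    by (intro ext) (simp add: scaleR_fun_def plus_fun_def)
  then show "convex {T. P T}" unfolding convex_def using assms(3) by simp
qed

lemma translation_average: "(\<lambda>f x. f (a \<cdot> x)) \<in> averages"
  unfolding averages_def left_translations_def by (rule hull_inc) auto

lemma averages_convex:
  assumes "S \<in> averages" "T \<in> averages" "0 \<le> u" "0 \<le> v" "u + v = 1"
  shows "(\<lambda>f x. u * S f x + v * T f x) \<in> averages"
proof -
  have "u *\<^sub>R S + v *\<^sub>R T = (\<lambda>f x. u * S f x + v * T f x)"
    by (intro ext) (simp add: scaleR_fun_def plus_fun_def)
  moreover have "convex averages" by (simp add: averages_def convex_convex_hull)
  ultimately show ?thesis using assms unfolding convex_def by metis
qed

lemma average_linear:
  assumes "T \<in> averages"
  shows "T (\<lambda>x. c * f x + d * g x) = (\<lambda>x. c * T f x + d * T g x)"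
  using assms by (induction rule: averages_induct) (auto simp: algebra_simps)

lemma average_mono:
  "T \<in> averages \<Longrightarrow> (\<And>x. f x \<le> g x) \<Longrightarrow> T f x \<le> T g x"
  by (induction arbitrary: x rule: averages_induct) (auto intro!: add_mono mult_left_mono)

lemma average_const: "T \<in> averages \<Longrightarrow> T (\<lambda>x. c) = (\<lambda>x. c)"
  by (induction rule: averages_induct) (auto simp flip: distrib_right)

text \<open>Left and right translations commute. An average of \<open>f\<close> therefore keeps the
  modulus of continuity that \<open>f\<close> has under right translations.\<close>

lemma average_right_translate:
  "T \<in> averages \<Longrightarrow> T (\<lambda>x. f (x \<cdot> b)) = (\<lambda>x. T f (x \<cdot> b))"
  by (induction rule: averages_induct) (auto simp: assoc)

lemma average_continuous:
  "T \<in> averages \<Longrightarrow> continuous_on UNIV f \<Longrightarrow> continuous_on UNIV (T f)"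
  by (induction rule: averages_induct) (auto intro!: continuous_translate continuous_intros)

lemma average_close_const:
  assumes "T \<in> averages" "\<And>x. \<bar>f x - c\<bar> \<le> \<epsilon>"
  shows "\<bar>T f x - c\<bar> \<le> \<epsilon>"
proof -
  have "T f x \<le> T (\<lambda>x. c + \<epsilon>) x" by (rule average_mono[OF assms(1)]) (use assms(2) abs_le_D1 in \<open>force simp: abs_le_iff algebra_simps\<close>)
  moreover have "T (\<lambda>x. c - \<epsilon>) x \<le> T f x" by (rule average_mono[OF assms(1)]) (use assms(2) in \<open>force simp: abs_le_iff algebra_simps\<close>)
  ultimately show ?thesis by (simp add: average_const[OF assms(1)] abs_le_iff)
qed

lemma average_compose:
  assumes "S \<in> averages" "T \<in> averages"
  shows "(\<lambda>f. S (T f)) \<in> averages"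
  using assms(1)
proof (induction rule: averages_induct)
  case (translation a)
  from assms(2) show ?case
  proof (induction rule: averages_induct)
    case (translation b)
    then show ?case using translation_average[of "b \<cdot> a"] by (simp add: assoc)
  next
    case (convex S T u v)
    then show ?case using averages_convex[of "\<lambda>f x. S f (a \<cdot> x)" "\<lambda>f x. T f (a \<cdot> x)"] by simp
  qed
next
  case (convex S1 S2 u v)
  then show ?case using averages_convex[of "\<lambda>f. S1 (T f)" "\<lambda>f. S2 (T f)"] by simp
qed

lemma average_sum:
  assumes "finite I" "I \<noteq> {}"
  shows "(\<lambda>f x. (\<Sum>i\<in>I. f (a i \<cdot> x)) / card I) \<in> averages"
proof -
  have "(\<Sum>i\<in>I. (1 / card I) *\<^sub>R (\<lambda>f x. f (a i \<cdot> x))) \<in> averages"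
    by (rule convex_sum) (use assms translation_average in \<open>auto simp: averages_def convex_convex_hull\<close>)
  moreover have "(\<Sum>i\<in>I. (1 / card I) *\<^sub>R (\<lambda>f x. f (a i \<cdot> x))) = (\<lambda>(f::'g \<Rightarrow> real) x. (\<Sum>i\<in>I. f (a i \<cdot> x)) / card I)"
  proof (intro ext)
    fix f :: "'g \<Rightarrow> real" and x
    have "(\<Sum>i\<in>I. F i) f x = (\<Sum>i\<in>I. F i f x)" for F :: "_ \<Rightarrow> ('g \<Rightarrow> real) \<Rightarrow> 'g \<Rightarrow> real"
      by (induction I rule: infinite_finite_induct) auto
    then show "(\<Sum>i\<in>I. (1 / card I) *\<^sub>R (\<lambda>f x. f (a i \<cdot> x))) f x = (\<Sum>i\<in>I. f (a i \<cdot> x)) / card I"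
      by (simp add: scaleR_fun_def sum_divide_distrib)
  qed
  ultimately show ?thesis by simp
qed

text \<open>A tube-lemma argument: compactness of the range of \<open>x\<close> makes continuity in
  \<open>u\<close> uniform.\<close>

lemma equicontinuous_at_e:
  assumes "continuous_on UNIV (f :: 'g \<Rightarrow> real)" "\<epsilon> > 0"
  obtains U where "open U" "e \<in> U" "\<And>u x. u \<in> U \<Longrightarrow> \<bar>f (x \<cdot> u) - f x\<bar> \<le> \<epsilon>"
proof -
  have c: "continuous_on (UNIV \<times> UNIV) (\<lambda>p. f (snd p \<cdot> fst p))"
  proof (rule continuous_on_compose2[OF assms(1)])
    show "continuous_on (UNIV \<times> UNIV) (\<lambda>p. snd p \<cdot> fst p)"
      using continuous_on_compose2[OF cont_mul continuous_on_swap[of UNIV]] by (simp add: split_beta)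
  qed simp
  obtain X0 where X0: "e \<in> X0" "open X0" "\<forall>x\<in>X0 \<inter> UNIV. \<forall>t\<in>UNIV. dist (f (t \<cdot> x)) (f (t \<cdot> e)) \<le> \<epsilon>"
    by (rule continuous_on_prod_compactE[OF c compact UNIV_I[of e] assms(2)]) simp
  show ?thesis
  proof (rule that[OF X0(2,1)])
    show "\<bar>f (x \<cdot> u) - f x\<bar> \<le> \<epsilon>" if "u \<in> X0" for u x
      using X0(3)[rule_format, of u x] that by (simp add: dist_real_def)
  qed
qed

lemma open_translate: "open U \<Longrightarrow> open ((\<lambda>x. a \<cdot> x) ` U)"
proof -
  assume "open U"
  have "(\<lambda>x. a \<cdot> x) ` U = (\<lambda>x. iv a \<cdot> x) -` U"
    by (auto intro!: image_eqI[of _ _ "iv a \<cdot> x" for x])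
  then show ?thesis
    using open_vimage[OF \<open>open U\<close> continuous_translate(1)[of "\<lambda>x. x" "iv a"]] by (simp add: continuous_on_id)
qed

lemma finite_translates_cover:
  assumes "open U" "e \<in> U"
  obtains I where "finite I" "I \<noteq> {}" "\<And>x. \<exists>c\<in>I. iv c \<cdot> x \<in> U"
proof -
  have "\<exists>D\<subseteq>range (\<lambda>c. (\<lambda>x. c \<cdot> x) ` U). finite D \<and> UNIV \<subseteq> \<Union>D"
  proof (rule compactE[OF compact])
    show "UNIV \<subseteq> \<Union> (range (\<lambda>c. (\<lambda>x. c \<cdot> x) ` U))"
    proof
      fix x have "x \<in> (\<lambda>y. x \<cdot> y) ` U" using assms(2) by (auto intro: image_eqI[of _ _ e])
      then show "x \<in> \<Union> (range (\<lambda>c. (\<lambda>x. c \<cdot> x) ` U))" by blast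
    qed
  qed (use open_translate[OF assms(1)] in auto)
  then obtain D where D: "D \<subseteq> range (\<lambda>c. (\<lambda>x. c \<cdot> x) ` U)" "finite D" "UNIV \<subseteq> \<Union>D" by blast
  from finite_subset_image[OF D(2,1)] obtain I where I: "finite I" "D = (\<lambda>c. (\<lambda>x. c \<cdot> x) ` U) ` I" by blast
  have *: "\<exists>c\<in>I. iv c \<cdot> x \<in> U" for x
  proof -
    have "x \<in> (\<Union>c\<in>I. (\<lambda>x. c \<cdot> x) ` U)" using D(3) I(2) by blast
    then obtain c u where "c \<in> I" "u \<in> U" "x = c \<cdot> u" by blast
    then show ?thesis by (intro bexI[of _ c]) simp_all
  qed
  then have "I \<noteq> {}" by blast
  from that[OF I(1) this *] show ?thesis .
qed

section \<open>Existence and uniqueness of the mean\<close>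

definition is_mean :: "('g \<Rightarrow> real) \<Rightarrow> real \<Rightarrow> bool" where
  "is_mean f c \<longleftrightarrow> (\<forall>\<epsilon>>0. \<exists>T\<in>averages. \<forall>x. \<bar>T f x - c\<bar> \<le> \<epsilon>)"

text \<open>If the maximum of an average of \<open>f\<close> is nearly as small as it can be, then that average is
  nearly constant: otherwise averaging over finitely many translates would lower the maximum
  by an amount that depends only on the modulus of continuity of \<open>f\<close>.\<close>

lemma mean_exists:
  assumes f: "continuous_on UNIV f"
  shows "\<exists>c. is_mean f c"
proof -
  define sup where "sup h = (SUP x. h x)" for h :: "'g \<Rightarrow> real"
  have bdd: "bdd_above (range h)" if "continuous_on UNIV h" for h :: "'g \<Rightarrow> real"
    using compact_continuous_image[OF that compact] by (simp add: bounded_imp_bdd_above compact_imp_bounded)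
  have le_sup: "h x \<le> sup h" if "continuous_on UNIV h" for h x
    unfolding sup_def by (rule cSUP_upper[OF _ bdd[OF that]]) auto
  obtain m where m: "\<And>x. m \<le> f x"
  proof -
    have "bounded (range f)" using compact_continuous_image[OF f compact] compact_imp_bounded by blast
    then obtain B where "\<forall>x. \<bar>f x\<bar> \<le> B" by (auto simp: bounded_iff)
    then show ?thesis using that[of "- B"] by (metis abs_le_iff minus_le_iff)
  qed
  have lb: "m \<le> sup (T f)" if "T \<in> averages" for T
    using average_mono[OF that, of "\<lambda>_. m" f e] m le_sup[OF average_continuous[OF that f], of e]
    by (simp add: average_const[OF that])
  \<comment> \<open>The candidate for the mean: the level to which averaging can push down the
    maximum.\<close>
  define c where "c = (INF T\<in>averages. sup (T f))"
  have c_le: "c \<le> sup (T f)" if "T \<in> averages" for T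
    unfolding c_def by (rule cINF_lower[OF _ that]) (use lb in \<open>auto intro!: bdd_belowI\<close>)
  have ne: "averages \<noteq> {}" using translation_average by blast
  have "\<exists>T\<in>averages. \<forall>x. \<bar>T f x - c\<bar> \<le> \<epsilon>" if \<epsilon>: "\<epsilon> > 0" for \<epsilon>
  proof -
    define \<delta> where "\<delta> = \<epsilon> / 4"
    have \<delta>: "\<delta> > 0" using \<epsilon> by (simp add: \<delta>_def)
    obtain U where U: "open U" "e \<in> U" "\<And>u x. u \<in> U \<Longrightarrow> \<bar>f (x \<cdot> u) - f x\<bar> \<le> \<delta>"
      by (rule equicontinuous_at_e[OF f \<delta>]) blast
    obtain I where I: "finite I" "I \<noteq> {}" "\<And>x. \<exists>c\<in>I. iv c \<cdot> x \<in> U"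
      by (rule finite_translates_cover[OF U(1,2)]) blast
    have N: "real (card I) > 0" using I by (simp add: card_gt_0_iff)
    \<comment> \<open>The margin is fixed by the count below: one summand of at most
      \<open>c - 2 * \<delta>\<close> together with \<open>card I - 1\<close> summands of at most
      \<open>c + \<delta> / card I\<close> stays below \<open>c * card I - \<delta>\<close>.\<close>
    have "c < c + \<delta> / card I" using \<delta> N by simp
    moreover have "bdd_below ((\<lambda>T. sup (T f)) ` averages)" using lb by (auto intro!: bdd_belowI)
    ultimately obtain T where T: "T \<in> averages" "sup (T f) < c + \<delta> / card I"
      using cINF_less_iff[OF ne, of "\<lambda>T. sup (T f)" "c + \<delta> / card I"] unfolding c_def by blast
    define h where "h = T f"
    have h: "continuous_on UNIV h" unfolding h_def by (rule average_continuous[OF T(1) f])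
    have eq: "\<bar>h (x \<cdot> u) - h x\<bar> \<le> \<delta>" if "u \<in> U" for u x
    proof -
      have *: "T (\<lambda>x. 1 * f (x \<cdot> u) + (- 1) * f x) = (\<lambda>x. 1 * T (\<lambda>x. f (x \<cdot> u)) x + (- 1) * T f x)"
        by (rule average_linear[OF T(1)])
      have "\<bar>T (\<lambda>x. f (x \<cdot> u) - f x) x - 0\<bar> \<le> \<delta>"
        by (rule average_close_const[OF T(1)]) (use U(3) that in simp)
      with * show ?thesis by (simp add: h_def average_right_translate[OF T(1)])
    qed
    have low: "h y \<ge> c - 3 * \<delta>" for y
    proof (rule ccontr)
      assume "\<not> h y \<ge> c - 3 * \<delta>"
      then have y: "h (y \<cdot> u) \<le> c - 2 * \<delta>" if "u \<in> U" for u
        using eq[OF that, of y] by (auto simp: abs_le_iff)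
      \<comment> \<open>For every \<open>x\<close> some \<open>i\<close> puts
        \<open>iv i \<cdot> x\<close> into \<open>U\<close>, so
        \<open>y \<cdot> iv i \<cdot> x\<close> is a point near \<open>y\<close> where
        \<open>h\<close> is low: each value of the new average contains a low summand.\<close>
      define S where "S = (\<lambda>(f::'g \<Rightarrow> real) x. (\<Sum>i\<in>I. f ((y \<cdot> iv i) \<cdot> x)) / card I)"
      have S: "S \<in> averages" unfolding S_def by (rule average_sum[OF I(1,2)])
      have "S h x \<le> c - \<delta> / card I" for x
      proof -
        obtain i where i: "i \<in> I" "iv i \<cdot> x \<in> U" using I(3) by blast
        have "(\<Sum>j\<in>I. h ((y \<cdot> iv j) \<cdot> x)) = h ((y \<cdot> iv i) \<cdot> x) + (\<Sum>j\<in>I-{i}. h ((y \<cdot> iv j) \<cdot> x))"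
          using i(1) I(1) by (simp add: sum.remove)
        also have "\<dots> \<le> (c - 2 * \<delta>) + (\<Sum>j\<in>I-{i}. c + \<delta> / card I)"
        proof (intro add_mono sum_mono)
          show "h ((y \<cdot> iv i) \<cdot> x) \<le> c - 2 * \<delta>" using y[OF i(2)] by (simp add: assoc)
          show "h ((y \<cdot> iv j) \<cdot> x) \<le> c + \<delta> / card I" for j
            using le_sup[OF h, of "(y \<cdot> iv j) \<cdot> x"] T(2) by (simp add: h_def)
        qed
        also have "\<dots> = c * card I - \<delta> - \<delta> / card I"
        proof -
          have "real (card (I - {i})) = real (card I) - 1" using i(1) I(1) N by (simp add: of_nat_diff)
          then have "(\<Sum>j\<in>I-{i}. c + \<delta> / card I) = (real (card I) - 1) * (c + \<delta> / card I)" by simp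
          also have "\<dots> = card I * c - c + card I * (\<delta> / card I) - \<delta> / card I" by argo
          also have "card I * (\<delta> / card I) = \<delta>" using N by simp
          finally show ?thesis by (simp add: algebra_simps)
        qed
        finally have "(\<Sum>j\<in>I. h ((y \<cdot> iv j) \<cdot> x)) \<le> c * card I - \<delta>"
          using divide_pos_pos[OF \<delta> N] by linarith
        then have "S h x \<le> (c * card I - \<delta>) / card I" unfolding S_def by (rule divide_right_mono) simp
        then show ?thesis using N by (simp add: diff_divide_distrib)
      qed
      then have "sup (S h) \<le> c - \<delta> / card I" unfolding sup_def by (intro cSUP_least) auto
      moreover have "c \<le> sup (S h)" using c_le[OF average_compose[OF S T(1)]] by (simp add: h_def)
      ultimately show False using divide_pos_pos[OF \<delta> N] by linarith
    qed
    have "1 \<le> real (card I)" using N by simp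
    then have "\<delta> / card I \<le> \<delta>" using \<delta> divide_left_mono[of 1 "real (card I)" \<delta>] by simp
    then have "h x \<le> c + \<delta>" for x using le_sup[OF h, of x] T(2) by (simp add: h_def)
    with low have "\<bar>h x - c\<bar> \<le> 4 * \<delta>" for x using \<delta> by (smt (verit))
    then have "\<bar>h x - c\<bar> \<le> \<epsilon>" for x by (simp add: \<delta>_def)
    then show ?thesis using T(1) h_def by blast
  qed
  then show ?thesis unfolding is_mean_def by blast
qed

text \<open>Left and right averages commute, so \<open>T (S f) = S (T f)\<close> is close to
  \<open>c\<close> as a right average of a nearly constant function, and close to \<open>d\<close>
  for the mirrored reason. Since right means exist by \<open>opposite\<close>, this also yields
  uniqueness of left means.\<close>

lemma mean_left_right_eq:
  assumes "is_mean f c" "compact_group.is_mean (\<lambda>x y. y \<cdot> x) f d"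
  shows "c = d"
proof -
  interpret op: compact_group "\<lambda>x y. y \<cdot> x" iv e by (rule opposite)
  have "\<bar>c - d\<bar> \<le> \<epsilon>" if "\<epsilon> > 0" for \<epsilon>
  proof -
    from that have "\<epsilon> / 2 > 0" by simp
    with assms obtain T S where T: "T \<in> averages" "\<And>x. \<bar>T f x - c\<bar> \<le> \<epsilon> / 2"
      and S: "S \<in> op.averages" "\<And>x. \<bar>S f x - d\<bar> \<le> \<epsilon> / 2"
      unfolding is_mean_def op.is_mean_def by metis
    have "T (S f) = S (T f)" using T(1)
    proof (induction rule: averages_induct)
      case (translation a)
      then show ?case using op.average_right_translate[OF S(1), of f a] by simp
    next
      case (convex T1 T2 u v)
      then show ?case using op.average_linear[OF S(1), of u "T1 f" v "T2 f"] by simp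
    qed
    then show ?thesis
      using average_close_const[OF T(1), of "S f" d "\<epsilon> / 2" e] S(2)
        op.average_close_const[OF S(1), of "T f" c "\<epsilon> / 2" e] T(2) by (simp add: abs_le_iff) argo
  qed
  then have "c - d = 0" by (rule dense_eq0_I)
  then show ?thesis by simp
qed

lemma mean_unique:
  assumes "continuous_on UNIV f" "is_mean f c" "is_mean f d"
  shows "c = d"
  using mean_left_right_eq assms compact_group.mean_exists[OF opposite assms(1)] by metis

section \<open>Properties of the invariant mean\<close>

definition mean :: "('g \<Rightarrow> real) \<Rightarrow> real" where
  "mean f = (THE c. is_mean f c)"

lemma mean_is_mean: "continuous_on UNIV f \<Longrightarrow> is_mean f (mean f)"
  unfolding mean_def using mean_exists mean_unique by (metis theI)

lemma mean_eqI: "continuous_on UNIV f \<Longrightarrow> is_mean f c \<Longrightarrow> mean f = c"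
  using mean_is_mean mean_unique by blast

text \<open>An average that flattens \<open>T f\<close>, composed with \<open>T\<close>, is an
  average that flattens \<open>f\<close>.\<close>

lemma mean_average:
  assumes "continuous_on UNIV f" "T \<in> averages"
  shows "mean (T f) = mean f"
proof -
  have c: "continuous_on UNIV (T f)" by (rule average_continuous[OF assms(2,1)])
  have "is_mean f (mean (T f))" unfolding is_mean_def
  proof (intro allI impI)
    fix \<epsilon> :: real assume "\<epsilon> > 0"
    then obtain S where "S \<in> averages" "\<forall>x. \<bar>S (T f) x - mean (T f)\<bar> \<le> \<epsilon>"
      using mean_is_mean[OF c] unfolding is_mean_def by blast
    then show "\<exists>S\<in>averages. \<forall>x. \<bar>S f x - mean (T f)\<bar> \<le> \<epsilon>"
      by (intro bexI[OF _ average_compose[OF _ assms(2)]])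
  qed
  then show ?thesis using mean_eqI[OF assms(1)] by simp
qed

lemma mean_left: "continuous_on UNIV f \<Longrightarrow> mean (\<lambda>x. f (a \<cdot> x)) = mean f"
  using mean_average[OF _ translation_average] by blast

text \<open>A single average has to flatten both functions. \<open>T\<close> is chosen for
  \<open>f\<close>, then \<open>S\<close> for \<open>T g\<close>; applying \<open>S\<close> does not
  spoil \<open>T f\<close>, which is already nearly constant, and \<open>T g\<close> has the same
  mean as \<open>g\<close>.\<close>

lemma mean_linear:
  assumes f: "continuous_on UNIV f" and g: "continuous_on UNIV g"
  shows "mean (\<lambda>x. c * f x + d * g x) = c * mean f + d * mean g"
proof (rule mean_eqI)
  show "continuous_on UNIV (\<lambda>x. c * f x + d * g x)" by (intro continuous_intros f g)
  show "is_mean (\<lambda>x. c * f x + d * g x) (c * mean f + d * mean g)"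
    unfolding is_mean_def
  proof (intro allI impI)
    fix \<epsilon> :: real assume "\<epsilon> > 0"
    define \<delta> where "\<delta> = \<epsilon> / (\<bar>c\<bar> + \<bar>d\<bar> + 1)"
    have \<delta>: "\<delta> > 0" using \<open>\<epsilon> > 0\<close> by (simp add: \<delta>_def add_nonneg_pos)
    obtain T where T: "T \<in> averages" "\<And>x. \<bar>T f x - mean f\<bar> \<le> \<delta>"
      using mean_is_mean[OF f] \<delta> unfolding is_mean_def by blast
    obtain S where S: "S \<in> averages" "\<And>x. \<bar>S (T g) x - mean g\<bar> \<le> \<delta>"
      using mean_is_mean[OF average_continuous[OF T(1) g]] \<delta> mean_average[OF g T(1)]
      unfolding is_mean_def by metis
    have "\<bar>S (T (\<lambda>x. c * f x + d * g x)) x - (c * mean f + d * mean g)\<bar> \<le> \<epsilon>" for x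
    proof -
      have "S (T (\<lambda>x. c * f x + d * g x)) x - (c * mean f + d * mean g)
          = c * (S (T f) x - mean f) + d * (S (T g) x - mean g)"
        by (simp add: average_linear[OF T(1)] average_linear[OF S(1)] algebra_simps)
      also have "\<bar>\<dots>\<bar> \<le> \<bar>c\<bar> * \<delta> + \<bar>d\<bar> * \<delta>"
        using average_close_const[OF S(1) T(2), where x = x] S(2)[of x]
        by (intro order_trans[OF abs_triangle_ineq] add_mono) (simp_all add: abs_mult mult_left_mono)
      also have "\<dots> \<le> (\<bar>c\<bar> + \<bar>d\<bar> + 1) * \<delta>" using \<delta> by (simp add: algebra_simps)
      also have "\<dots> = \<epsilon>"
      proof -
        have "\<bar>c\<bar> + \<bar>d\<bar> + 1 > 0" by simp
        then show ?thesis by (simp add: \<delta>_def)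
      qed
      finally show ?thesis .
    qed
    then show "\<exists>T\<in>averages. \<forall>x. \<bar>T (\<lambda>x. c * f x + d * g x) x - (c * mean f + d * mean g)\<bar> \<le> \<epsilon>"
      by (intro bexI[OF _ average_compose[OF S(1) T(1)]] allI)
  qed
qed

lemma mean_const [simp]: "mean (\<lambda>x. c) = c"
proof (rule mean_eqI)
  show "is_mean (\<lambda>x. c) c" unfolding is_mean_def
    by (intro allI impI bexI[OF _ translation_average[of e]]) simp
qed simp

lemma mean_abs_le:
  assumes "continuous_on UNIV f" "\<And>x. \<bar>f x - c\<bar> \<le> \<epsilon>"
  shows "\<bar>mean f - c\<bar> \<le> \<epsilon>"
proof (rule field_le_epsilon)
  fix \<delta> :: real assume "\<delta> > 0"
  then obtain T where T: "T \<in> averages" "\<And>x. \<bar>T f x - mean f\<bar> \<le> \<delta>"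
    using mean_is_mean[OF assms(1)] unfolding is_mean_def by blast
  show "\<bar>mean f - c\<bar> \<le> \<epsilon> + \<delta>"
    using T(2)[of e] average_close_const[OF T(1), of f c \<epsilon> e] assms(2) by fastforce
qed

lemma mean_nonneg:
  assumes "continuous_on UNIV f" "\<And>x. 0 \<le> f x"
  shows "0 \<le> mean f"
proof (rule field_le_epsilon)
  fix \<delta> :: real assume "\<delta> > 0"
  then obtain T where T: "T \<in> averages" "\<And>x. \<bar>T f x - mean f\<bar> \<le> \<delta>"
    using mean_is_mean[OF assms(1)] unfolding is_mean_def by blast
  have "T (\<lambda>_. 0) e \<le> T f e" using assms(2) by (intro average_mono[OF T(1)])
  then show "0 \<le> mean f + \<delta>"
    using T(2)[of e] by (simp add: average_const[OF T(1)])
qed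

lemma mean_sum:
  assumes "finite I" "\<And>i. i \<in> I \<Longrightarrow> continuous_on UNIV (f i)"
  shows "mean (\<lambda>x. \<Sum>i\<in>I. f i x) = (\<Sum>i\<in>I. mean (f i))"
  using assms
proof (induction I)
  case (insert i I)
  then show ?case
    using mean_linear[of "f i" "\<lambda>x. \<Sum>i\<in>I. f i x" 1 1] by (simp add: continuous_on_sum)
qed simp

text \<open>Shifted so that the positive value sits at the identity, \<open>f\<close> exceeds half
  that value on an open set, finitely many translates of which cover the group. The sum of the
  translated functions is bounded below by a positive constant, and its mean is a multiple of
  \<open>mean f\<close>.\<close>

lemma mean_pos:
  assumes f: "continuous_on UNIV f" "\<And>x. 0 \<le> f x" and "f p > 0"
  shows "mean f > 0"
proof -
  define h where "h = (\<lambda>x. f (p \<cdot> x))"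
  have h: "continuous_on UNIV h" "\<And>x. 0 \<le> h x" "h e > 0"
    using f(2) \<open>f p > 0\<close> continuous_translate(1)[OF f(1)] by (simp_all add: h_def)
  define U where "U = {x. h x > h e / 2}"
  have "open U" unfolding U_def
    using open_vimage[OF open_greaterThan h(1), of "h e / 2"] by (simp add: vimage_def)
  moreover have "e \<in> U" using h(3) by (simp add: U_def)
  ultimately obtain I where I: "finite I" "I \<noteq> {}" "\<And>x. \<exists>c\<in>I. iv c \<cdot> x \<in> U"
    by (rule finite_translates_cover) blast
  have ch: "continuous_on UNIV (\<lambda>x. h (iv i \<cdot> x))" for i by (rule continuous_translate(1)[OF h(1)])
  have ge: "h e / 2 \<le> (\<Sum>i\<in>I. h (iv i \<cdot> x))" for x
  proof -
    obtain i where "i \<in> I" "iv i \<cdot> x \<in> U" using I(3) by blast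
    then have "h e / 2 \<le> h (iv i \<cdot> x)" by (simp add: U_def)
    also have "\<dots> \<le> (\<Sum>i\<in>I. h (iv i \<cdot> x))"
      by (rule member_le_sum) (use \<open>i \<in> I\<close> I(1) h(2) in auto)
    finally show ?thesis .
  qed
  define F where "F = (\<lambda>x. \<Sum>i\<in>I. h (iv i \<cdot> x))"
  have F: "continuous_on UNIV F" unfolding F_def by (intro continuous_on_sum ch)
  define H where "H = (\<lambda>_::'g. h e / 2)"
  have H: "continuous_on UNIV H" "mean H = h e / 2" by (simp_all add: H_def)
  have "0 \<le> mean (\<lambda>x. 1 * F x + (- 1) * H x)"
  proof (rule mean_nonneg)
    show "continuous_on UNIV (\<lambda>x. 1 * F x + (- 1) * H x)"
      by (intro continuous_on_add continuous_on_mult continuous_on_const F H)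
    show "0 \<le> 1 * F x + (- 1) * H x" for x using ge[of x] by (simp add: F_def H_def)
  qed
  then have "h e / 2 \<le> mean F" using mean_linear[OF F H(1), of 1 "-1"] H(2) by simp
  moreover have "mean F = (\<Sum>i\<in>I. mean (\<lambda>x. h (iv i \<cdot> x)))"
    unfolding F_def by (rule mean_sum[OF I(1) ch])
  moreover have "mean (\<lambda>x. h (iv i \<cdot> x)) = mean f" for i
    using mean_left[OF h(1), of "iv i"] mean_left[OF f(1), of p] by (simp add: h_def)
  ultimately have "card I * mean f > 0" using h(3) by simp
  then show ?thesis by (simp add: zero_less_mult_iff)
qed

end

section \<open>Differentiation under a bounded functional\<close>

text \<open>All iterated derivatives in \<open>x\<close> are required to be continuous in both
  variables jointly: this is the condition under which a bounded functional in \<open>t\<close>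
  commutes with differentiation in \<open>x\<close>.\<close>

fun param_Ck :: "nat \<Rightarrow> 'a::real_normed_vector set \<Rightarrow> 'k::topological_space set \<Rightarrow> ('a \<Rightarrow> 'k \<Rightarrow> real) \<Rightarrow> bool" where
  "param_Ck 0 S K \<Phi> \<longleftrightarrow> continuous_on (S \<times> K) (\<lambda>(x, t). \<Phi> x t)"
| "param_Ck (Suc k) S K \<Phi> \<longleftrightarrow> continuous_on (S \<times> K) (\<lambda>(x, t). \<Phi> x t) \<and>
     (\<forall>t\<in>K. \<forall>x\<in>S. (\<lambda>x. \<Phi> x t) differentiable (at x)) \<and>
     (\<forall>v. param_Ck k S K (\<lambda>x t. frechet_derivative (\<lambda>x. \<Phi> x t) (at x) v))"

lemma param_Ck_continuous: "param_Ck k S K \<Phi> \<Longrightarrow> continuous_on (S \<times> K) (\<lambda>(x, t). \<Phi> x t)"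
  by (cases k) auto

text \<open>Integration over the unit interval and the invariant mean are both instances. The axioms
  speak of continuous functions only, because these are the functions on which the mean is
  controlled.\<close>

locale bounded_functional =
  fixes K :: "'k::topological_space set" and M :: "('k \<Rightarrow> real) \<Rightarrow> real" and C :: real
  assumes K: "compact K"
    and linear: "\<And>f g c d. continuous_on K f \<Longrightarrow> continuous_on K g \<Longrightarrow>
      M (\<lambda>x. c * f x + d * g x) = c * M f + d * M g"
    and bounded: "\<And>f B. continuous_on K f \<Longrightarrow> (\<And>x. x \<in> K \<Longrightarrow> \<bar>f x\<bar> \<le> B) \<Longrightarrow> \<bar>M f\<bar> \<le> C * B"
begin

text \<open>The axioms do not say outright that \<open>M\<close> ignores values outside
  \<open>K\<close>; the bound with \<open>B = 0\<close>, applied to the difference, does.\<close>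

lemma cong:
  assumes "continuous_on K f" "continuous_on K g" "\<And>x. x \<in> K \<Longrightarrow> f x = g x"
  shows "M f = M g"
proof -
  have "\<bar>M (\<lambda>x. 1 * f x + (- 1) * g x)\<bar> \<le> C * 0"
    by (rule bounded) (use assms in \<open>auto intro!: continuous_intros\<close>)
  with linear[OF assms(1,2), of 1 "-1"] show ?thesis by simp
qed

lemma sum:
  assumes "finite I" "\<And>i. i \<in> I \<Longrightarrow> continuous_on K (f i)"
  shows "M (\<lambda>x. \<Sum>i\<in>I. c i * f i x) = (\<Sum>i\<in>I. c i * M (f i))"
  using assms
proof (induction I)
  case empty
  show ?case using linear[of "\<lambda>_. 0" "\<lambda>_. 0" 0 0] by simp
next
  case (insert i I)
  have "continuous_on K (\<lambda>x. \<Sum>i\<in>I. c i * f i x)"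
    using insert.prems by (intro continuous_on_sum continuous_on_mult continuous_on_const) auto
  then show ?case
    using insert linear[of "f i" "\<lambda>x. \<Sum>i\<in>I. c i * f i x" "c i" 1] by simp
qed

lemma C_nonneg: "0 \<le> C"
  using bounded[of "\<lambda>_. 0" 1] abs_ge_zero[of "M (\<lambda>_. 0)"] by simp

lemma continuous_section:
  fixes \<Phi> :: "'a::real_normed_vector \<Rightarrow> 'k \<Rightarrow> real"
  assumes "continuous_on (S \<times> K) (\<lambda>(x, t). \<Phi> x t)" "x \<in> S"
  shows "continuous_on K (\<Phi> x)"
  using continuous_on_compose2[OF assms(1), of K "\<lambda>t. (x, t)"] assms(2)
  by (auto simp: continuous_on_Pair continuous_on_const continuous_on_id)

text \<open>Compactness of \<open>K\<close> makes continuity in \<open>x\<close> uniform in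
  \<open>t\<close>.\<close>

lemma near:
  fixes \<Phi> :: "'a::real_normed_vector \<Rightarrow> 'k \<Rightarrow> real"
  assumes "continuous_on (S \<times> K) (\<lambda>(x, t). \<Phi> x t)" "x \<in> S" "open S" "\<epsilon> > 0"
  shows "\<exists>r>0. ball x r \<subseteq> S \<and> (\<forall>y\<in>ball x r. \<forall>t\<in>K. \<bar>\<Phi> y t - \<Phi> x t\<bar> \<le> \<epsilon>)"
proof -
  obtain X where X: "x \<in> X" "open X"
    "\<forall>y\<in>X \<inter> S. \<forall>t\<in>K. dist ((\<lambda>(x, t). \<Phi> x t) (y, t)) ((\<lambda>(x, t). \<Phi> x t) (x, t)) \<le> \<epsilon>"
    by (rule continuous_on_prod_compactE[OF assms(1) K assms(2,4)])
  then obtain r where r: "r > 0" "ball x r \<subseteq> X \<inter> S"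
    using open_contains_ball[of "X \<inter> S"] open_Int[OF X(2) assms(3)] assms(2) X(1) by blast
  have "\<bar>\<Phi> y t - \<Phi> x t\<bar> \<le> \<epsilon>" if "y \<in> ball x r" "t \<in> K" for y t
  proof -
    have "y \<in> X \<inter> S" using r(2) that(1) by blast
    then show ?thesis using X(3)[rule_format, of y t] that(2) by (simp add: dist_real_def)
  qed
  with r show ?thesis by blast
qed

lemma continuous_param:
  fixes \<Phi> :: "'a::real_normed_vector \<Rightarrow> 'k \<Rightarrow> real"
  assumes "continuous_on (S \<times> K) (\<lambda>(x, t). \<Phi> x t)" "open S"
  shows "continuous_on S (\<lambda>x. M (\<Phi> x))"
  unfolding continuous_on_iff
proof (intro ballI allI impI)
  fix x \<epsilon> assume x: "x \<in> S" and "(\<epsilon>::real) > 0"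
  define \<delta> where "\<delta> = \<epsilon> / (C + 1)"
  have \<delta>: "\<delta> > 0" "C * \<delta> < \<epsilon>" using \<open>\<epsilon> > 0\<close> C_nonneg by (auto simp: \<delta>_def field_simps add_pos_nonneg)
  obtain r where r: "r > 0" "ball x r \<subseteq> S" "\<forall>y\<in>ball x r. \<forall>t\<in>K. \<bar>\<Phi> y t - \<Phi> x t\<bar> \<le> \<delta>"
    using near[OF assms(1) x assms(2) \<delta>(1)] by blast
  show "\<exists>d>0. \<forall>x'\<in>S. dist x' x < d \<longrightarrow> dist (M (\<Phi> x')) (M (\<Phi> x)) < \<epsilon>"
  proof (intro exI[of _ r] conjI r(1) ballI impI)
    fix y assume y: "y \<in> S" "dist y x < r"
    note c = continuous_section[OF assms(1) y(1)] continuous_section[OF assms(1) x]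
    have "\<bar>M (\<lambda>t. 1 * \<Phi> y t + (- 1) * \<Phi> x t)\<bar> \<le> C * \<delta>"
      by (rule bounded) (use r(3)[rule_format, of y] y c in \<open>auto intro!: continuous_intros simp: dist_commute\<close>)
    then show "dist (M (\<Phi> y)) (M (\<Phi> x)) < \<epsilon>"
      using linear[OF c, of 1 "-1"] \<delta>(2) by (simp add: dist_real_def)
  qed
qed

text \<open>The linearisation error must be small uniformly in \<open>t\<close> before
  \<open>M\<close> is applied. In finite dimension it is enough to control the derivatives along a
  basis, and \<open>near\<close> controls each of these uniformly on \<open>K\<close>.\<close>

lemma has_derivative_param:
  fixes \<Phi> :: "'a::euclidean_space \<Rightarrow> 'k \<Rightarrow> real"
  assumes \<Phi>: "param_Ck 1 S K \<Phi>" and S: "open S" and x: "x \<in> S"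
  shows "((\<lambda>x. M (\<Phi> x)) has_derivative (\<lambda>v. M (\<lambda>t. frechet_derivative (\<lambda>x. \<Phi> x t) (at x) v))) (at x)"
proof -
  define D where "D v y t = frechet_derivative (\<lambda>x. \<Phi> x t) (at y) v" for v y t
  have c\<Phi>: "continuous_on (S \<times> K) (\<lambda>(x, t). \<Phi> x t)" by (rule param_Ck_continuous[OF \<Phi>])
  have cD: "continuous_on (S \<times> K) (\<lambda>(x, t). D v x t)" for v using \<Phi> by (simp add: D_def)
  have d: "((\<lambda>x. \<Phi> x t) has_derivative (\<lambda>v. D v y t)) (at y)" if "y \<in> S" "t \<in> K" for y t
    using \<Phi> that by (simp add: D_def frechet_derivative_works[symmetric])
  have lin: "linear (\<lambda>v. D v y t)" if "y \<in> S" "t \<in> K" for y t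
    using has_derivative_linear[OF d[OF that]] .
  have Dexp: "D v y t = (\<Sum>b\<in>Basis. (v \<bullet> b) * D b y t)" if "y \<in> S" "t \<in> K" for v y t
  proof -
    have "D v y t = D (\<Sum>b\<in>Basis. (v \<bullet> b) *\<^sub>R b) y t" by (simp add: euclidean_representation)
    also have "\<dots> = (\<Sum>b\<in>Basis. (v \<bullet> b) * D b y t)"
      by (simp add: linear_sum[OF lin[OF that]] linear_scale[OF lin[OF that]])
    finally show ?thesis .
  qed
  note sec = continuous_section[OF cD x]
  have MD: "M (D v x) = (\<Sum>b\<in>Basis. (v \<bullet> b) * M (D b x))" for v
  proof -
    have "M (D v x) = M (\<lambda>t. \<Sum>b\<in>Basis. (v \<bullet> b) * D b x t)"
      by (rule cong) (auto intro!: sec continuous_intros Dexp x)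
    also have "\<dots> = (\<Sum>b\<in>Basis. (v \<bullet> b) * M (D b x))" by (rule sum) (auto intro: sec)
    finally show ?thesis .
  qed
  have "(\<lambda>v. M (D v x)) = (\<lambda>v. \<Sum>b\<in>Basis. (v \<bullet> b) * M (D b x))" by (rule ext) (rule MD)
  then have bl: "bounded_linear (\<lambda>v. M (D v x))"
    by (rule ssubst) (intro bounded_linear_sum bounded_linear_mult_const bounded_linear_inner_left)
  show ?thesis
    unfolding has_derivative_at_alt D_def[symmetric]
  proof (intro conjI bl allI impI)
    fix \<epsilon> :: real assume "\<epsilon> > 0"
    \<comment> \<open>Absorbs the norm bound \<open>C\<close> of the functional and the factor
      \<open>DIM('a)\<close> that arises from summing over the basis; the added ones keep the
      denominator positive.\<close>
    define \<delta> where "\<delta> = \<epsilon> / ((C + 1) * (DIM('a) + 1))"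
    have \<delta>: "\<delta> > 0" using \<open>\<epsilon> > 0\<close> C_nonneg by (simp add: \<delta>_def)
    have "\<exists>r>0. ball x r \<subseteq> S \<and> (\<forall>y\<in>ball x r. \<forall>t\<in>K. \<bar>D b y t - D b x t\<bar> \<le> \<delta>)" for b
      by (rule near[OF cD x S \<delta>])
    then have "\<exists>R. \<forall>b. R b > 0 \<and> ball x (R b) \<subseteq> S \<and> (\<forall>y\<in>ball x (R b). \<forall>t\<in>K. \<bar>D b y t - D b x t\<bar> \<le> \<delta>)"
      by (intro choice allI)
    then obtain R where "\<forall>b. R b > 0 \<and> ball x (R b) \<subseteq> S \<and> (\<forall>y\<in>ball x (R b). \<forall>t\<in>K. \<bar>D b y t - D b x t\<bar> \<le> \<delta>)" ..
    then have R: "\<And>b. R b > 0" "\<And>b. ball x (R b) \<subseteq> S"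
      "\<And>b y t. y \<in> ball x (R b) \<Longrightarrow> t \<in> K \<Longrightarrow> \<bar>D b y t - D b x t\<bar> \<le> \<delta>" by simp_all
    define r where "r = Min (R ` Basis)"
    have r: "r > 0" "\<And>b. b \<in> Basis \<Longrightarrow> r \<le> R b" using R(1) by (auto simp: r_def)
    obtain b0 :: 'a where "b0 \<in> Basis" using nonempty_Basis by blast
    then have rS: "ball x r \<subseteq> S" using R(2)[of b0] r(2)[of b0] by (meson subset_ball subset_trans)
    have op: "norm (D v y t - D v x t) \<le> norm v * (DIM('a) * \<delta>)" if "y \<in> ball x r" "t \<in> K" for v y t
    proof -
      have "y \<in> S" using rS that by blast
      then have "D v y t - D v x t = (\<Sum>b\<in>Basis. (v \<bullet> b) * (D b y t - D b x t))"
        using Dexp[OF \<open>y \<in> S\<close> that(2), of v] Dexp[OF x that(2), of v]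
        by (simp add: right_diff_distrib sum_subtractf)
      also have "norm \<dots> \<le> (\<Sum>b\<in>(Basis :: 'a set). norm v * \<delta>)"
      proof (rule sum_norm_le)
        fix b :: 'a assume b: "b \<in> Basis"
        have "\<bar>D b y t - D b x t\<bar> \<le> \<delta>" by (rule R(3)) (use that r(2)[OF b] in auto)
        then show "norm ((v \<bullet> b) * (D b y t - D b x t)) \<le> norm v * \<delta>"
          using Basis_le_norm[OF b, of v] by (simp add: abs_mult mult_mono)
      qed
      finally show ?thesis by (simp add: mult_ac)
    qed
    show "\<exists>d>0. \<forall>y. norm (y - x) < d \<longrightarrow> norm (M (\<Phi> y) - M (\<Phi> x) - M (D (y - x) x)) \<le> \<epsilon> * norm (y - x)"
    proof (intro exI[of _ r] conjI r(1) allI impI)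
      fix y assume y: "norm (y - x) < r"
      then have yb: "y \<in> ball x r" by (simp add: dist_norm norm_minus_commute)
      have yS: "y \<in> S" using yb rS by blast
      have lin_bound: "\<bar>\<Phi> y t - \<Phi> x t - D (y - x) x t\<bar> \<le> norm (y - x) * (DIM('a) * \<delta>)" if t: "t \<in> K" for t
      proof -
        have "norm (\<Phi> y t - \<Phi> x t - D (y - x) x t) \<le> norm (y - x) * (DIM('a) * \<delta>)"
        \<comment> \<open>The mean value inequality for the linearisation error, with
          \<open>op\<close> as the bound on the variation of the derivative over the ball.\<close>
        proof (rule differentiable_bound_linearization[where S = "ball x r"])
          show "x + s *\<^sub>R (y - x) \<in> ball x r" if "s \<in> {0..1}" for s
          proof -
            have "norm (s *\<^sub>R (y - x)) \<le> norm (y - x)" using that by (simp add: mult_left_le_one_le)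
            then show ?thesis using y by (simp add: dist_norm)
          qed
          show "((\<lambda>x. \<Phi> x t) has_derivative (\<lambda>v. D v z t)) (at z within ball x r)" if "z \<in> ball x r" for z
            using d[of z t] rS that t has_derivative_at_withinI by blast
          show "onorm ((\<lambda>v. D v z t) - (\<lambda>v. D v x t)) \<le> DIM('a) * \<delta>" if "z \<in> ball x r" for z
            by (rule onorm_le) (use op[OF that t] in \<open>simp add: mult.commute\<close>)
          show "x \<in> ball x r" using r(1) by simp
        qed
        then show ?thesis by simp
      qed
      note c = continuous_section[OF c\<Phi> yS] continuous_section[OF c\<Phi> x]
      have c2: "continuous_on K (\<lambda>t. 1 * \<Phi> y t + (- 1) * \<Phi> x t)" by (intro continuous_intros c)
      have eq: "M (\<lambda>t. 1 * (1 * \<Phi> y t + (- 1) * \<Phi> x t) + (- 1) * D (y - x) x t) =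
          M (\<Phi> y) - M (\<Phi> x) - M (D (y - x) x)"
        by (subst linear[OF c2 sec], subst linear[OF c]) simp
      have "\<bar>M (\<lambda>t. 1 * (1 * \<Phi> y t + (- 1) * \<Phi> x t) + (- 1) * D (y - x) x t)\<bar>
          \<le> C * (norm (y - x) * (DIM('a) * \<delta>))"
        by (rule bounded) (use lin_bound in \<open>auto intro!: continuous_intros c sec simp: algebra_simps\<close>)
      also have "\<dots> = (C * DIM('a)) * \<delta> * norm (y - x)" by simp
      also have "\<dots> \<le> ((C + 1) * (DIM('a) + 1)) * \<delta> * norm (y - x)"
        using C_nonneg \<delta> by (intro mult_right_mono mult_mono) auto
      also have "\<dots> = \<epsilon> * norm (y - x)"
        using C_nonneg by (simp add: \<delta>_def)
      finally show "norm (M (\<Phi> y) - M (\<Phi> x) - M (D (y - x) x)) \<le> \<epsilon> * norm (y - x)"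
        by (simp only: eq real_norm_def)
    qed
  qed
qed

lemma param_Ck_1: "param_Ck (Suc k) S K \<Phi> \<Longrightarrow> param_Ck 1 S K \<Phi>"
  by (auto dest: param_Ck_continuous)

theorem Ck_on_param:
  fixes \<Phi> :: "'a::euclidean_space \<Rightarrow> 'k \<Rightarrow> real"
  assumes "open S" "param_Ck k S K \<Phi>"
  shows "Ck_on k S (\<lambda>x. M (\<Phi> x))"
  using assms(2)
proof (induction k arbitrary: \<Phi>)
  case 0
  then show ?case using continuous_param[OF _ assms(1)] by simp
next
  case (Suc k)
  note d = has_derivative_param[OF param_Ck_1[OF Suc.prems] assms(1)]
  have "Ck_on k S (\<lambda>x. frechet_derivative (\<lambda>x. M (\<Phi> x)) (at x) v)" for v
  proof (subst Ck_on_cong[OF assms(1)])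
    show "frechet_derivative (\<lambda>x. M (\<Phi> x)) (at x) v = M (\<lambda>t. frechet_derivative (\<lambda>x. \<Phi> x t) (at x) v)"
      if "x \<in> S" for x
      using frechet_derivative_at[OF d[OF that]] by metis
    show "Ck_on k S (\<lambda>x. M (\<lambda>t. frechet_derivative (\<lambda>x. \<Phi> x t) (at x) v))"
      using Suc.IH Suc.prems by simp
  qed
  moreover have "(\<lambda>x. M (\<Phi> x)) differentiable (at x)" if "x \<in> S" for x
    by (rule differentiableI[OF d[OF that]])
  ultimately show ?case by simp
qed

end

section \<open>Checking the regularity of parametrised families\<close>

lemma param_Ck_cong:
  fixes \<Phi> \<Psi> :: "'a::real_normed_vector \<Rightarrow> 'k::topological_space \<Rightarrow> real"
  assumes "open S" "\<And>x t. x \<in> S \<Longrightarrow> t \<in> K \<Longrightarrow> \<Phi> x t = \<Psi> x t" "param_Ck k S K \<Phi>"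
  shows "param_Ck k S K \<Psi>"
  using assms(2,3)
proof (induction k arbitrary: \<Phi> \<Psi>)
  case 0
  have "continuous_on (S \<times> K) (\<lambda>(x, t). \<Phi> x t) \<longleftrightarrow> continuous_on (S \<times> K) (\<lambda>(x, t). \<Psi> x t)"
    by (rule continuous_on_cong) (use 0(1) in auto)
  with 0(2) show ?case by simp
next
  case (Suc k)
  have "continuous_on (S \<times> K) (\<lambda>(x, t). \<Phi> x t) \<longleftrightarrow> continuous_on (S \<times> K) (\<lambda>(x, t). \<Psi> x t)"
    by (rule continuous_on_cong) (use Suc.prems(1) in auto)
  with Suc.prems(2) have c: "continuous_on (S \<times> K) (\<lambda>(x, t). \<Psi> x t)" by simp
  have d: "(\<lambda>x. \<Psi> x t) differentiable (at x)" if "x \<in> S" "t \<in> K" for x t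
  proof -
    have "(\<lambda>x. \<Phi> x t) differentiable (at x)" using Suc.prems(2) that by simp
    then obtain D where "((\<lambda>x. \<Phi> x t) has_derivative D) (at x)" unfolding differentiable_def by blast
    then have "((\<lambda>x. \<Psi> x t) has_derivative D) (at x)"
      by (rule has_derivative_transform_within_open[OF _ \<open>open S\<close> that(1)]) (simp add: Suc.prems(1) that(2))
    then show ?thesis by (rule differentiableI)
  qed
  have "param_Ck k S K (\<lambda>x t. frechet_derivative (\<lambda>x. \<Psi> x t) (at x) v)" for v
  proof (rule Suc.IH)
    show "param_Ck k S K (\<lambda>x t. frechet_derivative (\<lambda>x. \<Phi> x t) (at x) v)" using Suc.prems(2) by simp
    show "frechet_derivative (\<lambda>x. \<Phi> x t) (at x) v = frechet_derivative (\<lambda>x. \<Psi> x t) (at x) v"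
      if "x \<in> S" "t \<in> K" for x t
    proof -
      have "(\<lambda>x. \<Phi> x t) differentiable (at x)" using Suc.prems(2) that by simp
      from frechet_derivative_transform_within_open[OF this \<open>open S\<close> that(1), of "\<lambda>x. \<Psi> x t"]
      show ?thesis by (simp add: Suc.prems(1) that(2))
    qed
  qed
  with c d show ?case by simp
qed

text \<open>Regularity is local in the parameter. When the parameter runs over a manifold, a formula
  in coordinates is available on one chart domain at a time.\<close>

lemma param_Ck_cover:
  fixes \<Phi> :: "'a::real_normed_vector \<Rightarrow> 'k::t2_space \<Rightarrow> real"
  assumes "open S" "\<And>t. t \<in> K \<Longrightarrow> \<exists>N. open N \<and> t \<in> N \<and> param_Ck k S (K \<inter> N) \<Phi>"
  shows "param_Ck k S K \<Phi>"
proof -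
  have cont: "continuous_on (S \<times> K) (\<lambda>(x, t). \<Phi> x t)"
    if cov: "\<And>t. t \<in> K \<Longrightarrow> \<exists>N. open N \<and> t \<in> N \<and> param_Ck k S (K \<inter> N) \<Phi>"
    for \<Phi> :: "'a \<Rightarrow> 'k \<Rightarrow> real" and k
    unfolding continuous_on_eq_continuous_within
  proof (intro ballI)
    fix p assume "p \<in> S \<times> K"
    then obtain x t where p: "p = (x, t)" "x \<in> S" "t \<in> K" by auto
    obtain N where N: "open N" "t \<in> N" "param_Ck k S (K \<inter> N) \<Phi>" using cov[OF p(3)] by blast
    from param_Ck_continuous[OF N(3)] have "continuous (at p within S \<times> (K \<inter> N)) (\<lambda>(x, t). \<Phi> x t)"
      using p N(2) by (auto simp: continuous_on_eq_continuous_within)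
    moreover have "at p within S \<times> K = at p within S \<times> (K \<inter> N)"
      by (rule at_within_nhd[of p "UNIV \<times> N"]) (use p N in \<open>auto intro: open_Times\<close>)
    ultimately show "continuous (at p within S \<times> K) (\<lambda>(x, t). \<Phi> x t)" by simp
  qed
  show ?thesis using assms(2)
  proof (induction k arbitrary: \<Phi>)
    case 0
    show ?case using cont[of 0 \<Phi>] 0 by simp
  next
    case (Suc k)
    have "(\<lambda>x. \<Phi> x t) differentiable (at x)" if "x \<in> S" "t \<in> K" for x t
      using Suc.prems[OF that(2)] that by auto
    moreover have "param_Ck k S K (\<lambda>x t. frechet_derivative (\<lambda>x. \<Phi> x t) (at x) v)" for v
    proof (rule Suc.IH)
      fix t assume "t \<in> K"
      from Suc.prems[OF this] obtain N where "open N" "t \<in> N" "param_Ck (Suc k) S (K \<inter> N) \<Phi>" by blast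
      then show "\<exists>N. open N \<and> t \<in> N \<and> param_Ck k S (K \<inter> N) (\<lambda>x t. frechet_derivative (\<lambda>x. \<Phi> x t) (at x) v)"
        by (intro exI[of _ N]) simp
    qed
    ultimately show ?case using cont[OF Suc.prems] by simp
  qed
qed

lemma frechet_derivative_section:
  assumes "h differentiable (at (x, z))"
  shows "(\<lambda>x. h (x, z)) differentiable (at x)"
    "frechet_derivative (\<lambda>x. h (x, z)) (at x) v = frechet_derivative h (at (x, z)) (v, 0)"
proof -
  have 1: "((\<lambda>x. (x, z)) has_derivative (\<lambda>v. (v, 0))) (at x)"
    by (intro has_derivative_Pair has_derivative_ident has_derivative_const)
  have "(h has_derivative frechet_derivative h (at (x, z))) (at (x, z))"
    using assms by (simp add: frechet_derivative_works[symmetric])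
  from diff_chain_at[OF 1 this]
  have 2: "((\<lambda>x. h (x, z)) has_derivative (\<lambda>v. frechet_derivative h (at (x, z)) (v, 0))) (at x)"
    by (simp add: o_def)
  then show "(\<lambda>x. h (x, z)) differentiable (at x)" by (rule differentiableI)
  show "frechet_derivative (\<lambda>x. h (x, z)) (at x) v = frechet_derivative h (at (x, z)) (v, 0)"
    using frechet_derivative_at[OF 2] by metis
qed

lemma frechet_derivative_section2:
  assumes "h differentiable (at (x, z))"
  shows "(\<lambda>z. h (x, z)) differentiable (at z)"
    "frechet_derivative (\<lambda>z. h (x, z)) (at z) v = frechet_derivative h (at (x, z)) (0, v)"
proof -
  have 1: "((\<lambda>z. (x, z)) has_derivative (\<lambda>v. (0, v))) (at z)"
    by (intro has_derivative_Pair has_derivative_ident has_derivative_const)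
  have "(h has_derivative frechet_derivative h (at (x, z))) (at (x, z))"
    using assms by (simp add: frechet_derivative_works[symmetric])
  from diff_chain_at[OF 1 this]
  have 2: "((\<lambda>z. h (x, z)) has_derivative (\<lambda>v. frechet_derivative h (at (x, z)) (0, v))) (at z)"
    by (simp add: o_def)
  then show "(\<lambda>z. h (x, z)) differentiable (at z)" by (rule differentiableI)
  show "frechet_derivative (\<lambda>z. h (x, z)) (at z) v = frechet_derivative h (at (x, z)) (0, v)"
    using frechet_derivative_at[OF 2] by metis
qed

text \<open>The smooth factor sees the parameter through a chart \<open>\<psi>\<close>, while the
  weight \<open>w\<close> is only continuous, as it is when \<open>w\<close> is an entry of a
  representation not yet known to be smooth. Differentiation in \<open>x\<close> never touches
  \<open>w\<close>.\<close>

lemma param_Ck_smooth_chart: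
  fixes h :: "'a::real_normed_vector \<times> 'b::real_normed_vector \<Rightarrow> real" and \<psi> :: "'k::topological_space \<Rightarrow> 'b"
  assumes "open S" "open W" "smooth_on W h" "continuous_on V \<psi>" "continuous_on V w"
    and "\<And>x t. x \<in> S \<Longrightarrow> t \<in> V \<Longrightarrow> (x, \<psi> t) \<in> W"
  shows "param_Ck k S V (\<lambda>x t. h (x, \<psi> t) * w t)"
proof -
  have cont: "continuous_on (S \<times> V) (\<lambda>(x, t). h (x, \<psi> t) * w t)" if "smooth_on W h" for h
    unfolding split_beta
    by (intro continuous_on_mult continuous_on_compose2[OF smooth_on_imp_continuous_on[OF that]]
        continuous_on_compose2[OF assms(4)] continuous_on_compose2[OF assms(5)]
        continuous_on_Pair continuous_on_fst continuous_on_snd continuous_on_id)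
      (use assms(6) in auto)
  show ?thesis using assms(3)
  proof (induction k arbitrary: h)
    case 0
    then show ?case using cont[of h] by simp
  next
    case (Suc k)
    have d: "h differentiable (at (x, \<psi> t))" if "x \<in> S" "t \<in> V" for x t
      by (rule smooth_on_differentiable[OF Suc.prems assms(6)[OF that]])
    have H: "((\<lambda>x. h (x, \<psi> t) * w t) has_derivative (\<lambda>v. frechet_derivative h (at (x, \<psi> t)) (v, 0) * w t)) (at x)"
      if "x \<in> S" "t \<in> V" for x t
    proof -
      have "((\<lambda>x. h (x, \<psi> t)) has_derivative frechet_derivative (\<lambda>x. h (x, \<psi> t)) (at x)) (at x)"
        using frechet_derivative_section(1)[OF d[OF that]] frechet_derivative_works by blast
      moreover have "frechet_derivative (\<lambda>x. h (x, \<psi> t)) (at x) = (\<lambda>v. frechet_derivative h (at (x, \<psi> t)) (v, 0))"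
        by (rule ext) (rule frechet_derivative_section(2)[OF d[OF that]])
      ultimately have "((\<lambda>x. h (x, \<psi> t)) has_derivative (\<lambda>v. frechet_derivative h (at (x, \<psi> t)) (v, 0))) (at x)"
        by simp
      then show ?thesis by (rule has_derivative_mult_left)
    qed
    have "param_Ck k S V (\<lambda>x t. frechet_derivative (\<lambda>x. h (x, \<psi> t) * w t) (at x) v)" for v
    proof (rule param_Ck_cong[OF \<open>open S\<close>])
      show "param_Ck k S V (\<lambda>x t. (\<lambda>p. frechet_derivative h (at p) (v, 0)) (x, \<psi> t) * w t)"
        by (rule Suc.IH) (rule smooth_on_frechet_derivative[OF Suc.prems])
      show "(\<lambda>p. frechet_derivative h (at p) (v, 0)) (x, \<psi> t) * w t =
          frechet_derivative (\<lambda>x. h (x, \<psi> t) * w t) (at x) v" if "x \<in> S" "t \<in> V" for x t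
        using frechet_derivative_at[OF H[OF that]] by metis
    qed
    moreover have "(\<lambda>x. h (x, \<psi> t) * w t) differentiable (at x)" if "x \<in> S" "t \<in> V" for x t
      by (rule differentiableI[OF H[OF that]])
    ultimately show ?case using cont[OF Suc.prems] by simp
  qed
qed

section \<open>Hadamard's lemma\<close>

lemma bounded_functional_integral: "bounded_functional {0..1::real} (integral {0..1}) 1"
proof
  show "integral {0..1} (\<lambda>x. c * f x + d * g x) = c * integral {0..1} f + d * integral {0..1} g"
    if "continuous_on {0..1} f" "continuous_on {0..1} g" for f g :: "real \<Rightarrow> real" and c d
    using that by (simp add: integral_add integrable_continuous_real continuous_on_mult_left)
  show "\<bar>integral {0..1} f\<bar> \<le> 1 * B"
    if "continuous_on {0..1} f" "\<And>x. x \<in> {0..1} \<Longrightarrow> \<bar>f x\<bar> \<le> B" for f :: "real \<Rightarrow> real" and B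
    using integral_bound[of 0 1 f B] that by simp
qed simp

text \<open>The increment of \<open>f\<close> is the integral of its derivative along the segment
  from \<open>y0\<close> to \<open>y\<close>. Expanding the direction \<open>y - y0\<close> in the
  basis puts its coordinates in front; the integrals that remain are the functions
  \<open>g b\<close>, smooth by differentiation under the integral.\<close>

lemma hadamard:
  fixes f :: "'a::euclidean_space \<Rightarrow> real"
  assumes f: "smooth_on (ball y0 r) f" and r: "r > 0"
  obtains g where "\<And>b. smooth_on (ball y0 r) (g b)" "\<And>b. g b y0 = frechet_derivative f (at y0) b"
    "\<And>y. y \<in> ball y0 r \<Longrightarrow> f y - f y0 = (\<Sum>b\<in>Basis. ((y - y0) \<bullet> b) * g b y)"
proof
  interpret bounded_functional "{0..1::real}" "integral {0..1}" 1 by (rule bounded_functional_integral)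
  let ?B = "ball y0 r"
  define \<gamma> where "\<gamma> p = y0 + snd p *\<^sub>R (fst p - y0)" for p :: "'a \<times> real"
  define W where "W = \<gamma> -` ?B"
  \<comment> \<open>The factor \<open>1\<close> is the weight that
    \<open>param_Ck_smooth_chart\<close> expects.\<close>
  define g where "g b y = integral {0..1} (\<lambda>t. frechet_derivative f (at (\<gamma> (y, t))) b * 1)" for b y
  have \<gamma>c: "continuous_on UNIV \<gamma>" unfolding \<gamma>_def by (intro continuous_intros)
  have W: "open W" unfolding W_def by (rule open_vimage[OF open_ball \<gamma>c])
  have \<gamma>: "smooth_on W \<gamma>"
  proof -
    have "smooth_on W (\<lambda>p. fst p + (- y0))"
      by (intro smooth_on_add smooth_on_linear[OF W bounded_linear_fst] smooth_on_const W)
    moreover have "smooth_on W snd" by (rule smooth_on_linear[OF W bounded_linear_snd])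
    ultimately have "smooth_on W (\<lambda>p. snd p *\<^sub>R (fst p + (- y0)))"
      using Ck_on_scaleR[OF W] unfolding smooth_on_def by blast
    then show ?thesis unfolding \<gamma>_def by (intro smooth_on_add W smooth_on_const) simp
  qed
  have inW: "(y, t) \<in> W" if "y \<in> ?B" "t \<in> {0..1}" for y t
  proof -
    have "norm (t *\<^sub>R (y - y0)) \<le> norm (y - y0)" using that(2) by (simp add: mult_left_le_one_le)
    then show ?thesis using that(1) by (simp add: W_def \<gamma>_def dist_norm norm_minus_commute)
  qed
  have sm: "smooth_on W (\<lambda>p. frechet_derivative f (at (\<gamma> p)) b)" for b
    by (rule smooth_on_compose[OF W open_ball \<gamma> smooth_on_frechet_derivative[OF f]]) (auto simp: W_def)
  have pc: "param_Ck k ?B {0..1} (\<lambda>y t. (\<lambda>p. frechet_derivative f (at (\<gamma> p)) b) (y, t) * 1)" for k b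
    by (rule param_Ck_smooth_chart[OF open_ball W sm, where \<psi> = "\<lambda>t. t"]) (auto intro: inW)
  show "smooth_on ?B (g b)" for b
    unfolding smooth_on_def g_def using Ck_on_param[OF open_ball pc] by blast
  show "g b y0 = frechet_derivative f (at y0) b" for b by (simp add: g_def \<gamma>_def)
  show "f y - f y0 = (\<Sum>b\<in>Basis. ((y - y0) \<bullet> b) * g b y)" if y: "y \<in> ?B" for y
  proof -
    let ?D = "\<lambda>t. frechet_derivative f (at (\<gamma> (y, t)))"
    have dt: "((\<lambda>t. f (\<gamma> (y, t))) has_vector_derivative ?D t (y - y0)) (at t within {0..1})"
      if "t \<in> {0..1}" for t
    proof -
      have "f differentiable (at (\<gamma> (y, t)))"
        by (rule smooth_on_differentiable[OF f]) (use inW[OF y that] in \<open>simp add: W_def\<close>)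
      then have 1: "(f has_derivative ?D t) (at (\<gamma> (y, t)))" by (simp add: frechet_derivative_works[symmetric])
      have "((\<lambda>t. \<gamma> (y, t)) has_derivative (\<lambda>s. s *\<^sub>R (y - y0))) (at t)"
        unfolding \<gamma>_def fst_conv snd_conv by (auto intro!: derivative_eq_intros)
      from has_derivative_compose[OF this 1]
      have "((\<lambda>t. f (\<gamma> (y, t))) has_derivative (\<lambda>s. ?D t (s *\<^sub>R (y - y0)))) (at t)" .
      moreover have "?D t (s *\<^sub>R (y - y0)) = s *\<^sub>R ?D t (y - y0)" for s
        using linear_scale[OF has_derivative_linear[OF 1]] .
      ultimately show ?thesis unfolding has_vector_derivative_def by (simp add: has_derivative_at_withinI)
    qed
    have "((\<lambda>t. ?D t (y - y0)) has_integral (f (\<gamma> (y, 1)) - f (\<gamma> (y, 0)))) {0..1}"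
      by (rule fundamental_theorem_of_calculus) (use dt in auto)
    then have "f y - f y0 = integral {0..1} (\<lambda>t. ?D t (y - y0))"
      by (simp add: \<gamma>_def integral_unique)
    also have "\<dots> = integral {0..1} (\<lambda>t. \<Sum>b\<in>Basis. ((y - y0) \<bullet> b) * (?D t b * 1))"
    proof (rule integral_cong)
      fix t :: real assume "t \<in> {0..1}"
      then have "f differentiable (at (\<gamma> (y, t)))"
        by (intro smooth_on_differentiable[OF f]) (use inW[OF y] in \<open>simp add: W_def\<close>)
      then have lin: "linear (?D t)" by (rule linear_frechet_derivative)
      have "?D t (y - y0) = ?D t (\<Sum>b\<in>Basis. ((y - y0) \<bullet> b) *\<^sub>R b)" by (simp add: euclidean_representation)
      then show "?D t (y - y0) = (\<Sum>b\<in>Basis. ((y - y0) \<bullet> b) * (?D t b * 1))"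
        by (simp add: linear_sum[OF lin] linear_scale[OF lin])
    qed
    also have "\<dots> = (\<Sum>b\<in>Basis. ((y - y0) \<bullet> b) * g b y)"
      unfolding g_def
      by (rule sum) (use continuous_section[OF param_Ck_continuous[OF pc] y] in auto)
    finally show ?thesis .
  qed
qed

lemma smooth_on_cutoff:
  assumes "open B" "smooth_on B f" "closed K" "K \<subseteq> B" "\<And>y. y \<notin> K \<Longrightarrow> f y = 0"
  shows "smooth_on UNIV f"
proof (rule smooth_on_local)
  fix x
  show "\<exists>T. open T \<and> x \<in> T \<and> smooth_on T f"
  proof (cases "x \<in> K")
    case True
    then show ?thesis using assms(1,2,4) by blast
  next
    case False
    have "open (- K)" using assms(3) by (rule open_Compl)
    moreover from this have "smooth_on (- K) f"
      by (subst smooth_on_cong[where g = "\<lambda>_. 0"]) (use assms(5) in auto)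
    ultimately show ?thesis using False by blast
  qed
qed

section \<open>The Lie algebra\<close>

locale lie =
  fixes G :: "('g::{t2_space, second_countable_topology}, 'e::euclidean_space) lie_structure"
  assumes lie: "lie_group G"
begin

abbreviation mul (infixl "\<cdot>" 70) where "x \<cdot> y \<equiv> x \<otimes>\<^bsub>G\<^esub> y"
abbreviation iv where "iv x \<equiv> inv\<^bsub>G\<^esub> x"
abbreviation un where "un \<equiv> \<one>\<^bsub>G\<^esub>"
abbreviation A where "A \<equiv> atlas G"
abbreviation C where "C \<equiv> smooth_functions G"
abbreviation L where "L \<equiv> lie_algebra G"

lemma group: "Group.group G" and carrier: "carrier G = UNIV"
  and A: "smooth_atlas A"
  and smooth_mul: "smooth_map (prod_atlas A A) A (\<lambda>(x, y). x \<cdot> y)"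
  and smooth_iv: "smooth_map A A (\<lambda>x. iv x)"
  using lie by (auto simp: lie_group_def)

lemma group_simps [simp]:
  "(x \<cdot> y) \<cdot> z = x \<cdot> (y \<cdot> z)" "un \<cdot> x = x" "x \<cdot> un = x" "iv x \<cdot> x = un" "x \<cdot> iv x = un"
  "iv x \<cdot> (x \<cdot> y) = y" "x \<cdot> (iv x \<cdot> y) = y" "iv un = un" "iv (iv x) = x" "iv (x \<cdot> y) = iv y \<cdot> iv x"
proof -
  interpret group G by (rule group)
  show "(x \<cdot> y) \<cdot> z = x \<cdot> (y \<cdot> z)" for x y z by (rule m_assoc) (auto simp: carrier)
  then have as: "x \<cdot> (y \<cdot> z) = (x \<cdot> y) \<cdot> z" for x y z by simp
  show *: "un \<cdot> x = x" "x \<cdot> un = x" "iv x \<cdot> x = un" "x \<cdot> iv x = un" "iv un = un" "iv (iv x) = x" "iv (x \<cdot> y) = iv y \<cdot> iv x"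
    for x y by (auto simp: carrier inv_mult_group)
  show "iv x \<cdot> (x \<cdot> y) = y" "x \<cdot> (iv x \<cdot> y) = y" by (simp_all only: as *)
qed

lemma smooth_iff: "f \<in> C \<longleftrightarrow> (\<forall>(U, \<phi>)\<in>A. smooth_on (\<phi> ` U) (\<lambda>y. f (inv_into U \<phi> y)))"
  by (simp add: smooth_functions_def smooth_map_euclidean_iff[OF A])

lemma smoothD: "f \<in> C \<Longrightarrow> (U, \<phi>) \<in> A \<Longrightarrow> smooth_on (\<phi> ` U) (\<lambda>y. f (inv_into U \<phi> y))"
  unfolding smooth_iff by fast

lemma smoothI: "(\<And>U \<phi>. (U, \<phi>) \<in> A \<Longrightarrow> smooth_on (\<phi> ` U) (\<lambda>y. f (inv_into U \<phi> y))) \<Longrightarrow> f \<in> C"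
  unfolding smooth_iff by fast

lemma smooth_continuous: "f \<in> C \<Longrightarrow> continuous_on UNIV f"
  by (simp add: smooth_functions_def smooth_map_continuous)

lemma C_const [simp]: "(\<lambda>x. c) \<in> C"
  by (rule smoothI) simp

lemma C_add: "f \<in> C \<Longrightarrow> g \<in> C \<Longrightarrow> (\<lambda>x. f x + g x) \<in> C"
  by (rule smoothI) (intro smooth_on_add smoothD smooth_atlas_chart(2)[OF A])

lemma C_mult: "f \<in> C \<Longrightarrow> g \<in> C \<Longrightarrow> (\<lambda>x. f x * g x) \<in> C"
  by (rule smoothI) (intro smooth_on_mult smoothD smooth_atlas_chart(2)[OF A])

lemma C_scale: "f \<in> C \<Longrightarrow> (\<lambda>x. c * f x) \<in> C"
  by (rule C_mult) auto

lemma C_uminus: "f \<in> C \<Longrightarrow> (\<lambda>x. - f x) \<in> C"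
  using C_scale[of f "-1"] by simp

lemma C_diff: "f \<in> C \<Longrightarrow> g \<in> C \<Longrightarrow> (\<lambda>x. f x - g x) \<in> C"
  using C_add[OF _ C_uminus] by simp

lemma C_sum: "(\<And>i. i \<in> I \<Longrightarrow> f i \<in> C) \<Longrightarrow> (\<lambda>x. \<Sum>i\<in>I. f i x) \<in> C"
  by (induction I rule: infinite_finite_induct) (auto intro: C_add)

lemma C_compose: "f \<in> C \<Longrightarrow> smooth_map A A p \<Longrightarrow> (\<lambda>x. f (p x)) \<in> C"
  unfolding smooth_functions_def
  using smooth_map_compose[OF A A smooth_atlas_euclidean, of p f] by simp

lemma smooth_map_mul:
  assumes B: "smooth_atlas B" and "smooth_map B A p" "smooth_map B A q"
  shows "smooth_map B A (\<lambda>x. p x \<cdot> q x)"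
  using smooth_map_compose[OF B smooth_atlas_prod[OF A A] A smooth_map_Pair[OF B A A assms(2,3)] smooth_mul]
  by simp

lemma smooth_map_iv:
  assumes B: "smooth_atlas B" and "smooth_map B A p"
  shows "smooth_map B A (\<lambda>x. iv (p x))"
  by (rule smooth_map_compose[OF B A A assms(2) smooth_iv])

lemma C_left: "f \<in> C \<Longrightarrow> (\<lambda>x. f (a \<cdot> x)) \<in> C"
  and C_right: "f \<in> C \<Longrightarrow> (\<lambda>x. f (x \<cdot> a)) \<in> C"
  by (auto intro!: C_compose smooth_map_mul smooth_map_const smooth_map_id A)

section \<open>Smooth functions of two group variables\<close>

definition C2 :: "('g \<Rightarrow> 'g \<Rightarrow> real) set" where
  "C2 = {F. smooth_map (prod_atlas A A) euclidean_atlas (\<lambda>(x, y). F x y)}"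

lemma C2_compose:
  assumes "f \<in> C" "smooth_map (prod_atlas A A) A (\<lambda>p. q (fst p) (snd p))"
  shows "(\<lambda>x y. f (q x y)) \<in> C2"
  using smooth_map_compose[OF smooth_atlas_prod[OF A A] A smooth_atlas_euclidean assms(2), of f] assms(1)
  by (simp add: C2_def smooth_functions_def case_prod_unfold)

text \<open>Smoothness in two variables is used in this form: a chart expression on a product of
  open sets, ready for partial derivatives in either factor.\<close>

lemma C2_chart:
  assumes "F \<in> C2" "(U, \<phi>) \<in> A" "(V, \<psi>) \<in> A"
  shows "smooth_on (\<phi> ` U \<times> \<psi> ` V) (\<lambda>p. F (inv_into U \<phi> (fst p)) (inv_into V \<psi> (snd p)))"
proof -
  note cU = smooth_atlas_chart[OF A assms(2)] and cV = smooth_atlas_chart[OF A assms(3)]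
  have op: "open (\<phi> ` U \<times> \<psi> ` V)" using cU(2) cV(2) by (rule open_Times)
  have "smooth_map (prod_atlas A A) euclidean_atlas (\<lambda>(x, y). F x y)" using assms(1) by (simp add: C2_def)
  then have "\<forall>(X, \<gamma>)\<in>prod_atlas A A. smooth_on (\<gamma> ` X) (\<lambda>y. (\<lambda>(x, y). F x y) (inv_into X \<gamma> y))"
    by (simp only: smooth_map_euclidean_iff[OF smooth_atlas_prod[OF A A]])
  with prod_atlasI[OF assms(2,3)]
  have "smooth_on (map_prod \<phi> \<psi> ` (U \<times> V)) (\<lambda>y. (\<lambda>(x, y). F x y) (inv_into (U \<times> V) (map_prod \<phi> \<psi>) y))"
    by fast
  moreover have "map_prod \<phi> \<psi> ` (U \<times> V) = \<phi> ` U \<times> \<psi> ` V" by auto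
  ultimately have "smooth_on (\<phi> ` U \<times> \<psi> ` V) (\<lambda>y. (\<lambda>(x, y). F x y) (inv_into (U \<times> V) (map_prod \<phi> \<psi>) y))" by simp
  then show ?thesis
    by (rule smooth_on_cong[THEN iffD1, OF op, rotated])
      (auto simp: inv_into_map_prod[OF cU(3) cV(3)] simp del: map_prod_simp)
qed

lemma C2_section1: "F \<in> C2 \<Longrightarrow> (\<lambda>x. F x y) \<in> C"
  and C2_section2: "F \<in> C2 \<Longrightarrow> (\<lambda>y. F x y) \<in> C"
  using smooth_map_compose[OF A smooth_atlas_prod[OF A A] smooth_atlas_euclidean
      smooth_map_Pair[OF A A A smooth_map_id[OF A] smooth_map_const[of _ _ y]], of "\<lambda>(x, y). F x y"]
    smooth_map_compose[OF A smooth_atlas_prod[OF A A] smooth_atlas_euclidean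
      smooth_map_Pair[OF A A A smooth_map_const[of _ _ x] smooth_map_id[OF A]], of "\<lambda>(x, y). F x y"]
  by (simp_all add: C2_def smooth_functions_def)

lemma C2_mul: "f \<in> C \<Longrightarrow> (\<lambda>x y. f (x \<cdot> y)) \<in> C2"
  by (rule C2_compose) (auto intro!: smooth_map_mul smooth_map_fst smooth_map_snd A smooth_atlas_prod)

lemma C2_div: "f \<in> C \<Longrightarrow> (\<lambda>x y. f (iv x \<cdot> y)) \<in> C2"
  by (rule C2_compose) (auto intro!: smooth_map_mul smooth_map_iv smooth_map_fst smooth_map_snd A smooth_atlas_prod)

lemma C2_conj: "f \<in> C \<Longrightarrow> (\<lambda>x y. f (iv y \<cdot> (x \<cdot> y))) \<in> C2"
  by (rule C2_compose) (auto intro!: smooth_map_mul smooth_map_iv smooth_map_fst smooth_map_snd A smooth_atlas_prod)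

section \<open>Left-invariant derivations\<close>

lemma L_smooth: "X \<in> L \<Longrightarrow> f \<in> C \<Longrightarrow> X f \<in> C"
  and L_nonsmooth: "X \<in> L \<Longrightarrow> f \<notin> C \<Longrightarrow> X f = (\<lambda>x. 0)"
  and L_left: "X \<in> L \<Longrightarrow> f \<in> C \<Longrightarrow> X (\<lambda>h. f (a \<cdot> h)) = (\<lambda>h. X f (a \<cdot> h))"
  and L_add: "X \<in> L \<Longrightarrow> f \<in> C \<Longrightarrow> g \<in> C \<Longrightarrow> X (\<lambda>x. f x + g x) = (\<lambda>x. X f x + X g x)"
  and L_mult: "X \<in> L \<Longrightarrow> f \<in> C \<Longrightarrow> g \<in> C \<Longrightarrow> X (\<lambda>x. f x * g x) = (\<lambda>x. X f x * g x + f x * X g x)"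
  and L_scale: "X \<in> L \<Longrightarrow> f \<in> C \<Longrightarrow> X (\<lambda>x. c * f x) = (\<lambda>x. c * X f x)"
  unfolding lie_algebra_def vector_fields_def
  by (auto simp: plus_fun_def times_fun_def scaleR_fun_def zero_fun_def)

lemma LI:
  assumes "\<And>f. f \<in> C \<Longrightarrow> X f \<in> C" "\<And>f. f \<notin> C \<Longrightarrow> X f = (\<lambda>x. 0)"
    and "\<And>f a. f \<in> C \<Longrightarrow> X (\<lambda>h. f (a \<cdot> h)) = (\<lambda>h. X f (a \<cdot> h))"
    and "\<And>f g. f \<in> C \<Longrightarrow> g \<in> C \<Longrightarrow> X (\<lambda>x. f x + g x) = (\<lambda>x. X f x + X g x)"
    and "\<And>f g. f \<in> C \<Longrightarrow> g \<in> C \<Longrightarrow> X (\<lambda>x. f x * g x) = (\<lambda>x. X f x * g x + f x * X g x)"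
    and "\<And>f c. f \<in> C \<Longrightarrow> X (\<lambda>x. c * f x) = (\<lambda>x. c * X f x)"
  shows "X \<in> L"
  unfolding lie_algebra_def vector_fields_def
  using assms by (auto simp: plus_fun_def times_fun_def scaleR_fun_def zero_fun_def)

lemma L_const: "X \<in> L \<Longrightarrow> X (\<lambda>x. c) = (\<lambda>x. 0)"
proof -
  assume X: "X \<in> L"
  have "X (\<lambda>x. 1 * 1) = (\<lambda>x. X (\<lambda>x. 1) x * 1 + 1 * X (\<lambda>x. 1) x)" by (rule L_mult[OF X]) auto
  then have "X (\<lambda>x. 1) x = 0" for x by (simp add: fun_eq_iff)
  moreover have "X (\<lambda>x. c * 1) = (\<lambda>x. c * X (\<lambda>x. 1) x)" by (rule L_scale[OF X]) auto
  ultimately show ?thesis by simp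
qed

lemma L_diff: "X \<in> L \<Longrightarrow> f \<in> C \<Longrightarrow> g \<in> C \<Longrightarrow> X (\<lambda>x. f x - g x) = (\<lambda>x. X f x - X g x)"
  using L_add[OF _ _ C_scale[of g "-1"], of X f] L_scale[of X g "-1"] by simp

lemma L_sum:
  assumes "X \<in> L" "\<And>i. i \<in> I \<Longrightarrow> f i \<in> C"
  shows "X (\<lambda>x. \<Sum>i\<in>I. f i x) = (\<lambda>x. \<Sum>i\<in>I. X (f i) x)"
  using assms(2)
proof (induction I rule: infinite_finite_induct)
  case (insert i I)
  then show ?case using L_add[OF assms(1), of "f i" "\<lambda>x. \<Sum>i\<in>I. f i x"] by (simp add: C_sum)
qed (simp_all add: L_const[OF assms(1)])

lemma L_at_un: "X \<in> L \<Longrightarrow> f \<in> C \<Longrightarrow> X f a = X (\<lambda>h. f (a \<cdot> h)) un"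
  by (simp add: L_left)

lemma L_subspace: "Real_Vector_Spaces.subspace L"
  unfolding Real_Vector_Spaces.subspace_def
proof (intro conjI ballI allI)
  show "0 \<in> L" by (rule LI) (auto simp: zero_fun_def)
  fix X assume X: "X \<in> L"
  show "c *\<^sub>R X \<in> L" for c
    by (rule LI) (auto simp: scaleR_fun_def L_nonsmooth[OF X] L_left[OF X] L_add[OF X] L_mult[OF X]
        L_scale[OF X] L_const[OF X] algebra_simps intro!: C_scale L_smooth[OF X])
  fix Y assume Y: "Y \<in> L"
  show "X + Y \<in> L"
    by (rule LI) (auto simp: plus_fun_def L_nonsmooth[OF X] L_left[OF X] L_add[OF X] L_mult[OF X]
        L_scale[OF X] L_nonsmooth[OF Y] L_left[OF Y] L_add[OF Y] L_mult[OF Y]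
        L_scale[OF Y] L_const[OF X] L_const[OF Y] algebra_simps intro!: C_add L_smooth[OF X] L_smooth[OF Y])
qed

lemma bracket_apply: "bracket X Y f x = X (Y f) x - Y (X f) x"
  by (simp add: bracket_def)

lemma bracket_L:
  assumes X: "X \<in> L" and Y: "Y \<in> L"
  shows "bracket X Y \<in> L"
proof (rule LI)
  note s = L_smooth[OF X] L_smooth[OF Y]
  have b: "bracket X Y f = (\<lambda>x. X (Y f) x - Y (X f) x)" for f by (rule ext) (rule bracket_apply)
  fix f
  show "bracket X Y f \<in> C" if "f \<in> C" unfolding b by (intro C_diff s that)
  show "bracket X Y f = (\<lambda>x. 0)" if "f \<notin> C"
    unfolding b L_nonsmooth[OF X that] L_nonsmooth[OF Y that] by (simp add: L_const X Y)
  assume f: "f \<in> C"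
  show "bracket X Y (\<lambda>h. f (a \<cdot> h)) = (\<lambda>h. bracket X Y f (a \<cdot> h))" for a
    unfolding b L_left[OF X f] L_left[OF Y f] L_left[OF X s(2)[OF f]] L_left[OF Y s(1)[OF f]] ..
  show "bracket X Y (\<lambda>x. c * f x) = (\<lambda>x. c * bracket X Y f x)" for c
    unfolding b L_scale[OF X f] L_scale[OF Y f] L_scale[OF X s(2)[OF f]] L_scale[OF Y s(1)[OF f]]
    by (simp add: algebra_simps)
  fix g assume g: "g \<in> C"
  show "bracket X Y (\<lambda>x. f x + g x) = (\<lambda>x. bracket X Y f x + bracket X Y g x)"
    unfolding b L_add[OF X f g] L_add[OF Y f g] L_add[OF X s(2)[OF f] s(2)[OF g]] L_add[OF Y s(1)[OF f] s(1)[OF g]]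
    by (simp add: algebra_simps)
  show "bracket X Y (\<lambda>x. f x * g x) = (\<lambda>x. bracket X Y f x * g x + f x * bracket X Y g x)"
    unfolding b L_mult[OF X f g] L_mult[OF Y f g]
    by (simp add: L_add[OF X] L_add[OF Y] L_mult[OF X] L_mult[OF Y] C_mult s f g algebra_simps)
qed

text \<open>By Hadamard's lemma, a derivation at the identity is determined by its values on
  (cut-off) coordinate functions.\<close>

theorem tangent_vector:
  assumes U: "(U, \<phi>) \<in> A" "un \<in> U"
  obtains F where "\<And>b. b \<in> Basis \<Longrightarrow> F b \<in> C"
    "\<And>X f. X \<in> L \<Longrightarrow> f \<in> C \<Longrightarrow> X f un =
      (\<Sum>b\<in>Basis. X (F b) un * frechet_derivative (\<lambda>y. f (inv_into U \<phi> y)) (at (\<phi> un)) b)"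
proof -
  note cU = smooth_atlas_chart[OF A U(1)]
  define y0 where "y0 = \<phi> un"
  have "y0 \<in> \<phi> ` U" using U(2) by (simp add: y0_def)
  then obtain \<epsilon> where \<epsilon>: "\<epsilon> > 0" "ball y0 \<epsilon> \<subseteq> \<phi> ` U" using cU(2) open_contains_ball by blast
  let ?K = "cball y0 (\<epsilon> / 2)"
  have KB: "?K \<subseteq> ball y0 \<epsilon>" using \<epsilon>(1) by auto
  have \<epsilon>2: "\<epsilon> / 2 > 0" using \<epsilon>(1) by simp
  obtain \<beta> :: "'e \<Rightarrow> real" where \<beta>: "smooth_on UNIV \<beta>" "\<beta> y0 = 1" "\<And>y. \<beta> y \<ge> 0" "\<And>y. y \<notin> ?K \<Longrightarrow> \<beta> y = 0"
    using smooth_bump_exists[OF \<epsilon>2, of y0] by blast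
  \<comment> \<open>\<open>X\<close> accepts globally defined smooth functions, so a function given
    near \<open>y0\<close> is multiplied by the bump and extended by zero.\<close>
  define ext where "ext h = (\<lambda>p. if p \<in> U then \<beta> (\<phi> p) * h (\<phi> p) else 0)" for h :: "'e \<Rightarrow> real"
  have ext: "ext h \<in> C" if "smooth_on (ball y0 \<epsilon>) h" for h
  proof -
    have "smooth_on UNIV (\<lambda>y. \<beta> y * h y)"
      by (rule smooth_on_cutoff[of "ball y0 \<epsilon>" _ ?K])
        (use KB \<beta>(4) that in \<open>auto intro!: smooth_on_mult smooth_on_subset[OF \<beta>(1)]\<close>)
    then have "smooth_map A euclidean_atlas (\<lambda>p. if p \<in> U then (\<lambda>y. \<beta> y * h y) (\<phi> p) else 0)"
      by (intro smooth_map_extend_zero[OF A U(1) _ compact_cball[of y0 "\<epsilon> / 2"]])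
        (use KB \<epsilon>(2) \<beta>(4) in \<open>auto intro: smooth_on_subset\<close>)
    then show ?thesis by (simp add: ext_def smooth_functions_def)
  qed
  have ext_un: "ext h un = h y0" for h using U(2) \<beta>(2) by (simp add: ext_def y0_def)
  define F where "F b = ext (\<lambda>y. (y - y0) \<bullet> b)" for b
  have F: "F b \<in> C" for b unfolding F_def
  proof (rule ext)
    have "smooth_on (ball y0 \<epsilon>) (\<lambda>y. (y + (- y0)) \<bullet> b)"
      by (intro smooth_on_bounded_linear[OF open_ball bounded_linear_inner_left] smooth_on_add
          smooth_on_id smooth_on_const open_ball)
    then show "smooth_on (ball y0 \<epsilon>) (\<lambda>y. (y - y0) \<bullet> b)" by simp
  qed
  have "X f un = (\<Sum>b\<in>Basis. X (F b) un * frechet_derivative (\<lambda>y. f (inv_into U \<phi> y)) (at y0) b)"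
    if X: "X \<in> L" and f: "f \<in> C" for X f
  proof -
    define f' where "f' = (\<lambda>y. f (inv_into U \<phi> y))"
    have f': "smooth_on (ball y0 \<epsilon>) f'" unfolding f'_def
      by (rule smooth_on_subset[OF smoothD[OF f U(1)] \<epsilon>(2)])
    obtain g where g: "\<And>b. smooth_on (ball y0 \<epsilon>) (g b)" "\<And>b. g b y0 = frechet_derivative f' (at y0) b"
      "\<And>y. y \<in> ball y0 \<epsilon> \<Longrightarrow> f' y - f' y0 = (\<Sum>b\<in>Basis. ((y - y0) \<bullet> b) * g b y)"
      using hadamard[OF f' \<epsilon>(1)] by blast
    \<comment> \<open>The extended cut-off. It enters \<open>eq\<close> squared because
      \<open>F b\<close> and \<open>ext (g b)\<close> each carry one factor of the bump.\<close>
    define \<chi>' where "\<chi>' = ext (\<lambda>_. 1)"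
    have \<chi>': "\<chi>' \<in> C" "\<chi>' un = 1" unfolding \<chi>'_def by (auto intro!: ext simp: ext_un)
    have eg: "ext (g b) \<in> C" for b by (rule ext[OF g(1)])
    have fu: "f' y0 = f un" using U(2) cU(3) by (simp add: f'_def y0_def)
    have eq: "(\<chi>' p * \<chi>' p) * (f p - f un) = (\<Sum>b\<in>Basis. F b p * ext (g b) p)" for p
    proof (cases "p \<in> U \<and> \<phi> p \<in> ball y0 \<epsilon>")
      case True
      then have "f p = f' (\<phi> p)" using cU(3) by (simp add: f'_def)
      with True g(3)[of "\<phi> p"] fu have "f p - f un = (\<Sum>b\<in>Basis. ((\<phi> p - y0) \<bullet> b) * g b (\<phi> p))" by simp
      then show ?thesis using True
        by (simp add: \<chi>'_def F_def ext_def sum_distrib_left mult_ac)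
    next
      case False
      then have "p \<notin> U \<or> \<beta> (\<phi> p) = 0" using KB \<beta>(4) by blast
      then show ?thesis by (auto simp: \<chi>'_def F_def ext_def)
    qed
    have df: "(\<lambda>p. f p - f un) \<in> C" by (intro C_diff f C_const)
    \<comment> \<open>At the identity the cut-off equals \<open>1\<close> and
      \<open>f - f un\<close> vanishes, so the product rule leaves \<open>X f un\<close>.\<close>
    have "X (\<lambda>p. (\<chi>' p * \<chi>' p) * (f p - f un)) un = X f un"
      by (simp add: L_mult[OF X C_mult[OF \<chi>'(1) \<chi>'(1)] df] L_diff[OF X f C_const] L_const[OF X] \<chi>'(2))
    moreover have "X (\<lambda>p. \<Sum>b\<in>Basis. F b p * ext (g b) p) un = (\<Sum>b\<in>Basis. X (F b) un * g b y0)"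
    proof -
      \<comment> \<open>Because of these zeros the product rule keeps the terms in which
        \<open>X\<close> falls on \<open>F b\<close>, and the values \<open>g b y0\<close> become
        the partial derivatives.\<close>
      have "F b un = 0" for b by (simp add: F_def ext_un)
      then show ?thesis
        by (subst L_sum[OF X]) (auto intro!: C_mult F eg sum.cong simp: L_mult[OF X F eg] ext_un)
    qed
    ultimately show ?thesis unfolding eq by (simp add: g(2) f'_def)
  qed
  then show ?thesis using F that[of F] unfolding y0_def by blast
qed

text \<open>Left invariance carries agreement at the identity to every point, and off the smooth
  functions both operators are zero.\<close>

lemma L_eqI:
  assumes X: "X \<in> L" and Y: "Y \<in> L" and eq: "\<And>f. f \<in> C \<Longrightarrow> X f un = Y f un"
  shows "X = Y"
proof (rule ext)
  fix f
  show "X f = Y f"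
  proof (cases "f \<in> C")
    case True
    have "X f a = Y f a" for a
      using L_at_un[OF X True, of a] L_at_un[OF Y True, of a] eq[OF C_left[OF True]] by simp
    then show ?thesis by (rule ext)
  qed (simp add: L_nonsmooth X Y)
qed

text \<open>One existential packs chart and test functions together, so that a locale can later be
  interpreted with them.\<close>

lemma coordinates_exist:
  "\<exists>U \<phi> F. (U, \<phi>) \<in> A \<and> un \<in> U \<and> (\<forall>b\<in>Basis. F b \<in> C) \<and>
    (\<forall>X\<in>L. \<forall>f\<in>C. X f un =
      (\<Sum>b\<in>Basis. X (F b) un * frechet_derivative (\<lambda>y. f (inv_into U \<phi> y)) (at (\<phi> un)) b))"
proof -
  obtain U \<phi> where U: "(U, \<phi>) \<in> A" "un \<in> U" by (rule smooth_atlas_cover[OF A])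
  obtain F where "\<And>b. b \<in> Basis \<Longrightarrow> F b \<in> C"
    "\<And>X f. X \<in> L \<Longrightarrow> f \<in> C \<Longrightarrow> X f un =
      (\<Sum>b\<in>Basis. X (F b) un * frechet_derivative (\<lambda>y. f (inv_into U \<phi> y)) (at (\<phi> un)) b)"
    by (rule tangent_vector[OF U]) blast
  with U show ?thesis by (intro exI[of _ U] exI[of _ \<phi>] exI[of _ F]) simp
qed

text \<open>Sending \<open>X\<close> to the vector of the values \<open>X (F b) un\<close> is linear
  and, by the coordinate expansion, injective on \<open>L\<close>; a basis of \<open>L\<close> is
  therefore mapped to an independent set in the Euclidean space \<open>'e\<close>.\<close>

lemma L_finite_dim:
  obtains B where "finite B" "Real_Vector_Spaces.independent B" "Real_Vector_Spaces.span B = L"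
proof -
  obtain U \<phi> F where "(U, \<phi>) \<in> A" "un \<in> U" and F: "\<forall>b\<in>Basis. F b \<in> C"
    "\<forall>X\<in>L. \<forall>f\<in>C. X f un =
      (\<Sum>b\<in>Basis. X (F b) un * frechet_derivative (\<lambda>y. f (inv_into U \<phi> y)) (at (\<phi> un)) b)"
    using coordinates_exist by blast
  define T where "T X = (\<Sum>b\<in>Basis. X (F b) un *\<^sub>R b)" for X :: "('g \<Rightarrow> real) \<Rightarrow> ('g \<Rightarrow> real)"
  have lin: "linear T"
    by (rule linearI) (simp_all add: T_def scaleR_fun_def plus_fun_def scaleR_add_left sum.distrib scaleR_sum_right)
  have inj: "inj_on T L"
  proof (rule inj_onI)
    fix X Y assume X: "X \<in> L" and Y: "Y \<in> L" and eq: "T X = T Y"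
    have "X (F b) un = Y (F b) un" if "b \<in> Basis" for b
      using arg_cong[OF eq, of "\<lambda>v. v \<bullet> b"] that
      by (simp add: T_def inner_sum_left inner_Basis if_distrib[of "\<lambda>z. _ * z"] cong: if_cong)
    then show "X = Y"
      by (intro L_eqI[OF X Y]) (simp add: F(2)[rule_format, OF X] F(2)[rule_format, OF Y])
  qed
  obtain B where B: "B \<subseteq> L" "Real_Vector_Spaces.independent B" "L \<subseteq> Real_Vector_Spaces.span B"
    using Real_Vector_Spaces.basis_exists[of L] by metis
  have sp: "Real_Vector_Spaces.span B = L"
    using B Real_Vector_Spaces.span_minimal[OF B(1) L_subspace] by blast
  have "Real_Vector_Spaces.independent (T ` B)"
    by (rule Real_Vector_Spaces.linear_independent_injective_image[OF lin B(2)]) (simp add: sp inj)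
  then have "finite (T ` B)" using independent_bound by blast
  then have "finite B" using finite_image_iff[OF inj_on_subset[OF inj B(1)]] by blast
  then show ?thesis using B(2) sp that by blast
qed

end

section \<open>Smoothness of continuous representations\<close>

text \<open>Diagonal dominance: for a kernel vector, the row of its entry of largest modulus would
  give \<open>cmod m \<le> n * d\<close>. The determinant thus is nonzero, and the inverse is taken
  among library matrices.\<close>

lemma near_identity_inverse:
  fixes N :: "nat \<Rightarrow> nat \<Rightarrow> complex"
  assumes near: "\<And>i j. i < n \<Longrightarrow> j < n \<Longrightarrow> cmod (N i j - (if i = j then m else 0)) \<le> d"
    and d: "real n * d < cmod m"
  obtains N' where "\<And>i j. i < n \<Longrightarrow> j < n \<Longrightarrow> (\<Sum>k<n. N i k * N' k j) = (if i = j then 1 else 0)"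
proof -
  define M where "M = Matrix.mat n n (\<lambda>(i, j). N i j)"
  have M: "M \<in> carrier_mat n n" by (simp add: M_def)
  have "det M \<noteq> 0"
  proof
    assume "det M = 0"
    then obtain v where v: "v \<in> carrier_vec n" "v \<noteq> 0\<^sub>v n" "M *\<^sub>v v = 0\<^sub>v n"
      using det_0_iff_vec_prod_zero_field[OF M] by blast
    have n: "n > 0" using v(1,2) by (cases n) auto
    have z: "(\<Sum>j<n. N i j * vec_index v j) = 0" if "i < n" for i
    proof -
      have "vec_index (M *\<^sub>v v) i = 0" using v(3) that by simp
      then show ?thesis using that v(1) by (simp add: M_def scalar_prod_def lessThan_atLeast0)
    qed
    have "Max ((\<lambda>i. cmod (vec_index v i)) ` {..<n}) \<in> (\<lambda>i. cmod (vec_index v i)) ` {..<n}"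
      by (rule Max_in) (use n in auto)
    then obtain i where i: "i < n" "Max ((\<lambda>i. cmod (vec_index v i)) ` {..<n}) = cmod (vec_index v i)" by auto
    have le: "cmod (vec_index v j) \<le> cmod (vec_index v i)" if "j < n" for j
      unfolding i(2)[symmetric] by (rule Max_ge) (use that in auto)
    have pos: "cmod (vec_index v i) > 0"
    proof (rule ccontr)
      assume "\<not> cmod (vec_index v i) > 0"
      then have "\<And>j. j < n \<Longrightarrow> vec_index v j = 0" using le by force
      then have "v = 0\<^sub>v n" using v(1) by (intro eq_vecI) auto
      with v(2) show False by simp
    qed
    have "m * vec_index v i = (\<Sum>j<n. (if i = j then m else 0) * vec_index v j)"
      using i(1) by (simp add: if_distrib[of "\<lambda>z. z * _"] cong: if_cong)
    also have "\<dots> = - (\<Sum>j<n. (N i j - (if i = j then m else 0)) * vec_index v j)"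
      using z[OF i(1)] by (simp add: left_diff_distrib sum_subtractf)
    finally have "cmod m * cmod (vec_index v i) = cmod (\<Sum>j<n. (N i j - (if i = j then m else 0)) * vec_index v j)"
      by (metis norm_minus_cancel norm_mult)
    also have "\<dots> \<le> (\<Sum>j<n. d * cmod (vec_index v i))"
    proof (rule sum_norm_le)
      fix j assume "j \<in> {..<n}"
      then show "cmod ((N i j - (if i = j then m else 0)) * vec_index v j) \<le> d * cmod (vec_index v i)"
        using near[OF i(1), of j] le[of j] order_trans[OF norm_ge_zero near[OF i(1), of j]]
        unfolding norm_mult by (intro mult_mono) auto
    qed
    also have "\<dots> = (real n * d) * cmod (vec_index v i)" by simp
    finally show False using d pos by simp
  qed
  then have "M \<in> Units (ring_mat TYPE(complex) n ())" by (rule det_non_zero_imp_unit[OF M])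
  then obtain B where B: "B \<in> carrier_mat n n" "M * B = 1\<^sub>m n"
    by (auto simp: Units_def ring_mat_simps)
  show ?thesis
  proof (rule that[of "\<lambda>k j. B $$ (k, j)"])
    fix i j assume ij: "i < n" "j < n"
    have "(M * B) $$ (i, j) = (if i = j then 1 else 0)" using ij by (simp add: B(2))
    then show "(\<Sum>k<n. N i k * B $$ (k, j)) = (if i = j then 1 else 0)"
      using ij B(1) by (simp add: M_def scalar_prod_def lessThan_atLeast0)
  qed
qed

locale compact_lie = lie G
  for G :: "('g::{t2_space, second_countable_topology}, 'e::euclidean_space) lie_structure" +
  assumes compact: "compact (UNIV :: 'g set)"
begin

sublocale H: compact_group "\<lambda>x y. x \<cdot> y" "\<lambda>x. iv x" un
proof
  show "continuous_on UNIV (\<lambda>(x, y). x \<cdot> y)" by (rule smooth_map_continuous[OF smooth_mul])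
qed (simp_all add: compact)

lemma mean_functional: "bounded_functional UNIV H.mean 1"
proof
  show "\<bar>H.mean f\<bar> \<le> 1 * B" if "continuous_on UNIV f" "\<And>x. x \<in> UNIV \<Longrightarrow> \<bar>f x\<bar> \<le> B" for f B
    using H.mean_abs_le[of f 0 B] that by simp
qed (use compact H.mean_linear in auto)

text \<open>All derivatives in \<open>h\<close> fall on the smooth factor \<open>f\<close>, while
  \<open>w\<close> only has to be continuous; this is how a merely continuous function acquires
  smoothness. The integration variable is treated chart by chart.\<close>

lemma convolution_smooth:
  assumes f: "f \<in> C" and w: "continuous_on UNIV w"
  shows "(\<lambda>h. H.mean (\<lambda>g. f (iv h \<cdot> g) * w g)) \<in> C"
proof (rule smoothI)
  interpret bounded_functional UNIV H.mean 1 by (rule mean_functional)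
  fix U \<phi> assume U: "(U, \<phi>) \<in> A"
  note cU = smooth_atlas_chart[OF A U]
  define \<Phi> where "\<Phi> y g = f (iv (inv_into U \<phi> y) \<cdot> g) * w g" for y g
  have "param_Ck k (\<phi> ` U) UNIV \<Phi>" for k
  proof (rule param_Ck_cover[OF cU(2)])
    fix t :: 'g
    obtain V \<psi> where V: "(V, \<psi>) \<in> A" "t \<in> V" by (rule smooth_atlas_cover[OF A])
    note cV = smooth_atlas_chart[OF A V(1)]
    define h where "h p = f (iv (inv_into U \<phi> (fst p)) \<cdot> inv_into V \<psi> (snd p))" for p
    have h: "smooth_on (\<phi> ` U \<times> \<psi> ` V) h"
      unfolding h_def by (rule C2_chart[OF C2_div[OF f] U V(1)])
    have "param_Ck k (\<phi> ` U) V (\<lambda>x t. h (x, \<psi> t) * w t)"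
      by (rule param_Ck_smooth_chart[OF cU(2) open_Times[OF cU(2) cV(2)] h cV(4)])
        (auto intro: continuous_on_subset[OF w])
    then have "param_Ck k (\<phi> ` U) V \<Phi>"
      by (rule param_Ck_cong[OF cU(2), rotated]) (simp add: h_def \<Phi>_def cV(3))
    then show "\<exists>N. open N \<and> t \<in> N \<and> param_Ck k (\<phi> ` U) (UNIV \<inter> N) \<Phi>"
      using cV(1) V(2) by (intro exI[of _ V]) simp
  qed
  then have "smooth_on (\<phi> ` U) (\<lambda>y. H.mean (\<Phi> y))"
    unfolding smooth_on_def using Ck_on_param[OF cU(2)] by simp
  then show "smooth_on (\<phi> ` U) (\<lambda>y. H.mean (\<lambda>g. f (iv (inv_into U \<phi> y) \<cdot> g) * w g))"
    unfolding \<Phi>_def .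
qed

lemma bump_at_un:
  assumes W: "open W" "un \<in> W"
  shows "\<exists>f\<in>C. f un = 1 \<and> (\<forall>x. 0 \<le> f x) \<and> (\<forall>x. x \<notin> W \<longrightarrow> f x = 0)"
proof -
  obtain U \<phi> where U: "(U, \<phi>) \<in> A" "un \<in> U" by (rule smooth_atlas_cover[OF A])
  note cU = smooth_atlas_chart[OF A U(1)]
  have "open (\<phi> ` (U \<inter> W))" using smooth_atlas_open_image[OF A U(1)] cU(1) W(1) by auto
  moreover have "\<phi> un \<in> \<phi> ` (U \<inter> W)" using U(2) W(2) by blast
  ultimately obtain \<epsilon> where \<epsilon>: "\<epsilon> > 0" "cball (\<phi> un) \<epsilon> \<subseteq> \<phi> ` (U \<inter> W)"
    using open_contains_cball by blast
  obtain \<beta> :: "'e \<Rightarrow> real" where \<beta>: "smooth_on UNIV \<beta>" "\<beta> (\<phi> un) = 1" "\<And>y. \<beta> y \<ge> 0" "\<And>y. y \<notin> cball (\<phi> un) \<epsilon> \<Longrightarrow> \<beta> y = 0"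
    using smooth_bump_exists[OF \<epsilon>(1), of "\<phi> un"] by blast
  define f where "f = (\<lambda>p. if p \<in> U then \<beta> (\<phi> p) else 0)"
  have "f \<in> C" unfolding f_def smooth_functions_def mem_Collect_eq
    by (rule smooth_map_extend_zero[OF A U(1) _ compact_cball[of "\<phi> un" \<epsilon>]])
      (use \<epsilon>(2) \<beta>(4) in \<open>auto intro: smooth_on_subset[OF \<beta>(1)]\<close>)
  moreover have "f x = 0" if "x \<notin> W" for x
  proof (cases "x \<in> U")
    case True
    have "\<phi> x \<notin> cball (\<phi> un) \<epsilon>"
    proof
      assume "\<phi> x \<in> cball (\<phi> un) \<epsilon>"
      then have "\<phi> x \<in> \<phi> ` (U \<inter> W)" using \<epsilon>(2) by blast
      then show False using True that cU(3) by (auto simp: inj_on_def)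
    qed
    then show ?thesis by (simp add: f_def \<beta>(4))
  qed (simp add: f_def)
  ultimately show ?thesis using U(2) \<beta>(2,3) by (intro bexI[of _ f]) (auto simp: f_def)
qed

section \<open>Complex-valued functions and their means\<close>

definition CC :: "('g \<Rightarrow> complex) set" where
  "CC = {u. (\<lambda>x. Re (u x)) \<in> C \<and> (\<lambda>x. Im (u x)) \<in> C}"

lemma CC_const [simp]: "(\<lambda>x. c) \<in> CC" by (simp add: CC_def)

lemma CC_add: "u \<in> CC \<Longrightarrow> v \<in> CC \<Longrightarrow> (\<lambda>x. u x + v x) \<in> CC"
  by (simp add: CC_def C_add)

lemma CC_mult: "u \<in> CC \<Longrightarrow> v \<in> CC \<Longrightarrow> (\<lambda>x. u x * v x) \<in> CC"
  by (simp add: CC_def C_add C_diff C_mult)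

lemma CC_cnj: "u \<in> CC \<Longrightarrow> (\<lambda>x. cnj (u x)) \<in> CC"
  by (simp add: CC_def C_uminus)

lemma CC_sum: "(\<And>i. i \<in> I \<Longrightarrow> u i \<in> CC) \<Longrightarrow> (\<lambda>x. \<Sum>i\<in>I. u i x) \<in> CC"
  by (induction I rule: infinite_finite_induct) (auto intro: CC_add)

definition cmean :: "('g \<Rightarrow> complex) \<Rightarrow> complex" where
  "cmean u = Complex (H.mean (\<lambda>x. Re (u x))) (H.mean (\<lambda>x. Im (u x)))"

lemma cmean_add:
  assumes "continuous_on UNIV u" "continuous_on UNIV v"
  shows "cmean (\<lambda>x. u x + v x) = cmean u + cmean v"
  using H.mean_linear[of "\<lambda>x. Re (u x)" "\<lambda>x. Re (v x)" 1 1] H.mean_linear[of "\<lambda>x. Im (u x)" "\<lambda>x. Im (v x)" 1 1] assms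
  by (simp add: cmean_def complex_eq_iff continuous_on_Re continuous_on_Im)

lemma cmean_mult:
  assumes "continuous_on UNIV u"
  shows "cmean (\<lambda>x. c * u x) = c * cmean u"
  using H.mean_linear[of "\<lambda>x. Re (u x)" "\<lambda>x. Im (u x)" "Re c" "- Im c"]
    H.mean_linear[of "\<lambda>x. Im (u x)" "\<lambda>x. Re (u x)" "Re c" "Im c"] assms
  by (simp add: cmean_def complex_eq_iff continuous_on_Re continuous_on_Im)

lemma cmean_sum:
  assumes "\<And>i. i \<in> I \<Longrightarrow> continuous_on UNIV (u i)"
  shows "cmean (\<lambda>x. \<Sum>i\<in>I. c i * u i x) = (\<Sum>i\<in>I. c i * cmean (u i))"
  using assms
proof (induction I rule: infinite_finite_induct)
  case (insert i I)
  have "cmean (\<lambda>x. c i * u i x + (\<Sum>i\<in>I. c i * u i x)) = cmean (\<lambda>x. c i * u i x) + cmean (\<lambda>x. \<Sum>i\<in>I. c i * u i x)"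
    by (rule cmean_add) (use insert.prems in \<open>auto intro!: continuous_on_sum continuous_on_mult\<close>)
  then show ?case using insert cmean_mult[of "u i" "c i"] by simp
qed (simp_all add: cmean_def complex_eq_iff)

lemma cmean_left:
  assumes "continuous_on UNIV u"
  shows "cmean (\<lambda>x. u (a \<cdot> x)) = cmean u"
  using H.mean_left[of "\<lambda>x. Re (u x)" a] H.mean_left[of "\<lambda>x. Im (u x)" a] assms
  by (simp add: cmean_def continuous_on_Re continuous_on_Im)

text \<open>Where \<open>f\<close> vanishes the value of \<open>v\<close> has no effect, so
  \<open>d * f + f * v\<close> and \<open>d * f - f * v\<close> are nonnegative at every
  point.\<close>

lemma mean_weighted_bound:
  assumes f: "continuous_on UNIV f" "\<And>x. 0 \<le> f x" and v: "continuous_on UNIV v"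
    and le: "\<And>x. f x \<noteq> 0 \<Longrightarrow> \<bar>v x\<bar> \<le> d"
  shows "\<bar>H.mean (\<lambda>x. f x * v x)\<bar> \<le> d * H.mean f"
proof -
  have fv: "continuous_on UNIV (\<lambda>x. f x * v x)" by (intro continuous_on_mult f v)
  have *: "\<bar>f x * v x\<bar> \<le> d * f x" for x
    using le[of x] f(2)[of x] by (cases "f x = 0") (auto simp: abs_mult mult.commute mult_left_mono)
  have "0 \<le> d * f x + 1 * (f x * v x)" "0 \<le> d * f x + (-1) * (f x * v x)" for x
    using *[of x] by (simp_all add: abs_le_iff)
  then have "0 \<le> H.mean (\<lambda>x. d * f x + 1 * (f x * v x))" "0 \<le> H.mean (\<lambda>x. d * f x + (-1) * (f x * v x))"
    by (intro H.mean_nonneg continuous_on_add continuous_on_mult continuous_on_const f v; blast)+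
  then show ?thesis
    using H.mean_linear[OF f(1) fv, of d 1] H.mean_linear[OF f(1) fv, of d "-1"] by (simp add: abs_le_iff)
qed

text \<open>Averaging \<open>\<pi>\<close> against a smooth function \<open>f\<close> concentrated near the identity gives an invertible
  matrix \<open>N\<close>, and \<open>\<pi> N\<close> is the smooth convolution of \<open>f\<close> with \<open>\<pi>\<close>.\<close>

theorem continuous_rep_smooth:
  fixes r :: "'g \<Rightarrow> nat \<Rightarrow> nat \<Rightarrow> complex"
  assumes hom: "\<And>g h i j. i < n \<Longrightarrow> j < n \<Longrightarrow> r (g \<cdot> h) i j = (\<Sum>k<n. r g i k * r h k j)"
    and one: "\<And>i j. i < n \<Longrightarrow> j < n \<Longrightarrow> r un i j = (if i = j then 1 else 0)"
    and cont: "\<And>i j. i < n \<Longrightarrow> j < n \<Longrightarrow> continuous_on UNIV (\<lambda>g. r g i j)"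
    and ij: "i < n" "j < n"
  shows "(\<lambda>g. r g i j) \<in> CC"
proof -
  \<comment> \<open>Real and imaginary parts each contribute an error of at most
    \<open>d * m\<close>, so an entry of \<open>N\<close> is off by at most
    \<open>2 * d * m\<close>; the choice makes \<open>n * (2 * d) < 1\<close>, which
    \<open>near_identity_inverse\<close> asks for.\<close>
  define d where "d = 1 / (4 * real n + 1)"
  have d: "d > 0" "real n * (2 * d) < 1" by (auto simp: d_def divide_less_eq add_nonneg_pos)
  define W where "W = (\<Inter>p\<in>{..<n}\<times>{..<n}. {g. cmod (r g (fst p) (snd p) - (if fst p = snd p then 1 else 0)) < d})"
  have "open W" unfolding W_def
  proof (intro open_INT ballI)
    fix p assume p: "p \<in> {..<n} \<times> {..<n}"
    have "continuous_on UNIV (\<lambda>g. cmod (r g (fst p) (snd p) - (if fst p = snd p then 1 else 0)))"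
      using p by (intro continuous_on_norm continuous_on_diff continuous_on_const cont) auto
    from open_vimage[OF open_lessThan this, of d]
    show "open {g. cmod (r g (fst p) (snd p) - (if fst p = snd p then 1 else 0)) < d}"
      by (simp add: vimage_def)
  qed simp
  moreover have "un \<in> W" using d(1) by (auto simp: W_def one)
  ultimately obtain f where f: "f \<in> C" "f un = 1" "\<And>x. 0 \<le> f x" "\<And>x. x \<notin> W \<Longrightarrow> f x = 0"
    using bump_at_un[of W] by blast
  have W: "cmod (r g k l - (if k = l then 1 else 0)) \<le> d" if "f g \<noteq> 0" "k < n" "l < n" for g k l
  proof -
    have "g \<in> W" using f(4) that(1) by blast
    then show ?thesis using that(2,3) unfolding W_def by (force intro: less_imp_le)
  qed
  have cf: "continuous_on UNIV f" by (rule smooth_continuous[OF f(1)])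
  have cfc: "continuous_on UNIV (\<lambda>g. complex_of_real (f g))" by (intro continuous_on_of_real cf)
  define m where "m = H.mean f"
  have m: "m > 0" unfolding m_def by (rule H.mean_pos[OF cf f(3), of un]) (simp add: f(2))
  define N where "N k l = cmean (\<lambda>g. f g * r g k l)" for k l
  define F where "F k l h = cmean (\<lambda>g. f (iv h \<cdot> g) * r g k l)" for k l h
  have near: "cmod (N k l - (if k = l then m else 0)) \<le> 2 * (d * m)" if "k < n" "l < n" for k l
  proof -
    define c :: complex where "c = (if k = l then 1 else 0)"
    have "cmean (\<lambda>g. f g * r g k l + (- c) * f g) = N k l + (- c) * cmean (\<lambda>g. f g)"
      unfolding N_def
      by (subst cmean_add) (auto intro!: continuous_on_mult cfc cont that continuous_on_minus simp: cmean_mult[OF cfc, of "- c", simplified])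
    moreover have "cmean (\<lambda>g. f g) = m" by (simp add: cmean_def m_def complex_eq_iff)
    ultimately have eq: "N k l - (if k = l then m else 0) = cmean (\<lambda>g. f g * r g k l + (- c) * f g)"
      by (simp add: c_def)
    have "\<bar>H.mean (\<lambda>g. f g * Re (r g k l - c))\<bar> \<le> d * m" unfolding m_def
      by (rule mean_weighted_bound[OF cf f(3)])
        (intro continuous_on_Re continuous_on_diff continuous_on_const cont that,
          rule order_trans[OF abs_Re_le_cmod], unfold c_def, rule W[OF _ that])
    moreover have "\<bar>H.mean (\<lambda>g. f g * Im (r g k l - c))\<bar> \<le> d * m" unfolding m_def
      by (rule mean_weighted_bound[OF cf f(3)])
        (intro continuous_on_Im continuous_on_diff continuous_on_const cont that,
          rule order_trans[OF abs_Im_le_cmod], unfold c_def, rule W[OF _ that])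
    moreover have "cmean (\<lambda>g. f g * r g k l + (- c) * f g) =
        Complex (H.mean (\<lambda>g. f g * Re (r g k l - c))) (H.mean (\<lambda>g. f g * Im (r g k l - c)))"
      by (simp add: cmean_def algebra_simps)
    ultimately show ?thesis unfolding eq using cmod_le[of "Complex (H.mean (\<lambda>g. f g * Re (r g k l - c))) (H.mean (\<lambda>g. f g * Im (r g k l - c)))"]
      by simp
  qed
  have "real n * (2 * d) * m < 1 * m" using d(2) m by (rule mult_strict_right_mono)
  then have lt: "real n * (2 * (d * m)) < cmod (complex_of_real m)" using m by (simp add: mult_ac)
  have near': "cmod (N k l - (if k = l then complex_of_real m else 0)) \<le> 2 * (d * m)" if "k < n" "l < n" for k l
    using near[OF that] by (simp split: if_splits)
  obtain N' where N': "\<And>i j. i < n \<Longrightarrow> j < n \<Longrightarrow> (\<Sum>k<n. N i k * N' k j) = (if i = j then 1 else 0)"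
    using near_identity_inverse[OF near' lt] by blast
  have F: "F k l h = (\<Sum>p<n. r h k p * N p l)" if "k < n" "l < n" for k l h
  proof -
    have c: "continuous_on UNIV (\<lambda>g. f (iv h \<cdot> g) * r g k l)"
      by (intro continuous_on_mult continuous_on_of_real H.continuous_translate(1) cf cont that)
    \<comment> \<open>By invariance of the mean, \<open>g\<close> may be replaced by
      \<open>h \<cdot> g\<close>: the convolution becomes \<open>r h\<close> times
      \<open>N\<close>.\<close>
    have "F k l h = cmean (\<lambda>g. f (iv h \<cdot> (h \<cdot> g)) * r (h \<cdot> g) k l)"
      unfolding F_def by (rule cmean_left[OF c, symmetric])
    also have "\<dots> = cmean (\<lambda>g. \<Sum>p<n. r h k p * (f g * r g p l))"
      by (simp add: hom[OF that] sum_distrib_left mult_ac)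
    also have "\<dots> = (\<Sum>p<n. r h k p * N p l)"
      unfolding N_def by (rule cmean_sum) (use that in \<open>auto intro!: continuous_on_mult cfc cont\<close>)
    finally show ?thesis .
  qed
  have FC: "F k l \<in> CC" if "k < n" "l < n" for k l
    using convolution_smooth[OF f(1), of "\<lambda>g. Re (r g k l)"] convolution_smooth[OF f(1), of "\<lambda>g. Im (r g k l)"]
      cont[OF that] by (simp add: CC_def F_def cmean_def continuous_on_Re continuous_on_Im)
  \<comment> \<open>Multiplying by the constant inverse of \<open>N\<close> transfers the smoothness
    of \<open>F\<close> to \<open>r\<close>.\<close>
  have "r h i j = (\<Sum>l<n. F i l h * N' l j)" for h
  proof -
    have "(\<Sum>l<n. F i l h * N' l j) = (\<Sum>l<n. \<Sum>p<n. r h i p * (N p l * N' l j))"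
      by (simp add: F ij sum_distrib_right mult.assoc)
    also have "\<dots> = (\<Sum>p<n. r h i p * (\<Sum>l<n. N p l * N' l j))"
      by (subst sum.swap) (simp add: sum_distrib_left)
    also have "\<dots> = r h i j" using ij by (simp add: N' if_distrib[of "\<lambda>z. _ * z"] cong: if_cong)
    finally show ?thesis ..
  qed
  then have "(\<lambda>h. r h i j) = (\<lambda>h. \<Sum>l<n. F i l h * N' l j)" by (rule ext)
  also have "\<dots> \<in> CC" by (intro CC_sum CC_mult FC ij CC_const) simp
  finally show ?thesis .
qed

end

section \<open>Symmetry of second derivatives, traces and orthonormal bases\<close>

text \<open>The second difference of \<open>h\<close> over a small parallelogram with sides along
  \<open>u\<close> and \<open>v\<close> is evaluated by the mean value theorem in both orders. Each
  order yields one of the mixed derivatives at a nearby point, and continuity of both at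
  \<open>x\<close> forces them to agree.\<close>

lemma second_derivative_symmetric:
  fixes h :: "'a::real_normed_vector \<Rightarrow> real"
  assumes h: "smooth_on W h" and W: "open W" "x \<in> W"
  shows "frechet_derivative (\<lambda>y. frechet_derivative h (at y) u) (at x) v =
    frechet_derivative (\<lambda>y. frechet_derivative h (at y) v) (at x) u"
proof -
  define D where "D w f = (\<lambda>y. frechet_derivative f (at y) w)" for w and f :: "'a \<Rightarrow> real"
  have sm: "smooth_on W (D w f)" if "smooth_on W f" for w f
    unfolding D_def by (rule smooth_on_frechet_derivative[OF that])
  define pt where "pt s t = x + s *\<^sub>R u + t *\<^sub>R v" for s t
  obtain r where r: "r > 0" "ball x r \<subseteq> W" using W open_contains_ball by blast
  have line: "((\<lambda>s. f (y + s *\<^sub>R w)) has_real_derivative D w f (y + s *\<^sub>R w)) (at s)"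
    if "smooth_on W f" "y + s *\<^sub>R w \<in> W" for f y w s
  proof -
    have "f differentiable (at (y + s *\<^sub>R w))" by (rule smooth_on_differentiable[OF that])
    then have 1: "(f has_derivative frechet_derivative f (at (y + s *\<^sub>R w))) (at (y + s *\<^sub>R w))"
      by (simp add: frechet_derivative_works[symmetric])
    have "((\<lambda>s. y + s *\<^sub>R w) has_derivative (\<lambda>d. d *\<^sub>R w)) (at s)" by (auto intro!: derivative_eq_intros)
    from has_derivative_compose[OF this 1]
    have "((\<lambda>s. f (y + s *\<^sub>R w)) has_derivative (\<lambda>d. frechet_derivative f (at (y + s *\<^sub>R w)) (d *\<^sub>R w))) (at s)" .
    then show ?thesis
      by (simp add: has_field_derivative_def D_def linear_scale[OF has_derivative_linear[OF 1]] mult_commute_abs)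
  qed
  have du: "((\<lambda>s. f (pt s t)) has_real_derivative D u f (pt s t)) (at s)" if "smooth_on W f" "pt s t \<in> W" for f s t
    using line[OF that(1), of "x + t *\<^sub>R v" s u] that(2) by (simp add: pt_def algebra_simps)
  have dv: "((\<lambda>t. f (pt s t)) has_real_derivative D v f (pt s t)) (at t)" if "smooth_on W f" "pt s t \<in> W" for f s t
    using line[OF that(1), of "x + s *\<^sub>R u" t v] that(2) by (simp add: pt_def algebra_simps)
  have near: "\<exists>s>0. \<forall>a\<in>{0..s}. \<forall>b\<in>{0..s}. pt a b \<in> ball x \<rho>" if "\<rho> > 0" for \<rho>
  proof (intro exI conjI ballI)
    let ?s = "\<rho> / (norm u + norm v + 1)"
    have p: "norm u + norm v + 1 > 0" by (simp add: add_nonneg_pos)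
    show "?s > 0" using that p by simp
    fix a b assume ab: "a \<in> {0..?s}" "b \<in> {0..?s}"
    have "norm (a *\<^sub>R u + b *\<^sub>R v) \<le> ?s * norm u + ?s * norm v"
    proof (intro order_trans[OF norm_triangle_ineq] add_mono)
      show "norm (a *\<^sub>R u) \<le> ?s * norm u" unfolding norm_scaleR by (rule mult_right_mono) (use ab in auto)
      show "norm (b *\<^sub>R v) \<le> ?s * norm v" unfolding norm_scaleR by (rule mult_right_mono) (use ab in auto)
    qed
    also have "\<dots> = ?s * (norm u + norm v)" by (simp add: distrib_left)
    also have "\<dots> < ?s * (norm u + norm v + 1)" using that p by (intro mult_strict_left_mono) simp_all
    also have "\<dots> = \<rho>" using p by simp
    finally have "norm (pt a b - x) < \<rho>" by (simp add: pt_def)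
    then show "pt a b \<in> ball x \<rho>" by (simp add: dist_norm norm_minus_commute)
  qed
  have "D v (D u h) x = D u (D v h) x"
  proof (rule ccontr)
    assume ne: "D v (D u h) x \<noteq> D u (D v h) x"
    define \<epsilon> where "\<epsilon> = \<bar>D v (D u h) x - D u (D v h) x\<bar> / 2"
    have \<epsilon>: "\<epsilon> > 0" using ne by (simp add: \<epsilon>_def)
    have cP: "continuous_on W (D v (D u h))" and cQ: "continuous_on W (D u (D v h))"
      by (auto intro!: smooth_on_imp_continuous_on sm h)
    obtain d1 where d1: "d1 > 0" "\<And>y. y \<in> W \<Longrightarrow> dist y x < d1 \<Longrightarrow> dist (D v (D u h) y) (D v (D u h) x) < \<epsilon>"
      using cP W(2) \<epsilon> unfolding continuous_on_iff by metis
    obtain d2 where d2: "d2 > 0" "\<And>y. y \<in> W \<Longrightarrow> dist y x < d2 \<Longrightarrow> dist (D u (D v h) y) (D u (D v h) x) < \<epsilon>"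
      using cQ W(2) \<epsilon> unfolding continuous_on_iff by metis
    define \<rho> where "\<rho> = min r (min d1 d2)"
    have "\<rho> > 0" using r(1) d1(1) d2(1) by (simp add: \<rho>_def)
    from near[OF this] obtain s where s: "s > 0" "\<And>a b. 0 \<le> a \<Longrightarrow> a \<le> s \<Longrightarrow> 0 \<le> b \<Longrightarrow> b \<le> s \<Longrightarrow> pt a b \<in> ball x \<rho>"
      by auto
    have inW: "pt a b \<in> W" if "0 \<le> a" "a \<le> s" "0 \<le> b" "b \<le> s" for a b
      using s(2)[OF that] r(2) by (auto simp: \<rho>_def)
    define \<Delta> where "\<Delta> = h (pt s s) - h (pt s 0) - h (pt 0 s) + h (pt 0 0)"
    have "\<exists>a b. 0 < a \<and> a < s \<and> 0 < b \<and> b < s \<and> \<Delta> = s * s * D v (D u h) (pt a b)"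
    proof -
      have "\<exists>a. 0 < a \<and> a < s \<and> (h (pt s s) - h (pt s 0)) - (h (pt 0 s) - h (pt 0 0)) =
          (s - 0) * (D u h (pt a s) - D u h (pt a 0))"
        by (rule MVT2[OF s(1)]) (auto intro!: DERIV_diff du h inW less_imp_le[OF s(1)])
      then obtain a where a: "0 < a" "a < s" "\<Delta> = s * (D u h (pt a s) - D u h (pt a 0))"
        by (auto simp: \<Delta>_def)
      have "\<exists>b. 0 < b \<and> b < s \<and> D u h (pt a s) - D u h (pt a 0) = (s - 0) * D v (D u h) (pt a b)"
        by (rule MVT2[OF s(1)]) (use a in \<open>auto intro!: dv sm h inW\<close>)
      with a show ?thesis by auto
    qed
    then obtain a b where ab: "0 < a" "a < s" "0 < b" "b < s" "\<Delta> = s * s * D v (D u h) (pt a b)" by blast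
    have "\<exists>a b. 0 < a \<and> a < s \<and> 0 < b \<and> b < s \<and> \<Delta> = s * s * D u (D v h) (pt a b)"
    proof -
      have "\<exists>b. 0 < b \<and> b < s \<and> (h (pt s s) - h (pt 0 s)) - (h (pt s 0) - h (pt 0 0)) =
          (s - 0) * (D v h (pt s b) - D v h (pt 0 b))"
        by (rule MVT2[OF s(1)]) (auto intro!: DERIV_diff dv h inW less_imp_le[OF s(1)])
      then obtain b where b: "0 < b" "b < s" "\<Delta> = s * (D v h (pt s b) - D v h (pt 0 b))"
        by (auto simp: \<Delta>_def algebra_simps)
      have "\<exists>a. 0 < a \<and> a < s \<and> D v h (pt s b) - D v h (pt 0 b) = (s - 0) * D u (D v h) (pt a b)"
        by (rule MVT2[OF s(1)]) (use b in \<open>auto intro!: du sm h inW\<close>)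
      with b show ?thesis by auto
    qed
    then obtain a' b' where ab': "0 < a'" "a' < s" "0 < b'" "b' < s" "\<Delta> = s * s * D u (D v h) (pt a' b')" by blast
    have eq: "D v (D u h) (pt a b) = D u (D v h) (pt a' b')" using ab(5) ab'(5) s(1) by simp
    have "dist (D v (D u h) (pt a b)) (D v (D u h) x) < \<epsilon>"
      by (rule d1(2)) (use s(2)[of a b] inW[of a b] ab in \<open>auto simp: \<rho>_def dist_commute\<close>)
    moreover have "dist (D u (D v h) (pt a' b')) (D u (D v h) x) < \<epsilon>"
      by (rule d2(2)) (use s(2)[of a' b'] inW[of a' b'] ab' in \<open>auto simp: \<rho>_def dist_commute\<close>)
    ultimately have "\<bar>D v (D u h) x - D u (D v h) x\<bar> < 2 * \<epsilon>" using eq unfolding dist_real_def by argo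
    then show False by (simp add: \<epsilon>_def)
  qed
  then show ?thesis by (simp add: D_def)
qed

text \<open>Linearity is asked on \<open>V\<close> alone: \<open>bracket X\<close> is defined on all
  operators on functions, and off the Lie algebra it need not be additive.\<close>

definition linear_endo :: "'v::real_vector set \<Rightarrow> ('v \<Rightarrow> 'v) \<Rightarrow> bool" where
  "linear_endo V T \<longleftrightarrow> (\<forall>x\<in>V. T x \<in> V) \<and> (\<forall>x\<in>V. \<forall>y\<in>V. T (x + y) = T x + T y) \<and>
    (\<forall>c. \<forall>x\<in>V. T (c *\<^sub>R x) = c *\<^sub>R T x)"

locale finite_dim_space =
  fixes V :: "'v::real_vector set" and B :: "'v set"
  assumes B: "finite B" "Real_Vector_Spaces.independent B" "Real_Vector_Spaces.span B = V"
begin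

lemma V: "Real_Vector_Spaces.subspace V"
  using B(3) Real_Vector_Spaces.subspace_span by blast

lemma B_in: "b \<in> B \<Longrightarrow> b \<in> V"
  using B(3) Real_Vector_Spaces.span_base by blast

lemma linear_endo_sum:
  assumes T: "linear_endo V T" and "finite I" "\<And>i. i \<in> I \<Longrightarrow> x i \<in> V"
  shows "T (\<Sum>i\<in>I. c i *\<^sub>R x i) = (\<Sum>i\<in>I. c i *\<^sub>R T (x i))"
  using assms(2,3)
proof (induction I)
  case empty
  have "0 \<in> V" using V by (rule Real_Vector_Spaces.subspace_0)
  then have "T (0 *\<^sub>R 0) = 0 *\<^sub>R T 0" using T unfolding linear_endo_def by blast
  then show ?case by simp
next
  case (insert i I)
  have "(\<Sum>i\<in>I. c i *\<^sub>R x i) \<in> V" "c i *\<^sub>R x i \<in> V"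
    using insert.prems V by (auto intro!: Real_Vector_Spaces.subspace_sum Real_Vector_Spaces.subspace_scale)
  then show ?case using insert T by (simp add: linear_endo_def)
qed

lemma expand: "x \<in> V \<Longrightarrow> x = (\<Sum>b\<in>B. Real_Vector_Spaces.representation B x b *\<^sub>R b)"
  using Real_Vector_Spaces.sum_representation_eq[OF B(2) _ B(1), of x] B(3) by simp

lemma rep_sum:
  assumes "finite I" "\<And>i. i \<in> I \<Longrightarrow> x i \<in> V"
  shows "Real_Vector_Spaces.representation B (\<Sum>i\<in>I. c i *\<^sub>R x i) b =
    (\<Sum>i\<in>I. c i * Real_Vector_Spaces.representation B (x i) b)"
proof -
  have *: "c i *\<^sub>R x i \<in> Real_Vector_Spaces.span B" if "i \<in> I" for i
    using assms(2)[OF that] B(3) Real_Vector_Spaces.span_scale by blast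
  have "Real_Vector_Spaces.representation B (\<Sum>i\<in>I. c i *\<^sub>R x i) b =
      (\<Sum>i\<in>I. Real_Vector_Spaces.representation B (c i *\<^sub>R x i) b)"
    by (subst Real_Vector_Spaces.representation_sum[OF B(2)]) (use * in auto)
  also have "\<dots> = (\<Sum>i\<in>I. c i * Real_Vector_Spaces.representation B (x i) b)"
    by (rule sum.cong[OF refl], subst Real_Vector_Spaces.representation_scale[OF B(2)])
      (use assms(2) B(3) in auto)
  finally show ?thesis .
qed

text \<open>\<open>trace_on\<close> picks some basis. Expanding each of the two bases in the other
  turns both diagonal sums into the same double sum.\<close>

lemma trace_eq:
  assumes T: "linear_endo V T"
  shows "trace_on V T = (\<Sum>b\<in>B. Real_Vector_Spaces.representation B (T b) b)"
proof -
  define B0 where "B0 = (SOME B. Real_Vector_Spaces.independent B \<and> Real_Vector_Spaces.span B = V)"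
  have B0: "Real_Vector_Spaces.independent B0" "Real_Vector_Spaces.span B0 = V"
    unfolding B0_def using someI_ex[of "\<lambda>B. Real_Vector_Spaces.independent B \<and> Real_Vector_Spaces.span B = V"] B by blast+
  have "finite B0"
    using Real_Vector_Spaces.independent_span_bound[OF B(1) B0(1)] B0(2) B(3) Real_Vector_Spaces.span_superset by blast
  then interpret b0: finite_dim_space V B0 by unfold_locales (use B0 in auto)
  let ?r = "Real_Vector_Spaces.representation"
  have TV: "T x \<in> V" if "x \<in> V" for x using T that by (simp add: linear_endo_def)
  have 1: "?r B (T b) b = (\<Sum>c\<in>B0. ?r B0 b c * ?r B (T c) b)" if "b \<in> B" for b
  proof -
    have "T b = T (\<Sum>c\<in>B0. ?r B0 b c *\<^sub>R c)" using b0.expand[OF B_in[OF that]] by simp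
    also have "\<dots> = (\<Sum>c\<in>B0. ?r B0 b c *\<^sub>R T c)"
      by (rule linear_endo_sum[OF T]) (auto simp: b0.B b0.B_in)
    finally have "T b = (\<Sum>c\<in>B0. ?r B0 b c *\<^sub>R T c)" .
    then have "?r B (T b) b = ?r B (\<Sum>c\<in>B0. ?r B0 b c *\<^sub>R T c) b" by simp
    also have "\<dots> = (\<Sum>c\<in>B0. ?r B0 b c * ?r B (T c) b)"
      by (rule rep_sum) (auto simp: b0.B b0.B_in TV)
    finally show ?thesis .
  qed
  have 2: "?r B0 (T c) c = (\<Sum>b\<in>B. ?r B (T c) b * ?r B0 b c)" if "c \<in> B0" for c
  proof -
    have "?r B0 (T c) c = ?r B0 (\<Sum>b\<in>B. ?r B (T c) b *\<^sub>R b) c"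
      using expand[OF TV[OF b0.B_in[OF that]]] by simp
    also have "\<dots> = (\<Sum>b\<in>B. ?r B (T c) b * ?r B0 b c)"
      by (rule b0.rep_sum) (auto simp: B B_in)
    finally show ?thesis .
  qed
  have "trace_on V T = (\<Sum>c\<in>B0. ?r B0 (T c) c)" by (simp add: trace_on_def B0_def Let_def)
  also have "\<dots> = (\<Sum>b\<in>B. \<Sum>c\<in>B0. ?r B0 b c * ?r B (T c) b)"
    by (subst sum.swap) (simp add: 2 mult.commute)
  also have "\<dots> = (\<Sum>b\<in>B. ?r B (T b) b)" by (simp add: 1)
  finally show ?thesis .
qed

lemma trace_cong:
  assumes "linear_endo V S" "\<And>x. x \<in> V \<Longrightarrow> S x = T x"
  shows "trace_on V T = trace_on V S"
proof -
  have "linear_endo V T"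
    unfolding linear_endo_def
  proof (intro conjI ballI allI)
    fix x assume x: "x \<in> V"
    show "T x \<in> V" using assms(1) assms(2)[OF x, symmetric] x by (simp add: linear_endo_def)
    show "T (c *\<^sub>R x) = c *\<^sub>R T x" for c
      using assms(1) assms(2)[OF x, symmetric] assms(2)[OF Real_Vector_Spaces.subspace_scale[OF V x, of c], symmetric] x
      by (simp add: linear_endo_def)
    show "T (x + y) = T x + T y" if y: "y \<in> V" for y
      using assms(1) assms(2)[OF x, symmetric] assms(2)[OF y, symmetric] assms(2)[OF Real_Vector_Spaces.subspace_add[OF V x y], symmetric] x y
      by (simp add: linear_endo_def)
  qed
  then show ?thesis using assms by (simp add: trace_eq B_in)
qed

lemma linear_endo_compose:
  "linear_endo V S \<Longrightarrow> linear_endo V T \<Longrightarrow> linear_endo V (\<lambda>x. S (T x))"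
  by (simp add: linear_endo_def)

lemma trace_commute:
  assumes S: "linear_endo V S" and T: "linear_endo V T"
  shows "trace_on V (\<lambda>x. S (T x)) = trace_on V (\<lambda>x. T (S x))"
proof -
  let ?r = "Real_Vector_Spaces.representation B"
  have *: "?r (S (T b)) b = (\<Sum>c\<in>B. ?r (T b) c * ?r (S c) b)"
    if "linear_endo V S" "linear_endo V T" "b \<in> B" for S T b
  proof -
    have "T b \<in> V" using that(2,3) B_in by (simp add: linear_endo_def)
    then have "S (T b) = S (\<Sum>c\<in>B. ?r (T b) c *\<^sub>R c)" using expand by simp
    also have "\<dots> = (\<Sum>c\<in>B. ?r (T b) c *\<^sub>R S c)"
      by (rule linear_endo_sum[OF that(1)]) (auto simp: B B_in)
    finally have "S (T b) = (\<Sum>c\<in>B. ?r (T b) c *\<^sub>R S c)" .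
    then have "?r (S (T b)) b = ?r (\<Sum>c\<in>B. ?r (T b) c *\<^sub>R S c) b" by simp
    also have "\<dots> = (\<Sum>c\<in>B. ?r (T b) c * ?r (S c) b)"
      by (rule rep_sum) (use that(1) B B_in in \<open>auto simp: linear_endo_def\<close>)
    finally show ?thesis .
  qed
  have "trace_on V (\<lambda>x. S (T x)) = (\<Sum>b\<in>B. \<Sum>c\<in>B. ?r (T b) c * ?r (S c) b)"
    by (simp add: trace_eq linear_endo_compose S T *)
  also have "\<dots> = (\<Sum>c\<in>B. \<Sum>b\<in>B. ?r (S c) b * ?r (T b) c)"
    by (subst sum.swap) (simp add: mult.commute)
  also have "\<dots> = trace_on V (\<lambda>x. T (S x))"
    by (simp add: trace_eq linear_endo_compose S T *)
  finally show ?thesis .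
qed

lemma trace_linear:
  assumes S: "linear_endo V S" and T: "linear_endo V T"
  shows "trace_on V (\<lambda>x. c *\<^sub>R S x + d *\<^sub>R T x) = c * trace_on V S + d * trace_on V T"
    and "linear_endo V (\<lambda>x. c *\<^sub>R S x + d *\<^sub>R T x)"
proof -
  show L: "linear_endo V (\<lambda>x. c *\<^sub>R S x + d *\<^sub>R T x)"
    using S T V by (auto simp: linear_endo_def algebra_simps
        intro!: Real_Vector_Spaces.subspace_add Real_Vector_Spaces.subspace_scale)
  let ?r = "Real_Vector_Spaces.representation B"
  have "?r (c *\<^sub>R S b + d *\<^sub>R T b) b = c * ?r (S b) b + d * ?r (T b) b" if "b \<in> B" for b
  proof -
    have "S b \<in> Real_Vector_Spaces.span B" "T b \<in> Real_Vector_Spaces.span B"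
      using S T B_in[OF that] B(3) by (auto simp: linear_endo_def)
    then show ?thesis
      by (simp add: Real_Vector_Spaces.representation_add[OF B(2)] Real_Vector_Spaces.representation_scale[OF B(2)]
          Real_Vector_Spaces.span_scale)
  qed
  then show "trace_on V (\<lambda>x. c *\<^sub>R S x + d *\<^sub>R T x) = c * trace_on V S + d * trace_on V T"
    by (simp add: trace_eq L S T sum.distrib sum_distrib_left)
qed

end

section \<open>Symmetric bilinear forms and orthonormal bases\<close>

locale bilinear_form =
  fixes V :: "'v::real_vector set" and \<beta> :: "'v \<Rightarrow> 'v \<Rightarrow> real"
  assumes sub: "Real_Vector_Spaces.subspace V"
    and add: "\<And>x y z. x \<in> V \<Longrightarrow> y \<in> V \<Longrightarrow> z \<in> V \<Longrightarrow> \<beta> (x + y) z = \<beta> x z + \<beta> y z"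
    and scale: "\<And>c x z. x \<in> V \<Longrightarrow> z \<in> V \<Longrightarrow> \<beta> (c *\<^sub>R x) z = c * \<beta> x z"
    and sym: "\<And>x y. x \<in> V \<Longrightarrow> y \<in> V \<Longrightarrow> \<beta> x y = \<beta> y x"
begin

lemma sum:
  assumes "finite I" "\<And>i. i \<in> I \<Longrightarrow> x i \<in> V" "z \<in> V"
  shows "\<beta> (\<Sum>i\<in>I. c i *\<^sub>R x i) z = (\<Sum>i\<in>I. c i * \<beta> (x i) z)"
  using assms(1,2)
proof (induction I)
  case empty
  show ?case using scale[of 0 z 0] Real_Vector_Spaces.subspace_0[OF sub] assms(3) by simp
next
  case (insert i I)
  have "(\<Sum>i\<in>I. c i *\<^sub>R x i) \<in> V" "c i *\<^sub>R x i \<in> V"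
    using insert.prems sub by (auto intro!: Real_Vector_Spaces.subspace_sum Real_Vector_Spaces.subspace_scale)
  then show ?case using insert assms(3) by (simp add: add scale)
qed

definition orthonormal :: "'v set \<Rightarrow> bool" where
  "orthonormal E \<longleftrightarrow> finite E \<and> E \<subseteq> V \<and> (\<forall>x\<in>E. \<forall>y\<in>E. \<beta> x y = (if x = y then 1 else 0))"

lemma orthonormal_coefficient:
  assumes "orthonormal E" "e \<in> E"
  shows "\<beta> (\<Sum>x\<in>E. c x *\<^sub>R x) e = c e"
proof -
  have "\<beta> (\<Sum>x\<in>E. c x *\<^sub>R x) e = (\<Sum>x\<in>E. c x * \<beta> x e)"
    by (rule sum) (use assms in \<open>auto simp: orthonormal_def\<close>)
  also have "\<dots> = (\<Sum>x\<in>E. c x * (if x = e then 1 else 0))"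
    by (rule sum.cong) (use assms in \<open>auto simp: orthonormal_def\<close>)
  also have "\<dots> = c e" using assms by (simp add: orthonormal_def if_distrib[of "\<lambda>z. _ * z"] cong: if_cong)
  finally show ?thesis .
qed

lemma orthonormal_expand:
  assumes E: "orthonormal E" "Real_Vector_Spaces.span E = V" and x: "x \<in> V"
  shows "x = (\<Sum>e\<in>E. \<beta> x e *\<^sub>R e)"
proof -
  have fin: "finite E" using E(1) by (simp add: orthonormal_def)
  from x E(2) obtain u where u: "x = (\<Sum>e\<in>E. u e *\<^sub>R e)"
    by (auto simp: Real_Vector_Spaces.span_finite[OF fin])
  have "\<beta> x e = u e" if "e \<in> E" for e unfolding u by (rule orthonormal_coefficient[OF E(1) that])
  then show ?thesis using u by simp
qed

lemma orthonormal_parseval: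
  assumes E: "orthonormal E" "Real_Vector_Spaces.span E = V" and x: "x \<in> V" and y: "y \<in> V"
  shows "\<beta> x y = (\<Sum>e\<in>E. \<beta> x e * \<beta> y e)"
proof -
  have EV: "E \<subseteq> V" "finite E" using E(1) by (auto simp: orthonormal_def)
  have "\<beta> x y = \<beta> (\<Sum>e\<in>E. \<beta> x e *\<^sub>R e) y" using orthonormal_expand[OF E x] by simp
  also have "\<dots> = (\<Sum>e\<in>E. \<beta> x e * \<beta> e y)" by (rule sum) (use EV y in auto)
  also have "\<dots> = (\<Sum>e\<in>E. \<beta> x e * \<beta> y e)" by (rule sum.cong) (use EV y sym in auto)
  finally show ?thesis .
qed

lemma orthonormal_independent:
  assumes E: "orthonormal E"
  shows "Real_Vector_Spaces.independent E"
proof -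
  have fin: "finite E" and EV: "E \<subseteq> V" using E by (auto simp: orthonormal_def)
  have "u e = 0" if "(\<Sum>x\<in>E. u x *\<^sub>R x) = 0" "e \<in> E" for u e
  proof -
    have "u e = \<beta> 0 e" using orthonormal_coefficient[OF E that(2), of u] that(1) by simp
    also have "\<dots> = 0" using scale[of 0 e 0] Real_Vector_Spaces.subspace_0[OF sub] EV that(2) by auto
    finally show ?thesis .
  qed
  then show ?thesis using Real_Vector_Spaces.dependent_finite[OF fin] by blast
qed

lemma trace_orthonormal:
  assumes E: "orthonormal E" "Real_Vector_Spaces.span E = V" and T: "linear_endo V T"
  shows "trace_on V T = (\<Sum>e\<in>E. \<beta> (T e) e)"
proof -
  have EV: "E \<subseteq> V" "finite E" using E(1) by (auto simp: orthonormal_def)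
  interpret finite_dim_space V E
    by unfold_locales (use EV E orthonormal_independent in auto)
  have "Real_Vector_Spaces.representation E (T e) e = \<beta> (T e) e" if e: "e \<in> E" for e
  proof -
    have TV: "T e \<in> V" using T B_in[OF e] by (simp add: linear_endo_def)
    have "\<beta> (T e) e = \<beta> (\<Sum>b\<in>E. Real_Vector_Spaces.representation E (T e) b *\<^sub>R b) e"
      using expand[OF TV] by simp
    then show ?thesis using orthonormal_coefficient[OF E(1) e] by simp
  qed
  then show ?thesis by (simp add: trace_eq[OF T])
qed

text \<open>A vector already in the span leaves the residual \<open>0\<close> and is dropped, so an
  arbitrary finite spanning set can serve as input.\<close>

lemma gram_schmidt:
  assumes pos: "\<And>x. x \<in> V \<Longrightarrow> x \<noteq> 0 \<Longrightarrow> \<beta> x x > 0"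
    and "finite S" "S \<subseteq> V"
  shows "\<exists>E. orthonormal E \<and> Real_Vector_Spaces.span E = Real_Vector_Spaces.span S"
  using assms(2,3)
proof (induction S)
  case empty
  show ?case by (rule exI[of _ "{}"]) (simp add: orthonormal_def)
next
  case (insert s S)
  then obtain E where E: "orthonormal E" "Real_Vector_Spaces.span E = Real_Vector_Spaces.span S" by auto
  have EV: "E \<subseteq> V" "finite E" and s: "s \<in> V" using E(1) insert.prems by (auto simp: orthonormal_def)
  define p where "p = (\<Sum>e\<in>E. \<beta> s e *\<^sub>R e)"
  define t where "t = s - p"
  have pE: "p \<in> Real_Vector_Spaces.span E" unfolding p_def
    by (intro Real_Vector_Spaces.span_sum Real_Vector_Spaces.span_scale Real_Vector_Spaces.span_base)
  have pV: "p \<in> V" unfolding p_def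
    using EV by (intro Real_Vector_Spaces.subspace_sum[OF sub] Real_Vector_Spaces.subspace_scale[OF sub]) auto
  then have tV: "t \<in> V" using s by (simp add: t_def Real_Vector_Spaces.subspace_diff[OF sub])
  have orth: "\<beta> t e = 0" if "e \<in> E" for e
  proof -
    have eV: "e \<in> V" using EV that by auto
    have "\<beta> t e = \<beta> (s + (-1) *\<^sub>R p) e" by (simp add: t_def)
    also have "\<dots> = \<beta> s e - \<beta> p e"
      using s pV eV by (simp only: add scale Real_Vector_Spaces.subspace_scale[OF sub])
    also have "\<beta> p e = \<beta> s e" unfolding p_def by (rule orthonormal_coefficient[OF E(1) that])
    finally show ?thesis by simp
  qed
  have span_s: "Real_Vector_Spaces.span (insert s S) = Real_Vector_Spaces.span (insert s E)"
    by (metis E(2) Real_Vector_Spaces.span_insert)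
  show ?case
  proof (cases "t = 0")
    case True
    then have "s \<in> Real_Vector_Spaces.span E" using pE by (simp add: t_def)
    then have "Real_Vector_Spaces.span (insert s E) = Real_Vector_Spaces.span E"
      by (rule Real_Vector_Spaces.span_redundant)
    with E(1) span_s show ?thesis by auto
  next
    case False
    define n where "n = (1 / sqrt (\<beta> t t)) *\<^sub>R t"
    have tt: "\<beta> t t > 0" by (rule pos[OF tV False])
    have nV: "n \<in> V" unfolding n_def by (rule Real_Vector_Spaces.subspace_scale[OF sub tV])
    have bn: "\<beta> n x = (1 / sqrt (\<beta> t t)) * \<beta> t x" if "x \<in> V" for x
      unfolding n_def by (rule scale[OF tV that])
    have nn: "\<beta> n n = 1"
    proof -
      have "\<beta> n n = (1 / sqrt (\<beta> t t)) * ((1 / sqrt (\<beta> t t)) * \<beta> t t)"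
        using bn[OF nV] bn[OF tV] sym[OF tV nV] by simp
      then show ?thesis using tt by (simp add: field_simps real_sqrt_mult_self flip: power2_eq_square)
    qed
    have ne: "\<beta> n e = 0" "\<beta> e n = 0" if "e \<in> E" for e
    proof -
      have eV: "e \<in> V" using EV that by auto
      show "\<beta> n e = 0" using bn[OF eV] orth[OF that] by simp
      then show "\<beta> e n = 0" using sym[OF nV eV] by simp
    qed
    have nE: "n \<notin> E" using ne(1) nn by force
    have "orthonormal (insert n E)"
      using E(1) nV nn ne nE unfolding orthonormal_def by auto
    moreover have "Real_Vector_Spaces.span (insert n E) = Real_Vector_Spaces.span (insert s E)"
    proof
      have "n \<in> Real_Vector_Spaces.span (insert s E)"
      proof -
        have "p \<in> Real_Vector_Spaces.span (insert s E)"
          using pE Real_Vector_Spaces.span_mono[of E "insert s E"] by blast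
        then show ?thesis unfolding n_def t_def
          by (intro Real_Vector_Spaces.span_scale Real_Vector_Spaces.span_diff)
            (auto intro: Real_Vector_Spaces.span_base)
      qed
      then show "Real_Vector_Spaces.span (insert n E) \<subseteq> Real_Vector_Spaces.span (insert s E)"
        by (intro Real_Vector_Spaces.span_minimal) (auto intro: Real_Vector_Spaces.span_base)
      have "s \<in> Real_Vector_Spaces.span (insert n E)"
      proof -
        have "s = sqrt (\<beta> t t) *\<^sub>R n + p" using tt by (simp add: n_def t_def)
        moreover have "p \<in> Real_Vector_Spaces.span (insert n E)"
          using pE Real_Vector_Spaces.span_mono[of E "insert n E"] by blast
        ultimately show ?thesis
          by (metis Real_Vector_Spaces.span_add Real_Vector_Spaces.span_base Real_Vector_Spaces.span_scale insertI1)
      qed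
      then show "Real_Vector_Spaces.span (insert s E) \<subseteq> Real_Vector_Spaces.span (insert n E)"
        by (intro Real_Vector_Spaces.span_minimal) (auto intro: Real_Vector_Spaces.span_base)
    qed
    ultimately show ?thesis using span_s by auto
  qed
qed

end

section \<open>The Killing form and the Laplacian\<close>

lemma sum_apply: "(\<Sum>i\<in>I. f i) x = (\<Sum>i\<in>I. f i x)" for f :: "'i \<Rightarrow> 'a \<Rightarrow> 'b::comm_monoid_add"
  by (induction I rule: infinite_finite_induct) auto

lemma frechet_derivative_linear_combination:
  fixes u :: "'i \<Rightarrow> 'a::real_normed_vector \<Rightarrow> real"
  assumes "\<And>i. i \<in> I \<Longrightarrow> u i differentiable (at z)"
  shows "frechet_derivative (\<lambda>z. \<Sum>i\<in>I. c i * u i z) (at z) v = (\<Sum>i\<in>I. c i * frechet_derivative (u i) (at z) v)"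
proof -
  have d: "(u i has_derivative frechet_derivative (u i) (at z)) (at z)" if "i \<in> I" for i
    by (rule frechet_derivative_works[THEN iffD1, OF assms[OF that]])
  have "((\<lambda>z. \<Sum>i\<in>I. c i * u i z) has_derivative (\<lambda>v. \<Sum>i\<in>I. c i * frechet_derivative (u i) (at z) v)) (at z)"
    by (intro has_derivative_sum has_derivative_mult_right d)
  from fun_cong[OF frechet_derivative_at[OF this], of v] show ?thesis by simp
qed

text \<open>Differentiating in one factor is a derivative of \<open>h\<close> in the direction
  \<open>(b, 0)\<close> or \<open>(0, c)\<close> of the product space, where the symmetry of second
  derivatives applies.\<close>

lemma mixed_sections:
  fixes h :: "'a::real_normed_vector \<times> 'b::real_normed_vector \<Rightarrow> real"
  assumes h: "smooth_on (S \<times> T) h" and S: "open S" "y \<in> S" and T: "open T" "z \<in> T"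
  shows "(\<lambda>z. frechet_derivative (\<lambda>y. h (y, z)) (at y) b) differentiable (at z)"
    and "(\<lambda>y. frechet_derivative (\<lambda>z. h (y, z)) (at z) c) differentiable (at y)"
    and "frechet_derivative (\<lambda>z. frechet_derivative (\<lambda>y. h (y, z)) (at y) b) (at z) c =
      frechet_derivative (\<lambda>y. frechet_derivative (\<lambda>z. h (y, z)) (at z) c) (at y) b"
proof -
  let ?b = "\<lambda>p. frechet_derivative h (at p) (b, 0)" and ?c = "\<lambda>p. frechet_derivative h (at p) (0, c)"
  have d: "h differentiable (at (y, z))" if "y \<in> S" "z \<in> T" for y z
    by (rule smooth_on_differentiable[OF h]) (use that in simp)
  have db: "?b differentiable (at (y, z))" and dc: "?c differentiable (at (y, z))"
    by (rule smooth_on_differentiable[OF smooth_on_frechet_derivative[OF h]], use S T in simp)+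
  have eb: "?b (y, z) = frechet_derivative (\<lambda>y. h (y, z)) (at y) b" if "z \<in> T" for z
    using frechet_derivative_section(2)[OF d[OF S(2) that]] by simp
  have ec: "?c (y, z) = frechet_derivative (\<lambda>z. h (y, z)) (at z) c" if "y \<in> S" for y
    using frechet_derivative_section2(2)[OF d[OF that T(2)]] by simp
  have sb: "(\<lambda>z. ?b (y, z)) differentiable (at z)" by (rule frechet_derivative_section2(1)[OF db])
  have sc: "(\<lambda>y. ?c (y, z)) differentiable (at y)" by (rule frechet_derivative_section(1)[OF dc])
  have "((\<lambda>z. ?b (y, z)) has_derivative frechet_derivative (\<lambda>z. ?b (y, z)) (at z)) (at z)"
    using sb frechet_derivative_works by blast
  from has_derivative_transform_within_open[OF this T(1) T(2)] eb
  have 1: "((\<lambda>z. frechet_derivative (\<lambda>y. h (y, z)) (at y) b) has_derivative frechet_derivative (\<lambda>z. ?b (y, z)) (at z)) (at z)"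
    by simp
  have "((\<lambda>y. ?c (y, z)) has_derivative frechet_derivative (\<lambda>y. ?c (y, z)) (at y)) (at y)"
    using sc frechet_derivative_works by blast
  from has_derivative_transform_within_open[OF this S(1) S(2)] ec
  have 2: "((\<lambda>y. frechet_derivative (\<lambda>z. h (y, z)) (at z) c) has_derivative frechet_derivative (\<lambda>y. ?c (y, z)) (at y)) (at y)"
    by simp
  show "(\<lambda>z. frechet_derivative (\<lambda>y. h (y, z)) (at y) b) differentiable (at z)" by (rule differentiableI[OF 1])
  show "(\<lambda>y. frechet_derivative (\<lambda>z. h (y, z)) (at z) c) differentiable (at y)" by (rule differentiableI[OF 2])
  have "frechet_derivative (\<lambda>z. frechet_derivative (\<lambda>y. h (y, z)) (at y) b) (at z) c = frechet_derivative ?b (at (y, z)) (0, c)"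
    using frechet_derivative_at[OF 1] frechet_derivative_section2(2)[OF db, of c] by simp
  also have "\<dots> = frechet_derivative ?c (at (y, z)) (b, 0)"
    by (rule second_derivative_symmetric[OF h open_Times[OF S(1) T(1)]]) (use S T in simp)
  also have "\<dots> = frechet_derivative (\<lambda>y. frechet_derivative (\<lambda>z. h (y, z)) (at z) c) (at y) b"
    using frechet_derivative_at[OF 2] frechet_derivative_section(2)[OF dc, of b] by simp
  finally show "frechet_derivative (\<lambda>z. frechet_derivative (\<lambda>y. h (y, z)) (at y) b) (at z) c =
      frechet_derivative (\<lambda>y. frechet_derivative (\<lambda>z. h (y, z)) (at z) c) (at y) b" .
qed

context lie
begin

section \<open>Brackets and the Killing form\<close>

lemma L_smooth_all: "X \<in> L \<Longrightarrow> X f \<in> C"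
  by (cases "f \<in> C") (auto simp: L_smooth L_nonsmooth)

lemma L_zero: "0 \<in> L" and L_plus: "X \<in> L \<Longrightarrow> Y \<in> L \<Longrightarrow> X + Y \<in> L" and L_scaleR: "X \<in> L \<Longrightarrow> c *\<^sub>R X \<in> L"
  and L_sum_in: "(\<And>i. i \<in> I \<Longrightarrow> D i \<in> L) \<Longrightarrow> (\<Sum>i\<in>I. D i) \<in> L"
  using L_subspace by (auto simp: Real_Vector_Spaces.subspace_0 Real_Vector_Spaces.subspace_add
      Real_Vector_Spaces.subspace_scale Real_Vector_Spaces.subspace_sum)

lemma bracket_self [simp]: "bracket X X = 0"
  by (intro ext) (simp add: bracket_def)

lemma bracket_swap: "bracket X Y = - bracket Y X"
  by (intro ext) (simp add: bracket_def)

lemma bracket_add: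
  assumes "X \<in> L" "Y \<in> L" "Z \<in> L"
  shows "bracket X (Y + Z) = bracket X Y + bracket X Z"
proof (intro ext)
  fix f x
  have "X (\<lambda>x. Y f x + Z f x) = (\<lambda>x. X (Y f) x + X (Z f) x)"
    by (rule L_add[OF assms(1)]) (auto intro: L_smooth_all assms)
  then show "bracket X (Y + Z) f x = (bracket X Y + bracket X Z) f x"
    by (simp add: bracket_apply plus_fun_def)
qed

lemma bracket_scaleR:
  assumes "X \<in> L" "Y \<in> L"
  shows "bracket X (c *\<^sub>R Y) = c *\<^sub>R bracket X Y"
proof (intro ext)
  fix f x
  have "X (\<lambda>x. c * Y f x) = (\<lambda>x. c * X (Y f) x)"
    by (rule L_scale[OF assms(1)]) (auto intro: L_smooth_all assms)
  then show "bracket X (c *\<^sub>R Y) f x = (c *\<^sub>R bracket X Y) f x"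
    by (simp add: bracket_apply scaleR_fun_def right_diff_distrib)
qed

lemma bracket_add_left:
  assumes "X \<in> L" "Y \<in> L" "Z \<in> L"
  shows "bracket (X + Y) Z = bracket X Z + bracket Y Z"
  using bracket_add[OF assms(3,1,2)] by (simp add: bracket_swap[of "X + Y"] bracket_swap[of X] bracket_swap[of Y])

lemma bracket_scaleR_left:
  assumes "X \<in> L" "Y \<in> L"
  shows "bracket (c *\<^sub>R X) Y = c *\<^sub>R bracket X Y"
  using bracket_scaleR[OF assms(2,1), of c] by (simp add: bracket_swap[of "c *\<^sub>R X"] bracket_swap[of X])

lemma jacobi:
  assumes "X \<in> L" "Y \<in> L" "Z \<in> L"
  shows "bracket X (bracket Y Z) = bracket (bracket X Y) Z + bracket Y (bracket X Z)"
proof (intro ext)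
  have d: "X (bracket Y Z f) = (\<lambda>x. X (Y (Z f)) x - X (Z (Y f)) x)" if "X \<in> L" "Y \<in> L" "Z \<in> L" for X Y Z f
  proof -
    have "bracket Y Z f = (\<lambda>x. Y (Z f) x - Z (Y f) x)" by (rule ext) (rule bracket_apply)
    then show ?thesis using L_diff[OF that(1), of "Y (Z f)" "Z (Y f)"] that by (simp add: L_smooth_all)
  qed
  fix f x
  show "bracket X (bracket Y Z) f x = (bracket (bracket X Y) Z + bracket Y (bracket X Z)) f x"
    using assms by (simp add: bracket_apply d)
qed

lemma ad_endo: "X \<in> L \<Longrightarrow> linear_endo L (bracket X)"
  by (simp add: linear_endo_def bracket_L bracket_add bracket_scaleR)

abbreviation K where "K \<equiv> killing_form G"

definition lie_basis where "lie_basis = (SOME B. finite B \<and> Real_Vector_Spaces.independent B \<and> Real_Vector_Spaces.span B = L)"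

sublocale F: finite_dim_space L lie_basis
proof
  have "\<exists>B. finite B \<and> Real_Vector_Spaces.independent B \<and> Real_Vector_Spaces.span B = L"
  proof -
    obtain B0 where "finite B0" "Real_Vector_Spaces.independent B0" "Real_Vector_Spaces.span B0 = L"
      by (rule L_finite_dim)
    then show ?thesis by (intro exI[of _ B0] conjI)
  qed
  from someI_ex[OF this]
  show "finite lie_basis" "Real_Vector_Spaces.independent lie_basis" "Real_Vector_Spaces.span lie_basis = L"
    unfolding lie_basis_def by auto
qed

lemma ad_ad_endo: "X \<in> L \<Longrightarrow> Y \<in> L \<Longrightarrow> linear_endo L (\<lambda>Z. bracket X (bracket Y Z))"
  by (rule F.linear_endo_compose[OF ad_endo ad_endo])

lemma K_form: "bilinear_form L K"
proof
  show "Real_Vector_Spaces.subspace L" by (rule L_subspace)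
  fix X Y assume X: "X \<in> L" and Y: "Y \<in> L"
  show "K X Y = K Y X"
    unfolding killing_form_def by (rule F.trace_commute[OF ad_endo ad_endo]) (use X Y in auto)
  show "K (c *\<^sub>R X) Y = c * K X Y" for c
  proof -
    have "K (c *\<^sub>R X) Y = trace_on L (\<lambda>Z. c *\<^sub>R bracket X (bracket Y Z) + 0 *\<^sub>R bracket X (bracket Y Z))"
      unfolding killing_form_def
      by (rule F.trace_cong[OF F.trace_linear(2)[OF ad_ad_endo[OF X Y] ad_ad_endo[OF X Y]]])
        (simp add: bracket_scaleR_left bracket_L X Y)
    then show ?thesis using F.trace_linear(1)[OF ad_ad_endo[OF X Y] ad_ad_endo[OF X Y], of c 0]
      by (simp add: killing_form_def)
  qed
  fix Z assume Z: "Z \<in> L"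
  have "K (X + Y) Z = trace_on L (\<lambda>W. 1 *\<^sub>R bracket X (bracket Z W) + 1 *\<^sub>R bracket Y (bracket Z W))"
    unfolding killing_form_def
    by (rule F.trace_cong[OF F.trace_linear(2)[OF ad_ad_endo[OF X Z] ad_ad_endo[OF Y Z]]])
      (simp add: bracket_add_left bracket_L X Y Z)
  then show "K (X + Y) Z = K X Z + K Y Z"
    using F.trace_linear(1)[OF ad_ad_endo[OF X Z] ad_ad_endo[OF Y Z], of 1 1]
    by (simp add: killing_form_def)
qed

text \<open>By the Jacobi identity \<open>ad [Z, X]\<close> is the commutator of \<open>ad Z\<close>
  and \<open>ad X\<close>; the two resulting traces cancel by cyclicity. This is what makes the
  connection term of the Laplacian vanish.\<close>

lemma K_bracket:
  assumes X: "X \<in> L" and Z: "Z \<in> L"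
  shows "K (bracket Z X) X = 0"
proof -
  note Zx = ad_endo[OF Z] and Xx = ad_endo[OF X]
  note XX = ad_ad_endo[OF X X] and ZX = ad_ad_endo[OF Z X]
  note e1 = F.linear_endo_compose[OF Zx XX] and e2 = F.linear_endo_compose[OF Xx ZX]
  have "K (bracket Z X) X = trace_on L (\<lambda>W. 1 *\<^sub>R bracket Z (bracket X (bracket X W)) + (-1) *\<^sub>R bracket X (bracket Z (bracket X W)))"
    unfolding killing_form_def
  proof (rule F.trace_cong[OF F.trace_linear(2)[OF e1 e2]])
    fix W assume W: "W \<in> L"
    show "1 *\<^sub>R bracket Z (bracket X (bracket X W)) + (-1) *\<^sub>R bracket X (bracket Z (bracket X W)) =
        bracket (bracket Z X) (bracket X W)"
      using jacobi[OF Z X bracket_L[OF X W]] by simp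
  qed
  also have "\<dots> = 1 * trace_on L (\<lambda>W. bracket Z (bracket X (bracket X W))) + (-1) * trace_on L (\<lambda>W. bracket X (bracket Z (bracket X W)))"
    by (rule F.trace_linear(1)[OF e1 e2])
  also have "trace_on L (\<lambda>W. bracket X (bracket Z (bracket X W))) = trace_on L (\<lambda>W. bracket Z (bracket X (bracket X W)))"
    by (rule F.trace_commute[OF Xx ZX])
  finally show ?thesis by simp
qed

text \<open>In the usual notation this is \<open>Ad (g\<^sup>-\<^sup>1)\<close>; hence \<open>Ad g \<circ> Ad h = Ad (h g)\<close> below.\<close>

definition Ad :: "'g \<Rightarrow> (('g \<Rightarrow> real) \<Rightarrow> ('g \<Rightarrow> real)) \<Rightarrow> (('g \<Rightarrow> real) \<Rightarrow> ('g \<Rightarrow> real))" where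
  "Ad g X = (\<lambda>f h. X (\<lambda>k. f (k \<cdot> g)) (h \<cdot> iv g))"

lemma Ad_L:
  assumes X: "X \<in> L"
  shows "Ad g X \<in> L"
proof (rule LI)
  fix f
  show "Ad g X f = (\<lambda>x. 0)" if "f \<notin> C"
  proof -
    have "(\<lambda>k. f (k \<cdot> g)) \<notin> C" using C_right[of "\<lambda>k. f (k \<cdot> g)" "iv g"] that by auto
    then show ?thesis by (simp add: Ad_def L_nonsmooth[OF X])
  qed
  assume f: "f \<in> C"
  note f' = C_right[OF f, of g]
  show "Ad g X f \<in> C" unfolding Ad_def by (rule C_right[OF L_smooth[OF X f']])
  show "Ad g X (\<lambda>h. f (a \<cdot> h)) = (\<lambda>h. Ad g X f (a \<cdot> h))" for a
    using L_left[OF X f', of a] by (simp add: Ad_def)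
  show "Ad g X (\<lambda>x. c * f x) = (\<lambda>x. c * Ad g X f x)" for c
    using L_scale[OF X f', of c] by (simp add: Ad_def)
  fix f2 assume f2: "f2 \<in> C"
  note f2' = C_right[OF f2, of g]
  show "Ad g X (\<lambda>x. f x + f2 x) = (\<lambda>x. Ad g X f x + Ad g X f2 x)"
    using L_add[OF X f' f2'] by (simp add: Ad_def)
  show "Ad g X (\<lambda>x. f x * f2 x) = (\<lambda>x. Ad g X f x * f2 x + f x * Ad g X f2 x)"
    using L_mult[OF X f' f2'] by (simp add: Ad_def)
qed

lemma Ad_Ad: "Ad g (Ad h X) = Ad (h \<cdot> g) X"
  by (simp add: Ad_def)

lemma Ad_un [simp]: "Ad un X = X"
  by (simp add: Ad_def)

lemma Ad_add: "Ad g (X + Y) = Ad g X + Ad g Y"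
  by (intro ext) (simp add: Ad_def)

lemma Ad_scaleR: "Ad g (c *\<^sub>R X) = c *\<^sub>R Ad g X"
  by (intro ext) (simp add: Ad_def scaleR_fun_def)

lemma Ad_bracket: "Ad g (bracket X Y) = bracket (Ad g X) (Ad g Y)"
  by (intro ext) (simp add: Ad_def bracket_def)

lemma Ad_endo: "linear_endo L (Ad g)"
  by (simp add: linear_endo_def Ad_L Ad_add Ad_scaleR)

text \<open>\<open>Ad g\<close> is an automorphism of the Lie algebra, so it conjugates
  \<open>ad X\<close> to \<open>ad (Ad g X)\<close>, and traces are invariant under
  conjugation.\<close>

lemma K_Ad:
  assumes X: "X \<in> L" and Y: "Y \<in> L"
  shows "K (Ad g X) (Ad g Y) = K X Y"
proof -
  note T = F.linear_endo_compose[OF ad_ad_endo[OF X Y] Ad_endo[of "iv g"]]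
  have "K (Ad g X) (Ad g Y) = trace_on L (\<lambda>Z. Ad g (bracket X (bracket Y (Ad (iv g) Z))))"
    unfolding killing_form_def
  proof (rule F.trace_cong[OF F.linear_endo_compose[OF Ad_endo T]])
    fix Z assume "Z \<in> L"
    show "Ad g (bracket X (bracket Y (Ad (iv g) Z))) = bracket (Ad g X) (bracket (Ad g Y) Z)"
      by (simp add: Ad_bracket Ad_Ad)
  qed
  also have "\<dots> = trace_on L (\<lambda>Z. bracket X (bracket Y (Ad (iv g) (Ad g Z))))"
    by (rule F.trace_commute[OF Ad_endo T])
  also have "\<dots> = K X Y" by (simp add: Ad_Ad killing_form_def)
  finally show ?thesis .
qed

lemma C2_swap: "Q \<in> C2 \<Longrightarrow> (\<lambda>x y. Q y x) \<in> C2"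
proof -
  assume "Q \<in> C2"
  then have Q: "smooth_map (prod_atlas A A) euclidean_atlas (\<lambda>(x, y). Q x y)" by (simp add: C2_def)
  note P = smooth_atlas_prod[OF A A]
  have "smooth_map (prod_atlas A A) euclidean_atlas (\<lambda>p. (\<lambda>(x, y). Q x y) (snd p, fst p))"
    by (rule smooth_map_compose[OF P P smooth_atlas_euclidean _ Q])
      (intro smooth_map_Pair P A smooth_map_fst smooth_map_snd)
  then show ?thesis by (simp add: C2_def case_prod_unfold)
qed

end

section \<open>An inner product invariant under the adjoint action\<close>

locale lie_coordinates = compact_lie G
  for G :: "('g::{t2_space, second_countable_topology}, 'e::euclidean_space) lie_structure" +
  fixes U \<phi> F
  assumes U: "(U, \<phi>) \<in> atlas G" "\<one>\<^bsub>G\<^esub> \<in> U"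
    and F: "\<And>b. b \<in> Basis \<Longrightarrow> F b \<in> smooth_functions G"
    and expand_X: "\<And>X f. X \<in> lie_algebra G \<Longrightarrow> f \<in> smooth_functions G \<Longrightarrow> X f \<one>\<^bsub>G\<^esub> =
      (\<Sum>b\<in>Basis. X (F b) \<one>\<^bsub>G\<^esub> * frechet_derivative (\<lambda>y. f (inv_into U \<phi> y)) (at (\<phi> \<one>\<^bsub>G\<^esub>)) b)"
begin

lemma y0: "\<phi> un \<in> \<phi> ` U" using U(2) by blast

lemmas cU = smooth_atlas_chart[OF A U(1)]

text \<open>At the identity \<open>X\<close> is a fixed linear combination of partial derivatives in
  the first variable, and these depend smoothly on the second.\<close>

lemma param_smooth:
  assumes Q: "Q \<in> C2" and X: "X \<in> L"
  shows "(\<lambda>g. X (\<lambda>h. Q h g) un) \<in> C"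
proof (rule smoothI)
  fix V \<psi> assume V: "(V, \<psi>) \<in> A"
  note cV = smooth_atlas_chart[OF A V]
  define h where "h p = Q (inv_into U \<phi> (fst p)) (inv_into V \<psi> (snd p))" for p
  have op: "open (\<phi> ` U \<times> \<psi> ` V)" by (rule open_Times[OF cU(2) cV(2)])
  have h: "smooth_on (\<phi> ` U \<times> \<psi> ` V) h" unfolding h_def by (rule C2_chart[OF Q U(1) V])
  have "smooth_on (\<psi> ` V) (\<lambda>z. frechet_derivative h (at (\<phi> un, z)) (b, 0))" for b
  proof (rule smooth_on_compose[OF cV(2) op _ smooth_on_frechet_derivative[OF h], where f = "\<lambda>z. (\<phi> un, z)"])
    show "smooth_on (\<psi> ` V) (\<lambda>z. (\<phi> un, z))"
      by (intro smooth_on_Pair cV(2) smooth_on_const smooth_on_id)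
  qed (use y0 in auto)
  then have "smooth_on (\<psi> ` V) (\<lambda>z. \<Sum>b\<in>Basis. X (F b) un * frechet_derivative h (at (\<phi> un, z)) (b, 0))"
    by (intro smooth_on_sum smooth_on_mult cV(2) smooth_on_const)
  then show "smooth_on (\<psi> ` V) (\<lambda>z. X (\<lambda>h. Q h (inv_into V \<psi> z)) un)"
  proof (rule smooth_on_cong[THEN iffD1, OF cV(2), rotated])
    fix z assume z: "z \<in> \<psi> ` V"
    have "h differentiable (at (\<phi> un, z))" by (rule smooth_on_differentiable[OF h]) (use z y0 in simp)
    from frechet_derivative_section(2)[OF this]
    show "(\<Sum>b\<in>Basis. X (F b) un * frechet_derivative h (at (\<phi> un, z)) (b, 0)) = X (\<lambda>h. Q h (inv_into V \<psi> z)) un"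
      using expand_X[OF X C2_section1[OF Q, of "inv_into V \<psi> z"]] by (simp add: h_def)
  qed
qed

text \<open>Expanding both derivations in coordinates leaves mixed second partial derivatives taken
  in opposite orders, which \<open>mixed_sections\<close> identifies.\<close>

lemma derivations_commute:
  assumes Q: "Q \<in> C2" and X: "X \<in> L" and Z: "Z \<in> L"
  shows "Z (\<lambda>g. X (\<lambda>h. Q h g) un) un = X (\<lambda>h. Z (\<lambda>g. Q h g) un) un"
proof -
  define h where "h p = Q (inv_into U \<phi> (fst p)) (inv_into U \<phi> (snd p))" for p
  have h: "smooth_on (\<phi> ` U \<times> \<phi> ` U) h" unfolding h_def by (rule C2_chart[OF Q U(1) U(1)])
  note mix = mixed_sections[OF h cU(2) y0 cU(2) y0]
  have "Z (\<lambda>g. X (\<lambda>h. Q h g) un) un =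
      (\<Sum>c\<in>Basis. Z (F c) un * frechet_derivative (\<lambda>z. X (\<lambda>h. Q h (inv_into U \<phi> z)) un) (at (\<phi> un)) c)"
    by (rule expand_X[OF Z param_smooth[OF Q X]])
  also have "(\<lambda>z. X (\<lambda>h. Q h (inv_into U \<phi> z)) un) =
      (\<lambda>z. \<Sum>b\<in>Basis. X (F b) un * frechet_derivative (\<lambda>y. h (y, z)) (at (\<phi> un)) b)"
    by (rule ext) (use expand_X[OF X C2_section1[OF Q]] in \<open>simp add: h_def\<close>)
  finally have l: "Z (\<lambda>g. X (\<lambda>h. Q h g) un) un = (\<Sum>c\<in>Basis. \<Sum>b\<in>Basis. Z (F c) un * (X (F b) un *
      frechet_derivative (\<lambda>z. frechet_derivative (\<lambda>y. h (y, z)) (at (\<phi> un)) b) (at (\<phi> un)) c))"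
    by (simp add: frechet_derivative_linear_combination[OF mix(1)] sum_distrib_left)
  have "X (\<lambda>h. Z (\<lambda>g. Q h g) un) un =
      (\<Sum>b\<in>Basis. X (F b) un * frechet_derivative (\<lambda>y. Z (\<lambda>g. Q (inv_into U \<phi> y) g) un) (at (\<phi> un)) b)"
    by (rule expand_X[OF X param_smooth[OF C2_swap[OF Q] Z]])
  also have "(\<lambda>y. Z (\<lambda>g. Q (inv_into U \<phi> y) g) un) =
      (\<lambda>y. \<Sum>c\<in>Basis. Z (F c) un * frechet_derivative (\<lambda>z. h (y, z)) (at (\<phi> un)) c)"
    by (rule ext) (use expand_X[OF Z C2_section2[OF Q]] in \<open>simp add: h_def\<close>)
  finally have r: "X (\<lambda>h. Z (\<lambda>g. Q h g) un) un = (\<Sum>b\<in>Basis. \<Sum>c\<in>Basis. X (F b) un * (Z (F c) un *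
      frechet_derivative (\<lambda>y. frechet_derivative (\<lambda>z. h (y, z)) (at (\<phi> un)) c) (at (\<phi> un)) b))"
    by (simp add: frechet_derivative_linear_combination[OF mix(2)] sum_distrib_left)
  show ?thesis unfolding l r mix(3) by (subst sum.swap) (simp add: mult_ac)
qed

text \<open>The values \<open>X (F b) un\<close> determine \<open>X\<close>; here these coordinates
  are followed along the orbit of \<open>X\<close> under the adjoint action.\<close>

definition coord :: "'e \<Rightarrow> (('g \<Rightarrow> real) \<Rightarrow> ('g \<Rightarrow> real)) \<Rightarrow> 'g \<Rightarrow> real" where
  "coord b X g = Ad g X (F b) un"

lemma coord_eq: "X \<in> L \<Longrightarrow> b \<in> Basis \<Longrightarrow> coord b X g = X (\<lambda>k. F b (iv g \<cdot> (k \<cdot> g))) un"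
  using L_at_un[OF _ C_right[OF F], of X b g "iv g"] by (simp add: coord_def Ad_def)

lemma coord_smooth: "X \<in> L \<Longrightarrow> b \<in> Basis \<Longrightarrow> coord b X \<in> C"
  using param_smooth[OF C2_conj[OF F], of b X] coord_eq[of X b] by (metis (no_types, lifting) ext)

lemmas coord_cont = smooth_continuous[OF coord_smooth]

lemma coord_add: "coord b (X + Y) g = coord b X g + coord b Y g"
  and coord_scaleR: "coord b (c *\<^sub>R X) g = c * coord b X g"
  by (simp_all only: coord_def Ad_add Ad_scaleR) (simp_all add: scaleR_fun_def)

text \<open>Weyl's unitarian trick for the adjoint representation: the coordinate inner product,
  averaged over the group.\<close>

definition form :: "(('g \<Rightarrow> real) \<Rightarrow> ('g \<Rightarrow> real)) \<Rightarrow> (('g \<Rightarrow> real) \<Rightarrow> ('g \<Rightarrow> real)) \<Rightarrow> real" where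
  "form X Y = H.mean (\<lambda>g. \<Sum>b\<in>Basis. coord b X g * coord b Y g)"

lemma form_cont: "X \<in> L \<Longrightarrow> Y \<in> L \<Longrightarrow> continuous_on UNIV (\<lambda>g. \<Sum>b\<in>Basis. coord b X g * coord b Y g)"
  by (intro continuous_on_sum continuous_on_mult coord_cont)

sublocale B: bilinear_form L form
proof
  show "Real_Vector_Spaces.subspace L" by (rule L_subspace)
  show "form X Y = form Y X" for X Y by (simp add: form_def mult.commute)
  fix X Y Z assume X: "X \<in> L" and Y: "Y \<in> L" and Z: "Z \<in> L"
  have "H.mean (\<lambda>g. 1 * (\<Sum>b\<in>Basis. coord b X g * coord b Z g) + 1 * (\<Sum>b\<in>Basis. coord b Y g * coord b Z g)) =
    1 * form X Z + 1 * form Y Z"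
    unfolding form_def by (rule H.mean_linear[OF form_cont[OF X Z] form_cont[OF Y Z]])
  then show "form (X + Y) Z = form X Z + form Y Z"
    by (simp add: form_def coord_add distrib_right sum.distrib)
next
  fix c X Z assume X: "X \<in> L" and Z: "Z \<in> L"
  have "H.mean (\<lambda>g. c * (\<Sum>b\<in>Basis. coord b X g * coord b Z g) + 0 * (\<Sum>b\<in>Basis. coord b X g * coord b Z g)) =
    c * form X Z + 0 * form X Z"
    unfolding form_def by (rule H.mean_linear[OF form_cont[OF X Z] form_cont[OF X Z]])
  then show "form (c *\<^sub>R X) Z = c * form X Z"
    by (simp add: form_def coord_scaleR sum_distrib_left mult.assoc)
qed

text \<open>A nonzero \<open>X\<close> has a nonzero coordinate at \<open>g = un\<close>, and the
  mean of a nonnegative continuous function that is positive somewhere is positive.\<close>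

lemma form_pos:
  assumes X: "X \<in> L" "X \<noteq> 0"
  shows "form X X > 0"
proof -
  have "\<exists>b\<in>Basis. X (F b) un \<noteq> 0"
  proof (rule ccontr)
    assume "\<not> (\<exists>b\<in>Basis. X (F b) un \<noteq> 0)"
    then have "X = 0" by (intro L_eqI X(1) L_zero) (simp add: expand_X[OF X(1)])
    with X(2) show False by simp
  qed
  then obtain b where b: "b \<in> Basis" "X (F b) un \<noteq> 0" by blast
  have "0 < coord b X un * coord b X un" using b(2) by (simp add: coord_def flip: power2_eq_square)
  also have "\<dots> \<le> (\<Sum>b\<in>Basis. coord b X un * coord b X un)"
    by (rule member_le_sum[OF b(1)]) auto
  finally show ?thesis unfolding form_def
    by (intro H.mean_pos[OF form_cont[OF X(1) X(1)], of un]) (auto intro: sum_nonneg)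
qed

lemma coord_Ad: "coord b (Ad s X) g = coord b X (s \<cdot> g)"
  by (simp add: coord_def Ad_Ad)

text \<open>\<open>Ad s\<close> merely translates the coordinate functions on the left, and the mean
  is left invariant.\<close>

lemma form_Ad: "X \<in> L \<Longrightarrow> Y \<in> L \<Longrightarrow> form (Ad s X) (Ad s Y) = form X Y"
  unfolding form_def coord_Ad by (rule H.mean_left[OF form_cont])

lemma form_Ad_smooth:
  assumes X: "X \<in> L" and Y: "Y \<in> L"
  shows "(\<lambda>g. form (Ad g X) Y) \<in> C"
proof -
  \<comment> \<open>A convolution in the sense of \<open>convolution_smooth\<close>, evaluated at
    \<open>iv g\<close>; composing with the smooth inversion restores \<open>g\<close>.\<close>
  have "(\<lambda>g. H.mean (\<lambda>s. coord b X (g \<cdot> s) * coord b Y s)) \<in> C" if "b \<in> Basis" for b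
    using C_compose[OF convolution_smooth[OF coord_smooth[OF X that] coord_cont[OF Y that]] smooth_iv] by simp
  moreover have "form (Ad g X) Y = (\<Sum>b\<in>Basis. H.mean (\<lambda>s. coord b X (g \<cdot> s) * coord b Y s))" for g
    unfolding form_def coord_Ad
    by (rule H.mean_sum) (auto intro!: continuous_on_mult coord_cont X Y H.continuous_translate(1))
  ultimately show ?thesis by (simp add: C_sum)
qed

text \<open>Differentiate \<open>X (f \<circ> R\<^sub>g) (1) = \<Sum>\<^sub>e a\<^sub>e(g) (e f)(g)\<close> with respect to \<open>g\<close>, where \<open>a\<^sub>e(g)\<close> are the
  coordinates of \<open>Ad g X\<close> and \<open>R\<^sub>g\<close> is the right translation.\<close>

lemma derivative_of_Ad:
  assumes E: "B.orthonormal E" "Real_Vector_Spaces.span E = L" and e: "e \<in> E"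
    and X: "X \<in> L" and Z: "Z \<in> L"
  shows "Z (\<lambda>g. form (Ad g X) e) un = form (bracket X Z) e"
proof -
  have EL: "E \<subseteq> L" "finite E" using E(1) by (auto simp: B.orthonormal_def)
  define a where "a e g = form (Ad g X) e" for e g
  have aC: "a e \<in> C" if "e \<in> E" for e unfolding a_def by (rule form_Ad_smooth[OF X]) (use EL that in auto)
  have ex: "Ad g X f h = (\<Sum>e\<in>E. a e g * e f h)" for g f h
  proof -
    have "Ad g X = (\<Sum>e\<in>E. a e g *\<^sub>R e)" unfolding a_def by (rule B.orthonormal_expand[OF E Ad_L[OF X]])
    then show ?thesis by (simp add: sum_apply scaleR_fun_def)
  qed
  define W where "W = (\<Sum>e\<in>E. Z (a e) un *\<^sub>R e)"
  \<comment> \<open>\<open>W\<close> is the derivative of \<open>Ad g X\<close> at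
    \<open>g = un\<close> along \<open>Z\<close>. The order of the bracket reflects that
    \<open>Ad g\<close> is the adjoint action of the inverse of \<open>g\<close>.\<close>
  have "W = bracket X Z"
  proof (rule L_eqI[OF _ bracket_L[OF X Z]])
    show "W \<in> L" unfolding W_def using EL by (intro L_sum_in L_scaleR) auto
    fix f assume f: "f \<in> C"
    have efC: "e f \<in> C" if "e \<in> E" for e using EL that by (auto intro: L_smooth[OF _ f])
    have "Z f = (\<lambda>k. Z (\<lambda>g. f (k \<cdot> g)) un)" by (rule ext) (rule L_at_un[OF Z f])
    then have "X (Z f) un = X (\<lambda>k. Z (\<lambda>g. f (k \<cdot> g)) un) un" by simp
    \<comment> \<open>In \<open>f (k \<cdot> g)\<close> the two fields act on different variables
      and may be interchanged; after that \<open>Z\<close> meets the coefficients \<open>a e\<close>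
      as well as the functions \<open>e f\<close>, and the product rule separates the two.\<close>
    also have "\<dots> = Z (\<lambda>g. X (\<lambda>k. f (k \<cdot> g)) un) un"
      by (rule derivations_commute[OF C2_mul[OF f] X Z, symmetric])
    also have "(\<lambda>g. X (\<lambda>k. f (k \<cdot> g)) un) = (\<lambda>g. \<Sum>e\<in>E. a e g * e f g)"
      by (rule ext) (simp add: ex[symmetric], simp add: Ad_def)
    also have "Z \<dots> un = (\<Sum>e\<in>E. Z (a e) un * e f un + a e un * Z (e f) un)"
    proof -
      have "Z (\<lambda>g. \<Sum>e\<in>E. a e g * e f g) = (\<lambda>x. \<Sum>e\<in>E. Z (\<lambda>g. a e g * e f g) x)"
        by (rule L_sum[OF Z]) (intro C_mult aC efC)
      moreover have "Z (\<lambda>g. a e g * e f g) = (\<lambda>x. Z (a e) x * e f x + a e x * Z (e f) x)" if "e \<in> E" for e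
        by (rule L_mult[OF Z aC[OF that] efC[OF that]])
      ultimately show ?thesis by simp
    qed
    also have "\<dots> = W f un + (\<Sum>e\<in>E. a e un * Z (e f) un)"
      by (simp add: sum.distrib W_def sum_apply scaleR_fun_def)
    also have "(\<Sum>e\<in>E. a e un * Z (e f) un) = Z (\<lambda>h. \<Sum>e\<in>E. a e un * e f h) un"
    proof -
      have "Z (\<lambda>h. \<Sum>e\<in>E. a e un * e f h) = (\<lambda>x. \<Sum>e\<in>E. Z (\<lambda>h. a e un * e f h) x)"
        by (rule L_sum[OF Z]) (intro C_scale efC)
      moreover have "Z (\<lambda>h. a e un * e f h) = (\<lambda>x. a e un * Z (e f) x)" if "e \<in> E" for e
        by (rule L_scale[OF Z efC[OF that]])
      ultimately show ?thesis by simp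
    qed
    also have "(\<lambda>h. \<Sum>e\<in>E. a e un * e f h) = X f"
      by (rule ext) (simp add: ex[symmetric])
    finally show "W f un = bracket X Z f un" by (simp add: bracket_apply)
  qed
  then have "form (bracket X Z) e = form W e" by simp
  also have "\<dots> = Z (a e) un" unfolding W_def by (rule B.orthonormal_coefficient[OF E(1) e])
  finally show ?thesis unfolding a_def by simp
qed

text \<open>The inner product of \<open>Ad g X\<close> and \<open>Ad g Y\<close> is constant in
  \<open>g\<close>. Written by Parseval as a sum of products of smooth functions, it can be
  differentiated at the identity along \<open>Z\<close>.\<close>

lemma form_invariant:
  assumes X: "X \<in> L" and Y: "Y \<in> L" and Z: "Z \<in> L"
  shows "form (bracket X Z) Y + form X (bracket Y Z) = 0"
proof -
  obtain E where E: "B.orthonormal E" "Real_Vector_Spaces.span E = L"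
    using B.gram_schmidt[OF form_pos F.B(1)] F.B(3) F.B_in by blast
  have EL: "E \<subseteq> L" "finite E" using E(1) by (auto simp: B.orthonormal_def)
  have s: "(\<lambda>g. form (Ad g W) e) \<in> C" if "e \<in> E" "W \<in> L" for e W
    by (rule form_Ad_smooth) (use that EL in auto)
  have "(\<lambda>g. \<Sum>e\<in>E. form (Ad g X) e * form (Ad g Y) e) = (\<lambda>g. form X Y)"
    by (rule ext) (simp add: B.orthonormal_parseval[OF E Ad_L[OF X] Ad_L[OF Y], symmetric] form_Ad X Y)
  then have "Z (\<lambda>g. \<Sum>e\<in>E. form (Ad g X) e * form (Ad g Y) e) un = 0" by (simp add: L_const[OF Z])
  moreover have "Z (\<lambda>g. \<Sum>e\<in>E. form (Ad g X) e * form (Ad g Y) e) un =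
      (\<Sum>e\<in>E. form (bracket X Z) e * form Y e + form X e * form (bracket Y Z) e)"
    by (subst L_sum[OF Z])
      (auto intro!: C_mult s X Y sum.cong simp: L_mult[OF Z s[OF _ X] s[OF _ Y]] derivative_of_Ad[OF E _ X Z] derivative_of_Ad[OF E _ Y Z])
  ultimately show ?thesis
    by (simp add: sum.distrib B.orthonormal_parseval[OF E] bracket_L X Y Z)
qed

lemma K_negative:
  assumes X: "X \<in> L"
  shows "K X X \<le> 0" and "K X X = 0 \<Longrightarrow> Y \<in> L \<Longrightarrow> bracket X Y = 0"
proof -
  obtain E where E: "B.orthonormal E" "Real_Vector_Spaces.span E = L"
    using B.gram_schmidt[OF form_pos F.B(1)] F.B(3) F.B_in by blast
  have EL: "\<And>e. e \<in> E \<Longrightarrow> e \<in> L" "finite E" using E(1) by (auto simp: B.orthonormal_def)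
  \<comment> \<open>\<open>ad X\<close> is skew for \<open>form\<close>: one bracket moves to the
    other slot at the price of a sign.\<close>
  have "form (bracket X (bracket X e)) e = - form (bracket X e) (bracket X e)" if "e \<in> L" for e
  proof -
    have "form (- bracket X (bracket X e)) e + form (bracket X e) (- bracket X e) = 0"
      using form_invariant[OF bracket_L[OF X that] that X] by (simp add: bracket_swap[of _ X])
    moreover have "form (- W) V = - form W V" if "W \<in> L" "V \<in> L" for W V
      using B.scale[OF that, of "-1"] by simp
    moreover have "- bracket X e \<in> L" using L_scaleR[OF bracket_L[OF X that], of "-1"] by simp
    ultimately show ?thesis
      using B.sym[of "bracket X e" "- bracket X e"] X that by (simp add: bracket_L)
  qed
  then have K: "K X X = - (\<Sum>e\<in>E. form (bracket X e) (bracket X e))"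
    unfolding killing_form_def B.trace_orthonormal[OF E ad_ad_endo[OF X X]]
    by (simp add: sum_negf EL)
  have nn: "0 \<le> form (bracket X e) (bracket X e)" if "e \<in> E" for e
    using form_pos[OF bracket_L[OF X EL(1)[OF that]]] B.scale[of 0 0 0] L_zero by (cases "bracket X e = 0") auto
  then show "K X X \<le> 0" unfolding K by (simp add: sum_nonneg)
  assume "K X X = 0" and Y: "Y \<in> L"
  then have "(\<Sum>e\<in>E. form (bracket X e) (bracket X e)) = 0" using K by simp
  then have z0: "\<forall>e\<in>E. form (bracket X e) (bracket X e) = 0"
    using sum_nonneg_eq_0_iff[OF EL(2), of "\<lambda>e. form (bracket X e) (bracket X e)"] nn by simp
  have z: "bracket X e = 0" if "e \<in> E" for e
  proof (rule ccontr)
    assume "bracket X e \<noteq> 0"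
    from form_pos[OF bracket_L[OF X EL(1)[OF that]] this] z0 that show False by simp
  qed
  have "bracket X Y = bracket X (\<Sum>e\<in>E. form Y e *\<^sub>R e)" using B.orthonormal_expand[OF E Y] by simp
  also have "\<dots> = (\<Sum>e\<in>E. form Y e *\<^sub>R bracket X e)"
    by (rule F.linear_endo_sum[OF ad_endo[OF X] EL(2) EL(1)])
  finally show "bracket X Y = 0" by (simp add: z)
qed

end

section \<open>The metric, its frames and the Laplacian\<close>

locale compact_semisimple = compact_lie G
  for G :: "('g::{t2_space, second_countable_topology}, 'e::euclidean_space) lie_structure" +
  assumes semisimple: "semisimple G"
begin

text \<open>The chart served to build \<open>form\<close>; as the conclusion does not mention it,
  any choice can be discharged here.\<close>

lemma K_negative:
  assumes X: "X \<in> L"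
  shows "K X X \<le> 0" and "K X X = 0 \<Longrightarrow> Y \<in> L \<Longrightarrow> bracket X Y = 0"
proof -
  obtain U \<phi> F where UF: "(U, \<phi>) \<in> A" "un \<in> U" "\<forall>b\<in>Basis. F b \<in> C"
    "\<forall>X\<in>L. \<forall>f\<in>C. X f un =
      (\<Sum>b\<in>Basis. X (F b) un * frechet_derivative (\<lambda>y. f (inv_into U \<phi> y)) (at (\<phi> un)) b)"
    using coordinates_exist by blast
  interpret lie_coordinates G U \<phi> F
    by unfold_locales (use UF in auto)
  show "K X X \<le> 0" "K X X = 0 \<Longrightarrow> Y \<in> L \<Longrightarrow> bracket X Y = 0"
    using K_negative[OF X] by auto
qed

text \<open>The centre is an ideal on which all brackets vanish, so its derived series is zero after
  one step and semisimplicity applies.\<close>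

lemma center_trivial:
  assumes X: "X \<in> L" "\<And>Y. Y \<in> L \<Longrightarrow> bracket X Y = 0"
  shows "X = 0"
proof -
  define I where "I = {X \<in> L. \<forall>Y\<in>L. bracket X Y = 0}"
  have Iz: "bracket Y X = 0" if "Y \<in> L" "X \<in> I" for X Y
    using that bracket_swap[of Y X] by (simp add: I_def)
  have "lie_ideal G I" unfolding lie_ideal_def
  proof (intro conjI ballI)
    show "Real_Vector_Spaces.subspace I" unfolding Real_Vector_Spaces.subspace_def I_def
      using bracket_scaleR_left[of 0 _ 0]
      by (auto simp: L_zero L_plus L_scaleR bracket_add_left bracket_scaleR_left)
    show "I \<subseteq> L" by (auto simp: I_def)
    fix Y X assume "Y \<in> L" "X \<in> I"
    then show "bracket Y X \<in> I"
      using Iz \<open>Real_Vector_Spaces.subspace I\<close> by (simp add: Real_Vector_Spaces.subspace_0)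
  qed
  moreover have "derived_series I 1 = {0}"
  proof -
    have "{bracket X Y | X Y. X \<in> I \<and> Y \<in> I} \<subseteq> {0}" using Iz by (auto simp: I_def)
    then have "Real_Vector_Spaces.span {bracket X Y | X Y. X \<in> I \<and> Y \<in> I} \<subseteq> {0}"
      by (rule Real_Vector_Spaces.span_minimal) (rule Real_Vector_Spaces.subspace_single_0)
    moreover have "0 \<in> Real_Vector_Spaces.span {bracket X Y | X Y. X \<in> I \<and> Y \<in> I}"
      by (rule Real_Vector_Spaces.span_zero)
    ultimately show ?thesis by auto
  qed
  ultimately have "I = {0}" using semisimple unfolding semisimple_def by blast
  moreover have "X \<in> I" using X by (simp add: I_def)
  ultimately show ?thesis by simp
qed

abbreviation mt where "mt \<equiv> metric G"

sublocale M: bilinear_form L mt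
proof -
  interpret bilinear_form L K by (rule K_form)
  show "bilinear_form L mt"
    by unfold_locales (auto simp: metric_def add scale sym L_subspace)
qed

lemma metric_pos:
  assumes "X \<in> L" "X \<noteq> 0"
  shows "mt X X > 0"
  using K_negative[OF assms(1)] center_trivial[OF assms(1)] assms(2) by (force simp: metric_def)

lemma metric_Ad: "X \<in> L \<Longrightarrow> Y \<in> L \<Longrightarrow> mt (Ad h X) (Ad h Y) = mt X Y"
  by (simp add: metric_def K_Ad)

lemma frame_iff: "orthonormal_frame G E \<longleftrightarrow> M.orthonormal E \<and> Real_Vector_Spaces.span E = L"
  unfolding orthonormal_frame_def M.orthonormal_def using Real_Vector_Spaces.span_superset by blast

text \<open>The same choice term as in \<open>laplacian\<close>, so that unfolding the Laplacian
  produces a sum over \<open>Fr\<close>.\<close>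

definition Fr where "Fr = (SOME E. orthonormal_frame G E)"

lemma frame: "orthonormal_frame G Fr"
proof -
  have "\<exists>E. orthonormal_frame G E"
    unfolding frame_iff using M.gram_schmidt[OF metric_pos F.B(1)] F.B(3) F.B_in by blast
  then show ?thesis unfolding Fr_def by (rule someI_ex)
qed

lemma Fr: "finite Fr" "\<And>X. X \<in> Fr \<Longrightarrow> X \<in> L"
  using frame unfolding frame_iff M.orthonormal_def by auto

text \<open>With equal arguments the right side of the Koszul formula reduces to
  \<open>2 * mt (bracket Z X) X\<close>, which is zero by \<open>K_bracket\<close>; definiteness of
  the metric leaves \<open>0\<close> as the unique solution. The Laplacian thus becomes the plain
  sum of squares of a frame.\<close>

lemma levi_civita_self:
  assumes X: "X \<in> L"
  shows "levi_civita G X X = 0"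
  unfolding levi_civita_def
proof (rule the_equality)
  have rhs: "mt (bracket X X) Z - mt (bracket X Z) X + mt (bracket Z X) X = 0" if Z: "Z \<in> L" for Z
  proof -
    have "mt (bracket X Z) X = mt ((-1) *\<^sub>R bracket Z X) X" using bracket_swap[of X Z] by simp
    also have "\<dots> = - mt (bracket Z X) X" using M.scale[OF bracket_L[OF Z X] X, of "-1"] by simp
    finally have 1: "mt (bracket X Z) X = - mt (bracket Z X) X" .
    have 2: "mt (bracket Z X) X = 0" by (simp add: metric_def K_bracket X Z)
    have 3: "mt 0 Z = 0" using M.scale[OF L_zero Z, of 0] by simp
    show ?thesis using 1 2 3 by simp
  qed
  have mt0: "mt 0 Z = 0" if "Z \<in> L" for Z using M.scale[OF L_zero that, of 0] by simp
  show "0 \<in> L \<and> (\<forall>Z\<in>L. 2 * mt 0 Z = mt (bracket X X) Z - mt (bracket X Z) X + mt (bracket Z X) X)"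
    using rhs mt0 L_zero by simp
  fix W assume W: "W \<in> L \<and> (\<forall>Z\<in>L. 2 * mt W Z = mt (bracket X X) Z - mt (bracket X Z) X + mt (bracket Z X) X)"
  then have "2 * mt W W = 0" using rhs[of W] by simp
  then show "W = 0" using metric_pos[of W] W by force
qed

lemma laplacian_eq: "laplacian G f x = (\<Sum>X\<in>Fr. X (X f) x)"
proof -
  have "laplacian G f = (\<Sum>X\<in>Fr. X (X f) - levi_civita G X X f)"
    by (simp add: laplacian_def Fr_def)
  then show ?thesis by (simp add: sum_apply levi_civita_self Fr)
qed

text \<open>\<open>Ad h\<close> preserves the metric, so orthonormality survives, and it is
  invertible on \<open>L\<close>, so the image of the frame still spans.\<close>

lemma frame_Ad: "orthonormal_frame G (Ad h ` Fr)" and Ad_inj: "inj_on (Ad h) Fr"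
proof -
  show inj: "inj_on (Ad h) Fr"
    by (rule inj_on_inverseI[of _ "Ad (iv h)"]) (simp add: Ad_Ad)
  have on: "M.orthonormal Fr" "Real_Vector_Spaces.span Fr = L" using frame by (auto simp: frame_iff)
  have "M.orthonormal (Ad h ` Fr)"
    using on(1) inj unfolding M.orthonormal_def by (auto simp: metric_Ad Fr Ad_L inj_on_eq_iff)
  moreover have "Real_Vector_Spaces.span (Ad h ` Fr) = L"
  proof
    show "Real_Vector_Spaces.span (Ad h ` Fr) \<subseteq> L"
      by (rule Real_Vector_Spaces.span_minimal[OF _ L_subspace]) (auto simp: Ad_L Fr)
    show "L \<subseteq> Real_Vector_Spaces.span (Ad h ` Fr)"
    proof
      fix X assume X: "X \<in> L"
      have "Ad (iv h) X = (\<Sum>e\<in>Fr. mt (Ad (iv h) X) e *\<^sub>R e)"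
        by (rule M.orthonormal_expand[OF on Ad_L[OF X]])
      then have "Ad h (Ad (iv h) X) = Ad h (\<Sum>e\<in>Fr. mt (Ad (iv h) X) e *\<^sub>R e)" by simp
      also have "\<dots> = (\<Sum>e\<in>Fr. mt (Ad (iv h) X) e *\<^sub>R Ad h e)"
        by (rule F.linear_endo_sum[OF Ad_endo Fr])
      finally have "X = (\<Sum>e\<in>Fr. mt (Ad (iv h) X) e *\<^sub>R Ad h e)" by (simp add: Ad_Ad)
      also have "\<dots> \<in> Real_Vector_Spaces.span (Ad h ` Fr)"
        by (intro Real_Vector_Spaces.span_sum Real_Vector_Spaces.span_scale Real_Vector_Spaces.span_base) auto
      finally show "X \<in> Real_Vector_Spaces.span (Ad h ` Fr)" .
    qed
  qed
  ultimately show "orthonormal_frame G (Ad h ` Fr)" by (simp add: frame_iff)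
qed

text \<open>For \<open>\<theta> X Y = d\<pi> X \<cdot> d\<pi> Y\<close> and the conjugated frame, this says that the Casimir operator commutes
  with \<open>\<pi>\<close>.\<close>

lemma frame_independence:
  fixes \<theta> :: "(('g \<Rightarrow> real) \<Rightarrow> ('g \<Rightarrow> real)) \<Rightarrow> (('g \<Rightarrow> real) \<Rightarrow> ('g \<Rightarrow> real)) \<Rightarrow> complex"
  assumes E: "orthonormal_frame G E"
    and lin1: "\<And>Y c. Y \<in> L \<Longrightarrow> \<theta> (\<Sum>e\<in>Fr. c e *\<^sub>R e) Y = (\<Sum>e\<in>Fr. c e * \<theta> e Y)"
    and lin2: "\<And>X c. X \<in> L \<Longrightarrow> \<theta> X (\<Sum>e\<in>Fr. c e *\<^sub>R e) = (\<Sum>e\<in>Fr. c e * \<theta> X e)"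
  shows "(\<Sum>X\<in>E. \<theta> X X) = (\<Sum>X\<in>Fr. \<theta> X X)"
proof -
  have E': "M.orthonormal E" "Real_Vector_Spaces.span E = L" and Fr': "M.orthonormal Fr" "Real_Vector_Spaces.span Fr = L"
    using E frame by (auto simp: frame_iff)
  have EL: "X \<in> L" if "X \<in> E" for X using E'(1) that by (auto simp: M.orthonormal_def)
  have X: "\<theta> X X = (\<Sum>e\<in>Fr. \<Sum>e'\<in>Fr. mt e X * mt e' X * \<theta> e e')" if "X \<in> E" for X
  proof -
    have XL: "X \<in> L" by (rule EL[OF that])
    have ex: "X = (\<Sum>e\<in>Fr. mt X e *\<^sub>R e)" by (rule M.orthonormal_expand[OF Fr' XL])
    have "\<theta> X X = \<theta> (\<Sum>e\<in>Fr. mt X e *\<^sub>R e) X" using ex by simp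
    also have "\<dots> = (\<Sum>e\<in>Fr. mt X e * \<theta> e X)" by (rule lin1[OF XL])
    also have "\<dots> = (\<Sum>e\<in>Fr. mt X e * \<theta> e (\<Sum>e'\<in>Fr. mt X e' *\<^sub>R e'))" using ex by simp
    also have "\<dots> = (\<Sum>e\<in>Fr. mt X e * (\<Sum>e'\<in>Fr. mt X e' * \<theta> e e'))" by (simp add: lin2 Fr(2))
    also have "\<dots> = (\<Sum>e\<in>Fr. \<Sum>e'\<in>Fr. mt e X * mt e' X * \<theta> e e')"
      using M.sym[OF XL] by (simp add: sum_distrib_left mult.assoc Fr(2))
    finally show ?thesis .
  qed
  \<comment> \<open>With \<open>X\<close> expanded over \<open>Fr\<close> in both slots, the sum
    over \<open>E\<close> falls on the coefficients alone, where Parseval turns it into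
    \<open>mt e e'\<close>.\<close>
  have "(\<Sum>X\<in>E. \<theta> X X) = (\<Sum>e\<in>Fr. \<Sum>e'\<in>Fr. (\<Sum>X\<in>E. complex_of_real (mt e X * mt e' X)) * \<theta> e e')"
    by (simp add: X sum_distrib_right, subst sum.swap, rule sum.cong[OF refl], subst sum.swap) simp
  also have "\<dots> = (\<Sum>e\<in>Fr. \<Sum>e'\<in>Fr. complex_of_real (mt e e') * \<theta> e e')"
    by (simp add: M.orthonormal_parseval[OF E' Fr(2) Fr(2)])
  also have "\<dots> = (\<Sum>e\<in>Fr. \<Sum>e'\<in>Fr. (if e = e' then \<theta> e e' else 0))"
    using Fr'(1) by (intro sum.cong refl) (auto simp: M.orthonormal_def)
  also have "\<dots> = (\<Sum>e\<in>Fr. \<theta> e e)" by (simp add: Fr(1))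
  finally show ?thesis .
qed

end

section \<open>Complex matrices\<close>

type_synonym cmatrix = "nat \<Rightarrow> nat \<Rightarrow> complex"

text \<open>Matrices and vectors vanish outside their size, so that matrix identities are equalities of
  functions.\<close>

definition mats :: "nat \<Rightarrow> nat \<Rightarrow> cmatrix set" where
  "mats n m = {M. \<forall>i j. n \<le> i \<or> m \<le> j \<longrightarrow> M i j = 0}"

definition vecs :: "nat \<Rightarrow> (nat \<Rightarrow> complex) set" where
  "vecs n = {v. \<forall>i\<ge>n. v i = 0}"

text \<open>The parameter is the inner dimension, over which the sum runs: an index function does
  not record its own size.\<close>

definition mm :: "nat \<Rightarrow> cmatrix \<Rightarrow> cmatrix \<Rightarrow> cmatrix" where
  "mm n M N = (\<lambda>i j. \<Sum>k<n. M i k * N k j)"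

definition mv :: "nat \<Rightarrow> cmatrix \<Rightarrow> (nat \<Rightarrow> complex) \<Rightarrow> (nat \<Rightarrow> complex)" where
  "mv n M v = (\<lambda>i. \<Sum>k<n. M i k * v k)"

definition adj :: "cmatrix \<Rightarrow> cmatrix" where
  "adj M = (\<lambda>i j. cnj (M j i))"

definition idm :: "nat \<Rightarrow> cmatrix" where
  "idm n = (\<lambda>i j. if i = j \<and> i < n then 1 else 0)"

lemma mm_assoc: "mm m (mm n M N) Q = mm n M (mm m N Q)"
proof (intro ext)
  fix i j
  show "mm m (mm n M N) Q i j = mm n M (mm m N Q) i j"
    unfolding mm_def sum_distrib_right sum_distrib_left by (subst sum.swap) (simp add: mult.assoc)
qed

lemma mv_mm: "mv m (mm n M N) v = mv n M (mv m N v)"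
proof (intro ext)
  fix i
  show "mv m (mm n M N) v i = mv n M (mv m N v) i"
    unfolding mm_def mv_def sum_distrib_right sum_distrib_left by (subst sum.swap) (simp add: mult.assoc)
qed

lemma adj_mm: "adj (mm n M N) = mm n (adj N) (adj M)"
  by (simp add: adj_def mm_def mult.commute)

lemma adj_adj [simp]: "adj (adj M) = M"
  by (simp add: adj_def)

lemma adj_idm [simp]: "adj (idm n) = idm n"
  by (intro ext) (auto simp: adj_def idm_def)

lemma adj_mats: "M \<in> mats n m \<Longrightarrow> adj M \<in> mats m n"
  by (auto simp: mats_def adj_def)

lemma idm_mats: "idm n \<in> mats n n"
  by (auto simp: mats_def idm_def)

lemma mm_mats: "M \<in> mats p a \<Longrightarrow> N \<in> mats b q \<Longrightarrow> mm n M N \<in> mats p q"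
  by (auto simp: mats_def mm_def)

lemma mv_vecs: "M \<in> mats p a \<Longrightarrow> mv n M v \<in> vecs p"
  by (auto simp: mats_def vecs_def mv_def)

lemma mats_eqI:
  assumes "M \<in> mats n m" "N \<in> mats n m" "\<And>i j. i < n \<Longrightarrow> j < m \<Longrightarrow> M i j = N i j"
  shows "M = N"
proof (intro ext)
  fix i j
  show "M i j = N i j"
    by (cases "i < n \<and> j < m") (use assms in \<open>auto simp: mats_def not_less\<close>)
qed

lemma mm_idm_right: "M \<in> mats p n \<Longrightarrow> mm n M (idm n) = M"
  by (rule mats_eqI[OF mm_mats[OF _ idm_mats]])
    (auto simp: mm_def idm_def if_distrib[of "\<lambda>z. _ * z"] cong: if_cong)

lemma mm_idm_left: "M \<in> mats n p \<Longrightarrow> mm n (idm n) M = M"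
  by (rule mats_eqI[OF mm_mats[OF idm_mats]])
    (auto simp: mm_def idm_def if_distrib[of "\<lambda>z. z * _"] cong: if_cong)

lemma mv_idm: "v \<in> vecs n \<Longrightarrow> mv n (idm n) v = v"
proof (intro ext)
  fix i assume "v \<in> vecs n"
  then show "mv n (idm n) v i = v i"
    by (cases "i < n") (auto simp: mv_def idm_def vecs_def if_distrib[of "\<lambda>z. z * _"] cong: if_cong)
qed

lemma mm_add_left: "mm n (M + N) Q = mm n M Q + mm n N Q"
  by (intro ext) (simp add: mm_def distrib_right sum.distrib)

lemma mm_add_right: "mm n Q (M + N) = mm n Q M + mm n Q N"
  by (intro ext) (simp add: mm_def distrib_left sum.distrib)

lemma mv_add: "mv n M (v + w) = mv n M v + mv n M w"
  by (intro ext) (simp add: mv_def distrib_left sum.distrib)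

lemma mv_scale: "mv n M (\<lambda>i. c * v i) = (\<lambda>i. c * mv n M v i)"
  by (intro ext) (simp add: mv_def sum_distrib_left mult_ac)

text \<open>A subspace with an orthonormal basis, stored as the columns of \<open>T\<close>:
  \<open>mm m T (adj T)\<close> is the orthogonal projection onto it and \<open>adj T\<close> takes
  coordinates.\<close>

definition isometry :: "nat \<Rightarrow> nat \<Rightarrow> cmatrix \<Rightarrow> bool" where
  "isometry n m T \<longleftrightarrow> T \<in> mats n m \<and> mm n (adj T) T = idm m"

lemma isometry_trace:
  assumes "isometry n m T"
  shows "(\<Sum>i<n. mm m T (adj T) i i) = of_nat m"
proof -
  have "(\<Sum>i<n. mm m T (adj T) i i) = (\<Sum>k<m. mm n (adj T) T k k)"
    unfolding mm_def adj_def by (subst sum.swap) (simp add: mult.commute)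
  also have "\<dots> = (\<Sum>k<m. 1)" using assms by (simp add: isometry_def idm_def)
  finally show ?thesis by simp
qed

text \<open>The projection \<open>?P\<close> satisfies
  \<open>?P i i = (\<Sum>k<n. (cmod (?P i k))\<^sup>2)\<close>, hence its diagonal entries are at
  most \<open>1\<close>, while its trace is \<open>m\<close>.\<close>

lemma isometry_le:
  assumes T: "isometry n m T"
  shows "m \<le> n"
proof -
  define s where "s i = (\<Sum>k<m. (cmod (T i k))\<^sup>2)" for i
  let ?P = "mm m T (adj T)"
  have s: "?P i i = complex_of_real (s i)" for i
    by (simp add: mm_def adj_def s_def complex_norm_square[symmetric] mult.commute)
  have PP: "mm n ?P ?P = ?P"
  proof -
    have "mm n ?P ?P = mm m T (mm m (mm n (adj T) T) (adj T))" by (simp add: mm_assoc)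
    also have "\<dots> = ?P"
    proof -
      have "T \<in> mats n m" "mm n (adj T) T = idm m" using T by (auto simp: isometry_def)
      then show ?thesis by (simp only: mm_idm_left[OF adj_mats])
    qed
    finally show ?thesis .
  qed
  have "s i \<le> 1" if "i < n" for i
  proof -
    have "complex_of_real (s i) = mm n ?P ?P i i" by (simp only: PP s)
    also have "\<dots> = (\<Sum>k<n. ?P i k * cnj (?P i k))"
      unfolding mm_def[of n] by (rule sum.cong[OF refl]) (simp add: mm_def adj_def mult.commute)
    also have "\<dots> = complex_of_real (\<Sum>k<n. (cmod (?P i k))\<^sup>2)"
      by (simp add: complex_norm_square[symmetric])
    finally have "s i = (\<Sum>k<n. (cmod (?P i k))\<^sup>2)" using of_real_eq_iff by blast
    also have "\<dots> \<ge> (cmod (?P i i))\<^sup>2" by (rule member_le_sum) (use that in auto)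
    finally have "(s i)\<^sup>2 \<le> s i" unfolding s by simp
    show "s i \<le> 1"
    proof (rule ccontr)
      assume "\<not> s i \<le> 1"
      then have "1 * s i < s i * s i" by (intro mult_strict_right_mono) auto
      with \<open>(s i)\<^sup>2 \<le> s i\<close> show False by (simp add: power2_eq_square)
    qed
  qed
  then have "(\<Sum>i<n. s i) \<le> (\<Sum>i<n. 1)" by (intro sum_mono) simp
  moreover have "complex_of_real (\<Sum>i<n. s i) = of_nat m"
    using isometry_trace[OF T] by (simp add: s)
  then have "(\<Sum>i<n. s i) = real m" by (metis of_real_eq_iff of_real_of_nat_eq)
  ultimately show ?thesis by simp
qed

section \<open>Subspaces and orthogonal projections\<close>

definition csub :: "nat \<Rightarrow> (nat \<Rightarrow> complex) set \<Rightarrow> bool" where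
  "csub n W \<longleftrightarrow> W \<subseteq> vecs n \<and> 0 \<in> W \<and> (\<forall>v\<in>W. \<forall>w\<in>W. v + w \<in> W) \<and> (\<forall>c. \<forall>v\<in>W. (\<lambda>i. c * v i) \<in> W)"

lemma csub_add: "csub n W \<Longrightarrow> v \<in> W \<Longrightarrow> w \<in> W \<Longrightarrow> v + w \<in> W"
  and csub_scale: "csub n W \<Longrightarrow> v \<in> W \<Longrightarrow> (\<lambda>i. c * v i) \<in> W"
  unfolding csub_def by blast+

lemma csub_sum:
  assumes "csub n W" "\<And>k. k < m \<Longrightarrow> (\<lambda>i. T i k) \<in> W"
  shows "mv m T w \<in> W"
  using assms(2)
proof (induction m)
  case 0
  have z: "mv 0 T w = 0" by (simp add: mv_def fun_eq_iff)
  have "0 \<in> W" using assms(1) unfolding csub_def by blast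
  then show ?case unfolding z .
next
  case (Suc m)
  have eq: "mv (Suc m) T w = mv m T w + (\<lambda>i. w m * T i m)"
    by (intro ext) (simp add: mv_def mult.commute)
  have "mv m T w \<in> W" by (rule Suc.IH) (rule Suc.prems, simp)
  then show ?case unfolding eq by (rule csub_add[OF assms(1)]) (rule csub_scale[OF assms(1) Suc.prems], simp)
qed

text \<open>An orthonormal system in \<open>W\<close> of maximal size exists because
  \<open>isometry_le\<close> bounds the size. A vector of \<open>W\<close> not fixed by the
  projection would have a nonzero residual, and this, normalised, could be appended as a further
  column.\<close>

lemma csub_isometry:
  assumes W: "csub n W"
  shows "\<exists>m T. isometry n m T \<and> (\<forall>k<m. (\<lambda>i. T i k) \<in> W) \<and> (\<forall>v\<in>W. mv n (mm m T (adj T)) v = v)"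
proof -
  define P where "P m \<longleftrightarrow> (\<exists>T. isometry n m T \<and> (\<forall>k<m. (\<lambda>i. T i k) \<in> W))" for m
  have "P 0" unfolding P_def
    by (rule exI[of _ "\<lambda>i j. 0"]) (auto simp: isometry_def mats_def mm_def adj_def idm_def fun_eq_iff)
  moreover have "\<forall>m. P m \<longrightarrow> m < Suc n" unfolding P_def using isometry_le le_imp_less_Suc by blast
  ultimately obtain m where m: "P m" "\<And>m'. P m' \<Longrightarrow> m' \<le> m"
    using ex_has_greatest_nat[of P 0 "\<lambda>m. m" "Suc n"] by auto
  then obtain T where T: "isometry n m T" "\<And>k. k < m \<Longrightarrow> (\<lambda>i. T i k) \<in> W" unfolding P_def by blast
  have Tm: "T \<in> mats n m" and TT: "mm n (adj T) T = idm m" using T(1) by (auto simp: isometry_def)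
  have "mv n (mm m T (adj T)) v = v" if v: "v \<in> W" for v
  proof (rule ccontr)
    assume ne: "mv n (mm m T (adj T)) v \<noteq> v"
    define p where "p = mv n (mm m T (adj T)) v"
    define u where "u = v + (\<lambda>i. (-1) * p i)"
    have p: "p \<in> W" unfolding p_def mv_mm by (rule csub_sum[OF W T(2)])
    have u: "u \<in> W" unfolding u_def by (rule csub_add[OF W v csub_scale[OF W p]])
    then have uv: "u \<in> vecs n" using W by (auto simp: csub_def)
    have "u \<noteq> 0"
    proof
      assume "u = 0"
      then have "v i = p i" for i by (auto simp: u_def fun_eq_iff)
      then show False using ne by (auto simp: p_def fun_eq_iff)
    qed
    then obtain i0 where i0: "u i0 \<noteq> 0" by (auto simp: fun_eq_iff)
    then have "i0 < n" using uv by (metis (mono_tags, lifting) linorder_not_less mem_Collect_eq vecs_def)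
    define N where "N = sqrt (\<Sum>i<n. (cmod (u i))\<^sup>2)"
    have "(\<Sum>i<n. (cmod (u i))\<^sup>2) > 0"
      by (rule sum_pos2[of _ i0]) (use \<open>i0 < n\<close> i0 in auto)
    then have N: "N > 0" "(\<Sum>i<n. (cmod (u i))\<^sup>2) = N * N" by (auto simp: N_def)
    have orth: "mv n (adj T) u = 0"
    proof -
      have "mv n (adj T) p = mv n (mm m (mm n (adj T) T) (adj T)) v"
        unfolding p_def by (simp add: mv_mm[symmetric] mm_assoc)
      also have "\<dots> = mv n (adj T) v" by (simp only: TT mm_idm_left[OF adj_mats[OF Tm]])
      finally show ?thesis unfolding u_def mv_add mv_scale by (simp add: fun_eq_iff)
    qed
    define T' where "T' = (\<lambda>i j. if j = m then u i / N else T i j)"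
    have T'm: "T' \<in> mats n (Suc m)" using Tm uv by (auto simp: mats_def vecs_def T'_def)
    have "isometry n (Suc m) T'"
      unfolding isometry_def
    proof (intro conjI T'm mats_eqI[OF mm_mats[OF adj_mats[OF T'm] T'm] idm_mats])
      fix i j assume ij: "i < Suc m" "j < Suc m"
      have o: "(\<Sum>k<n. cnj (T k i) * u k) = 0" if "i < m" for i
        using fun_cong[OF orth, of i] by (simp add: mv_def adj_def)
      have o': "(\<Sum>k<n. cnj (u k) * T k i) = 0" if "i < m" for i
        using arg_cong[OF o[OF that], of cnj] by (simp add: mult.commute)
      have tt: "(\<Sum>k<n. cnj (T k i) * T k j) = (if i = j then 1 else 0)" if "i < m" "j < m" for i j
        using fun_cong[OF fun_cong[OF TT], of i j] that by (simp add: mm_def adj_def idm_def)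
      have uu: "(\<Sum>k<n. cnj (u k) * u k) = complex_of_real (N * N)"
        unfolding N(2)[symmetric] by (simp add: complex_norm_square[symmetric] mult.commute)
      consider "i < m" "j < m" | "i = m" "j < m" | "i < m" "j = m" | "i = m" "j = m" using ij by linarith
      then show "mm n (adj T') T' i j = idm (Suc m) i j"
      proof cases
        case 1 then show ?thesis by (simp add: mm_def adj_def T'_def idm_def tt)
      next
        case 2
        have "(\<Sum>k<n. cnj (u k) / N * T k j) = (\<Sum>k<n. cnj (u k) * T k j) / N"
          by (simp add: sum_divide_distrib)
        with 2 show ?thesis by (simp add: mm_def adj_def T'_def idm_def o')
      next
        case 3
        have "(\<Sum>k<n. cnj (T k i) * (u k / N)) = (\<Sum>k<n. cnj (T k i) * u k) / N"
          by (simp add: sum_divide_distrib)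
        with 3 show ?thesis by (simp add: mm_def adj_def T'_def idm_def o)
      next
        case 4
        have "(\<Sum>k<n. cnj (u k) / N * (u k / N)) = (\<Sum>k<n. cnj (u k) * u k) / (N * N)"
          by (simp add: sum_divide_distrib)
        with 4 N(1) show ?thesis by (simp add: mm_def adj_def T'_def idm_def uu)
      qed
    qed
    moreover have "(\<lambda>i. T' i k) \<in> W" if "k < Suc m" for k
    proof (cases "k = m")
      case True
      have "(\<lambda>i. (1 / N) * u i) \<in> W" by (rule csub_scale[OF W u])
      then show ?thesis using True by (simp add: T'_def)
    next
      case False
      then show ?thesis using T(2)[of k] that by (simp add: T'_def)
    qed
    ultimately have "P (Suc m)" unfolding P_def by blast
    then show False using m(2)[of "Suc m"] by simp
  qed
  then show ?thesis using T by blast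
qed

text \<open>The second isometry comes from the kernel of \<open>adj T1\<close>, the orthogonal
  complement of \<open>W\<close>. Both dimensions are recorded because the decomposition of
  representations is an induction on them.\<close>

lemma orthogonal_decomposition:
  assumes W: "csub n W"
  shows "\<exists>m1 m2 T1 T2. isometry n m1 T1 \<and> isometry n m2 T2 \<and>
    mm m1 T1 (adj T1) + mm m2 T2 (adj T2) = idm n \<and> m1 + m2 = n \<and>
    (\<forall>v\<in>W. mv n (mm m1 T1 (adj T1)) v = v) \<and> (\<forall>w. mv m1 T1 w \<in> W)"
proof -
  obtain m1 T1 where T1: "isometry n m1 T1" "\<And>k. k < m1 \<Longrightarrow> (\<lambda>i. T1 i k) \<in> W"
    "\<And>v. v \<in> W \<Longrightarrow> mv n (mm m1 T1 (adj T1)) v = v"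
    using csub_isometry[OF W] by blast
  define W' where "W' = {v \<in> vecs n. mv n (adj T1) v = 0}"
  have W': "csub n W'" unfolding csub_def W'_def
    by (auto simp: mv_add mv_scale vecs_def) (simp_all add: mv_def fun_eq_iff)
  obtain m2 T2 where T2: "isometry n m2 T2" "\<And>k. k < m2 \<Longrightarrow> (\<lambda>i. T2 i k) \<in> W'"
    "\<And>v. v \<in> W' \<Longrightarrow> mv n (mm m2 T2 (adj T2)) v = v"
    using csub_isometry[OF W'] by blast
  have m: "T1 \<in> mats n m1" "T2 \<in> mats n m2" and i1: "mm n (adj T1) T1 = idm m1"
    using T1(1) T2(1) by (auto simp: isometry_def)
  let ?P1 = "mm m1 T1 (adj T1)" and ?P2 = "mm m2 T2 (adj T2)"
  have Pm: "?P1 \<in> mats n n" "?P2 \<in> mats n n" using m by (auto intro: mm_mats adj_mats)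
  have "mm n (adj T1) T2 = (\<lambda>i j. 0)"
  proof (rule mats_eqI[OF mm_mats[OF adj_mats[OF m(1)] m(2)]])
    show "mm n (adj T1) T2 i j = 0" if "j < m2" for i j
      using T2(2)[OF that] by (auto simp: W'_def mv_def mm_def fun_eq_iff)
  qed (auto simp: mats_def)
  then have "adj (mm n (adj T1) T2) = (\<lambda>i j. 0)" by (simp add: adj_def)
  then have orth: "mm n (adj T2) T1 = (\<lambda>i j. 0)" by (simp add: adj_mm)
  have "mm n ?P2 ?P1 = mm m2 T2 (mm m1 (mm n (adj T2) T1) (adj T1))" by (simp add: mm_assoc)
  also have "\<dots> = (\<lambda>i j. 0)" by (simp add: orth) (simp add: mm_def)
  finally have P21: "mm n ?P2 ?P1 = (\<lambda>i j. 0)" .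
  \<comment> \<open>Subtracting its first projection moves \<open>v\<close> into \<open>W'\<close>,
    where \<open>?P2\<close> is the identity, and \<open>?P2\<close> annihilates what was
    subtracted.\<close>
  have key: "mv n ?P1 v + mv n ?P2 v = v" if v: "v \<in> vecs n" for v
  proof -
    define u where "u = v + (\<lambda>i. (-1) * mv n ?P1 v i)"
    have pv: "mv n ?P1 v \<in> vecs n" by (rule mv_vecs[OF Pm(1)])
    have "mv n (adj T1) (mv n ?P1 v) = mv n (mm m1 (mm n (adj T1) T1) (adj T1)) v"
      by (simp add: mv_mm[symmetric] mm_assoc)
    also have "\<dots> = mv n (adj T1) v" by (simp only: i1 mm_idm_left[OF adj_mats[OF m(1)]])
    finally have "mv n (adj T1) u = 0" unfolding u_def mv_add mv_scale by (simp add: fun_eq_iff)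
    moreover have "u \<in> vecs n" using v pv by (simp add: u_def vecs_def)
    ultimately have "mv n ?P2 u = u" using T2(3) by (simp add: W'_def)
    moreover have "mv n ?P2 u = mv n ?P2 v"
    proof -
      have "mv n ?P2 (mv n ?P1 v) = 0"
        using mv_mm[of n n ?P2 ?P1 v] P21 by (simp add: mv_def fun_eq_iff)
      then show ?thesis unfolding u_def mv_add mv_scale by (simp add: fun_eq_iff)
    qed
    ultimately have "mv n ?P2 v = u" by simp
    then show ?thesis by (simp add: u_def fun_eq_iff)
  qed
  have sum: "?P1 + ?P2 = idm n"
  proof (rule mats_eqI[of _ n n])
    show "?P1 + ?P2 \<in> mats n n" using Pm by (simp add: mats_def)
    fix i j assume ij: "i < n" "j < n"
    have "(\<lambda>k. if k = j then 1 else 0) \<in> vecs n" using ij by (simp add: vecs_def)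
    from fun_cong[OF key[OF this], of i] show "(?P1 + ?P2) i j = idm n i j"
      using ij by (simp add: mv_def idm_def if_distrib[of "\<lambda>z. _ * z"] cong: if_cong)
  qed (rule idm_mats)
  \<comment> \<open>Traces count dimensions.\<close>
  have "(\<Sum>i<n. ?P1 i i) + (\<Sum>i<n. ?P2 i i) = (\<Sum>i<n. idm n i i)"
    unfolding sum[symmetric] by (simp add: sum.distrib)
  then have "of_nat m1 + of_nat m2 = (of_nat n :: complex)"
    unfolding isometry_trace[OF T1(1)] isometry_trace[OF T2(1)] by (simp add: idm_def)
  then have "m1 + m2 = n" using of_nat_eq_iff[of "m1 + m2" n, where 'a = complex] by simp
  moreover have "mv m1 T1 w \<in> W" for w by (rule csub_sum[OF W T1(2)])
  ultimately show ?thesis using T1 T2 sum by blast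
qed

text \<open>The bookkeeping of tensor indices: \<open>p\<close> stands for the pair of
  \<open>p div m\<close> and \<open>p mod m\<close>.\<close>

lemma sum_div_mod:
  fixes f :: "nat \<Rightarrow> nat \<Rightarrow> 'a::comm_monoid_add"
  shows "(\<Sum>p<n * m. f (p div m) (p mod m)) = (\<Sum>i<n. \<Sum>j<m. f i j)"
proof (cases "m = 0")
  case False
  have "(\<Sum>p<n * m. f (p div m) (p mod m)) = (\<Sum>(i, j)\<in>{..<n} \<times> {..<m}. f i j)"
  proof (rule sum.reindex_bij_witness[of _ "\<lambda>(i, j). i * m + j" "\<lambda>p. (p div m, p mod m)"])
    show "(case p of (i, j) \<Rightarrow> i * m + j) \<in> {..<n * m}" if "p \<in> {..<n} \<times> {..<m}" for p
    proof -
      obtain i j where p: "p = (i, j)" "i < n" "j < m" using \<open>p \<in> _\<close> by auto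
      have "i * m + j < Suc i * m" using p by simp
      also have "\<dots> \<le> n * m" using p by (intro mult_le_mono1) simp
      finally show ?thesis using p by simp
    qed
  qed (use False in \<open>auto simp: less_mult_imp_div_less\<close>)
  then show ?thesis by (simp add: sum.cartesian_product)
qed simp

section \<open>Representations and the Casimir operator\<close>

lemma cmod_sq: "complex_of_real ((cmod z)\<^sup>2) = cnj z * z"
  by (metis complex_norm_square mult.commute of_real_power)

lemma cnj_mv_mult: "cnj (mv n M v p) * z = (\<Sum>q<n. cnj (v q) * cnj (M p q) * z)"
  by (simp add: mv_def sum_distrib_right mult.commute[of "cnj (M p _)"])

context compact_lie
begin

definition D :: "(('g \<Rightarrow> real) \<Rightarrow> ('g \<Rightarrow> real)) \<Rightarrow> ('g \<Rightarrow> complex) \<Rightarrow> ('g \<Rightarrow> complex)" where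
  "D X u = (\<lambda>x. Complex (X (\<lambda>h. Re (u h)) x) (X (\<lambda>h. Im (u h)) x))"

lemma CC_Re: "u \<in> CC \<Longrightarrow> (\<lambda>x. Re (u x)) \<in> C" and CC_Im: "u \<in> CC \<Longrightarrow> (\<lambda>x. Im (u x)) \<in> C"
  by (auto simp: CC_def)

lemma D_CC: "X \<in> L \<Longrightarrow> D X u \<in> CC"
  by (simp add: CC_def D_def L_smooth_all)

lemma D_const: "X \<in> L \<Longrightarrow> D X (\<lambda>x. c) = (\<lambda>x. 0)"
  by (simp add: D_def L_const complex_eq_iff fun_eq_iff)

lemma D_add:
  assumes "X \<in> L" "u \<in> CC" "v \<in> CC"
  shows "D X (\<lambda>x. u x + v x) = (\<lambda>x. D X u x + D X v x)"
  using L_add[OF assms(1) CC_Re[OF assms(2)] CC_Re[OF assms(3)]] L_add[OF assms(1) CC_Im[OF assms(2)] CC_Im[OF assms(3)]]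
  by (simp add: D_def complex_eq_iff fun_eq_iff)

lemma D_mult:
  assumes X: "X \<in> L" and u: "u \<in> CC" and v: "v \<in> CC"
  shows "D X (\<lambda>x. u x * v x) = (\<lambda>x. D X u x * v x + u x * D X v x)"
proof -
  note c = CC_Re[OF u] CC_Re[OF v] CC_Im[OF u] CC_Im[OF v]
  have "X (\<lambda>x. Re (u x) * Re (v x) - Im (u x) * Im (v x)) =
    (\<lambda>x. (X (\<lambda>x. Re (u x)) x * Re (v x) + Re (u x) * X (\<lambda>x. Re (v x)) x)
      - (X (\<lambda>x. Im (u x)) x * Im (v x) + Im (u x) * X (\<lambda>x. Im (v x)) x))"
    by (simp add: L_diff[OF X C_mult[OF c(1,2)] C_mult[OF c(3,4)]] L_mult[OF X c(1,2)] L_mult[OF X c(3,4)])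
  moreover have "X (\<lambda>x. Re (u x) * Im (v x) + Im (u x) * Re (v x)) =
    (\<lambda>x. (X (\<lambda>x. Re (u x)) x * Im (v x) + Re (u x) * X (\<lambda>x. Im (v x)) x)
      + (X (\<lambda>x. Im (u x)) x * Re (v x) + Im (u x) * X (\<lambda>x. Re (v x)) x))"
    by (simp add: L_add[OF X C_mult[OF c(1,4)] C_mult[OF c(3,2)]] L_mult[OF X c(1,4)] L_mult[OF X c(3,2)])
  ultimately show ?thesis by (simp add: D_def complex_eq_iff fun_eq_iff algebra_simps)
qed

lemma D_cmult: "X \<in> L \<Longrightarrow> u \<in> CC \<Longrightarrow> D X (\<lambda>x. c * u x) = (\<lambda>x. c * D X u x)"
  by (simp add: D_mult D_const)

lemma D_cnj: "X \<in> L \<Longrightarrow> u \<in> CC \<Longrightarrow> D X (\<lambda>x. cnj (u x)) = (\<lambda>x. cnj (D X u x))"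
  using L_scale[OF _ CC_Im, of X u "-1"] by (simp add: D_def complex_eq_iff fun_eq_iff)

lemma D_sum:
  assumes "X \<in> L" "\<And>i. i \<in> I \<Longrightarrow> u i \<in> CC"
  shows "D X (\<lambda>x. \<Sum>i\<in>I. u i x) = (\<lambda>x. \<Sum>i\<in>I. D X (u i) x)"
  using assms(2)
proof (induction I rule: infinite_finite_induct)
  case (insert i I)
  then show ?case using D_add[OF assms(1), of "u i" "\<lambda>x. \<Sum>i\<in>I. u i x"] by (simp add: CC_sum)
qed (simp_all add: D_const[OF assms(1)])

lemma D_left:
  assumes "X \<in> L" "u \<in> CC"
  shows "D X u x = D X (\<lambda>h. u (x \<cdot> h)) un"
  using L_at_un[OF assms(1) CC_Re[OF assms(2)], of x] L_at_un[OF assms(1) CC_Im[OF assms(2)], of x]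
  by (simp add: D_def)

lemma D_Ad: "D (Ad h X) u p = D X (\<lambda>k. u (k \<cdot> h)) (p \<cdot> iv h)"
  by (simp add: D_def Ad_def)

lemma D_combination: "D (\<Sum>e\<in>I. c e *\<^sub>R e) u x = (\<Sum>e\<in>I. complex_of_real (c e) * D e u x)"
  by (induction I rule: infinite_finite_induct) (auto simp: D_def complex_eq_iff scaleR_fun_def)

section \<open>Unitary representations and their differentials\<close>

definition urep :: "nat \<Rightarrow> ('g \<Rightarrow> cmatrix) \<Rightarrow> bool" where
  "urep n r \<longleftrightarrow> (\<forall>h. r h \<in> mats n n) \<and> (\<forall>h k. r (h \<cdot> k) = mm n (r h) (r k)) \<and>
    (\<forall>h. mm n (adj (r h)) (r h) = idm n) \<and> (\<forall>i<n. \<forall>j<n. continuous_on UNIV (\<lambda>h. r h i j))"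

definition irr :: "nat \<Rightarrow> ('g \<Rightarrow> cmatrix) \<Rightarrow> bool" where
  "irr n r \<longleftrightarrow> (\<forall>W. csub n W \<and> (\<forall>h. \<forall>v\<in>W. mv n (r h) v \<in> W) \<longrightarrow> W = {0} \<or> W = vecs n)"

text \<open>The operator \<open>d\<pi> X\<close> of the Lie algebra representation, read off entry
  by entry.\<close>

definition dr :: "('g \<Rightarrow> cmatrix) \<Rightarrow> (('g \<Rightarrow> real) \<Rightarrow> ('g \<Rightarrow> real)) \<Rightarrow> cmatrix" where
  "dr r X = (\<lambda>i j. D X (\<lambda>h. r h i j) un)"

lemma dr_combination: "dr r (\<Sum>e\<in>I. c e *\<^sub>R e) i j = (\<Sum>e\<in>I. complex_of_real (c e) * dr r e i j)"
  by (simp add: dr_def D_combination)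

context
  fixes n r
  assumes r: "urep n r"
begin

lemma r_mats: "r h \<in> mats n n" and r_mul: "r (h \<cdot> k) = mm n (r h) (r k)"
  and r_unitary: "mm n (adj (r h)) (r h) = idm n"
  using r by (auto simp: urep_def)

lemma r_un: "r un = idm n"
proof -
  have "idm n = mm n (adj (r un)) (r (un \<cdot> un))" by (simp add: r_unitary)
  also have "\<dots> = mm n (mm n (adj (r un)) (r un)) (r un)" unfolding r_mul by (simp add: mm_assoc)
  also have "\<dots> = r un" by (simp only: r_unitary mm_idm_left[OF r_mats])
  finally show ?thesis by simp
qed

lemma r_iv: "r (iv h) = adj (r h)"
proof -
  have "adj (r h) = mm n (adj (r h)) (r (h \<cdot> iv h))"
    by (simp add: r_un mm_idm_right[OF adj_mats[OF r_mats]])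
  also have "\<dots> = mm n (mm n (adj (r h)) (r h)) (r (iv h))" unfolding r_mul by (simp add: mm_assoc)
  also have "\<dots> = r (iv h)" by (simp only: r_unitary mm_idm_left[OF r_mats])
  finally show ?thesis by simp
qed

lemma r_CC: "(\<lambda>h. r h i j) \<in> CC"
proof (cases "i < n \<and> j < n")
  case True
  show ?thesis
  proof (rule continuous_rep_smooth[of n])
    show "r (g \<cdot> h) i j = (\<Sum>k<n. r g i k * r h k j)" for g h i j by (simp add: r_mul mm_def)
    show "r un i j = (if i = j then 1 else 0)" if "i < n" "j < n" for i j using that by (simp add: r_un idm_def)
    show "continuous_on UNIV (\<lambda>g. r g i j)" if "i < n" "j < n" for i j using r that by (simp add: urep_def)
  qed (use True in auto)
next
  case False
  then have "(\<lambda>h. r h i j) = (\<lambda>h. 0)" using r_mats by (auto simp: mats_def not_less)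
  then show ?thesis by simp
qed

lemma D_row:
  assumes "X \<in> L"
  shows "D X (\<lambda>h. \<Sum>k<m. c k * r h (f k) (q k)) x = (\<Sum>k<m. c k * D X (\<lambda>h. r h (f k) (q k)) x)"
  by (simp add: D_sum[OF assms] CC_mult r_CC D_cmult[OF assms])

lemma dr_mats: "X \<in> L \<Longrightarrow> dr r X \<in> mats n n"
proof -
  assume X: "X \<in> L"
  have "dr r X i j = 0" if "n \<le> i \<or> n \<le> j" for i j
  proof -
    have "(\<lambda>h. r h i j) = (\<lambda>h. 0)" using r_mats that by (auto simp: mats_def)
    then show ?thesis by (simp add: dr_def D_const[OF X])
  qed
  then show ?thesis by (auto simp: mats_def)
qed

text \<open>A left-invariant field differentiates \<open>r (x \<cdot> h)\<close> in \<open>h\<close>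
  at the identity, so the constant factor \<open>r x\<close> stays in front.\<close>

lemma D_entry:
  assumes X: "X \<in> L"
  shows "D X (\<lambda>h. r h i j) x = mm n (r x) (dr r X) i j"
proof -
  have "D X (\<lambda>h. r h i j) x = D X (\<lambda>h. r (x \<cdot> h) i j) un" by (rule D_left[OF X r_CC])
  also have "\<dots> = D X (\<lambda>h. \<Sum>k<n. r x i k * r h k j) un" by (simp add: r_mul mm_def)
  also have "\<dots> = mm n (r x) (dr r X) i j" by (simp add: D_row[OF X] mm_def dr_def)
  finally show ?thesis .
qed

lemma D_D_entry:
  assumes X: "X \<in> L"
  shows "D X (D X (\<lambda>h. r h i j)) x = mm n (r x) (mm n (dr r X) (dr r X)) i j"
proof -
  have "D X (\<lambda>h. r h i j) = (\<lambda>x. \<Sum>k<n. dr r X k j * r x i k)"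
    by (rule ext) (simp add: D_entry[OF X] mm_def mult.commute)
  then have "D X (D X (\<lambda>h. r h i j)) x = (\<Sum>k<n. dr r X k j * D X (\<lambda>h. r h i k) x)"
    by (simp add: D_row[OF X])
  also have "\<dots> = mm n (mm n (r x) (dr r X)) (dr r X) i j"
    by (simp add: D_entry[OF X] mm_def[of n "mm n (r x) (dr r X)"] mult.commute)
  finally show ?thesis by (simp add: mm_assoc)
qed

text \<open>Differentiate \<open>adj (r h) r h = 1\<close> at the identity.\<close>

lemma dr_skew:
  assumes X: "X \<in> L"
  shows "cnj (dr r X j i) = - dr r X i j"
proof (cases "i < n \<and> j < n")
  case True
  have "D X (\<lambda>h. \<Sum>k<n. cnj (r h k i) * r h k j) un =
      (\<Sum>k<n. cnj (dr r X k i) * r un k j + cnj (r un k i) * dr r X k j)"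
    by (simp add: D_sum[OF X] CC_mult CC_cnj r_CC D_mult[OF X CC_cnj[OF r_CC] r_CC] D_cnj[OF X r_CC] dr_def)
  moreover have "(\<lambda>h. \<Sum>k<n. cnj (r h k i) * r h k j) = (\<lambda>h. idm n i j)"
  proof (rule ext)
    fix h
    show "(\<Sum>k<n. cnj (r h k i) * r h k j) = idm n i j"
      using fun_cong[OF fun_cong[OF r_unitary[of h], of i], of j] by (simp add: mm_def adj_def)
  qed
  moreover have "(\<Sum>k<n. cnj (dr r X k i) * r un k j + cnj (r un k i) * dr r X k j) = cnj (dr r X j i) + dr r X i j"
    using True
    by (simp add: r_un idm_def sum.distrib if_distrib[of "\<lambda>z. _ * z"] if_distrib[of "\<lambda>z. z * _"] if_distrib[of cnj] cong: if_cong)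
  ultimately show ?thesis by (simp add: D_const[OF X] eq_neg_iff_add_eq_0)
next
  case False
  then show ?thesis using dr_mats[OF X] by (auto simp: mats_def not_less)
qed

text \<open>The inverse stands on the left because \<open>Ad h\<close> is the adjoint action of the
  inverse of \<open>h\<close>.\<close>

lemma dr_Ad:
  assumes X: "X \<in> L"
  shows "dr r (Ad h X) = mm n (r (iv h)) (mm n (dr r X) (r h))"
proof (intro ext)
  fix i j
  have "dr r (Ad h X) i j = D X (\<lambda>k. \<Sum>l<n. r h l j * r k i l) (iv h)"
    by (simp add: dr_def D_Ad r_mul mm_def mult.commute)
  also have "\<dots> = (\<Sum>l<n. r h l j * mm n (r (iv h)) (dr r X) i l)"
    by (simp add: D_row[OF X] D_entry[OF X])
  also have "\<dots> = mm n (mm n (r (iv h)) (dr r X)) (r h) i j"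
    by (simp add: mm_def[of n _ "r h"] mult.commute)
  finally show "dr r (Ad h X) i j = mm n (r (iv h)) (mm n (dr r X) (r h)) i j" by (simp add: mm_assoc)
qed

end

text \<open>The entries of the intertwining relation are linear in the entries of the two
  representations, so the relation can be differentiated at the identity.\<close>

lemma dr_intertwine:
  assumes P: "urep N P" and r: "urep n r" and X: "X \<in> L"
    and T: "\<And>h. mm N (P h) T = mm n T (r h)"
  shows "mm N (dr P X) T = mm n T (dr r X)"
proof (intro ext)
  fix i j
  have "mm N (dr P X) T i j = D X (\<lambda>h. mm N (P h) T i j) un"
    using D_row[OF P X, where m = N and c = "\<lambda>k. T k j" and f = "\<lambda>_. i" and q = "\<lambda>k. k" and x = un] by (simp add: mm_def dr_def mult.commute)
  also have "\<dots> = mm n T (dr r X) i j"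
    unfolding T using D_row[OF r X, where m = n and c = "\<lambda>k. T i k" and f = "\<lambda>k. k" and q = "\<lambda>_. j" and x = un] by (simp add: mm_def dr_def)
  finally show "mm N (dr P X) T i j = mm n T (dr r X) i j" .
qed

text \<open>Over the complex numbers \<open>M\<close> has an eigenvalue, found among library
  matrices. Its eigenspace is invariant and nonzero, hence the whole space.\<close>

lemma schur:
  assumes r: "urep n r" and irr: "irr n r" and n: "n > 0" and M: "M \<in> mats n n"
    and comm: "\<And>h. mm n (r h) M = mm n M (r h)"
  shows "\<exists>\<mu>. M = (\<lambda>i j. \<mu> * idm n i j)"
proof -
  define J where "J = Matrix.mat n n (\<lambda>(i, j). M i j)"
  have J: "J \<in> carrier_mat n n" by (simp add: J_def)
  obtain \<mu> where "eigenvalue J \<mu>"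
    using spectrum_non_empty[OF J] n unfolding spectrum_def by auto
  then obtain w where w: "w \<in> carrier_vec n" "w \<noteq> 0\<^sub>v n" "J *\<^sub>v w = \<mu> \<cdot>\<^sub>v w"
    using J unfolding eigenvalue_def eigenvector_def by auto
  define w' where "w' = (\<lambda>i. if i < n then vec_index w i else 0)"
  define W where "W = {v \<in> vecs n. mv n M v = (\<lambda>i. \<mu> * v i)}"
  have W: "csub n W" unfolding csub_def
  proof (intro conjI ballI allI)
    show "W \<subseteq> vecs n" by (auto simp: W_def)
    show "0 \<in> W" by (simp add: W_def vecs_def mv_def)
    fix v assume v: "v \<in> W"
    show "(\<lambda>i. c * v i) \<in> W" for c
      using v unfolding W_def mem_Collect_eq mv_scale by (simp add: vecs_def mult.left_commute)
    fix w assume w: "w \<in> W"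
    show "v + w \<in> W"
      using v w unfolding W_def mem_Collect_eq mv_add by (simp add: vecs_def distrib_left plus_fun_def)
  qed
  have "\<forall>h. \<forall>v\<in>W. mv n (r h) v \<in> W"
  proof (intro allI ballI)
    fix h v assume v: "v \<in> W"
    have "mv n M (mv n (r h) v) = mv n (r h) (mv n M v)" by (simp add: mv_mm[symmetric] comm)
    also have "\<dots> = (\<lambda>i. \<mu> * mv n (r h) v i)" using v by (simp add: W_def mv_scale)
    finally show "mv n (r h) v \<in> W" using mv_vecs[OF r_mats[OF r]] by (simp add: W_def)
  qed
  with irr W have "W = {0} \<or> W = vecs n" unfolding irr_def by blast
  moreover have "w' \<in> W"
  proof -
    have "mv n M w' i = \<mu> * w' i" for i
    proof (cases "i < n")
      case True
      have "vec_index (J *\<^sub>v w) i = \<mu> * vec_index w i" using w(1,3) True by simp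
      then show ?thesis using True w(1)
        by (simp add: J_def scalar_prod_def lessThan_atLeast0 mv_def w'_def)
    next
      case False
      then show ?thesis using M by (simp add: mv_def w'_def mats_def)
    qed
    then show ?thesis by (simp add: W_def vecs_def w'_def fun_eq_iff)
  qed
  moreover have "w' \<noteq> 0"
  proof
    assume "w' = 0"
    then have "w' i = 0" for i by simp
    then have "vec_index w i = 0" if "i < n" for i using that unfolding w'_def by metis
    then have "w = 0\<^sub>v n" using w(1) by (intro eq_vecI) auto
    with w(2) show False by simp
  qed
  ultimately have all: "W = vecs n" by blast
  have "M i j = \<mu> * idm n i j" if "i < n" "j < n" for i j
  proof -
    have "(\<lambda>k. if k = j then 1 else 0) \<in> W" unfolding all using that by (simp add: vecs_def)
    then have "mv n M (\<lambda>k. if k = j then 1 else 0) i = \<mu> * (if i = j then 1 else 0)" by (simp add: W_def)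
    then show ?thesis using that by (simp add: mv_def idm_def if_distrib[of "\<lambda>z. _ * z"] cong: if_cong)
  qed
  then have "M = (\<lambda>i j. \<mu> * idm n i j)"
    by (intro mats_eqI[OF M]) (auto simp: mats_def idm_def)
  then show ?thesis ..
qed

text \<open>Because the projection commutes with \<open>P\<close>, it can be moved past
  \<open>P h\<close> and absorbed into \<open>T\<close>; the compression to the columns of
  \<open>T\<close> is then multiplicative and unitary, and \<open>T\<close> intertwines.\<close>

lemma subrep:
  assumes P: "urep N P" and T: "isometry N m T"
    and comm: "\<And>h. mm N (P h) (mm m T (adj T)) = mm N (mm m T (adj T)) (P h)"
  defines "r \<equiv> \<lambda>h. mm N (adj T) (mm N (P h) T)"
  shows "urep m r" and "\<And>h. mm N (P h) T = mm m T (r h)"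
proof -
  have Tm: "T \<in> mats N m" and TT: "mm N (adj T) T = idm m" using T by (auto simp: isometry_def)
  show int: "mm N (P h) T = mm m T (r h)" for h
  proof -
    have "mm m T (r h) = mm N (mm N (mm m T (adj T)) (P h)) T" by (simp add: r_def mm_assoc)
    also have "\<dots> = mm N (mm N (P h) (mm m T (adj T))) T" by (simp only: comm)
    also have "\<dots> = mm N (P h) (mm m T (mm N (adj T) T))" by (simp add: mm_assoc)
    also have "\<dots> = mm N (P h) T" by (simp only: TT mm_idm_right[OF Tm])
    finally show ?thesis by simp
  qed
  have rT: "mm N (mm N (adj T) (P h)) T = r h" for h by (simp add: r_def mm_assoc)
  show "urep m r" unfolding urep_def
  proof (intro conjI allI impI)
    show "r h \<in> mats m m" for h
      unfolding r_def by (rule mm_mats[OF adj_mats[OF Tm] mm_mats[OF r_mats[OF P] Tm]])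
    show "r (h \<cdot> k) = mm m (r h) (r k)" for h k
    proof -
      have "r (h \<cdot> k) = mm N (mm N (adj T) (P h)) (mm N (P k) T)" by (simp add: r_def r_mul[OF P] mm_assoc)
      also have "\<dots> = mm m (mm N (mm N (adj T) (P h)) T) (r k)"
        unfolding int[of k] by (simp only: mm_assoc)
      finally show ?thesis by (simp only: rT)
    qed
    show "mm m (adj (r h)) (r h) = idm m" for h
    proof -
      have "adj (r h) = mm N (mm N (adj T) (adj (P h))) T" by (simp add: r_def adj_mm mm_assoc)
      then have "mm m (adj (r h)) (r h) = mm N (mm N (adj T) (adj (P h))) (mm N (P h) T)"
        by (simp only: int mm_assoc)
      also have "\<dots> = mm N (adj T) (mm N (mm N (adj (P h)) (P h)) T)" by (simp add: mm_assoc)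
      also have "\<dots> = idm m" by (simp only: r_unitary[OF P] mm_idm_left[OF Tm] TT)
      finally show ?thesis .
    qed
    show "continuous_on UNIV (\<lambda>h. r h i j)" for i j
      unfolding r_def mm_def using P unfolding urep_def
      by (intro continuous_on_sum continuous_on_mult continuous_on_const) auto
  qed
qed

text \<open>The isometric intertwiner is kept in the definition, since the eigenvalue estimate needs
  a vector of the component inside the large space.\<close>

definition pieces :: "nat \<Rightarrow> ('g \<Rightarrow> cmatrix) \<Rightarrow> ('g \<Rightarrow> complex) set" where
  "pieces N P = {\<lambda>h. r h k l | r n k l. urep n r \<and> irr n r \<and> k < n \<and> l < n \<and>
    (\<exists>T. isometry N n T \<and> (\<forall>h. mm N (P h) T = mm n T (r h)))}"

lemma pieces_subrep:
  assumes T: "isometry N m T" and int: "\<And>h. mm N (P h) T = mm m T (r h)"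
  shows "pieces m r \<subseteq> pieces N P"
proof
  fix u assume "u \<in> pieces m r"
  then obtain s n k l S where u: "u = (\<lambda>h. s h k l)" "urep n s" "irr n s" "k < n" "l < n"
    and S: "isometry m n S" "\<And>h. mm m (r h) S = mm n S (s h)"
    unfolding pieces_def by blast
  have Tm: "T \<in> mats N m" "mm N (adj T) T = idm m" using T by (auto simp: isometry_def)
  have Sm: "S \<in> mats m n" "mm m (adj S) S = idm n" using S(1) by (auto simp: isometry_def)
  have "mm N (adj (mm m T S)) (mm m T S) = mm m (adj S) (mm m (mm N (adj T) T) S)"
    by (simp add: adj_mm mm_assoc)
  also have "\<dots> = idm n" by (simp only: Tm(2) mm_idm_left[OF Sm(1)] Sm(2))
  finally have "isometry N n (mm m T S)" unfolding isometry_def using mm_mats[OF Tm(1) Sm(1)] by simp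
  moreover have "mm N (P h) (mm m T S) = mm n (mm m T S) (s h)" for h
  proof -
    have "mm N (P h) (mm m T S) = mm m (mm N (P h) T) S" by (simp add: mm_assoc)
    also have "\<dots> = mm m T (mm m (r h) S)" by (simp only: int mm_assoc)
    also have "\<dots> = mm n (mm m T S) (s h)" by (simp only: S(2) mm_assoc)
    finally show ?thesis .
  qed
  ultimately show "u \<in> pieces N P" unfolding pieces_def using u by blast
qed

text \<open>Strong induction on the dimension: unless \<open>P\<close> is irreducible, an invariant
  subspace and its complement split it into two smaller unitary representations, whose pieces are
  pieces of \<open>P\<close>.\<close>

theorem complete_reducibility:
  assumes "urep N P" "i < N" "j < N"
  shows "(\<lambda>h. P h i j) \<in> fun_cvec.span (pieces N P)"
  using assms
proof (induction N arbitrary: P i j rule: less_induct)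
  case (less N)
  note P = less.prems(1)
  show ?case
  proof (cases "irr N P")
    case True
    have "isometry N N (idm N)" unfolding isometry_def using mm_idm_right[OF idm_mats] by (simp add: idm_mats)
    moreover have "mm N (P h) (idm N) = mm N (idm N) (P h)" for h
      using mm_idm_right[OF r_mats[OF P]] mm_idm_left[OF r_mats[OF P]] by simp
    ultimately have "(\<lambda>h. P h i j) \<in> pieces N P"
      unfolding pieces_def using True P less.prems(2,3) by blast
    then show ?thesis by (rule fun_cvec.span_base)
  next
    case False
    then obtain W where W: "csub N W" "\<And>h v. v \<in> W \<Longrightarrow> mv N (P h) v \<in> W" "W \<noteq> {0}" "W \<noteq> vecs N"
      unfolding irr_def by blast
    obtain m1 m2 T1 T2 where T1: "isometry N m1 T1" and T2: "isometry N m2 T2"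
      and sum: "mm m1 T1 (adj T1) + mm m2 T2 (adj T2) = idm N" and m: "m1 + m2 = N"
      and fixW: "\<And>v. v \<in> W \<Longrightarrow> mv N (mm m1 T1 (adj T1)) v = v" and ran: "\<And>w. mv m1 T1 w \<in> W"
      using orthogonal_decomposition[OF W(1)] by blast
    let ?P1 = "mm m1 T1 (adj T1)" and ?P2 = "mm m2 T2 (adj T2)"
    have Tm: "T1 \<in> mats N m1" "T2 \<in> mats N m2" using T1 T2 by (auto simp: isometry_def)
    have "m1 \<noteq> 0"
    proof
      assume "m1 = 0"
      then have "mv N ?P1 v = 0" for v by (simp add: mm_def mv_def fun_eq_iff)
      then have "W \<subseteq> {0}" using fixW by force
      then show False using W(1,3) unfolding csub_def by blast
    qed
    moreover have "m2 \<noteq> 0"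
    proof
      assume "m2 = 0"
      then have "?P2 = 0" by (simp add: mm_def fun_eq_iff)
      then have "?P1 = idm N" using sum by simp
      then have "v \<in> W" if "v \<in> vecs N" for v
        using mv_idm[OF that] ran[of "mv N (adj T1) v"] by (simp add: mv_mm[symmetric])
      then show False using W(1,4) unfolding csub_def by blast
    qed
    ultimately have lt: "m1 < N" "m2 < N" using m by auto
    \<comment> \<open>\<open>P h\<close> maps the columns of \<open>T1\<close>, which lie in
      \<open>W\<close>, into \<open>W\<close>, and there \<open>?P1\<close> acts as the
      identity.\<close>
    have PT: "mm N ?P1 (mm N (P h) T1) = mm N (P h) T1" for h
    proof (intro ext)
      fix a b
      show "mm N ?P1 (mm N (P h) T1) a b = mm N (P h) T1 a b"
      proof (cases "b < m1")
        case True
        have "mv m1 T1 (\<lambda>k. if k = b then 1 else 0) = (\<lambda>i. T1 i b)"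
          using True by (simp add: mv_def if_distrib[of "\<lambda>z. _ * z"] cong: if_cong)
        then have "mv N (P h) (\<lambda>i. T1 i b) \<in> W" using W(2)[OF ran] by metis
        from fun_cong[OF fixW[OF this], of a] show ?thesis by (simp add: mv_def mm_def)
      next
        case False
        then show ?thesis using Tm(1) by (simp add: mm_def mats_def)
      qed
    qed
    have a1: "mm N ?P1 (mm N (P h) ?P1) = mm N (P h) ?P1" for h
      using arg_cong[OF PT[of h], of "\<lambda>M. mm m1 M (adj T1)"] by (simp add: mm_assoc)
    have adjP1: "adj ?P1 = ?P1" by (simp add: adj_mm)
    \<comment> \<open>Unitarity enters here: the adjoint of the relation \<open>a1\<close> at
      \<open>iv h\<close> says that the complement of \<open>W\<close> is invariant too. Together
      with \<open>a1\<close> it makes the projection commute with \<open>P h\<close>.\<close>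
    have "mm N (mm N ?P1 (P h)) ?P1 = mm N ?P1 (P h)" for h
      using arg_cong[OF a1[of "iv h"], of adj] r_iv[OF P, of h] by (simp add: adj_mm adjP1)
    then have c1: "mm N (P h) ?P1 = mm N ?P1 (P h)" for h
      using a1[of h] by (simp add: mm_assoc)
    have c2: "mm N (P h) ?P2 = mm N ?P2 (P h)" for h
    proof -
      have "mm N (P h) ?P1 + mm N (P h) ?P2 = mm N ?P1 (P h) + mm N ?P2 (P h)"
        unfolding mm_add_left[symmetric] mm_add_right[symmetric] sum
        by (simp only: mm_idm_right[OF r_mats[OF P]] mm_idm_left[OF r_mats[OF P]])
      then show ?thesis using c1 by simp
    qed
    define r1 where "r1 h = mm N (adj T1) (mm N (P h) T1)" for h
    define r2 where "r2 h = mm N (adj T2) (mm N (P h) T2)" for h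
    note s1 = subrep[OF P T1 c1, folded r1_def] and s2 = subrep[OF P T2 c2, folded r2_def]
    have in_span: "(\<lambda>h. r h k l) \<in> fun_cvec.span (pieces N P)"
      if "urep m r" "isometry N m T" "\<And>h. mm N (P h) T = mm m T (r h)" "m < N" "k < m" "l < m" for r m T k l
      by (rule subsetD[OF fun_cvec.span_mono[OF pieces_subrep[OF that(2,3)]] less.IH[OF that(4,1,5,6)]])
    have part: "(\<lambda>h. mm N (P h) (mm m T (adj T)) i j) \<in> fun_cvec.span (pieces N P)"
      if r: "urep m r" and T: "isometry N m T" "\<And>h. mm N (P h) T = mm m T (r h)" "m < N" for r m T
    proof -
      have "mm N (P h) (mm m T (adj T)) i j = (\<Sum>k<m. \<Sum>l<m. (T i l * adj T k j) * r h l k)" for h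
      proof -
        have "mm N (P h) (mm m T (adj T)) i j = mm m (mm m T (r h)) (adj T) i j"
          by (simp only: mm_assoc[symmetric] T(2))
        also have "\<dots> = (\<Sum>k<m. \<Sum>l<m. (T i l * adj T k j) * r h l k)"
          unfolding mm_def sum_distrib_right by (simp add: mult_ac)
        finally show ?thesis .
      qed
      then have eq: "(\<lambda>h. mm N (P h) (mm m T (adj T)) i j) = (\<Sum>k<m. \<Sum>l<m. (\<lambda>h. (T i l * adj T k j) * r h l k))"
        by (intro ext) (simp add: sum_apply)
      show ?thesis unfolding eq
        by (intro fun_cvec.span_sum fun_cvec.span_scale in_span[OF r T]) auto
    qed
    have "(\<lambda>h. P h i j) = (\<lambda>h. mm N (P h) ?P1 i j) + (\<lambda>h. mm N (P h) ?P2 i j)"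
    proof (rule ext)
      fix h
      have "P h = mm N (P h) (?P1 + ?P2)" unfolding sum by (rule mm_idm_right[OF r_mats[OF P], symmetric])
      then have "P h i j = (mm N (P h) ?P1 + mm N (P h) ?P2) i j" by (simp only: mm_add_right)
      then show "P h i j = ((\<lambda>h. mm N (P h) ?P1 i j) + (\<lambda>h. mm N (P h) ?P2 i j)) h" by simp
    qed
    then show ?thesis
      using fun_cvec.span_add[OF part[OF s1(1) T1 s1(2) lt(1)] part[OF s2(1) T2 s2(2) lt(2)]] by metis
  qed
qed

section \<open>Tensor products\<close>

definition kron :: "nat \<Rightarrow> ('g \<Rightarrow> cmatrix) \<Rightarrow> ('g \<Rightarrow> cmatrix) \<Rightarrow> ('g \<Rightarrow> cmatrix)" where
  "kron m r s h = (\<lambda>p q. r h (p div m) (q div m) * s h (p mod m) (q mod m))"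

lemma idm_kron: "m > 0 \<Longrightarrow> idm n (p div m) (q div m) * idm m (p mod m) (q mod m) = idm (n * m) p q"
  by (auto simp: idm_def less_mult_imp_div_less div_less_iff_less_mult) (metis div_mult_mod_eq)+

lemma kron_urep:
  assumes r: "urep n r" and s: "urep m s" and m: "m > 0"
  shows "urep (n * m) (kron m r s)"
  unfolding urep_def
proof (intro conjI allI impI)
  show "kron m r s h \<in> mats (n * m) (n * m)" for h
    using r_mats[OF r, of h] m by (auto simp: mats_def kron_def less_eq_div_iff_mult_less_eq)
  \<comment> \<open>The mixed-product rule for Kronecker products, from which multiplicativity and
    unitarity both follow.\<close>
  have prod: "mm (n * m) (\<lambda>p q. a (p div m) (q div m) * b (p mod m) (q mod m))
      (\<lambda>p q. c (p div m) (q div m) * d (p mod m) (q mod m)) =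
      (\<lambda>p q. mm n a c (p div m) (q div m) * mm m b d (p mod m) (q mod m))" for a b c d
  proof (intro ext)
    fix p q
    have "mm (n * m) (\<lambda>p q. a (p div m) (q div m) * b (p mod m) (q mod m))
      (\<lambda>p q. c (p div m) (q div m) * d (p mod m) (q mod m)) p q =
      (\<Sum>i<n. \<Sum>j<m. (a (p div m) i * b (p mod m) j) * (c i (q div m) * d j (q mod m)))"
      unfolding mm_def
      by (rule sum_div_mod[of "\<lambda>i j. (a (p div m) i * b (p mod m) j) * (c i (q div m) * d j (q mod m))"])
    also have "\<dots> = mm n a c (p div m) (q div m) * mm m b d (p mod m) (q mod m)"
      by (simp add: mm_def sum_product mult_ac)
    finally show "mm (n * m) (\<lambda>p q. a (p div m) (q div m) * b (p mod m) (q mod m))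
      (\<lambda>p q. c (p div m) (q div m) * d (p mod m) (q mod m)) p q =
      mm n a c (p div m) (q div m) * mm m b d (p mod m) (q mod m)" .
  qed
  show "kron m r s (h \<cdot> k) = mm (n * m) (kron m r s h) (kron m r s k)" for h k
    unfolding kron_def prod by (simp add: r_mul[OF r] r_mul[OF s])
  show "mm (n * m) (adj (kron m r s h)) (kron m r s h) = idm (n * m)" for h
  proof -
    have "adj (kron m r s h) = (\<lambda>p q. adj (r h) (p div m) (q div m) * adj (s h) (p mod m) (q mod m))"
      by (simp add: adj_def kron_def)
    then show ?thesis
      by (simp add: kron_def prod r_unitary[OF r] r_unitary[OF s] idm_kron[OF m])
  qed
  show "continuous_on UNIV (\<lambda>h. kron m r s h p q)" if "p < n * m" "q < n * m" for p q
    unfolding kron_def using r s that m unfolding urep_def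
    by (intro continuous_on_mult) (auto simp: less_mult_imp_div_less)
qed

text \<open>The Leibniz rule at the identity, where both factors are identity matrices:
  \<open>d\<pi> X \<otimes> 1 + 1 \<otimes> d\<rho> X\<close>.\<close>

lemma dr_kron:
  assumes r: "urep n r" and s: "urep m s" and X: "X \<in> L"
  shows "dr (kron m r s) X p q = dr r X (p div m) (q div m) * idm m (p mod m) (q mod m) +
    idm n (p div m) (q div m) * dr s X (p mod m) (q mod m)"
  by (simp add: dr_def kron_def D_mult[OF X r_CC[OF r] r_CC[OF s]] r_un[OF r] r_un[OF s])

end

section \<open>Casimir eigenvalues\<close>

context compact_semisimple
begin

lemma complex_laplacian_eq: "complex_laplacian G u x = (\<Sum>X\<in>Fr. D X (D X u) x)"
  by (simp add: complex_laplacian_def laplacian_eq D_def complex_eq_iff)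

definition casimir :: "nat \<Rightarrow> ('g \<Rightarrow> cmatrix) \<Rightarrow> cmatrix" where
  "casimir n r = (\<lambda>i j. \<Sum>X\<in>Fr. mm n (dr r X) (dr r X) i j)"

text \<open>The quadratic form of minus the Casimir operator, written as a sum of squares so that
  the triangle inequality can be applied to it.\<close>

definition energy :: "nat \<Rightarrow> ('g \<Rightarrow> cmatrix) \<Rightarrow> (nat \<Rightarrow> complex) \<Rightarrow> real" where
  "energy n r v = (\<Sum>X\<in>Fr. \<Sum>p<n. (cmod (mv n (dr r X) v p))\<^sup>2)"

text \<open>Energy at the first basis vector makes the number real and nonnegative by construction;
  that it is the eigenvalue is the content of \<open>casimir_irr\<close>.\<close>

definition lam :: "nat \<Rightarrow> ('g \<Rightarrow> cmatrix) \<Rightarrow> real" where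
  "lam n r = energy n r (\<lambda>i. if i = 0 then 1 else 0)"

text \<open>Summing over the frame moved by \<open>Ad h\<close> leaves the Casimir operator
  unchanged, whereas by \<open>dr_Ad\<close> it conjugates every summand with
  \<open>r h\<close>.\<close>

lemma casimir_commute:
  assumes r: "urep n r"
  shows "mm n (r h) (casimir n r) = mm n (casimir n r) (r h)"
proof -
  have one: "mm n (r h) (r (iv h)) = idm n" using r_mul[OF r, of h "iv h"] r_un[OF r] by simp
  have casimir_eq: "casimir n r i j = mm n (r (iv h)) (mm n (casimir n r) (r h)) i j" for i j
  proof -
    define \<theta> where "\<theta> X Y = mm n (dr r X) (dr r Y) i j" for X Y
    have "(\<Sum>X\<in>Ad h ` Fr. \<theta> X X) = (\<Sum>X\<in>Fr. \<theta> X X)"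
    proof (rule frame_independence[OF frame_Ad, where \<theta> = \<theta>])
      fix X and c :: "(('g \<Rightarrow> real) \<Rightarrow> ('g \<Rightarrow> real)) \<Rightarrow> real"
      show "\<theta> (\<Sum>e\<in>Fr. c e *\<^sub>R e) X = (\<Sum>e\<in>Fr. c e * \<theta> e X)"
        unfolding \<theta>_def mm_def dr_combination sum_distrib_right sum_distrib_left
        by (subst sum.swap) (simp add: mult.assoc)
      show "\<theta> X (\<Sum>e\<in>Fr. c e *\<^sub>R e) = (\<Sum>e\<in>Fr. c e * \<theta> X e)"
        unfolding \<theta>_def mm_def dr_combination sum_distrib_right sum_distrib_left
        by (subst sum.swap) (simp add: mult_ac)
    qed
    moreover have "(\<Sum>X\<in>Ad h ` Fr. \<theta> X X) = (\<Sum>X\<in>Fr. \<theta> (Ad h X) (Ad h X))"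
      by (simp add: sum.reindex[OF Ad_inj])
    moreover have "\<theta> (Ad h X) (Ad h X) = mm n (r (iv h)) (mm n (mm n (dr r X) (dr r X)) (r h)) i j"
      if X: "X \<in> Fr" for X
    proof -
      have "mm n (dr r (Ad h X)) (dr r (Ad h X)) =
          mm n (r (iv h)) (mm n (dr r X) (mm n (mm n (r h) (r (iv h))) (mm n (dr r X) (r h))))"
        by (simp add: dr_Ad[OF r Fr(2)[OF X]] mm_assoc)
      also have "\<dots> = mm n (r (iv h)) (mm n (dr r X) (mm n (dr r X) (r h)))"
        by (simp only: one mm_idm_left[OF mm_mats[OF dr_mats[OF r Fr(2)[OF X]] r_mats[OF r]]])
      finally show ?thesis by (simp add: \<theta>_def mm_assoc)
    qed
    ultimately have "casimir n r i j = (\<Sum>X\<in>Fr. mm n (r (iv h)) (mm n (mm n (dr r X) (dr r X)) (r h)) i j)"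
      by (simp add: casimir_def \<theta>_def)
    also have "\<dots> = mm n (r (iv h)) (mm n (casimir n r) (r h)) i j"
    proof -
      have 1: "mm n (casimir n r) (r h) = (\<lambda>a b. \<Sum>X\<in>Fr. mm n (mm n (dr r X) (dr r X)) (r h) a b)"
        by (intro ext) (unfold mm_def[of n _ "r h"] casimir_def sum_distrib_right, rule sum.swap)
      show ?thesis unfolding 1 mm_def[of n "r (iv h)"] sum_distrib_left by (rule sum.swap)
    qed
    finally show ?thesis .
  qed
  have "casimir n r \<in> mats n n"
    unfolding casimir_def mats_def using mm_mats[OF dr_mats[OF r Fr(2)] dr_mats[OF r Fr(2)]]
    by (auto simp: mats_def intro!: sum.neutral)
  have "mm n (r h) (casimir n r) = mm n (r h) (mm n (r (iv h)) (mm n (casimir n r) (r h)))"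
    using casimir_eq by (metis ext)
  also have "\<dots> = mm n (mm n (r h) (r (iv h))) (mm n (casimir n r) (r h))" by (simp add: mm_assoc)
  also have "\<dots> = mm n (casimir n r) (r h)"
    by (simp only: one mm_idm_left[OF mm_mats[OF \<open>casimir n r \<in> mats n n\<close> r_mats[OF r]]])
  finally show ?thesis .
qed

lemma casimir_mats: "urep n r \<Longrightarrow> casimir n r \<in> mats n n"
  unfolding casimir_def mats_def using mm_mats[OF dr_mats[OF _ Fr(2)] dr_mats[OF _ Fr(2)]]
  by (auto simp: mats_def intro!: sum.neutral)

text \<open>Each \<open>dr r X\<close> is skew-Hermitian, so one factor of the squared norm moves
  across the inner product with a sign.\<close>

lemma energy_casimir:
  assumes r: "urep n r"
  shows "complex_of_real (energy n r v) = - (\<Sum>p<n. cnj (v p) * mv n (casimir n r) v p)"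
proof -
  have "complex_of_real (\<Sum>p<n. (cmod (mv n (dr r X) v p))\<^sup>2) = - (\<Sum>p<n. cnj (v p) * mv n (mm n (dr r X) (dr r X)) v p)"
    if X: "X \<in> Fr" for X
  proof -
    let ?w = "mv n (dr r X) v"
    have "complex_of_real (\<Sum>p<n. (cmod (?w p))\<^sup>2) = (\<Sum>p<n. cnj (?w p) * ?w p)"
      by (simp only: of_real_sum cmod_sq)
    also have "\<dots> = (\<Sum>p<n. \<Sum>q<n. cnj (v q) * cnj (dr r X p q) * ?w p)"
      by (simp only: cnj_mv_mult)
    also have "\<dots> = - (\<Sum>q<n. \<Sum>p<n. cnj (v q) * dr r X q p * ?w p)"
      unfolding dr_skew[OF r Fr(2)[OF X]] by (subst sum.swap) (simp add: sum_negf)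
    also have "(\<Sum>q<n. \<Sum>p<n. cnj (v q) * dr r X q p * ?w p) = (\<Sum>q<n. cnj (v q) * mv n (dr r X) ?w q)"
      by (simp add: mv_def[of n _ ?w] sum_distrib_left mult.assoc)
    finally show ?thesis by (simp add: mv_mm)
  qed
  then have "complex_of_real (energy n r v) = - (\<Sum>X\<in>Fr. \<Sum>p<n. cnj (v p) * mv n (mm n (dr r X) (dr r X)) v p)"
    by (simp add: energy_def sum_negf)
  also have "(\<Sum>X\<in>Fr. \<Sum>p<n. cnj (v p) * mv n (mm n (dr r X) (dr r X)) v p) = (\<Sum>p<n. cnj (v p) * mv n (casimir n r) v p)"
  proof -
    have "mv n (casimir n r) v p = (\<Sum>X\<in>Fr. mv n (mm n (dr r X) (dr r X)) v p)" for p
      unfolding mv_def casimir_def sum_distrib_right by (rule sum.swap)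
    then show ?thesis unfolding sum_distrib_left by (simp add: sum_distrib_left) (rule sum.swap)
  qed
  finally show ?thesis .
qed

lemma casimir_irr:
  assumes r: "urep n r" and irr: "irr n r" and n: "n > 0"
  shows "casimir n r = (\<lambda>i j. - complex_of_real (lam n r) * idm n i j)"
proof -
  obtain \<mu> where \<mu>: "casimir n r = (\<lambda>i j. \<mu> * idm n i j)"
    using schur[OF r irr n casimir_mats[OF r] casimir_commute[OF r]] by blast
  have "complex_of_real (lam n r) = - \<mu>"
    unfolding lam_def energy_casimir[OF r] \<mu> using n
    by (simp add: mv_def idm_def if_distrib[of cnj] if_distrib[of "\<lambda>z. _ * z"] if_distrib[of "\<lambda>z. z * _"] cong: if_cong)
  then show ?thesis using \<mu> by (simp add: minus_equation_iff)
qed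

text \<open>The Casimir operator is a scalar, so its quadratic form sees nothing of \<open>v\<close>
  but the norm. The tensor estimate relies on this to ignore how the vector sits in the
  product.\<close>

lemma energy_irr:
  assumes r: "urep n r" and irr: "irr n r" and n: "n > 0"
  shows "energy n r v = lam n r * (\<Sum>p<n. (cmod (v p))\<^sup>2)"
proof -
  have "mv n (casimir n r) v p = - complex_of_real (lam n r) * v p" if "p < n" for p
    unfolding casimir_irr[OF r irr n] using that
    by (simp add: sum_negf mv_def idm_def if_distrib[of "\<lambda>z. _ * z"] if_distrib[of "\<lambda>z. z * _"] cong: if_cong)
  then have "complex_of_real (energy n r v) = complex_of_real (lam n r * (\<Sum>p<n. (cmod (v p))\<^sup>2))"
    unfolding energy_casimir[OF r] of_real_mult of_real_sum cmod_sq by (simp add: sum_distrib_left sum_negf mult_ac)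
  then show ?thesis by (simp only: of_real_eq_iff)
qed

lemma isometry_norm:
  assumes "isometry N n T"
  shows "(\<Sum>p<N. (cmod (mv n T w p))\<^sup>2) = (\<Sum>k<n. (cmod (w k))\<^sup>2)"
proof -
  have "complex_of_real (\<Sum>p<N. (cmod (mv n T w p))\<^sup>2) = (\<Sum>p<N. cnj (mv n T w p) * mv n T w p)"
    by (simp only: of_real_sum cmod_sq)
  also have "\<dots> = (\<Sum>p<N. \<Sum>k<n. cnj (w k) * (adj T k p * mv n T w p))"
    by (simp only: cnj_mv_mult adj_def mult.assoc)
  also have "\<dots> = (\<Sum>k<n. cnj (w k) * mv N (adj T) (mv n T w) k)"
    by (subst sum.swap) (simp add: mv_def[of N] sum_distrib_left)
  also have "\<dots> = (\<Sum>k<n. cnj (w k) * mv n (idm n) w k)"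
    using assms by (simp add: isometry_def flip: mv_mm)
  also have "\<dots> = (\<Sum>k<n. cnj (w k) * w k)"
    by (rule sum.cong) (auto simp: mv_def idm_def if_distrib[of "\<lambda>z. z * _"] cong: if_cong)
  also have "\<dots> = complex_of_real (\<Sum>k<n. (cmod (w k))\<^sup>2)"
    by (simp only: of_real_sum cmod_sq)
  finally show ?thesis by (simp only: of_real_eq_iff)
qed

text \<open>\<open>T\<close> carries \<open>dr r X\<close> to \<open>dr P X\<close> and preserves
  norms, so the summand of every frame vector is preserved.\<close>

lemma energy_intertwine:
  assumes P: "urep N P" and r: "urep n r" and T: "isometry N n T" "\<And>h. mm N (P h) T = mm n T (r h)"
  shows "energy N P (mv n T w) = energy n r w"
  unfolding energy_def
proof (rule sum.cong[OF refl])
  fix X assume X: "X \<in> Fr"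
  have "mv N (dr P X) (mv n T w) = mv n T (mv n (dr r X) w)"
    by (simp add: mv_mm[symmetric] dr_intertwine[OF P r Fr(2)[OF X] T(2)])
  then show "(\<Sum>p<N. (cmod (mv N (dr P X) (mv n T w) p))\<^sup>2) = (\<Sum>p<n. (cmod (mv n (dr r X) w p))\<^sup>2)"
    by (simp add: isometry_norm[OF T(1)])
qed

lemma unit_norm: "(n::nat) > 0 \<Longrightarrow> (\<Sum>k<n. (cmod (if k = 0 then 1 else 0))\<^sup>2) = 1"
proof -
  assume "n > 0"
  have "(\<Sum>k<n. (cmod (if k = 0 then 1 else 0))\<^sup>2) = (\<Sum>k<n. if k = 0 then 1 else 0)"
    by (rule sum.cong) auto
  also have "\<dots> = 1" using \<open>n > 0\<close> by (subst sum.delta) auto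
  finally show ?thesis .
qed

lemma lam_intertwine:
  assumes P: "urep N P" "irr N P" and r: "urep n r" and n: "n > 0" "N > 0"
    and T: "isometry N n T" "\<And>h. mm N (P h) T = mm n T (r h)"
  shows "lam n r = lam N P"
proof -
  let ?e = "\<lambda>i::nat. if i = 0 then 1 else (0::complex)"
  have "lam n r = energy N P (mv n T ?e)" unfolding lam_def by (rule energy_intertwine[OF P(1) r T, symmetric])
  also have "\<dots> = lam N P * (\<Sum>k<n. (cmod (?e k))\<^sup>2)"
    by (simp only: energy_irr[OF P n(2)] isometry_norm[OF T(1)])
  finally show ?thesis by (simp only: unit_norm[OF n(1)] mult_1_right)
qed

lemma laplacian_irr:
  assumes r: "urep n r" and irr: "irr n r" and n: "n > 0"
  shows "complex_laplacian G (\<lambda>h. r h i j) x = - complex_of_real (lam n r) * r x i j"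
proof -
  have "complex_laplacian G (\<lambda>h. r h i j) x = (\<Sum>X\<in>Fr. mm n (r x) (mm n (dr r X) (dr r X)) i j)"
    unfolding complex_laplacian_eq by (rule sum.cong) (auto simp: D_D_entry[OF r] Fr)
  also have "\<dots> = mm n (r x) (casimir n r) i j"
    unfolding mm_def[of n "r x"] casimir_def sum_distrib_left by (rule sum.swap)
  also have "\<dots> = - complex_of_real (lam n r) * mm n (r x) (idm n) i j"
    unfolding casimir_irr[OF r irr n] by (simp add: mm_def sum_distrib_left sum_negf mult_ac)
  finally show ?thesis by (simp only: mm_idm_right[OF r_mats[OF r]])
qed

lemma l2_triangle:
  fixes f g :: "'i \<Rightarrow> complex"
  shows "L2_set (\<lambda>i. cmod (f i + g i)) S \<le> L2_set (\<lambda>i. cmod (f i)) S + L2_set (\<lambda>i. cmod (g i)) S"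
  by (rule order_trans[OF L2_set_mono L2_set_triangle_ineq]) (auto intro: norm_triangle_ineq)

text \<open>On the tensor product a frame vector acts by \<open>\<alpha> + \<beta>\<close>, and the squares of \<open>\<alpha>\<close> and of \<open>\<beta>\<close>
  sum up to the two eigenvalues; the bounds are the triangle inequality in \<open>\<ell>\<^sup>2\<close>.\<close>

theorem tensor_eigenvalue:
  assumes r: "urep n r" "irr n r" "n > 0" and s: "urep m s" "irr m s" "m > 0"
    and t: "urep k t" "k > 0"
    and T: "isometry (n * m) k T" "\<And>h. mm (n * m) (kron m r s h) T = mm k T (t h)"
  shows "\<bar>sqrt (lam n r) - sqrt (lam m s)\<bar> \<le> sqrt (lam k t)"
    and "sqrt (lam k t) \<le> sqrt (lam n r) + sqrt (lam m s)"
proof -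
  let ?e = "\<lambda>i::nat. if i = 0 then 1 else (0::complex)"
  \<comment> \<open>A unit vector of the component, placed in the tensor product.\<close>
  define v where "v = mv k T ?e"
  have v1: "(\<Sum>p<n * m. (cmod (v p))\<^sup>2) = 1"
    unfolding v_def isometry_norm[OF T(1)] by (rule unit_norm[OF t(2)])
  \<comment> \<open>The same vector as an \<open>n\<close> by \<open>m\<close> array. The first
    representation acts on its columns, which gives \<open>\<alpha>\<close>, and the second on its
    rows, which gives \<open>\<beta>\<close>.\<close>
  define V where "V i j = v (i * m + j)" for i j
  have vV: "v p = V (p div m) (p mod m)" for p by (simp add: V_def)
  define \<alpha> where "\<alpha> = (\<lambda>(X, p). mv n (dr r X) (\<lambda>i. V i (p mod m)) (p div m))"
  define \<beta> where "\<beta> = (\<lambda>(X, p). mv m (dr s X) (\<lambda>j. V (p div m) j) (p mod m))"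
  let ?S = "Fr \<times> {..<n * m}"
  have L2: "L2_set (\<lambda>z. cmod (f z)) ?S = sqrt (\<Sum>X\<in>Fr. \<Sum>p<n * m. (cmod (f (X, p)))\<^sup>2)" for f
    by (simp add: L2_set_def sum.cartesian_product split_beta)
  have Vsum: "(\<Sum>i<n. \<Sum>j<m. (cmod (V i j))\<^sup>2) = 1"
    using v1 unfolding vV sum_div_mod[of "\<lambda>i j. (cmod (V i j))\<^sup>2"] .
  \<comment> \<open>Summed over the frame, each column contributes \<open>lam n r\<close> times its
    squared norm, whether or not \<open>v\<close> is a pure tensor, and the squared norms of the
    columns add up to \<open>1\<close>.\<close>
  have A: "L2_set (\<lambda>z. cmod (\<alpha> z)) ?S = sqrt (lam n r)"
  proof -
    have "(\<Sum>X\<in>Fr. \<Sum>p<n * m. (cmod (\<alpha> (X, p)))\<^sup>2) =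
        (\<Sum>X\<in>Fr. \<Sum>i<n. \<Sum>j<m. (cmod (mv n (dr r X) (\<lambda>i. V i j) i))\<^sup>2)"
      unfolding \<alpha>_def prod.case
      by (rule sum.cong[OF refl]) (rule sum_div_mod[of "\<lambda>i j. (cmod (mv n (dr r _) (\<lambda>i. V i j) i))\<^sup>2"])
    also have "\<dots> = (\<Sum>j<m. energy n r (\<lambda>i. V i j))"
      unfolding energy_def
      by (subst (2) sum.swap) (simp add: sum.swap[of _ "{..<m}" "{..<n}"])
    also have "\<dots> = lam n r * (\<Sum>j<m. \<Sum>i<n. (cmod (V i j))\<^sup>2)"
      by (simp add: energy_irr[OF r] sum_distrib_left)
    also have "(\<Sum>j<m. \<Sum>i<n. (cmod (V i j))\<^sup>2) = 1" by (subst sum.swap) (rule Vsum)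
    finally show ?thesis by (simp add: L2)
  qed
  have B: "L2_set (\<lambda>z. cmod (\<beta> z)) ?S = sqrt (lam m s)"
  proof -
    have "(\<Sum>X\<in>Fr. \<Sum>p<n * m. (cmod (\<beta> (X, p)))\<^sup>2) =
        (\<Sum>X\<in>Fr. \<Sum>i<n. \<Sum>j<m. (cmod (mv m (dr s X) (\<lambda>j. V i j) j))\<^sup>2)"
      unfolding \<beta>_def prod.case
      by (rule sum.cong[OF refl]) (rule sum_div_mod[of "\<lambda>i j. (cmod (mv m (dr s _) (\<lambda>j. V i j) j))\<^sup>2"])
    also have "\<dots> = (\<Sum>i<n. energy m s (\<lambda>j. V i j))"
      unfolding energy_def by (rule sum.swap)
    also have "\<dots> = lam m s * (\<Sum>i<n. \<Sum>j<m. (cmod (V i j))\<^sup>2)"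
      by (simp add: energy_irr[OF s] sum_distrib_left)
    finally show ?thesis by (simp add: L2 Vsum)
  qed
  have AB: "L2_set (\<lambda>z. cmod (\<alpha> z + \<beta> z)) ?S = sqrt (lam k t)"
  proof -
    have "mv (n * m) (dr (kron m r s) X) v p = \<alpha> (X, p) + \<beta> (X, p)" if X: "X \<in> Fr" and p: "p < n * m" for X p
    proof -
      have pm: "p mod m < m" "p div m < n" using s(3) p by (auto simp: less_mult_imp_div_less)
      have "mv (n * m) (dr (kron m r s) X) v p = (\<Sum>i<n. \<Sum>j<m. (dr r X (p div m) i * idm m (p mod m) j +
          idm n (p div m) i * dr s X (p mod m) j) * V i j)"
        unfolding mv_def dr_kron[OF r(1) s(1) Fr(2)[OF X]] vV
        by (rule sum_div_mod[of "\<lambda>i j. (dr r X (p div m) i * idm m (p mod m) j + idm n (p div m) i * dr s X (p mod m) j) * V i j"])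
      also have "\<dots> = (\<Sum>i<n. \<Sum>j<m. idm m (p mod m) j * (dr r X (p div m) i * V i j)) +
          (\<Sum>i<n. idm n (p div m) i * (\<Sum>j<m. dr s X (p mod m) j * V i j))"
        by (simp add: algebra_simps sum.distrib sum_distrib_left)
      also have "\<dots> = \<alpha> (X, p) + \<beta> (X, p)"
        using pm by (simp add: \<alpha>_def \<beta>_def mv_def idm_def if_distrib[of "\<lambda>z. z * _"] cong: if_cong)
      finally show ?thesis .
    qed
    then have "(\<Sum>X\<in>Fr. \<Sum>p<n * m. (cmod (\<alpha> (X, p) + \<beta> (X, p)))\<^sup>2) = energy (n * m) (kron m r s) v"
      unfolding energy_def by (intro sum.cong refl) simp
    also have "\<dots> = lam k t" unfolding v_def lam_def
      by (rule energy_intertwine[OF kron_urep[OF r(1) s(1,3)] t(1) T])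
    finally show ?thesis using L2[of "\<lambda>z. \<alpha> z + \<beta> z"] by simp
  qed
  show "sqrt (lam k t) \<le> sqrt (lam n r) + sqrt (lam m s)"
    using l2_triangle[of \<alpha> \<beta> ?S] unfolding A B AB .
  \<comment> \<open>\<open>\<alpha>\<close> is recovered as
    \<open>(\<alpha> + \<beta>) + (- \<beta>)\<close>, and likewise \<open>\<beta>\<close>: together
    the reverse triangle inequality.\<close>
  have "sqrt (lam n r) \<le> sqrt (lam k t) + sqrt (lam m s)"
    using l2_triangle[of "\<lambda>z. \<alpha> z + \<beta> z" "\<lambda>z. - \<beta> z" ?S] by (simp add: A B AB)
  moreover have "sqrt (lam m s) \<le> sqrt (lam k t) + sqrt (lam n r)"
    using l2_triangle[of "\<lambda>z. \<alpha> z + \<beta> z" "\<lambda>z. - \<alpha> z" ?S] by (simp add: A B AB)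
  ultimately show "\<bar>sqrt (lam n r) - sqrt (lam m s)\<bar> \<le> sqrt (lam k t)" by simp
qed

end

section \<open>Products of matrix entries\<close>

definition entries :: "nat \<Rightarrow> ('g \<Rightarrow> complex mat) \<Rightarrow> ('g \<Rightarrow> cmatrix)" where
  "entries n \<pi> h = (\<lambda>i j. if i < n \<and> j < n then \<pi> h $$ (i, j) else 0)"

lemma mat_adjoint_index:
  fixes T :: "complex mat"
  assumes "T \<in> carrier_mat n n" "i < n" "j < n"
  shows "mat_adjoint T $$ (i, j) = cnj (T $$ (j, i))"
  using assms by (simp add: mat_adjoint_def mat_of_rows_def)

lemma mult_mat_index:
  assumes "M \<in> carrier_mat n n" "N \<in> carrier_mat n n" "i < n" "j < n"
  shows "(M * N) $$ (i, j) = (\<Sum>k<n. M $$ (i, k) * N $$ (k, j))"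
  using assms by (simp add: scalar_prod_def lessThan_atLeast0)

lemma unitary_mat_iff:
  assumes "T \<in> carrier_mat n n"
  shows "unitary_mat n T \<longleftrightarrow>
    (\<forall>i<n. \<forall>j<n. (\<Sum>k<n. cnj (T $$ (k, i)) * T $$ (k, j)) = (if i = j then 1 else 0))"
proof -
  have A: "mat_adjoint T \<in> carrier_mat n n" using assms by (simp add: mat_adjoint_def mat_of_rows_def)
  have "mat_adjoint T * T = 1\<^sub>m n \<longleftrightarrow> (\<forall>i<n. \<forall>j<n. (mat_adjoint T * T) $$ (i, j) = (1\<^sub>m n :: complex mat) $$ (i, j))"
    using A assms by (auto simp: mat_eq_iff)
  then show ?thesis using assms
    by (simp add: unitary_mat_def mult_mat_index[OF A assms] mat_adjoint_index[OF assms])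
qed

context compact_semisimple
begin

lemma unitary_rep_carrier: "unitary_rep G n \<pi> \<Longrightarrow> \<pi> h \<in> carrier_mat n n"
  by (simp add: unitary_rep_def unitary_mat_def)

lemma entries_urep:
  assumes \<pi>: "unitary_rep G n \<pi>"
  shows "urep n (entries n \<pi>)"
  unfolding urep_def
proof (intro conjI allI impI)
  note c = unitary_rep_carrier[OF \<pi>]
  show m: "entries n \<pi> h \<in> mats n n" for h by (auto simp: mats_def entries_def)
  show "entries n \<pi> (h \<cdot> k) = mm n (entries n \<pi> h) (entries n \<pi> k)" for h k
  proof (rule mats_eqI[OF m mm_mats[OF m m]])
    fix i j assume "i < n" "j < n"
    moreover have "\<pi> (h \<cdot> k) = \<pi> h * \<pi> k" using \<pi> by (simp add: unitary_rep_def)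
    ultimately show "entries n \<pi> (h \<cdot> k) i j = mm n (entries n \<pi> h) (entries n \<pi> k) i j"
      by (simp add: entries_def mm_def mult_mat_index[OF c c])
  qed
  show "mm n (adj (entries n \<pi> h)) (entries n \<pi> h) = idm n" for h
  proof (rule mats_eqI[OF mm_mats[OF adj_mats[OF m] m] idm_mats])
    fix i j assume "i < n" "j < n"
    moreover have "unitary_mat n (\<pi> h)" using \<pi> by (simp add: unitary_rep_def)
    ultimately show "mm n (adj (entries n \<pi> h)) (entries n \<pi> h) i j = idm n i j"
      unfolding unitary_mat_iff[OF c] by (simp add: entries_def mm_def adj_def idm_def)
  qed
  show "continuous_on UNIV (\<lambda>h. entries n \<pi> h i j)" if "i < n" "j < n" for i j
    using \<pi> that by (simp add: entries_def unitary_rep_def)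
qed

definition fvec :: "nat \<Rightarrow> complex Matrix.vec \<Rightarrow> (nat \<Rightarrow> complex)" where
  "fvec n v = (\<lambda>i. if i < n then vec_index v i else 0)"

lemma fvec_vec: "w \<in> vecs n \<Longrightarrow> fvec n (Matrix.vec n w) = w"
  by (auto simp: fvec_def vecs_def fun_eq_iff)

lemma vec_fvec: "v \<in> carrier_vec n \<Longrightarrow> Matrix.vec n (fvec n v) = v"
  by (intro eq_vecI) (auto simp: fvec_def)

lemma fvec_mult:
  assumes "M \<in> carrier_mat n n" "v \<in> carrier_vec n"
  shows "fvec n (M *\<^sub>v v) = mv n (\<lambda>i j. if i < n \<and> j < n then M $$ (i, j) else 0) (fvec n v)"
proof (rule ext)
  fix i
  show "fvec n (M *\<^sub>v v) i = mv n (\<lambda>i j. if i < n \<and> j < n then M $$ (i, j) else 0) (fvec n v) i"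
    using assms by (cases "i < n") (simp_all add: fvec_def mv_def scalar_prod_def lessThan_atLeast0)
qed

text \<open>Library vectors of size \<open>n\<close> correspond to index functions that vanish from
  \<open>n\<close> on, and under this correspondence invariant subspaces go over into invariant
  subspaces.\<close>

lemma irreducible_entries:
  assumes "\<pi> \<in> irreducible_unitary_reps G"
  obtains n where "n > 0" "unitary_rep G n \<pi>" "urep n (entries n \<pi>)" "irr n (entries n \<pi>)"
proof -
  obtain n where n: "n > 0" "unitary_rep G n \<pi>"
    and ir: "\<And>W. invariant_subspace n \<pi> W \<Longrightarrow> W = {0\<^sub>v n} \<or> W = carrier_vec n"
    using assms unfolding irreducible_unitary_reps_def by blast
  note c = unitary_rep_carrier[OF n(2)]
  have "irr n (entries n \<pi>)" unfolding irr_def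
  proof (intro allI impI)
    fix W assume W: "csub n W \<and> (\<forall>h. \<forall>v\<in>W. mv n (entries n \<pi> h) v \<in> W)"
    define W' where "W' = {v \<in> carrier_vec n. fvec n v \<in> W}"
    have "invariant_subspace n \<pi> W'" unfolding invariant_subspace_def
    proof (intro conjI ballI allI)
      show "W' \<subseteq> carrier_vec n" by (auto simp: W'_def)
      have "fvec n (0\<^sub>v n) = 0" by (auto simp: fvec_def)
      moreover have "0 \<in> W" using W unfolding csub_def by blast
      ultimately show "0\<^sub>v n \<in> W'" unfolding W'_def by (simp only: mem_Collect_eq) simp
      fix v assume v: "v \<in> W'"
      show "c \<cdot>\<^sub>v v \<in> W'" for c
      proof -
        have "fvec n (c \<cdot>\<^sub>v v) = (\<lambda>i. c * fvec n v i)" using v by (auto simp: fvec_def W'_def)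
        then show ?thesis using v csub_scale[OF conjunct1[OF W], of "fvec n v" c] by (simp add: W'_def)
      qed
      show "\<pi> h *\<^sub>v v \<in> W'" for h
        using v W fvec_mult[OF c, of v h] c[of h] by (auto simp: W'_def entries_def)
      fix w assume w: "w \<in> W'"
      have "fvec n (v + w) = fvec n v + fvec n w" using v w by (auto simp: fvec_def W'_def)
      then show "v + w \<in> W'" using v w csub_add[OF conjunct1[OF W], of "fvec n v" "fvec n w"]
        unfolding W'_def by (simp only: mem_Collect_eq) simp
    qed
    from ir[OF this] show "W = {0} \<or> W = vecs n"
    proof
      assume W': "W' = {0\<^sub>v n}"
      have "w = 0" if "w \<in> W" for w
      proof -
        have wv: "w \<in> vecs n" using W that unfolding csub_def by blast
        then have "Matrix.vec n w \<in> W'" using that by (simp add: W'_def fvec_vec)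
        then have "Matrix.vec n w = 0\<^sub>v n" using W' by simp
        then have "fvec n (Matrix.vec n w) = fvec n (0\<^sub>v n)" by simp
        then show ?thesis using wv by (simp add: fvec_vec) (auto simp: fvec_def)
      qed
      moreover have "0 \<in> W" using W unfolding csub_def by blast
      ultimately have "W = {0}" by blast
      then show ?thesis ..
    next
      assume W': "W' = carrier_vec n"
      have "w \<in> W" if "w \<in> vecs n" for w
      proof -
        have "Matrix.vec n w \<in> W'" using W' by simp
        then show ?thesis using that by (simp add: W'_def fvec_vec)
      qed
      moreover have "W \<subseteq> vecs n" using W unfolding csub_def by blast
      ultimately have "W = vecs n" by blast
      then show ?thesis ..
    qed
  qed
  then show ?thesis using that[OF n entries_urep[OF n(2)]] by blast
qed

text \<open>The way back: a component found by decomposing a tensor product is an index-function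
  representation and must become a library one before its class is an element of the dual.\<close>

lemma irreducible_of_urep:
  assumes r: "urep n r" and irr: "irr n r" and n: "n > 0"
  defines "\<pi> \<equiv> \<lambda>h. Matrix.mat n n (\<lambda>(i, j). r h i j)"
  shows "\<pi> \<in> irreducible_unitary_reps G" and "unitary_rep G n \<pi>" and "entries n \<pi> = r"
proof -
  have c: "\<pi> h \<in> carrier_mat n n" for h by (simp add: \<pi>_def)
  have ix: "\<pi> h $$ (i, j) = r h i j" if "i < n" "j < n" for h i j using that by (simp add: \<pi>_def)
  show e: "entries n \<pi> = r"
    by (intro ext) (use r_mats[OF r] in \<open>auto simp: entries_def ix mats_def not_less\<close>)
  show u: "unitary_rep G n \<pi>" unfolding unitary_rep_def
  proof (intro conjI allI impI)
    show "unitary_mat n (\<pi> h)" for h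
      unfolding unitary_mat_iff[OF c]
    proof (intro allI impI)
      fix i j assume "i < n" "j < n"
      then show "(\<Sum>k<n. cnj (\<pi> h $$ (k, i)) * \<pi> h $$ (k, j)) = (if i = j then 1 else 0)"
        using fun_cong[OF fun_cong[OF r_unitary[OF r, of h], of i], of j]
        by (simp add: ix mm_def adj_def idm_def)
    qed
    show "\<pi> (h \<cdot> k) = \<pi> h * \<pi> k" for h k
    proof (rule eq_matI)
      fix i j assume "i < dim_row (\<pi> h * \<pi> k)" "j < dim_col (\<pi> h * \<pi> k)"
      then have "i < n" "j < n" by (auto simp: \<pi>_def)
      then show "\<pi> (h \<cdot> k) $$ (i, j) = (\<pi> h * \<pi> k) $$ (i, j)"
        by (simp add: ix mult_mat_index[OF c c] r_mul[OF r] mm_def)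
    qed (auto simp: \<pi>_def)
    show "continuous_on UNIV (\<lambda>h. \<pi> h $$ (i, j))" if "i < n" "j < n" for i j
      using r that by (simp add: ix urep_def)
  qed
  have "W = {0\<^sub>v n} \<or> W = carrier_vec n" if W: "invariant_subspace n \<pi> W" for W
  proof -
    have Wc: "W \<subseteq> carrier_vec n" and W0: "0\<^sub>v n \<in> W" and Wa: "\<And>v w. v \<in> W \<Longrightarrow> w \<in> W \<Longrightarrow> v + w \<in> W"
      and Ws: "\<And>v c. v \<in> W \<Longrightarrow> c \<cdot>\<^sub>v v \<in> W" and Wi: "\<And>v h. v \<in> W \<Longrightarrow> \<pi> h *\<^sub>v v \<in> W"
      using W unfolding invariant_subspace_def by blast+
    define W' where "W' = fvec n ` W"
    have cs: "csub n W'" unfolding csub_def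
    proof (intro conjI ballI allI)
      show "W' \<subseteq> vecs n" by (auto simp: W'_def fvec_def vecs_def)
      have "fvec n (0\<^sub>v n) = 0" by (auto simp: fvec_def)
      then show "0 \<in> W'" using W0 unfolding W'_def by force
      fix a assume "a \<in> W'"
      then obtain v where v: "v \<in> W" "a = fvec n v" by (auto simp: W'_def)
      have vc: "v \<in> carrier_vec n" using v(1) Wc by blast
      have "fvec n (c \<cdot>\<^sub>v v) = (\<lambda>i. c * a i)" for c
        by (rule ext) (use vc in \<open>simp add: v(2) fvec_def\<close>)
      then show "(\<lambda>i. c * a i) \<in> W'" for c using Ws[OF v(1), of c] unfolding W'_def by (metis image_eqI)
      fix b assume "b \<in> W'"
      then obtain w where w: "w \<in> W" "b = fvec n w" by (auto simp: W'_def)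
      have wc: "w \<in> carrier_vec n" using w(1) Wc by blast
      have "fvec n (v + w) = a + b"
        by (rule ext) (use vc wc in \<open>simp add: v(2) w(2) fvec_def\<close>)
      then show "a + b \<in> W'" using Wa[OF v(1) w(1)] unfolding W'_def by (metis image_eqI)
    qed
    have "mv n (r h) a \<in> W'" if a: "a \<in> W'" for h a
    proof -
      obtain v where v: "v \<in> W" "a = fvec n v" using a by (auto simp: W'_def)
      have "v \<in> carrier_vec n" using v(1) Wc by blast
      from fvec_mult[OF c this, of h] have "fvec n (\<pi> h *\<^sub>v v) = mv n (r h) a"
        unfolding e[symmetric] entries_def v(2) .
      then show ?thesis using Wi[OF v(1), of h] unfolding W'_def by (metis image_eqI)
    qed
    with irr cs have "W' = {0} \<or> W' = vecs n" unfolding irr_def by blast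
    then show ?thesis
    proof
      assume z: "W' = {0}"
      have "v = 0\<^sub>v n" if "v \<in> W" for v
      proof -
        have "fvec n v = 0" using that z by (auto simp: W'_def)
        then have "Matrix.vec n (fvec n v) = 0\<^sub>v n" by (intro eq_vecI) auto
        then show ?thesis using vec_fvec[of v n] that Wc by auto
      qed
      then show ?thesis using W0 by blast
    next
      assume a: "W' = vecs n"
      have "v \<in> W" if "v \<in> carrier_vec n" for v
      proof -
        have "fvec n v \<in> W'" unfolding a by (simp add: vecs_def fvec_def)
        then obtain w where w: "w \<in> W" "fvec n v = fvec n w" by (auto simp: W'_def)
        then have "v = w" using vec_fvec[OF that] vec_fvec[of w n] Wc by auto
        with w show ?thesis by simp
      qed
      then show ?thesis using Wc by blast
    qed
  qed
  then show "\<pi> \<in> irreducible_unitary_reps G"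
    unfolding irreducible_unitary_reps_def using n u by blast
qed

text \<open>A representation given as a bare function carries no dimension; it is read off the
  matrix at the identity.\<close>

definition eigval :: "('g \<Rightarrow> complex mat) \<Rightarrow> real" where
  "eigval \<pi> = lam (dim_row (\<pi> un)) (entries (dim_row (\<pi> un)) \<pi>)"

lemma eigval_eq: "unitary_rep G n \<pi> \<Longrightarrow> eigval \<pi> = lam n (entries n \<pi>)"
  using unitary_rep_carrier[of n \<pi> un] by (simp add: eigval_def)

lemma eigval_equivalent:
  assumes "(\<pi>, \<rho>) \<in> unitary_equivalence G"
  shows "eigval \<pi> = eigval \<rho>"
proof -
  obtain n T where irr: "\<pi> \<in> irreducible_unitary_reps G" "\<rho> \<in> irreducible_unitary_reps G"
    and T: "unitary_mat n T" "\<And>h. T * \<pi> h = \<rho> h * T"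
    using assms unfolding unitary_equivalence_def by blast
  obtain n1 where n1: "n1 > 0" "unitary_rep G n1 \<pi>" "urep n1 (entries n1 \<pi>)" "irr n1 (entries n1 \<pi>)"
    by (rule irreducible_entries[OF irr(1)])
  obtain n2 where n2: "n2 > 0" "unitary_rep G n2 \<rho>" "urep n2 (entries n2 \<rho>)" "irr n2 (entries n2 \<rho>)"
    by (rule irreducible_entries[OF irr(2)])
  have Tc: "T \<in> carrier_mat n n" using T(1) by (simp add: unitary_mat_def)
  note c1 = unitary_rep_carrier[OF n1(2)] and c2 = unitary_rep_carrier[OF n2(2)]
  \<comment> \<open>Equivalence names only the size of \<open>T\<close>; comparing dimensions in
    \<open>T * \<pi> un = \<rho> un * T\<close> shows that both representations have it too.\<close>
  have "dim_row (T * \<pi> un) = dim_row (\<rho> un * T)" "dim_col (T * \<pi> un) = dim_col (\<rho> un * T)"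
    by (simp_all only: T(2))
  then have n: "n1 = n" "n2 = n" using Tc c1[of un] c2[of un] by auto
  define S where "S = (\<lambda>i j. if i < n \<and> j < n then T $$ (i, j) else 0)"
  have S: "S \<in> mats n n" by (auto simp: S_def mats_def)
  have "isometry n n S" unfolding isometry_def
  proof (intro conjI S mats_eqI[OF mm_mats[OF adj_mats[OF S] S] idm_mats])
    fix i j assume "i < n" "j < n"
    then show "mm n (adj S) S i j = idm n i j"
      using T(1) unfolding unitary_mat_iff[OF Tc] by (simp add: S_def mm_def adj_def idm_def)
  qed
  moreover have "mm n (entries n \<rho> h) S = mm n S (entries n \<pi> h)" for h
  proof -
    have m: "entries n \<rho> h \<in> mats n n" "entries n \<pi> h \<in> mats n n" by (auto simp: entries_def mats_def)
    show ?thesis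
    proof (rule mats_eqI[OF mm_mats[OF m(1) S] mm_mats[OF S m(2)]])
      fix i j assume ij: "i < n" "j < n"
      have "(\<rho> h * T) $$ (i, j) = (T * \<pi> h) $$ (i, j)" by (simp only: T(2))
      then show "mm n (entries n \<rho> h) S i j = mm n S (entries n \<pi> h) i j"
        using ij mult_mat_index[OF c2[of h, unfolded n] Tc ij] mult_mat_index[OF Tc c1[of h, unfolded n] ij]
        by (simp add: S_def mm_def entries_def)
    qed
  qed
  ultimately have "lam n (entries n \<pi>) = lam n (entries n \<rho>)"
    using lam_intertwine[of n "entries n \<rho>" n "entries n \<pi>" S] n1 n2 unfolding n by blast
  then show ?thesis using eigval_eq[OF n1(2)] eigval_eq[OF n2(2)] n by simp
qed

section \<open>Classes in the dual and their eigenvalues\<close>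

lemma complex_laplacian_add: "u \<in> CC \<Longrightarrow> v \<in> CC \<Longrightarrow>
    complex_laplacian G (\<lambda>x. u x + v x) x = complex_laplacian G u x + complex_laplacian G v x"
  by (simp add: complex_laplacian_eq D_add Fr D_CC sum.distrib)

lemma complex_laplacian_mult: "u \<in> CC \<Longrightarrow>
    complex_laplacian G (\<lambda>x. c * u x) x = c * complex_laplacian G u x"
  by (simp add: complex_laplacian_eq D_cmult Fr D_CC sum_distrib_left)

definition generators :: "('g \<Rightarrow> complex mat) set \<Rightarrow> ('g \<Rightarrow> complex) set" where
  "generators \<xi> = {\<lambda>g. \<pi> g $$ (i, j) | \<pi> i j.
       \<pi> \<in> \<xi> \<and> (\<forall>g. i < dim_row (\<pi> g) \<and> j < dim_col (\<pi> g))}"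

lemma matrix_entry_space_span: "matrix_entry_space \<xi> = fun_cvec.span (generators \<xi>)"
  by (simp add: matrix_entry_space_def generators_def)

lemma dual_class:
  assumes "\<xi> \<in> unitary_dual G"
  obtains \<pi>0 where "\<pi>0 \<in> irreducible_unitary_reps G" "\<xi> = unitary_equivalence G `` {\<pi>0}"
  using assms unfolding unitary_dual_def quotient_def by auto

lemma equivalence_refl:
  assumes "\<pi> \<in> irreducible_unitary_reps G"
  shows "(\<pi>, \<pi>) \<in> unitary_equivalence G"
proof -
  obtain n where n: "unitary_rep G n \<pi>" using irreducible_entries[OF assms] by blast
  note c = unitary_rep_carrier[OF n]
  have "unitary_mat n (1\<^sub>m n)"
    unfolding unitary_mat_iff[OF one_carrier_mat] by (auto simp: if_distrib[of cnj] if_distrib[of "\<lambda>z. z * _"] cong: if_cong)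
  moreover have "1\<^sub>m n * \<pi> g = \<pi> g * 1\<^sub>m n" for g using c[of g] by simp
  ultimately show ?thesis unfolding unitary_equivalence_def using assms by blast
qed

text \<open>Both members are compared with the representative that generates the class.\<close>

lemma dual_class_member:
  assumes "\<xi> \<in> unitary_dual G" "\<pi> \<in> \<xi>" "\<rho> \<in> \<xi>"
  shows "\<pi> \<in> irreducible_unitary_reps G" and "eigval \<pi> = eigval \<rho>"
proof -
  obtain \<pi>0 where "\<xi> = unitary_equivalence G `` {\<pi>0}" by (rule dual_class[OF assms(1)])
  then have "(\<pi>0, \<pi>) \<in> unitary_equivalence G" "(\<pi>0, \<rho>) \<in> unitary_equivalence G" using assms by auto
  then show "\<pi> \<in> irreducible_unitary_reps G" "eigval \<pi> = eigval \<rho>"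
    using eigval_equivalent[of \<pi>0 \<pi>] eigval_equivalent[of \<pi>0 \<rho>] by (auto simp: unitary_equivalence_def)
qed

lemma generator_entry:
  assumes "\<xi> \<in> unitary_dual G" "u \<in> generators \<xi>"
  obtains \<pi> n i j where "\<pi> \<in> \<xi>" "n > 0" "unitary_rep G n \<pi>" "urep n (entries n \<pi>)" "irr n (entries n \<pi>)"
    "i < n" "j < n" "u = (\<lambda>g. entries n \<pi> g i j)"
proof -
  obtain \<pi> i j where \<pi>: "\<pi> \<in> \<xi>" "\<And>g. i < dim_row (\<pi> g) \<and> j < dim_col (\<pi> g)" "u = (\<lambda>g. \<pi> g $$ (i, j))"
    using assms(2) unfolding generators_def by blast
  obtain n where n: "n > 0" "unitary_rep G n \<pi>" "urep n (entries n \<pi>)" "irr n (entries n \<pi>)"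
    by (rule irreducible_entries[OF dual_class_member(1)[OF assms(1) \<pi>(1) \<pi>(1)]])
  have ij: "i < n" "j < n" using \<pi>(2)[of un] unitary_rep_carrier[OF n(2), of un] by auto
  then have "u = (\<lambda>g. entries n \<pi> g i j)" using \<pi>(3) by (simp add: entries_def)
  with \<pi>(1) n ij show ?thesis by (rule that)
qed

text \<open>The eigenvalue equation spreads from the matrix entries to their span by linearity.
  Uniqueness, which \<open>THE\<close> requires, comes from the entry with indices
  \<open>(0, 0)\<close>: its value at the identity is \<open>1\<close>, so it is a nonzero
  eigenfunction.\<close>

lemma eigenvalue_of_eq:
  assumes \<xi>: "\<xi> \<in> unitary_dual G" and \<rho>: "\<rho> \<in> \<xi>"
  shows "eigenvalue_of G \<xi> = eigval \<rho>"
  unfolding eigenvalue_of_def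
proof (rule the_equality)
  have "u \<in> CC \<and> (\<forall>x. complex_laplacian G u x = - complex_of_real (eigval \<rho>) * u x)"
    if "u \<in> matrix_entry_space \<xi>" for u
    using that unfolding matrix_entry_space_span
  proof (induction rule: fun_cvec.span_induct_alt)
    case base
    show ?case using D_const by (simp add: zero_fun_def complex_laplacian_eq Fr)
  next
    case (step c u v)
    obtain \<pi> n i j where \<pi>: "\<pi> \<in> \<xi>" "n > 0" "unitary_rep G n \<pi>" "urep n (entries n \<pi>)" "irr n (entries n \<pi>)"
      "i < n" "j < n" "u = (\<lambda>g. entries n \<pi> g i j)"
      by (rule generator_entry[OF \<xi> step(1)])
    have u: "u \<in> CC" unfolding \<pi>(8) by (rule r_CC[OF \<pi>(4)])
    have ev: "eigval \<rho> = lam n (entries n \<pi>)"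
      using dual_class_member(2)[OF \<xi> \<rho> \<pi>(1)] eigval_eq[OF \<pi>(3)] by simp
    have "complex_laplacian G u x = - complex_of_real (eigval \<rho>) * u x" for x
      unfolding \<pi>(8) ev by (rule laplacian_irr[OF \<pi>(4,5,2)])
    then show ?case using u step(2)
      by (simp add: plus_fun_def CC_add CC_mult complex_laplacian_add complex_laplacian_mult algebra_simps)
  qed
  then show "\<forall>u\<in>matrix_entry_space \<xi>. (\<lambda>g. - complex_laplacian G u g) = (\<lambda>g. complex_of_real (eigval \<rho>) * u g)"
    by (intro ballI ext) simp
  fix l assume l: "\<forall>u\<in>matrix_entry_space \<xi>. (\<lambda>g. - complex_laplacian G u g) = (\<lambda>g. complex_of_real l * u g)"
  obtain n where n: "n > 0" "unitary_rep G n \<rho>" "urep n (entries n \<rho>)" "irr n (entries n \<rho>)"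
    by (rule irreducible_entries[OF dual_class_member(1)[OF \<xi> \<rho> \<rho>]])
  have "dim_row (\<rho> g) = n" "dim_col (\<rho> g) = n" for g
    using unitary_rep_carrier[OF n(2), of g] by simp_all
  then have "(\<lambda>g. \<rho> g $$ (0, 0)) \<in> generators \<xi>"
    unfolding generators_def using n(1)
    by (intro CollectI exI[of _ \<rho>] exI[of _ 0] conjI refl \<rho> allI) auto
  then have "(\<lambda>g. entries n \<rho> g 0 0) \<in> matrix_entry_space \<xi>"
    using n(1) unfolding matrix_entry_space_span entries_def by (simp add: fun_cvec.span_base)
  with l have "- complex_laplacian G (\<lambda>g. entries n \<rho> g 0 0) un = complex_of_real l * entries n \<rho> un 0 0"
    by (auto simp: fun_eq_iff)
  then have "complex_of_real (lam n (entries n \<rho>)) = complex_of_real l"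
    using n(1) by (simp add: laplacian_irr[OF n(3,4,1)] r_un[OF n(3)] idm_def)
  then show "l = eigval \<rho>" using eigval_eq[OF n(2)] by (simp only: of_real_eq_iff)
qed

text \<open>Complete reducibility spreads an entry of the tensor product over its irreducible
  components, and each component comes with the isometric intertwiner from which
  \<open>tensor_eigenvalue\<close> derives both bounds.\<close>

lemma product_of_entries:
  assumes \<xi>: "\<xi>1 \<in> unitary_dual G" "\<xi>2 \<in> unitary_dual G"
    and u: "u1 \<in> generators \<xi>1" "u2 \<in> generators \<xi>2"
  shows "(\<lambda>x. u1 x * u2 x) \<in> fun_cvec.span (\<Union>\<xi>\<in>{\<xi>\<in>unitary_dual G.
    \<bar>dual_abs G \<xi>1 - dual_abs G \<xi>2\<bar> \<le> dual_abs G \<xi> \<and>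
    dual_abs G \<xi> \<le> dual_abs G \<xi>1 + dual_abs G \<xi>2}. matrix_entry_space \<xi>)" (is "_ \<in> fun_cvec.span ?U")
proof -
  obtain \<pi> n i j where \<pi>: "\<pi> \<in> \<xi>1" "n > 0" "unitary_rep G n \<pi>" "urep n (entries n \<pi>)" "irr n (entries n \<pi>)"
      "i < n" "j < n" "u1 = (\<lambda>g. entries n \<pi> g i j)"
    by (rule generator_entry[OF \<xi>(1) u(1)])
  obtain \<rho> m k l where \<rho>: "\<rho> \<in> \<xi>2" "m > 0" "unitary_rep G m \<rho>" "urep m (entries m \<rho>)" "irr m (entries m \<rho>)"
      "k < m" "l < m" "u2 = (\<lambda>g. entries m \<rho> g k l)"
    by (rule generator_entry[OF \<xi>(2) u(2)])
  let ?P = "kron m (entries n \<pi>) (entries m \<rho>)"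
  have d: "dual_abs G \<xi>1 = sqrt (lam n (entries n \<pi>))" "dual_abs G \<xi>2 = sqrt (lam m (entries m \<rho>))"
    using eigenvalue_of_eq[OF \<xi>(1) \<pi>(1)] eigval_eq[OF \<pi>(3)] eigenvalue_of_eq[OF \<xi>(2) \<rho>(1)] eigval_eq[OF \<rho>(3)]
    by (simp_all add: dual_abs_def)
  have lt: "a * m + b < n * m" if "a < n" "b < m" for a b
  proof -
    have "a * m + b < Suc a * m" using that by simp
    also have "\<dots> \<le> n * m" using that by (intro mult_le_mono1) simp
    finally show ?thesis .
  qed
  \<comment> \<open>The product of two entries is a single entry of the Kronecker product, at the
    paired row and column indices.\<close>
  have "(\<lambda>x. u1 x * u2 x) = (\<lambda>x. ?P x (i * m + k) (j * m + l))"
    using \<pi>(8) \<rho>(6,7,8) by (simp add: kron_def)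
  also have "\<dots> \<in> fun_cvec.span (pieces (n * m) ?P)"
    by (rule complete_reducibility[OF kron_urep[OF \<pi>(4) \<rho>(4,2)] lt[OF \<pi>(6) \<rho>(6)] lt[OF \<pi>(7) \<rho>(7)]])
  also have "\<dots> \<subseteq> fun_cvec.span ?U"
  proof (rule fun_cvec.span_mono, rule subsetI)
    fix u assume "u \<in> pieces (n * m) ?P"
    then obtain t q a b T where t: "u = (\<lambda>h. t h a b)" "urep q t" "irr q t" "a < q" "b < q"
      and T: "isometry (n * m) q T" "\<And>h. mm (n * m) (?P h) T = mm q T (t h)"
      unfolding pieces_def by blast
    have q: "q > 0" using t(4) by simp
    define \<sigma> where "\<sigma> = (\<lambda>h. Matrix.mat q q (\<lambda>(i, j). t h i j))"
    note \<sigma> = irreducible_of_urep[OF t(2,3) q, folded \<sigma>_def]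
    define \<xi> where "\<xi> = unitary_equivalence G `` {\<sigma>}"
    have \<xi>d: "\<xi> \<in> unitary_dual G" unfolding unitary_dual_def \<xi>_def using \<sigma>(1) by (rule quotientI)
    have \<sigma>\<xi>: "\<sigma> \<in> \<xi>" unfolding \<xi>_def using equivalence_refl[OF \<sigma>(1)] by simp
    have "dual_abs G \<xi> = sqrt (lam q t)"
      using eigenvalue_of_eq[OF \<xi>d \<sigma>\<xi>] eigval_eq[OF \<sigma>(2)] \<sigma>(3) by (simp add: dual_abs_def)
    then have "\<bar>dual_abs G \<xi>1 - dual_abs G \<xi>2\<bar> \<le> dual_abs G \<xi>" "dual_abs G \<xi> \<le> dual_abs G \<xi>1 + dual_abs G \<xi>2"
      using tensor_eigenvalue[OF \<pi>(4,5,2) \<rho>(4,5,2) t(2) q T] d by simp_all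
    moreover have "u \<in> matrix_entry_space \<xi>"
    proof -
      have "u = (\<lambda>g. \<sigma> g $$ (a, b))" using t(1,4,5) by (simp add: \<sigma>_def)
      then have "u \<in> generators \<xi>" unfolding generators_def
        by (intro CollectI exI[of _ \<sigma>] exI[of _ a] exI[of _ b] conjI \<sigma>\<xi> allI)
          (use t(4,5) in \<open>auto simp: \<sigma>_def\<close>)
      then show ?thesis unfolding matrix_entry_space_span by (rule fun_cvec.span_base)
    qed
    ultimately show "u \<in> ?U" using \<xi>d by blast
  qed
  finally show ?thesis .
qed

text \<open>Bilinear extension, by one span induction for each factor.\<close>

lemma product_in_span:
  assumes "\<And>u1 u2. u1 \<in> S1 \<Longrightarrow> u2 \<in> S2 \<Longrightarrow> (\<lambda>x. u1 x * u2 x) \<in> fun_cvec.span V"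
    and "u1 \<in> fun_cvec.span S1" "u2 \<in> fun_cvec.span S2"
  shows "(\<lambda>x. u1 x * u2 x :: complex) \<in> fun_cvec.span V"
proof -
  have 1: "(\<lambda>x. s x * u2 x) \<in> fun_cvec.span V" if s: "s \<in> S1" for s
    using assms(3)
  proof (induction rule: fun_cvec.span_induct_alt)
    case base
    show ?case using fun_cvec.span_zero[of V] by (simp add: zero_fun_def)
  next
    case (step c u v)
    have "(\<lambda>x. s x * ((\<lambda>x. c * u x) + v) x) = (\<lambda>x. c * (s x * u x)) + (\<lambda>x. s x * v x)"
      by (rule ext) (simp add: algebra_simps)
    then show ?case
      using fun_cvec.span_add[OF fun_cvec.span_scale[OF assms(1)[OF s step(1)], of c] step(2)] by simp
  qed
  show ?thesis using assms(2)
  proof (induction rule: fun_cvec.span_induct_alt)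
    case base
    show ?case using fun_cvec.span_zero[of V] by (simp add: zero_fun_def)
  next
    case (step c u v)
    have "(\<lambda>x. ((\<lambda>x. c * u x) + v) x * u2 x) = (\<lambda>x. c * (u x * u2 x)) + (\<lambda>x. v x * u2 x)"
      by (rule ext) (simp add: algebra_simps)
    then show ?case
      using fun_cvec.span_add[OF fun_cvec.span_scale[OF 1[OF step(1)], of c] step(2)] by simp
  qed
qed

end

theorem corollary2p3p1:
  fixes G :: "('g::{t2_space, second_countable_topology}, 'e::euclidean_space) lie_structure"
  assumes "lie_group G"
    and "compact (UNIV :: 'g set)"
    and "simply_connected (UNIV :: 'g set)"
    and "semisimple G"
  shows "\<exists>c::real. 0 < c \<and> c \<le> 1 \<and>
    (\<forall>\<xi>1\<in>unitary_dual G. \<forall>\<xi>2\<in>unitary_dual G.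
     \<forall>u1\<in>matrix_entry_space \<xi>1. \<forall>u2\<in>matrix_entry_space \<xi>2.
       (\<lambda>g. u1 g * u2 g) \<in> fun_cvec.span (\<Union>\<xi>\<in>{\<xi>\<in>unitary_dual G.
          c * \<bar>dual_abs G \<xi>1 - dual_abs G \<xi>2\<bar> \<le> dual_abs G \<xi> \<and>
          dual_abs G \<xi> \<le> dual_abs G \<xi>1 + dual_abs G \<xi>2}. matrix_entry_space \<xi>))"
proof (rule exI[of _ 1], intro conjI ballI)
  interpret compact_semisimple G
    by unfold_locales (use assms in auto)
  fix \<xi>1 \<xi>2 u1 u2
  assume \<xi>: "\<xi>1 \<in> unitary_dual G" "\<xi>2 \<in> unitary_dual G"
    and u: "u1 \<in> matrix_entry_space \<xi>1" "u2 \<in> matrix_entry_space \<xi>2"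
  show "(\<lambda>g. u1 g * u2 g) \<in> fun_cvec.span (\<Union>\<xi>\<in>{\<xi>\<in>unitary_dual G.
          1 * \<bar>dual_abs G \<xi>1 - dual_abs G \<xi>2\<bar> \<le> dual_abs G \<xi> \<and>
          dual_abs G \<xi> \<le> dual_abs G \<xi>1 + dual_abs G \<xi>2}. matrix_entry_space \<xi>)"
    unfolding mult_1
    by (rule product_in_span[OF product_of_entries[OF \<xi>] u[unfolded matrix_entry_space_span]])
qed simp_all

end
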